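(* Let $d\ge3$ and $s\ge\frac12$. There exists a universal constant $C_0>0$ such that, for every even $w=w_d+w_\infty$ with $w_d\in L^{d,\infty}$, $w_\infty\in L^\infty$, and every $\psi_0\in H^s$ satisfying $$\|(w_d)_-\|_{L^{d,\infty}}\|\psi_0\|_{L^2}^2<C_0,$$ the Cauchy problem $i\partial_t\psi=(\langle\nabla\rangle+w*|\psi|^2)\psi$, $\psi|_{t=0}=\psi_0$ admits a unique solution $\psi\in\mathcal{C}^0([0,\infty),H^s)\cap\mathcal{C}^1([0,\infty),H^{s-1})$.
   Context: $\langle\nabla\rangle:=\mathcal{F}^{-1}\sqrt{1+|\xi|^2}\mathcal{F}$ with $\mathcal{F}$ the unitary Fourier transform; $H^s=\{f:\langle\nabla\rangle^sf\in L^2\}$. The potential $w$ is real-valued; $f_-=\max\{-f,0\}$ denotes the negative part. $L^{d,\infty}$ is the weak $L^d$ (Lorentz) space. A solution on $[0,\infty)$ is a function in the stated space satisfying the equation in $H^{s-1}$. *)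

theory Defs
  imports "HOL-Analysis.Analysis"
begin

text \<open>Functions on R^d are modelled as functions on the type real^'n, d = CARD('n).
  Elements of H^sigma are represented on the Fourier side (weighted L^2).\<close>

definition sq_int :: "('a::euclidean_space \<Rightarrow> complex) \<Rightarrow> bool" where
  "sq_int f \<longleftrightarrow> f \<in> borel_measurable lborel \<and> integrable lborel (\<lambda>x. (cmod (f x))\<^sup>2)"

definition L2n :: "('a::euclidean_space \<Rightarrow> complex) \<Rightarrow> real" where
  "L2n f = sqrt (LINT x|lborel. (cmod (f x))\<^sup>2)"

definition jb :: "real \<Rightarrow> real^'n \<Rightarrow> real" where
  "jb \<sigma> \<xi> = (1 + (norm \<xi>)\<^sup>2) powr (\<sigma> / 2)"

definition FT1 :: "(real^'n \<Rightarrow> complex) \<Rightarrow> real^'n \<Rightarrow> complex" where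
  "FT1 f \<xi> = complex_of_real ((2 * pi) powr (- (real CARD('n) / 2))) *
     (LINT x|lborel. exp (- \<i> * complex_of_real (x \<bullet> \<xi>)) * f x)"

text \<open>g is the (unitary, Plancherel) Fourier transform of the L^2 function f:
  L^2-limit of the transforms of the truncations f 1_{B_R}.\<close>
definition isFT :: "(real^'n \<Rightarrow> complex) \<Rightarrow> (real^'n \<Rightarrow> complex) \<Rightarrow> bool" where
  "isFT f g \<longleftrightarrow> sq_int f \<and> sq_int g \<and>
     ((\<lambda>R. L2n (\<lambda>\<xi>. FT1 (\<lambda>x. indicator (ball 0 R) x * f x) \<xi> - g \<xi>)) \<longlongrightarrow> 0) at_top"

definition wL2 :: "real \<Rightarrow> (real^'n \<Rightarrow> complex) \<Rightarrow> bool" where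
  "wL2 \<sigma> g \<longleftrightarrow> sq_int (\<lambda>\<xi>. complex_of_real (jb \<sigma> \<xi>) * g \<xi>)"

definition wnorm :: "real \<Rightarrow> (real^'n \<Rightarrow> complex) \<Rightarrow> real" where
  "wnorm \<sigma> g = L2n (\<lambda>\<xi>. complex_of_real (jb \<sigma> \<xi>) * g \<xi>)"

definition in_H :: "real \<Rightarrow> (real^'n \<Rightarrow> complex) \<Rightarrow> bool" where
  "in_H s f \<longleftrightarrow> (\<exists>g. isFT f g \<and> wL2 s g)"

definition weakL_bounds :: "nat \<Rightarrow> ('a::euclidean_space \<Rightarrow> real) \<Rightarrow> real set" where
  "weakL_bounds p f = {C. C \<ge> 0 \<and>
      (\<forall>a>0. emeasure lborel {x. \<bar>f x\<bar> > a} \<le> ennreal ((C / a) ^ p))}"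

definition weakL :: "nat \<Rightarrow> ('a::euclidean_space \<Rightarrow> real) \<Rightarrow> bool" where
  "weakL p f \<longleftrightarrow> f \<in> borel_measurable lborel \<and> weakL_bounds p f \<noteq> {}"

definition weakLnorm :: "nat \<Rightarrow> ('a::euclidean_space \<Rightarrow> real) \<Rightarrow> real" where
  "weakLnorm p f = Inf (weakL_bounds p f)"

definition Linf :: "('a::euclidean_space \<Rightarrow> real) \<Rightarrow> bool" where
  "Linf f \<longleftrightarrow> f \<in> borel_measurable lborel \<and> (\<exists>M. AE x in lborel. \<bar>f x\<bar> \<le> M)"

definition negpart :: "('a \<Rightarrow> real) \<Rightarrow> 'a \<Rightarrow> real" where
  "negpart f x = max (- f x) 0"

definition hartree :: "(real^'n \<Rightarrow> real) \<Rightarrow> (real^'n \<Rightarrow> complex) \<Rightarrow> real^'n \<Rightarrow> complex" where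
  "hartree w \<psi> x = complex_of_real (LINT y|lborel. w (x - y) * (cmod (\<psi> y))\<^sup>2) * \<psi> x"

definition wcont :: "real \<Rightarrow> (real \<Rightarrow> real^'n \<Rightarrow> complex) \<Rightarrow> bool" where
  "wcont \<sigma> f \<longleftrightarrow> (\<forall>t\<ge>0. wL2 \<sigma> (f t) \<and>
      ((\<lambda>t'. wnorm \<sigma> (\<lambda>\<xi>. f t' \<xi> - f t \<xi>)) \<longlongrightarrow> 0) (at t within {0..}))"

definition is_solution :: "real \<Rightarrow> (real^'n \<Rightarrow> real) \<Rightarrow> (real^'n \<Rightarrow> complex)
     \<Rightarrow> (real \<Rightarrow> real^'n \<Rightarrow> complex) \<Rightarrow> bool" where
  "is_solution s w \<psi>0 \<psi> \<longleftrightarrow>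
    (\<exists>u v n.
      (\<forall>t\<ge>0. isFT (\<psi> t) (u t)) \<and>
      wcont s u \<and>
      wcont (s - 1) v \<and>
      (\<forall>t\<ge>0. ((\<lambda>h. wnorm (s - 1) (\<lambda>\<xi>. (u (t + h) \<xi> - u t \<xi>) / complex_of_real h - v t \<xi>))
                 \<longlongrightarrow> 0) (at 0 within {-t..})) \<and>
      (\<forall>t\<ge>0. isFT (hartree w (\<psi> t)) (n t)) \<and>
      (\<forall>t\<ge>0. AE \<xi> in lborel.
          \<i> * v t \<xi> = complex_of_real (jb 1 \<xi>) * u t \<xi> + n t \<xi>) \<and>
      (AE x in lborel. \<psi> 0 x = \<psi>0 x))"

end

theory Submission
  imports Defs "HOL-Probability.Characteristic_Functions"
begin

text \<open>
  The solution is constructed in the interaction picture on the Fourier side: with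
  \<open>U t = S t (a t)\<close>, where \<open>S t\<close> is the free propagator, the equation is
  \<open>a' = - \<i> * S (- t) (N (U t))\<close>. Everything rests on one potential estimate: layer-cake
  integration with a frequency cutoff depending on the level gives, for \<open>d \<ge> 3\<close>,
  \<open>\<integral>|w||\<psi>|\<^sup>2 \<le> C \<parallel>w\<parallel>\<^sub>d\<^sub>,\<^sub>\<infinity> \<integral>|\<xi>||\<psi>^|\<^sup>2\<close>, uniformly in translations of the potential.
  It bounds the trilinear Hartree form in \<open>L\<^sup>2\<close> with any one factor in \<open>L\<^sup>2\<close> and the others in \<open>H\<^sup>1\<^sup>/\<^sup>2\<close>; as the
  form maps frequencies below R into frequencies below 3R, integrating over R yields a tame
  \<open>H\<^sup>s\<close> estimate without fractional Leibniz rules. Frequency-truncated equations have global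
  solutions; smallness of the negative part turns conservation of mass and energy into a uniform
  \<open>H\<^sup>1\<^sup>/\<^sup>2\<close> bound, and Gronwall propagates \<open>H\<^sup>s\<close> regularity and convergence in \<open>L\<^sup>2\<close>. Uniqueness is Gronwall for
  the \<open>L\<^sup>2\<close> norm of a difference, computed as the \<open>H\<^sup>-\<^sup>1\<^sup>/\<^sup>2\<close>--\<open>H\<^sup>1\<^sup>/\<^sup>2\<close> pairing of the difference with itself.
\<close>

section \<open>The Hilbert space of square integrable functions\<close>

text \<open>Two obstacles shape the construction. Their convergence, in turn, is controlled only in
  L^2, with rate k^(-1/2); continuity of the limit in H^s comes from Lipschitz bounds in time that
  are uniform in k and survive L^2 limits. These bounds need the interaction picture: the derivative
  of the profile \<open>a\<close> lies in H^s, while that of \<open>Sg t (a t)\<close> loses one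
  derivative. The threshold is \<open>1 / weakL_const\<close>: below it the negative part of
  \<open>quartic / 4\<close> costs at most a quarter of the squared H^(1/2) norm plus a multiple of
  the squared mass, against the half present in the energy. L^2 is made a Banach space type so that
  the contraction principle, vector derivatives and integrals apply to it directly. Plancherel's
  theorem is built from Gaussian regularisation and indicators of boxes.\<close>

definition nn_sq :: "('a::euclidean_space \<Rightarrow> complex) \<Rightarrow> ennreal" where
  "nn_sq f = (\<integral>\<^sup>+x. ennreal ((cmod (f x))\<^sup>2) \<partial>lborel)"

lemma sq_int_iff: "sq_int f \<longleftrightarrow> f \<in> borel_measurable borel \<and> nn_sq f < \<infinity>"
  unfolding sq_int_def nn_sq_def by (auto simp: integrable_iff_bounded)

lemma sq_intI: "f \<in> borel_measurable borel \<Longrightarrow> nn_sq f < \<infinity> \<Longrightarrow> sq_int f"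
  by (simp add: sq_int_iff)

lemma sq_int_measurable: "sq_int f \<Longrightarrow> f \<in> borel_measurable borel"
  by (simp add: sq_int_iff)

lemma sq_int_nsq: "sq_int f \<Longrightarrow> nn_sq f < \<infinity>"
  by (simp add: sq_int_iff)

lemma L2n_eq: "f \<in> borel_measurable borel \<Longrightarrow> L2n f = sqrt (enn2real (nn_sq f))"
  unfolding L2n_def nn_sq_def by (subst integral_eq_nn_integral) auto

lemma L2n_nonneg [simp]: "L2n f \<ge> 0"
  by (simp add: L2n_def)

lemma nn_sq_L2n: "sq_int f \<Longrightarrow> nn_sq f = ennreal ((L2n f)\<^sup>2)"
  by (subst L2n_eq) (auto simp: sq_int_iff)

lemma L2n_leI: "f \<in> borel_measurable borel \<Longrightarrow> nn_sq f \<le> ennreal (c\<^sup>2) \<Longrightarrow> 0 \<le> c \<Longrightarrow> L2n f \<le> c"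
  by (subst L2n_eq) (auto intro!: real_le_lsqrt enn2real_leI)

lemma nn_sq_cong_AE: "AE x in lborel. f x = g x \<Longrightarrow> nn_sq f = nn_sq g"
  unfolding nn_sq_def by (rule nn_integral_cong_AE) auto

lemma L2n_cong_AE:
  assumes "AE x in lborel. f x = g x" "f \<in> borel_measurable borel" "g \<in> borel_measurable borel"
  shows "L2n f = L2n g"
  using assms by (simp add: L2n_eq nn_sq_cong_AE[OF assms(1)])

lemma sq_int_cong_AE:
  "AE x in lborel. f x = g x \<Longrightarrow> g \<in> borel_measurable borel \<Longrightarrow> sq_int f \<Longrightarrow> sq_int g"
  using nn_sq_cong_AE[of f g] by (simp add: sq_int_iff)

lemma nn_sq_mono: "(\<And>x. cmod (f x) \<le> cmod (g x)) \<Longrightarrow> nn_sq f \<le> nn_sq g"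
  unfolding nn_sq_def by (intro nn_integral_mono ennreal_leI power_mono) auto

lemma nn_sq_cmult:
  "f \<in> borel_measurable borel \<Longrightarrow> nn_sq (\<lambda>x. c * f x) = ennreal ((cmod c)\<^sup>2) * nn_sq f"
  unfolding nn_sq_def
  by (subst nn_integral_cmult[symmetric]) (auto simp: norm_mult power_mult_distrib ennreal_mult)

lemma sq_int_bound:
  assumes "sq_int f" "g \<in> borel_measurable borel" "\<And>x. cmod (g x) \<le> C * cmod (f x)"
  shows "sq_int g"
proof (rule sq_intI)
  have [measurable]: "f \<in> borel_measurable borel" using assms(1) by (simp add: sq_int_iff)
  have "nn_sq g \<le> nn_sq (\<lambda>x. complex_of_real \<bar>C\<bar> * f x)"
    by (rule nn_sq_mono) (metis abs_ge_self assms(3) mult_right_mono norm_ge_zero norm_mult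
        norm_of_real order_trans abs_abs)
  also have "\<dots> < \<infinity>"
    using sq_int_nsq[OF assms(1)] by (subst nn_sq_cmult) (auto simp: ennreal_mult_less_top)
  finally show "nn_sq g < \<infinity>" .
qed fact

lemma cmod_add_sq: "(cmod (a + b))\<^sup>2 \<le> 2 * (cmod a)\<^sup>2 + 2 * (cmod b)\<^sup>2"
proof -
  have "(cmod (a + b))\<^sup>2 \<le> (cmod a + cmod b)\<^sup>2"
    by (intro power_mono norm_triangle_ineq) auto
  also have "\<dots> \<le> 2 * (cmod a)\<^sup>2 + 2 * (cmod b)\<^sup>2"
    using sum_squares_bound[of "cmod a" "cmod b"] by (simp add: power2_sum)
  finally show ?thesis .
qed

lemma nn_sq_add:
  assumes [measurable]: "f \<in> borel_measurable borel" "g \<in> borel_measurable borel"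
  shows "nn_sq (\<lambda>x. f x + g x) \<le> 2 * nn_sq f + 2 * nn_sq g"
proof -
  have "nn_sq (\<lambda>x. f x + g x) \<le>
     (\<integral>\<^sup>+x. 2 * ennreal ((cmod (f x))\<^sup>2) + 2 * ennreal ((cmod (g x))\<^sup>2) \<partial>lborel)"
    unfolding nn_sq_def
  proof (rule nn_integral_mono)
    fix x
    show "ennreal ((cmod (f x + g x))\<^sup>2) \<le> 2 * ennreal ((cmod (f x))\<^sup>2) + 2 * ennreal ((cmod (g x))\<^sup>2)"
      using ennreal_leI[OF cmod_add_sq[of "f x" "g x"]] by (simp add: ennreal_mult)
  qed
  also have "\<dots> = 2 * nn_sq f + 2 * nn_sq g"
    unfolding nn_sq_def by (simp add: nn_integral_add nn_integral_cmult)
  finally show ?thesis .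
qed

lemma sq_int_add [intro]:
  assumes "sq_int f" "sq_int g" shows "sq_int (\<lambda>x. f x + g x)"
proof (rule sq_intI)
  show "nn_sq (\<lambda>x. f x + g x) < \<infinity>"
    using nn_sq_add[of f g] assms sq_int_nsq[of f] sq_int_nsq[of g]
    by (auto simp: sq_int_iff ennreal_mult_less_top intro: le_less_trans)
qed (use assms in \<open>auto simp: sq_int_iff\<close>)

lemma sq_int_cmult [intro]: "sq_int f \<Longrightarrow> sq_int (\<lambda>x. c * f x)"
  by (rule sq_int_bound[of f _ "cmod c"]) (auto simp: norm_mult sq_int_iff)

lemma sq_int_minus [intro]: "sq_int f \<Longrightarrow> sq_int (\<lambda>x. - f x)"
  by (rule sq_int_bound[of f _ 1]) (auto simp: sq_int_iff)

lemma sq_int_diff [intro]: "sq_int f \<Longrightarrow> sq_int g \<Longrightarrow> sq_int (\<lambda>x. f x - g x)"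
  using sq_int_add[of f "\<lambda>x. - g x"] by auto

lemma sq_int_zero [simp]: "sq_int (\<lambda>x. 0)"
  by (simp add: sq_int_iff nn_sq_def)

lemma integrable_mult_sq:
  assumes "sq_int f" "sq_int g"
  shows "integrable lborel (\<lambda>x. f x * g x)"
proof (rule Bochner_Integration.integrable_bound)
  show "integrable lborel (\<lambda>x. (cmod (f x))\<^sup>2 + (cmod (g x))\<^sup>2)"
    using assms by (auto simp: sq_int_def)
  show "(\<lambda>x. f x * g x) \<in> borel_measurable lborel" using assms by (auto simp: sq_int_def)
  show "AE x in lborel. norm (f x * g x) \<le> norm ((cmod (f x))\<^sup>2 + (cmod (g x))\<^sup>2)"
  proof (rule AE_I2)
    fix x
    show "norm (f x * g x) \<le> norm ((cmod (f x))\<^sup>2 + (cmod (g x))\<^sup>2)"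
      using sum_squares_bound[of "cmod (f x)" "cmod (g x)"]
        mult_nonneg_nonneg[OF norm_ge_zero[of "f x"] norm_ge_zero[of "g x"]]
      unfolding norm_mult real_norm_def by linarith
  qed
qed

lemma cnj_measurable [measurable]: "cnj \<in> borel_measurable borel"
  by (intro borel_measurable_continuous_onI continuous_intros)

lemma sq_int_cnj [intro]: "sq_int f \<Longrightarrow> sq_int (\<lambda>x. cnj (f x))"
  by (rule sq_int_bound[of f _ 1], assumption)
    (auto intro!: measurable_compose[OF sq_int_measurable cnj_measurable])

lemma integrable_inner_sq:
  assumes "sq_int f" "sq_int g"
  shows "integrable lborel (\<lambda>x. f x \<bullet> g x)"
proof -
  have "integrable lborel (\<lambda>x. Re (f x * cnj (g x)))"
    by (intro integrable_Re integrable_mult_sq assms sq_int_cnj)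
  then show ?thesis by (simp add: inner_complex_def)
qed

section \<open>L^2 as a quotient by almost everywhere equality, and its completeness\<close>

definition l2rel :: "('a::euclidean_space \<Rightarrow> complex) \<Rightarrow> ('a \<Rightarrow> complex) \<Rightarrow> bool" where
  "l2rel f g \<longleftrightarrow> sq_int f \<and> sq_int g \<and> (AE x in lborel. f x = g x)"

\<comment> \<open>A partial quotient: functions outside \<open>sq_int\<close> are related to
  nothing, so every element of the type is a genuine L^2 class. A type, rather than a set of
  functions, is what lets Banach space results be applied.\<close>
quotient_type (overloaded) 'a l2 = "'a::euclidean_space \<Rightarrow> complex" / partial: l2rel
proof (rule part_equivpI)
  show "\<exists>x. l2rel x x" by (rule exI[of _ "\<lambda>_. 0"]) (simp add: l2rel_def)
  show "symp l2rel" by (rule sympI) (auto simp: l2rel_def)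
  show "transp l2rel" by (rule transpI) (auto simp: l2rel_def)
qed

lemma sq_int_rep [simp, intro]: "sq_int (rep_l2 A)"
  using Quotient3_rel_rep[OF Quotient3_l2, of A A] by (simp add: l2rel_def)

lemma rep_measurable [measurable]: "rep_l2 A \<in> borel_measurable borel"
  using sq_int_measurable[OF sq_int_rep] .

lemma abs_rep [simp]: "abs_l2 (rep_l2 A) = A"
  by (rule Quotient3_abs_rep[OF Quotient3_l2])

lemma rep_abs: "sq_int f \<Longrightarrow> AE x in lborel. rep_l2 (abs_l2 f) x = f x"
  using Quotient3_rep_abs[OF Quotient3_l2, of f] by (simp add: l2rel_def)

lemma abs_eqI: "sq_int f \<Longrightarrow> sq_int g \<Longrightarrow> AE x in lborel. f x = g x \<Longrightarrow> abs_l2 f = abs_l2 g"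
  using Quotient3_rel[OF Quotient3_l2, of f g] by (simp add: l2rel_def)

lemma l2_eqI: "AE x in lborel. rep_l2 A x = rep_l2 B x \<Longrightarrow> A = B"
  using abs_eqI[of "rep_l2 A" "rep_l2 B"] by simp

text \<open>The pairing is the real part of the complex one, as the class is over the reals. Complex
  scalars act later as constant multipliers, and skewness of \<open>cm \<i>\<close> in this real
  pairing replaces taking imaginary parts.\<close>

instantiation l2 :: (euclidean_space) real_inner
begin

definition zero_l2 :: "'a l2" where "zero_l2 = abs_l2 (\<lambda>_. 0)"
definition plus_l2 :: "'a l2 \<Rightarrow> 'a l2 \<Rightarrow> 'a l2" where
  "plus_l2 A B = abs_l2 (\<lambda>x. rep_l2 A x + rep_l2 B x)"
definition minus_l2 :: "'a l2 \<Rightarrow> 'a l2 \<Rightarrow> 'a l2" where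
  "minus_l2 A B = abs_l2 (\<lambda>x. rep_l2 A x - rep_l2 B x)"
definition uminus_l2 :: "'a l2 \<Rightarrow> 'a l2" where
  "uminus_l2 A = abs_l2 (\<lambda>x. - rep_l2 A x)"
definition scaleR_l2 :: "real \<Rightarrow> 'a l2 \<Rightarrow> 'a l2" where
  "scaleR_l2 r A = abs_l2 (\<lambda>x. complex_of_real r * rep_l2 A x)"
definition inner_l2 :: "'a l2 \<Rightarrow> 'a l2 \<Rightarrow> real" where
  "inner_l2 A B = (LINT x|lborel. rep_l2 A x \<bullet> rep_l2 B x)"
definition norm_l2 :: "'a l2 \<Rightarrow> real" where "norm_l2 A = sqrt (inner A A)"
definition sgn_l2 :: "'a l2 \<Rightarrow> 'a l2" where "sgn_l2 A = scaleR (inverse (norm A)) A"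
definition dist_l2 :: "'a l2 \<Rightarrow> 'a l2 \<Rightarrow> real" where "dist_l2 A B = norm (A - B)"
definition uniformity_l2 :: "('a l2 \<times> 'a l2) filter" where
  "uniformity_l2 = (INF e\<in>{0 <..}. principal {(x, y). dist x y < e})"
definition open_l2 :: "'a l2 set \<Rightarrow> bool" where
  "open_l2 S = (\<forall>x\<in>S. \<forall>\<^sub>F (x', y) in uniformity. x' = x \<longrightarrow> y \<in> S)"

lemma rep_zero: "AE x in lborel. rep_l2 (0::'a l2) x = 0"
  unfolding zero_l2_def by (rule rep_abs) auto
lemma rep_plus: "AE x in lborel. rep_l2 (A + B :: 'a l2) x = rep_l2 A x + rep_l2 B x"
  unfolding plus_l2_def by (rule rep_abs) auto
lemma rep_minus: "AE x in lborel. rep_l2 (A - B :: 'a l2) x = rep_l2 A x - rep_l2 B x"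
  unfolding minus_l2_def by (rule rep_abs) auto
lemma rep_uminus: "AE x in lborel. rep_l2 (- A :: 'a l2) x = - rep_l2 A x"
  unfolding uminus_l2_def by (rule rep_abs) auto
lemma rep_scaleR: "AE x in lborel. rep_l2 (r *\<^sub>R A :: 'a l2) x = complex_of_real r * rep_l2 A x"
  unfolding scaleR_l2_def by (rule rep_abs) auto

lemma inner_l2_cong:
  fixes A B :: "'a l2"
  assumes "AE x in lborel. rep_l2 A x = f x" "AE x in lborel. rep_l2 B x = g x"
    "f \<in> borel_measurable borel" "g \<in> borel_measurable borel"
  shows "inner A B = (LINT x|lborel. f x \<bullet> g x)"
  unfolding inner_l2_def using assms by (intro integral_cong_AE) (measurable, auto)

instance
proof
  fix A B C :: "'a l2" and r s :: real and S :: "'a l2 set"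
  show "A + B + C = A + (B + C)"
    using rep_plus[of "A + B" C] rep_plus[of A B] rep_plus[of A "B + C"] rep_plus[of B C]
    by (intro l2_eqI) (auto elim!: eventually_elim2)
  show "A + B = B + A"
    using rep_plus[of A B] rep_plus[of B A] by (intro l2_eqI) auto
  show "0 + A = A"
    using rep_plus[of 0 A] rep_zero by (intro l2_eqI) auto
  show "- A + A = 0"
    using rep_plus[of "- A" A] rep_zero rep_uminus[of A] by (intro l2_eqI) auto
  show "A - B = A + - B"
    using rep_plus[of A "- B"] rep_uminus[of B] rep_minus[of A B] by (intro l2_eqI) auto
  show "r *\<^sub>R (A + B) = r *\<^sub>R A + r *\<^sub>R B"
    using rep_plus[of A B] rep_plus[of "r *\<^sub>R A" "r *\<^sub>R B"] rep_scaleR[of r A] rep_scaleR[of r B]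
      rep_scaleR[of r "A + B"]
    by (intro l2_eqI) (auto simp: algebra_simps)
  show "(r + s) *\<^sub>R A = r *\<^sub>R A + s *\<^sub>R A"
    using rep_plus[of "r *\<^sub>R A" "s *\<^sub>R A"] rep_scaleR[of r A] rep_scaleR[of s A]
      rep_scaleR[of "r + s" A]
    by (intro l2_eqI) (auto simp: algebra_simps)
  show "r *\<^sub>R s *\<^sub>R A = (r * s) *\<^sub>R A"
    using rep_scaleR[of r "s *\<^sub>R A"] rep_scaleR[of s A] rep_scaleR[of "r * s" A]
    by (intro l2_eqI) auto
  show "1 *\<^sub>R A = A"
    using rep_scaleR[of 1 A] by (intro l2_eqI) auto
  show "inner A B = inner B A"
    by (simp add: inner_l2_def inner_commute)
  show "inner (A + B) C = inner A C + inner B C"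
  proof -
    have "inner (A + B) C = (LINT x|lborel. (rep_l2 A x + rep_l2 B x) \<bullet> rep_l2 C x)"
      by (rule inner_l2_cong[OF rep_plus]) auto
    also have "\<dots> = inner A C + inner B C"
      by (simp add: inner_add_left integrable_inner_sq inner_l2_def)
    finally show ?thesis .
  qed
  show "inner (r *\<^sub>R A) B = r * inner A B"
  proof -
    have "inner (r *\<^sub>R A) B = (LINT x|lborel. (complex_of_real r * rep_l2 A x) \<bullet> rep_l2 B x)"
      by (rule inner_l2_cong[OF rep_scaleR]) auto
    also have "\<dots> = (LINT x|lborel. r * (rep_l2 A x \<bullet> rep_l2 B x))"
      by (intro Bochner_Integration.integral_cong) (auto simp: inner_complex_def algebra_simps)
    finally show ?thesis by (simp add: inner_l2_def)
  qed
  show "0 \<le> inner A A" unfolding inner_l2_def by simp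
  show "(inner A A = 0) = (A = 0)"
  proof
    assume "inner A A = 0"
    then have "AE x in lborel. rep_l2 A x \<bullet> rep_l2 A x = 0"
      unfolding inner_l2_def
      by (subst (asm) integral_nonneg_eq_0_iff_AE) (auto intro!: integrable_inner_sq)
    then show "A = 0" using rep_zero by (intro l2_eqI) auto
  next
    assume "A = 0"
    then have "inner A A = (LINT x|lborel. (0::complex) \<bullet> 0)"
      using rep_zero inner_l2_cong[of A "\<lambda>_. 0" A "\<lambda>_. 0"] by auto
    then show "inner A A = 0" by simp
  qed
  show "norm A = sqrt (inner A A)" by (rule norm_l2_def)
  show "sgn A = scaleR (inverse (norm A)) A" by (rule sgn_l2_def)
  show "dist A B = norm (A - B)" by (rule dist_l2_def)
  show "(uniformity :: ('a l2 \<times> 'a l2) filter) = (INF e\<in>{0 <..}. principal {(x, y). dist x y < e})"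
    by (rule uniformity_l2_def)
  show "open S = (\<forall>x\<in>S. \<forall>\<^sub>F (x', y) in uniformity. x' = x \<longrightarrow> y \<in> S)"
    by (rule open_l2_def)
qed

end

lemma norm_l2_L2n: "norm A = L2n (rep_l2 A)"
  by (simp add: norm_l2_def inner_l2_def L2n_def dot_square_norm)

lemma norm_l2_nn_sq: "ennreal ((norm A)\<^sup>2) = nn_sq (rep_l2 A)"
  by (simp add: norm_l2_L2n nn_sq_L2n)

lemma norm_abs_l2: "sq_int f \<Longrightarrow> norm (abs_l2 f) = L2n f"
  unfolding norm_l2_L2n by (rule L2n_cong_AE[OF rep_abs]) (auto simp: sq_int_iff)

lemma norm_abs_nn_sq: "sq_int f \<Longrightarrow> ennreal ((norm (abs_l2 f))\<^sup>2) = nn_sq f"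
  by (simp add: norm_abs_l2 nn_sq_L2n)

lemma abs_diff: "sq_int f \<Longrightarrow> sq_int g \<Longrightarrow> abs_l2 f - abs_l2 g = abs_l2 (\<lambda>x. f x - g x)"
  unfolding minus_l2_def using rep_abs[of f] rep_abs[of g]
  by (intro abs_eqI) (auto elim!: eventually_elim2)

lemma abs_add: "sq_int f \<Longrightarrow> sq_int g \<Longrightarrow> abs_l2 f + abs_l2 g = abs_l2 (\<lambda>x. f x + g x)"
  unfolding plus_l2_def using rep_abs[of f] rep_abs[of g]
  by (intro abs_eqI) (auto elim!: eventually_elim2)

lemma inner_abs: "sq_int f \<Longrightarrow> sq_int g \<Longrightarrow> inner (abs_l2 f) (abs_l2 g) = (LINT x|lborel. f x \<bullet> g x)"
  by (rule inner_l2_cong[OF rep_abs rep_abs]) (auto simp: sq_int_iff)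

text \<open>Riesz-Fischer without Minkowski's inequality: the sum of 2^k |D_k|^2 has finite
  integral, hence is finite almost everywhere, and |D_k| <= 2^(-k) + 2^k |D_k|^2 then gives absolute
  pointwise convergence of the telescoping series.\<close>

lemma l2_Cauchy_subseq_converges:
  fixes Y :: "nat \<Rightarrow> 'a::euclidean_space l2"
  assumes C: "Cauchy Y" and step: "\<And>k. norm (Y (Suc k) - Y k) \<le> (1/2)^k"
  shows "\<exists>L. Y \<longlonglongrightarrow> L"
proof -
  define f where "f k = rep_l2 (Y k)" for k
  define D where "D k = rep_l2 (Y (Suc k) - Y k)" for k
  have [measurable]: "f k \<in> borel_measurable borel" "D k \<in> borel_measurable borel" for k
    by (auto simp: f_def D_def)
  have 1: "AE x in lborel. \<forall>k. D k x = f (Suc k) x - f k x"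
    unfolding AE_all_countable D_def f_def using rep_minus by auto
  have "(\<integral>\<^sup>+x. (\<Sum>k. ennreal (2^k * (cmod (D k x))\<^sup>2)) \<partial>lborel)
      = (\<Sum>k. \<integral>\<^sup>+x. ennreal (2^k * (cmod (D k x))\<^sup>2) \<partial>lborel)"
    by (rule nn_integral_suminf) auto
  also have "\<dots> = (\<Sum>k. ennreal (2^k * (norm (Y (Suc k) - Y k))\<^sup>2))"
    by (simp add: ennreal_mult nn_integral_cmult nn_sq_def[symmetric] D_def norm_l2_nn_sq)
  also have "\<dots> \<le> (\<Sum>k. ennreal ((1/2)^k))"
  proof (intro suminf_le summableI ennreal_leI)
    fix k
    have "2^k * (norm (Y (Suc k) - Y k))\<^sup>2 \<le> 2^k * ((1/2)^k)\<^sup>2"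
      by (intro mult_left_mono power_mono step) auto
    also have "\<dots> = (1/2::real)^k"
      by (simp add: power2_eq_square power_divide)
    finally show "2^k * (norm (Y (Suc k) - Y k))\<^sup>2 \<le> (1/2::real)^k" .
  qed
  also have "\<dots> < \<infinity>"
    by (simp add: suminf_ennreal2 summable_geometric less_top[symmetric])
  finally have "AE x in lborel. (\<Sum>k. ennreal (2^k * (cmod (D k x))\<^sup>2)) \<noteq> \<infinity>"
    by (intro nn_integral_PInf_AE) auto
  then have 2: "AE x in lborel. convergent (\<lambda>k. f k x)"
    using 1
  proof eventually_elim
    case (elim x)
    have s: "summable (\<lambda>k. 2^k * (cmod (D k x))\<^sup>2)"
      using elim(1) by (intro summable_suminf_not_top) auto
    have "summable (\<lambda>k. norm (D k x))"
    proof (rule summable_comparison_test')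
      show "summable (\<lambda>k. (1/2)^k + 2^k * (cmod (D k x))\<^sup>2)"
        by (intro summable_add s) (simp add: summable_geometric)
      fix k :: nat
      have "0 \<le> (1 - 2^k * cmod (D k x))\<^sup>2" by simp
      then have "2 * (2^k * cmod (D k x)) \<le> 1 + (2^k)\<^sup>2 * (cmod (D k x))\<^sup>2"
        by (simp add: power2_eq_square algebra_simps)
      then have "2^k * (2 * cmod (D k x)) \<le> 2^k * ((1/2)^k + 2^k * (cmod (D k x))\<^sup>2)"
        by (simp add: algebra_simps power2_eq_square power_divide)
      then have "2 * cmod (D k x) \<le> (1/2)^k + 2^k * (cmod (D k x))\<^sup>2"
        by (simp only: mult_le_cancel_left_pos zero_less_power zero_less_numeral)
      moreover have "0 \<le> cmod (D k x)" by simp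
      ultimately show "norm (norm (D k x)) \<le> (1/2)^k + 2^k * (cmod (D k x))\<^sup>2"
        unfolding real_norm_def by linarith
    qed
    then have "summable (\<lambda>k. D k x)" by (rule summable_norm_cancel)
    then have "convergent (\<lambda>n. \<Sum>k<n. D k x)" by (simp add: summable_iff_convergent)
    moreover have "(\<Sum>k<n. D k x) = f n x - f 0 x" for n
      by (induction n) (use elim(2) in auto)
    ultimately have "convergent (\<lambda>n. f n x - f 0 x)" by simp
    from convergent_add[OF this convergent_const[of "f 0 x"]] show ?case by simp
  qed
  define g where "g x = lim (\<lambda>k. f k x)" for x
  have [measurable]: "g \<in> borel_measurable borel"
    unfolding g_def by (rule borel_measurable_lim_metric) auto
  \<comment> \<open>Fatou in the first index turns the Cauchy bound into a bound on the distance to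
    the pointwise limit; it yields both square integrability of \<open>g\<close> and the
    convergence.\<close>
  have Fatou: "nn_sq (\<lambda>x. g x - f k x) \<le> ennreal (e\<^sup>2)"
    if "\<forall>m\<ge>K. \<forall>n\<ge>K. dist (Y m) (Y n) < e" "K \<le> k" for e K k
  proof -
    have "nn_sq (\<lambda>x. g x - f k x) =
        (\<integral>\<^sup>+x. liminf (\<lambda>m. ennreal ((cmod (f m x - f k x))\<^sup>2)) \<partial>lborel)"
      unfolding nn_sq_def
    proof (rule nn_integral_cong_AE, use 2 in eventually_elim)
      case (elim x)
      then have "(\<lambda>m. f m x) \<longlonglongrightarrow> g x" by (simp add: g_def convergent_LIMSEQ_iff)
      then have "(\<lambda>m. ennreal ((cmod (f m x - f k x))\<^sup>2)) \<longlonglongrightarrow> ennreal ((cmod (g x - f k x))\<^sup>2)"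
        by (intro tendsto_intros)
      then show ?case using lim_imp_Liminf[OF sequentially_bot] by metis
    qed
    also have "\<dots> \<le> liminf (\<lambda>m. \<integral>\<^sup>+x. ennreal ((cmod (f m x - f k x))\<^sup>2) \<partial>lborel)"
      by (rule nn_integral_liminf) auto
    also have "\<dots> = liminf (\<lambda>m. ennreal ((norm (Y m - Y k))\<^sup>2))"
    proof -
      have "nn_sq (\<lambda>x. f m x - f k x) = ennreal ((norm (Y m - Y k))\<^sup>2)" for m
        unfolding norm_l2_nn_sq f_def using rep_minus[of "Y m" "Y k"] by (intro nn_sq_cong_AE) auto
      then show ?thesis by (simp add: nn_sq_def)
    qed
    also have "\<dots> \<le> liminf (\<lambda>m. ennreal (e\<^sup>2))"
    proof (rule Liminf_mono)
      show "\<forall>\<^sub>F m in sequentially. ennreal ((norm (Y m - Y k))\<^sup>2) \<le> ennreal (e\<^sup>2)"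
        using eventually_ge_at_top[of K]
        by eventually_elim (use that in \<open>auto intro!: ennreal_leI power_mono simp: dist_norm less_imp_le\<close>)
    qed
    also have "\<dots> = ennreal (e\<^sup>2)" by (simp add: Liminf_const)
    finally show ?thesis .
  qed
  have sqd: "sq_int (\<lambda>x. g x - f k x)" if "nn_sq (\<lambda>x. g x - f k x) \<le> ennreal (e\<^sup>2)" for e k
    using that by (intro sq_intI) (auto intro: le_less_trans)
  obtain K where "\<forall>m\<ge>K. \<forall>n\<ge>K. dist (Y m) (Y n) < 1"
    using C unfolding Cauchy_def by (metis zero_less_one)
  from sqd[OF Fatou[OF this order_refl]] have "sq_int (\<lambda>x. (g x - f K x) + f K x)"
    by (intro sq_int_add) (auto simp: f_def)
  then have sg: "sq_int g" by simp
  have "Y \<longlonglongrightarrow> abs_l2 g"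
  proof (rule metric_LIMSEQ_I)
    fix e :: real assume "e > 0"
    then obtain K where K: "\<forall>m\<ge>K. \<forall>n\<ge>K. dist (Y m) (Y n) < e/2"
      using C unfolding Cauchy_def by (metis half_gt_zero)
    have "dist (Y k) (abs_l2 g) < e" if "k \<ge> K" for k
    proof -
      have "abs_l2 g - Y k = abs_l2 (\<lambda>x. g x - f k x)"
        using abs_diff[OF sg sq_int_rep[of "Y k"]] by (simp add: f_def)
      then have "norm (abs_l2 g - Y k) = L2n (\<lambda>x. g x - f k x)"
        using sg by (simp add: norm_abs_l2 f_def sq_int_diff)
      also have "\<dots> \<le> e/2"
        using Fatou[OF K that] \<open>e > 0\<close> by (intro L2n_leI) auto
      finally show ?thesis using \<open>e > 0\<close> by (simp add: dist_norm norm_minus_commute)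
    qed
    then show "\<exists>no. \<forall>n\<ge>no. dist (Y n) (abs_l2 g) < e" by auto
  qed
  then show ?thesis by blast
qed

instance l2 :: (euclidean_space) complete_space
proof
  fix X :: "nat \<Rightarrow> 'a l2" assume C: "Cauchy X"
  have "\<exists>N. \<forall>m\<ge>N. \<forall>n\<ge>N. dist (X m) (X n) < (1/2)^k" for k :: nat
    using C unfolding Cauchy_def by simp
  then obtain N where N: "\<And>k m n. m \<ge> N k \<Longrightarrow> n \<ge> N k \<Longrightarrow> dist (X m) (X n) < (1/2)^k"
    by metis
  \<comment> \<open>The sum dominates each \<open>N k\<close>, and the extra \<open>k\<close> makes
    the sequence strictly increasing.\<close>
  define r where "r k = (\<Sum>j\<le>k. N j) + k" for k
  have r: "strict_mono r" by (rule strict_monoI_Suc) (simp add: r_def)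
  have rN: "r k \<ge> N k" for k
    unfolding r_def using member_le_sum[of k "{..k}" N] by auto
  have "Cauchy (X \<circ> r)" using C r by (rule Cauchy_subseq_Cauchy)
  moreover have "norm ((X \<circ> r) (Suc k) - (X \<circ> r) k) \<le> (1/2)^k" for k
  proof -
    have "r k \<le> r (Suc k)" using r by (simp add: strict_mono_less_eq)
    then show ?thesis
      using N[of k "r (Suc k)" "r k"] rN[of k] by (simp add: dist_norm)
  qed
  ultimately obtain L where "(X \<circ> r) \<longlonglongrightarrow> L" using l2_Cauchy_subseq_converges by blast
  then have "X \<longlonglongrightarrow> L" using C r Cauchy_converges_subseq by blast
  then show "convergent X" by (auto simp: convergent_def)
qed

instance l2 :: (euclidean_space) banach ..

section \<open>Fourier multipliers\<close>

text \<open>\<open>mul m A\<close> is meaningful only if \<open>mok m A\<close>, as \<open>abs_l2\<close> is unspecified off \<open>sq_int\<close>.\<close>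

definition mok :: "('a::euclidean_space \<Rightarrow> complex) \<Rightarrow> 'a l2 \<Rightarrow> bool" where
  "mok m A \<longleftrightarrow> sq_int (\<lambda>x. m x * rep_l2 A x)"

definition mul :: "('a::euclidean_space \<Rightarrow> complex) \<Rightarrow> 'a l2 \<Rightarrow> 'a l2" where
  "mul m A = abs_l2 (\<lambda>x. m x * rep_l2 A x)"

lemma rep_mul: "mok m A \<Longrightarrow> AE x in lborel. rep_l2 (mul m A) x = m x * rep_l2 A x"
  unfolding mok_def mul_def by (rule rep_abs)

lemma mok_bounded:
  "m \<in> borel_measurable borel \<Longrightarrow> (\<And>x. cmod (m x) \<le> C) \<Longrightarrow> mok m A"
  unfolding mok_def by (rule sq_int_bound[OF sq_int_rep, of _ C]) (auto simp: norm_mult intro: mult_right_mono)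

lemma mok_dom:
  assumes "mok m A" "k \<in> borel_measurable borel" "\<And>x. cmod (k x) \<le> C * cmod (m x)"
  shows "mok k A"
  unfolding mok_def
  by (rule sq_int_bound[OF assms(1)[unfolded mok_def], of _ C])
    (use assms(2,3) in \<open>auto simp: norm_mult mult.assoc[symmetric] intro: mult_right_mono\<close>)

lemma mul_eqI: "mok m A \<Longrightarrow> AE x in lborel. rep_l2 B x = m x * rep_l2 A x \<Longrightarrow> mul m A = B"
  using rep_mul[of m A] by (intro l2_eqI) auto

lemma mok_mul_iff:
  assumes "mok m A" "k \<in> borel_measurable borel" "m \<in> borel_measurable borel"
  shows "mok k (mul m A) \<longleftrightarrow> mok (\<lambda>x. k x * m x) A"
proof -
  note [measurable] = assms(2,3)
  have a: "AE x in lborel. k x * rep_l2 (mul m A) x = k x * m x * rep_l2 A x"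
    using rep_mul[OF assms(1)] by auto
  have b: "AE x in lborel. k x * m x * rep_l2 A x = k x * rep_l2 (mul m A) x"
    using rep_mul[OF assms(1)] by auto
  have c: "(\<lambda>x. k x * rep_l2 (mul m A) x) \<in> borel_measurable borel"
    and d: "(\<lambda>x. k x * m x * rep_l2 A x) \<in> borel_measurable borel" by measurable
  show ?thesis
    unfolding mok_def using sq_int_cong_AE[OF a d] sq_int_cong_AE[OF b c] by (rule iffI)
qed

lemma mul_mul:
  assumes "mok m A" "k \<in> borel_measurable borel" "m \<in> borel_measurable borel" "mok (\<lambda>x. k x * m x) A"
  shows "mul k (mul m A) = mul (\<lambda>x. k x * m x) A"
proof (rule mul_eqI)
  show "mok k (mul m A)" using assms mok_mul_iff by blast
  show "AE x in lborel. rep_l2 (mul (\<lambda>x. k x * m x) A) x = k x * rep_l2 (mul m A) x"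
    using rep_mul[OF assms(1)] rep_mul[OF assms(4)] by eventually_elim simp
qed

lemma mok_add: "m \<in> borel_measurable borel \<Longrightarrow> mok m A \<Longrightarrow> mok m B \<Longrightarrow> mok m (A + B)"
  unfolding mok_def
  apply (rule sq_int_cong_AE[OF _ _ sq_int_add[of "\<lambda>x. m x * rep_l2 A x" "\<lambda>x. m x * rep_l2 B x"]])
  using rep_plus[of A B] by (auto simp: algebra_simps)

lemma mul_add:
  assumes "m \<in> borel_measurable borel" "mok m A" "mok m B"
  shows "mul m (A + B) = mul m A + mul m B"
proof (intro mul_eqI mok_add assms)
  show "AE x in lborel. rep_l2 (mul m A + mul m B) x = m x * rep_l2 (A + B) x"
    using rep_mul[OF assms(2)] rep_mul[OF assms(3)] rep_plus[of A B] rep_plus[of "mul m A" "mul m B"]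
    by eventually_elim (simp add: algebra_simps)
qed

lemma mok_scaleR: "m \<in> borel_measurable borel \<Longrightarrow> mok m A \<Longrightarrow> mok m (r *\<^sub>R A)"
  unfolding mok_def
  apply (rule sq_int_cong_AE[OF _ _ sq_int_cmult[of "\<lambda>x. m x * rep_l2 A x" "complex_of_real r"]])
  using rep_scaleR[of r A] by (auto simp: algebra_simps)

lemma mul_scaleR:
  assumes "m \<in> borel_measurable borel" "mok m A"
  shows "mul m (r *\<^sub>R A) = r *\<^sub>R mul m A"
proof (intro mul_eqI mok_scaleR assms)
  show "AE x in lborel. rep_l2 (r *\<^sub>R mul m A) x = m x * rep_l2 (r *\<^sub>R A) x"
    using rep_mul[OF assms(2)] rep_scaleR[of r A] rep_scaleR[of r "mul m A"]
    by eventually_elim (simp add: algebra_simps)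
qed

lemma mok_minus: "m \<in> borel_measurable borel \<Longrightarrow> mok m A \<Longrightarrow> mok m (- A)"
  using mok_scaleR[of m A "-1"] by simp

lemma mul_minus: "m \<in> borel_measurable borel \<Longrightarrow> mok m A \<Longrightarrow> mul m (- A) = - mul m A"
  using mul_scaleR[of m A "-1"] by simp

lemma mok_diff: "m \<in> borel_measurable borel \<Longrightarrow> mok m A \<Longrightarrow> mok m B \<Longrightarrow> mok m (A - B)"
  using mok_add[of m A "- B"] mok_minus[of m B] by simp

lemma mul_diff:
  "m \<in> borel_measurable borel \<Longrightarrow> mok m A \<Longrightarrow> mok m B \<Longrightarrow> mul m (A - B) = mul m A - mul m B"
  using mul_add[of m A "- B"] mok_minus[of m B] mul_minus[of m B] by simp

lemma norm_mul_mono: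
  assumes "mok m A" "mok k B" "AE x in lborel. cmod (m x * rep_l2 A x) \<le> C * cmod (k x * rep_l2 B x)" "0 \<le> C"
  shows "norm (mul m A) \<le> C * norm (mul k B)"
proof -
  have "ennreal ((norm (mul m A))\<^sup>2) = nn_sq (\<lambda>x. m x * rep_l2 A x)"
    using assms(1) unfolding mul_def mok_def by (rule norm_abs_nn_sq)
  also have "\<dots> \<le> nn_sq (\<lambda>x. complex_of_real C * (k x * rep_l2 B x))"
    unfolding nn_sq_def using assms(3,4)
    by (intro nn_integral_mono_AE) (auto simp: norm_mult mult.assoc intro!: ennreal_leI power_mono)
  also have "\<dots> = ennreal (C\<^sup>2) * ennreal ((norm (mul k B))\<^sup>2)"
    using assms(2) unfolding mul_def mok_def
    by (subst nn_sq_cmult) (auto simp: norm_abs_nn_sq sq_int_iff)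
  finally have "(norm (mul m A))\<^sup>2 \<le> (C * norm (mul k B))\<^sup>2"
    by (simp add: ennreal_mult[symmetric] power_mult_distrib)
  then show ?thesis using assms(4) by (auto intro: power2_le_imp_le)
qed

lemma mul_one [simp]: "mul (\<lambda>_. 1) A = A"
  by (simp add: mul_def)

lemma mok_one [simp]: "mok (\<lambda>_. 1) A"
  by (simp add: mok_def)

lemma norm_mul_le:
  assumes "m \<in> borel_measurable borel" "\<And>x. cmod (m x) \<le> C"
  shows "norm (mul m A) \<le> C * norm A"
proof -
  have "0 \<le> C" using assms(2) norm_ge_zero order_trans by blast
  moreover have "AE x in lborel. cmod (m x * rep_l2 A x) \<le> C * cmod (1 * rep_l2 A x)"
    by (intro AE_I2) (simp add: norm_mult mult_right_mono assms(2))
  ultimately show ?thesis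
    using norm_mul_mono[of m A "\<lambda>_. 1" A C] mok_bounded[OF assms] by simp
qed

lemma bounded_linear_mul:
  assumes "m \<in> borel_measurable borel" "\<And>x. cmod (m x) \<le> C"
  shows "bounded_linear (mul m)"
  using norm_mul_le[OF assms]
  by (intro bounded_linear_intro[of _ C])
    (auto simp: mul_add mul_scaleR assms mok_bounded[OF assms] mult.commute)

lemma norm_mul_eq:
  assumes "m \<in> borel_measurable borel" "\<And>x. cmod (m x) = 1"
  shows "norm (mul m A) = norm A"
proof -
  have mk: "mok m A" using mok_bounded[of m 1 A] assms by simp
  show ?thesis
    using norm_mul_mono[of m A "\<lambda>_. 1" A 1] norm_mul_mono[of "\<lambda>_. 1" A m A 1] mk assms
    by (auto simp: norm_mult)
qed

lemma inner_mul:
  assumes "mok m A" "mok (\<lambda>x. cnj (m x)) B"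
  shows "inner (mul m A) B = inner A (mul (\<lambda>x. cnj (m x)) B)"
proof -
  have "inner (mul m A) B = (LINT x|lborel. (m x * rep_l2 A x) \<bullet> rep_l2 B x)"
    using assms by (intro inner_l2_cong rep_mul) (auto simp: mok_def sq_int_iff)
  also have "\<dots> = (LINT x|lborel. rep_l2 A x \<bullet> (cnj (m x) * rep_l2 B x))"
    by (intro Bochner_Integration.integral_cong) (auto simp: inner_complex_def algebra_simps)
  also have "\<dots> = inner A (mul (\<lambda>x. cnj (m x)) B)"
    using assms by (intro inner_l2_cong[symmetric] rep_mul) (auto simp: mok_def sq_int_iff)
  finally show ?thesis .
qed

section \<open>The Fourier transform of integrable functions\<close>

lemma fubini_swap:
  fixes f :: "'a::euclidean_space \<Rightarrow> 'b::euclidean_space \<Rightarrow> complex"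
  assumes m: "case_prod f \<in> borel_measurable (lborel \<Otimes>\<^sub>M lborel)"
    and fin: "(\<integral>\<^sup>+x. \<integral>\<^sup>+y. ennreal (cmod (f x y)) \<partial>lborel \<partial>lborel) < \<infinity>"
  shows "(LINT x|lborel. LINT y|lborel. f x y) = (LINT y|lborel. LINT x|lborel. f x y)"
proof -
  note [measurable] = m
  have "(\<integral>\<^sup>+z. ennreal (cmod (case_prod f z)) \<partial>(lborel \<Otimes>\<^sub>M lborel)) < \<infinity>"
    using fin by (subst lborel.nn_integral_fst[symmetric]) auto
  then have "integrable (lborel \<Otimes>\<^sub>M lborel) (case_prod f)"
    by (intro integrableI_bounded m)
  from lborel_pair.Fubini_integral[OF this] show ?thesis by simp
qed

lemma nn_swap:
  fixes f :: "'a::euclidean_space \<Rightarrow> 'b::euclidean_space \<Rightarrow> ennreal"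
  assumes m: "case_prod f \<in> borel_measurable (lborel \<Otimes>\<^sub>M lborel)"
  shows "(\<integral>\<^sup>+x. \<integral>\<^sup>+y. f x y \<partial>lborel \<partial>lborel) = (\<integral>\<^sup>+y. \<integral>\<^sup>+x. f x y \<partial>lborel \<partial>lborel)"
  using lborel_pair.Fubini'[OF m] by simp

lemma nn_integral_affine:
  fixes f :: "'a::euclidean_space \<Rightarrow> ennreal"
  assumes [measurable]: "f \<in> borel_measurable borel" and "c \<noteq> 0"
  shows "(\<integral>\<^sup>+x. f x \<partial>lborel) = ennreal (\<bar>c\<bar> ^ DIM('a)) * (\<integral>\<^sup>+x. f (t + c *\<^sub>R x) \<partial>lborel)"
  by (subst lborel_affine[OF assms(2), of t])
    (simp add: nn_integral_density nn_integral_distr nn_integral_cmult)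

lemma nn_integral_reflect:
  fixes f :: "'a::euclidean_space \<Rightarrow> ennreal"
  assumes [measurable]: "f \<in> borel_measurable borel"
  shows "(\<integral>\<^sup>+x. f (t - x) \<partial>lborel) = (\<integral>\<^sup>+x. f x \<partial>lborel)"
  using nn_integral_affine[OF assms, of "-1" t] by simp

lemma lborel_distr_reflect: "distr lborel borel (\<lambda>x. t - x :: 'a::euclidean_space) = lborel"
  using lborel_affine[of "-1" t] by (simp add: density_1)

lemma integral_reflect:
  fixes f :: "'a::euclidean_space \<Rightarrow> 'b::{banach, second_countable_topology}"
  assumes [measurable]: "f \<in> borel_measurable borel"
  shows "(LINT x|lborel. f (t - x)) = (LINT x|lborel. f x)"
  by (subst (2) lborel_distr_reflect[of t, symmetric]) (simp add: integral_distr)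

lemma AE_reflect:
  fixes P :: "'a::euclidean_space \<Rightarrow> bool"
  assumes "AE x in lborel. P x" shows "AE x in lborel. P (t - x)"
proof -
  from assms obtain N where N: "{x. \<not> P x} \<subseteq> N" "N \<in> sets lborel" "emeasure lborel N = 0"
    by (auto elim!: AE_E)
  have [measurable]: "N \<in> sets borel" using N by simp
  have "emeasure lborel ((\<lambda>x. t - x) -` N \<inter> space lborel) = emeasure (distr lborel borel (\<lambda>x. t - x)) N"
    by (subst emeasure_distr) auto
  also have "\<dots> = 0" using N by (simp add: lborel_distr_reflect)
  moreover have "(\<lambda>x. t - x) -` N \<inter> space lborel \<in> sets lborel"
    by (rule measurable_sets[of _ lborel borel]) auto
  ultimately have "(\<lambda>x. t - x) -` N \<in> null_sets lborel"
    by (auto simp: null_sets_def)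
  then show ?thesis by (rule AE_I') (use N in auto)
qed

section \<open>Gaussians, heat kernels and the transform on L^1\<close>

lemma gaussian_char_1d:
  fixes t s :: real assumes "s > 0"
  shows "integrable lborel (\<lambda>x::real. exp (- \<i> * complex_of_real (t * x)) * complex_of_real (exp (- (s\<^sup>2 * x\<^sup>2 / 2))))" (is ?A)
    and "(LINT x|lborel. exp (- \<i> * complex_of_real (t * x)) * complex_of_real (exp (- (s\<^sup>2 * x\<^sup>2 / 2))))
       = complex_of_real (sqrt (2 * pi) / s * exp (- (t\<^sup>2 / (2 * s\<^sup>2))))" (is ?B)
proof -
  define h where "h u x = exp (- \<i> * complex_of_real (u * x)) * complex_of_real (exp (- (x\<^sup>2 / 2)))" for u x :: real
  have i1: "integrable lborel (\<lambda>x::real. exp (- (x\<^sup>2 / 2)))"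
  proof -
    have "integrable lborel (\<lambda>x. sqrt (2 * pi) * (std_normal_density x * \<bar>x\<bar> ^ 0))"
      by (intro integrable_mult_right integrable_std_normal_moment_abs)
    then show ?thesis by (simp add: std_normal_density_def)
  qed
  have hm [measurable]: "h u \<in> borel_measurable borel" for u
    unfolding h_def[abs_def] by measurable
  have hi: "integrable lborel (h u)" for u
    by (rule Bochner_Integration.integrable_bound[OF i1])
      (auto simp: h_def norm_mult)
  \<comment> \<open>The sign convention of \<open>FT1\<close> corresponds to the characteristic
    function of the normal law at \<open>-u\<close>.\<close>
  have hv: "(LINT x|lborel. h u x) = complex_of_real (sqrt (2 * pi) * exp (- (u\<^sup>2 / 2)))" for u
  proof -
    have "complex_of_real (exp (- ((-u)\<^sup>2) / 2)) = char std_normal_distribution (-u)"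
      by (simp only: char_std_normal_distribution)
    also have "\<dots> = (LINT x|lborel. std_normal_density x *\<^sub>R iexp (- u * x))"
      unfolding char_def by (subst integral_density) (auto simp: normal_density_nonneg)
    also have "\<dots> = (LINT x|lborel. complex_of_real (1 / sqrt (2 * pi)) * h u x)"
      by (intro Bochner_Integration.integral_cong)
        (auto simp: h_def std_normal_density_def scaleR_conv_of_real)
    also have "\<dots> = complex_of_real (1 / sqrt (2 * pi)) * (LINT x|lborel. h u x)"
      by (rule integral_mult_right_zero)
    finally show ?thesis by (simp add: field_simps)
  qed
  have eq: "exp (- \<i> * complex_of_real (t * x)) * complex_of_real (exp (- (s\<^sup>2 * x\<^sup>2 / 2))) = h (t / s) (0 + s * x)" for x
    using assms by (simp add: h_def power_mult_distrib)
  show ?A unfolding eq using assms by (intro lborel_integrable_real_affine hi) auto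
  have "(LINT x|lborel. h (t/s) x) = \<bar>s\<bar> *\<^sub>R (LINT x|lborel. h (t / s) (0 + s * x))"
    using assms by (intro lborel_integral_real_affine) auto
  then show ?B unfolding eq hv using assms
    by (simp add: scaleR_conv_of_real field_simps power_divide)
qed

lemma integral_lborel_prod:
  fixes f :: "'a::euclidean_space \<Rightarrow> real \<Rightarrow> complex"
  assumes "\<And>b. b \<in> Basis \<Longrightarrow> integrable lborel (f b)"
  shows "integrable lborel (\<lambda>x::'a. \<Prod>b\<in>Basis. f b (x \<bullet> b))"
    "(LINT x|lborel. (\<Prod>b\<in>Basis. f b ((x::'a) \<bullet> b))) = (\<Prod>b\<in>Basis. LINT x|lborel. f b x)"
proof -
  interpret product_sigma_finite "\<lambda>_::'a. lborel :: real measure" ..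
  have [measurable]: "\<And>b. b \<in> Basis \<Longrightarrow> f b \<in> borel_measurable borel" using assms by auto
  have M: "(\<lambda>f. \<Sum>b\<in>Basis. f b *\<^sub>R b :: 'a) \<in> (\<Pi>\<^sub>M b\<in>Basis. lborel) \<rightarrow>\<^sub>M borel" by measurable
  have P: "(\<lambda>x::'a. \<Prod>b\<in>Basis. f b (x \<bullet> b)) \<in> borel_measurable borel" by measurable
  have e: "(\<Prod>b\<in>Basis. f b ((\<Sum>c\<in>Basis. x c *\<^sub>R c) \<bullet> b)) = (\<Prod>b\<in>(Basis::'a set). f b (x b))" for x :: "'a \<Rightarrow> real"
    by (intro prod.cong) (auto simp: inner_sum_left inner_Basis if_distrib sum.delta cong: if_cong)
  have "integrable (\<Pi>\<^sub>M b\<in>Basis. lborel) (\<lambda>x. \<Prod>b\<in>(Basis::'a set). f b (x b))"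
    by (intro product_integrable_prod assms) auto
  then show "integrable lborel (\<lambda>x::'a. \<Prod>b\<in>Basis. f b (x \<bullet> b))"
    by (subst lborel_eq) (simp add: integrable_distr_eq[OF M P] e)
  have "(LINT x|lborel. (\<Prod>b\<in>Basis. f b ((x::'a) \<bullet> b))) = integral\<^sup>L (\<Pi>\<^sub>M b\<in>Basis. lborel) (\<lambda>x. \<Prod>b\<in>(Basis::'a set). f b (x b))"
    by (subst lborel_eq) (simp add: integral_distr[OF M P] e)
  also have "\<dots> = (\<Prod>b\<in>Basis. LINT x|lborel. f b x)"
    by (intro product_integral_prod assms) auto
  finally show "(LINT x|lborel. (\<Prod>b\<in>Basis. f b ((x::'a) \<bullet> b))) = (\<Prod>b\<in>Basis. LINT x|lborel. f b x)" .
qed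

lemma norm_sq_Basis: "(norm (x::'a::euclidean_space))\<^sup>2 = (\<Sum>b\<in>Basis. (x \<bullet> b)\<^sup>2)"
  by (subst power2_norm_eq_inner, subst euclidean_inner) (simp add: power2_eq_square)

lemma gaussian_char:
  fixes z :: "'a::euclidean_space" assumes "s > 0"
  shows "integrable lborel (\<lambda>x::'a. exp (- \<i> * complex_of_real (x \<bullet> z)) * complex_of_real (exp (- (s\<^sup>2 * (norm x)\<^sup>2 / 2))))" (is ?A)
    and "(LINT x|lborel. exp (- \<i> * complex_of_real (x \<bullet> z)) * complex_of_real (exp (- (s\<^sup>2 * (norm x)\<^sup>2 / 2))))
       = complex_of_real ((sqrt (2 * pi) / s) ^ DIM('a) * exp (- ((norm z)\<^sup>2 / (2 * s\<^sup>2))))" (is ?B)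
proof -
  define f where "f b u = exp (- \<i> * complex_of_real ((z \<bullet> b) * u)) * complex_of_real (exp (- (s\<^sup>2 * u\<^sup>2 / 2)))"
    for b :: 'a and u :: real
  have fi: "integrable lborel (f b)" and
    fv: "(LINT x|lborel. f b x) = complex_of_real (sqrt (2 * pi) / s * exp (- ((z \<bullet> b)\<^sup>2 / (2 * s\<^sup>2))))" for b
    unfolding f_def[abs_def] using gaussian_char_1d[OF assms, of "z \<bullet> b"] by this
  have e: "exp (- \<i> * complex_of_real (x \<bullet> z)) * complex_of_real (exp (- (s\<^sup>2 * (norm x)\<^sup>2 / 2)))
     = (\<Prod>b\<in>Basis. f b (x \<bullet> b))" for x
  proof -
    have "- \<i> * complex_of_real (x \<bullet> z) = (\<Sum>b\<in>Basis. - \<i> * complex_of_real ((z \<bullet> b) * (x \<bullet> b)))"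
      by (subst euclidean_inner) (simp add: sum_distrib_left mult.commute sum_negf)
    moreover have "- (s\<^sup>2 * (norm x)\<^sup>2 / 2) = (\<Sum>b\<in>Basis. - (s\<^sup>2 * (x \<bullet> b)\<^sup>2 / 2))"
      by (simp add: norm_sq_Basis sum_distrib_left sum_negf sum_divide_distrib)
    ultimately show ?thesis
      by (simp only: exp_sum[OF finite_Basis] of_real_prod f_def prod.distrib)
  qed
  show ?A unfolding e by (rule integral_lborel_prod(1)[OF fi])
  have "(\<Prod>b\<in>(Basis::'a set). exp (- ((z \<bullet> b)\<^sup>2 / (2 * s\<^sup>2)))) = exp (- ((norm z)\<^sup>2 / (2 * s\<^sup>2)))"
    by (subst exp_sum[OF finite_Basis, symmetric]) (simp add: norm_sq_Basis sum_negf sum_divide_distrib)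
  then show ?B unfolding e integral_lborel_prod(2)[OF fi] fv
    by (simp only: of_real_prod[symmetric] prod.distrib prod_constant)
qed

definition fourier_const :: "'n::finite itself \<Rightarrow> real" where
  "fourier_const _ = (2 * pi) powr (- (real CARD('n) / 2))"

lemma fourier_const_pos: "fourier_const TYPE('n::finite) > 0"
  by (simp add: fourier_const_def)

lemma fourier_const_sqrt: "fourier_const TYPE('n::finite) * sqrt (2 * pi) ^ CARD('n) = 1"
proof -
  have "sqrt (2 * pi) ^ CARD('n) = (2 * pi) powr (real CARD('n) / 2)"
    by (simp add: powr_half_sqrt[symmetric] powr_powr flip: powr_realpow)
  then show ?thesis by (simp add: fourier_const_def powr_minus)
qed

text \<open>The Gaussian density with standard deviation \<open>s\<close> in each coordinate, that
  is, heat flow at time s^2/2. Up to the factor \<open>fourier_const\<close> it is the transform of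
  \<open>gaussian s\<close> (see \<open>FT1_gaussian\<close>), so damping by
  \<open>gaussian s\<close> in frequency is averaging in space.\<close>

definition heat_kernel :: "real \<Rightarrow> real^'n \<Rightarrow> real" where
  "heat_kernel s z = fourier_const TYPE('n) * (1 / s) ^ CARD('n) * exp (- ((norm z)\<^sup>2 / (2 * s\<^sup>2)))"

lemma heat_kernel_nonneg: "s > 0 \<Longrightarrow> heat_kernel s (z::real^'n) \<ge> 0"
  using fourier_const_pos[where 'n='n] by (simp add: heat_kernel_def)

lemma heat_kernel_measurable [measurable]: "heat_kernel s \<in> borel_measurable borel"
  unfolding heat_kernel_def by measurable

lemma heat_kernel_integral:
  assumes "s > 0"
  shows "integrable lborel (heat_kernel s :: real^'n \<Rightarrow> real)" "(LINT z|lborel. heat_kernel s (z::real^'n)) = 1"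
proof -
  have i: "integrable lborel (\<lambda>x::real^'n. complex_of_real (exp (- ((1/s)\<^sup>2 * (norm x)\<^sup>2 / 2))))"
    and v: "(LINT x|lborel. complex_of_real (exp (- ((1/s)\<^sup>2 * (norm (x::real^'n))\<^sup>2 / 2)))) = complex_of_real ((sqrt (2 * pi) / (1/s)) ^ CARD('n))"
    using gaussian_char[of "1/s" "0::real^'n"] assms by (simp_all)
  have e: "(1/s)\<^sup>2 * (norm x)\<^sup>2 / 2 = (norm x)\<^sup>2 / (2 * s\<^sup>2)" for x :: "real^'n"
    by (simp add: field_simps power_divide)
  have i2: "integrable lborel (\<lambda>x::real^'n. exp (- ((norm x)\<^sup>2 / (2 * s\<^sup>2))))"
    using integrable_Re[OF i] unfolding e by simp
  then show "integrable lborel (heat_kernel s :: real^'n \<Rightarrow> real)"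
    unfolding heat_kernel_def by (intro integrable_mult_right)
  have "(LINT x|lborel. exp (- ((norm (x::real^'n))\<^sup>2 / (2 * s\<^sup>2)))) = (sqrt (2 * pi) / (1/s)) ^ CARD('n)"
    using v unfolding e integral_complex_of_real of_real_eq_iff .
  then have "(LINT z|lborel. heat_kernel s (z::real^'n)) = fourier_const TYPE('n) * (1 / s) ^ CARD('n) * (sqrt (2 * pi) / (1/s)) ^ CARD('n)"
    unfolding heat_kernel_def by simp
  also have "\<dots> = 1"
    using assms fourier_const_sqrt[where 'n='n] by (simp add: power_mult_distrib power_divide field_simps)
  finally show "(LINT z|lborel. heat_kernel s (z::real^'n)) = 1" .
qed

lemma nn_heat_kernel: "s > 0 \<Longrightarrow> (\<integral>\<^sup>+z. ennreal (heat_kernel s (z::real^'n)) \<partial>lborel) = 1"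
  using heat_kernel_integral[of s, where 'n='n] by (subst nn_integral_eq_integral) (auto simp: heat_kernel_nonneg)

abbreviation gaussian :: "real \<Rightarrow> real^'n \<Rightarrow> real" where
  "gaussian s x \<equiv> exp (- (s\<^sup>2 * (norm x)\<^sup>2 / 2))"

lemma gaussian_integrable: "s > 0 \<Longrightarrow> integrable lborel (\<lambda>x::real^'n. gaussian s x)"
  using integrable_Re[OF gaussian_char(1)[of s "0::real^'n"]] by simp

lemma FT1_eq: "FT1 f \<xi> = complex_of_real (fourier_const TYPE('n)) * (LINT x|lborel. exp (- \<i> * complex_of_real (x \<bullet> \<xi>)) * f x)"
  for f :: "real^'n \<Rightarrow> complex"
  by (simp add: FT1_def fourier_const_def)

lemma FT1_gaussian: "s > 0 \<Longrightarrow> FT1 (\<lambda>x::real^'n. complex_of_real (gaussian s x)) z = complex_of_real (heat_kernel s z / fourier_const TYPE('n))"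
proof -
  assume s: "s > 0"
  have "FT1 (\<lambda>x::real^'n. complex_of_real (gaussian s x)) z =
      complex_of_real ((fourier_const TYPE('n) * sqrt (2 * pi) ^ CARD('n)) * ((1 / s) ^ CARD('n) * exp (- ((norm z)\<^sup>2 / (2 * s\<^sup>2)))))"
    unfolding FT1_eq gaussian_char(2)[OF s] of_real_mult[symmetric] by (simp add: power_divide)
  also have "\<dots> = complex_of_real (heat_kernel s z / fourier_const TYPE('n))"
    unfolding fourier_const_sqrt heat_kernel_def using fourier_const_pos[where 'n='n] by simp
  finally show ?thesis .
qed

lemma heat_kernel_even: "heat_kernel s (x - y) = heat_kernel s (y - x)"
  by (simp add: heat_kernel_def norm_minus_commute)

lemma FT1_measurable [measurable]:
  fixes f :: "real^'n \<Rightarrow> complex"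
  assumes [measurable]: "f \<in> borel_measurable borel" shows "FT1 f \<in> borel_measurable borel"
proof -
  have "(\<lambda>\<xi>::real^'n. LINT x|lborel. exp (- \<i> * complex_of_real (x \<bullet> \<xi>)) * f x) \<in> borel_measurable borel"
    by (rule lborel.borel_measurable_lebesgue_integral) measurable
  then show ?thesis unfolding FT1_eq[abs_def] by measurable
qed

lemma FT1_cong_AE:
  fixes f :: "real^'n \<Rightarrow> complex"
  assumes "AE x in lborel. f x = g x" and [measurable]: "f \<in> borel_measurable borel" "g \<in> borel_measurable borel"
  shows "FT1 f = FT1 g"
proof
  fix \<xi>
  have "(LINT x|lborel. exp (- \<i> * complex_of_real (x \<bullet> \<xi>)) * f x) = (LINT x|lborel. exp (- \<i> * complex_of_real (x \<bullet> \<xi>)) * g x)"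
    by (rule integral_cong_AE) (use assms(1) in \<open>auto\<close>)
  then show "FT1 f \<xi> = FT1 g \<xi>" by (simp add: FT1_eq)
qed

lemma FT1_integrand:
  fixes f :: "real^'n \<Rightarrow> complex"
  assumes "integrable lborel f"
  shows "integrable lborel (\<lambda>x. exp (- \<i> * complex_of_real (x \<bullet> \<xi>)) * f x)"
  by (rule Bochner_Integration.integrable_bound[OF assms])
    (use assms in \<open>auto simp: norm_mult\<close>)

lemma FT1_bound:
  fixes f :: "real^'n \<Rightarrow> complex"
  shows "cmod (FT1 f \<xi>) \<le> fourier_const TYPE('n) * (LINT x|lborel. cmod (f x))"
proof -
  have "cmod (LINT x|lborel. exp (- \<i> * complex_of_real (x \<bullet> \<xi>)) * f x) \<le> (LINT x|lborel. cmod (exp (- \<i> * complex_of_real (x \<bullet> \<xi>)) * f x))"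
    by (rule integral_norm_bound)
  then show ?thesis
    using fourier_const_pos[where 'n='n] by (simp add: FT1_eq norm_mult)
qed

lemma FT1_add:
  fixes f :: "real^'n \<Rightarrow> complex"
  assumes "integrable lborel f" "integrable lborel g"
  shows "FT1 (\<lambda>x. f x + g x) \<xi> = FT1 f \<xi> + FT1 g \<xi>"
  using FT1_integrand[OF assms(1)] FT1_integrand[OF assms(2)]
  by (simp add: FT1_eq distrib_left)

lemma FT1_diff:
  fixes f :: "real^'n \<Rightarrow> complex"
  assumes "integrable lborel f" "integrable lborel g"
  shows "FT1 (\<lambda>x. f x - g x) \<xi> = FT1 f \<xi> - FT1 g \<xi>"
  using FT1_integrand[OF assms(1)] FT1_integrand[OF assms(2)]
  by (simp add: FT1_eq right_diff_distrib)

lemma FT1_cmult: "FT1 (\<lambda>x. c * f x) \<xi> = c * FT1 f \<xi>"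
proof -
  have "(LINT x|lborel. exp (- \<i> * complex_of_real (x \<bullet> \<xi>)) * (c * f x)) = (LINT x|lborel. c * (exp (- \<i> * complex_of_real (x \<bullet> \<xi>)) * f x))"
    by (simp add: ac_simps)
  then show ?thesis by (simp add: FT1_eq)
qed

lemma nn_iterated_prod:
  fixes f :: "'a::euclidean_space \<Rightarrow> complex" and k :: "'b::euclidean_space \<Rightarrow> complex"
  assumes "integrable lborel f" "integrable lborel k"
  shows "(\<integral>\<^sup>+x. \<integral>\<^sup>+y. ennreal (cmod (f x) * cmod (k y)) \<partial>lborel \<partial>lborel) < \<infinity>"
proof -
  have [measurable]: "f \<in> borel_measurable borel" "k \<in> borel_measurable borel" using assms by auto
  have "(\<integral>\<^sup>+x. \<integral>\<^sup>+y. ennreal (cmod (f x) * cmod (k y)) \<partial>lborel \<partial>lborel) =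
     (\<integral>\<^sup>+x. ennreal (cmod (f x)) \<partial>lborel) * (\<integral>\<^sup>+y. ennreal (cmod (k y)) \<partial>lborel)"
    by (simp add: ennreal_mult nn_integral_cmult nn_integral_multc)
  also have "\<dots> < \<infinity>"
    using assms by (auto simp: integrable_iff_bounded ennreal_mult_less_top)
  finally show ?thesis .
qed

lemma FT1_mult_formula:
  fixes f k :: "real^'n \<Rightarrow> complex"
  assumes f: "integrable lborel f" and k: "integrable lborel k"
  shows "(LINT \<xi>|lborel. FT1 f \<xi> * k \<xi>) = (LINT x|lborel. f x * FT1 k x)"
proof -
  have [measurable]: "f \<in> borel_measurable borel" "k \<in> borel_measurable borel" using assms by auto
  have "(LINT \<xi>|lborel. LINT x|lborel. exp (- \<i> * complex_of_real (x \<bullet> \<xi>)) * f x * k \<xi>) =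
     (LINT x|lborel. LINT \<xi>|lborel. exp (- \<i> * complex_of_real (x \<bullet> \<xi>)) * f x * k \<xi>)"
  proof (rule fubini_swap)
    have "(\<integral>\<^sup>+ \<xi>. \<integral>\<^sup>+ x. ennreal (cmod (exp (- \<i> * complex_of_real (x \<bullet> \<xi>)) * f x * k \<xi>)) \<partial>lborel \<partial>lborel)
       = (\<integral>\<^sup>+ \<xi>. \<integral>\<^sup>+ x. ennreal (cmod (k \<xi>) * cmod (f x)) \<partial>lborel \<partial>lborel)"
      by (simp add: norm_mult mult.commute)
    also have "\<dots> < \<infinity>" by (rule nn_iterated_prod[OF k f])
    finally show "(\<integral>\<^sup>+ \<xi>. \<integral>\<^sup>+ x. ennreal (cmod (exp (- \<i> * complex_of_real (x \<bullet> \<xi>)) * f x * k \<xi>)) \<partial>lborel \<partial>lborel) < \<infinity>" .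
  qed measurable
  moreover have "FT1 f \<xi> * k \<xi> = complex_of_real (fourier_const TYPE('n)) * (LINT x|lborel. exp (- \<i> * complex_of_real (x \<bullet> \<xi>)) * f x * k \<xi>)" for \<xi>
    by (simp add: FT1_eq)
  moreover have "f x * FT1 k x = complex_of_real (fourier_const TYPE('n)) * (LINT \<xi>|lborel. exp (- \<i> * complex_of_real (x \<bullet> \<xi>)) * f x * k \<xi>)" for x
  proof -
    have "(LINT \<xi>|lborel. exp (- \<i> * complex_of_real (x \<bullet> \<xi>)) * f x * k \<xi>) = (LINT \<xi>|lborel. f x * (exp (- \<i> * complex_of_real (\<xi> \<bullet> x)) * k \<xi>))"
      by (intro Bochner_Integration.integral_cong) (auto simp: inner_commute)
    then show ?thesis by (simp add: FT1_eq)
  qed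
  ultimately show ?thesis by (simp only: integral_mult_right_zero)
qed

text \<open>Parseval's identity with a Gaussian regulariser, which makes both sides absolutely
  convergent for integrable functions. The multiplication formula is used twice: to move the
  transform off \<open>f\<close>, and to compute the transform of the damped conjugate of
  \<open>FT1 h\<close>.\<close>

lemma FT1_gauss_pair:
  fixes f h :: "real^'n \<Rightarrow> complex"
  assumes f: "integrable lborel f" and h: "integrable lborel h" and s: "s > 0"
  shows "(LINT \<xi>|lborel. FT1 f \<xi> * (cnj (FT1 h \<xi>) * complex_of_real (gaussian s \<xi>)))
    = (LINT x|lborel. f x * (LINT y|lborel. cnj (h y) * complex_of_real (heat_kernel s (x - y))))"
proof -
  have [measurable]: "f \<in> borel_measurable borel" "h \<in> borel_measurable borel" using assms by auto
  define k where "k \<xi> = cnj (FT1 h \<xi>) * complex_of_real (gaussian s \<xi>)" for \<xi>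
  have [measurable]: "k \<in> borel_measurable borel" unfolding k_def[abs_def] by measurable
  have gi: "integrable lborel (\<lambda>\<xi>::real^'n. gaussian s \<xi>)" using gaussian_integrable[OF s] .
  have k: "integrable lborel k"
  proof (rule Bochner_Integration.integrable_bound)
    show "integrable lborel (\<lambda>\<xi>::real^'n. (fourier_const TYPE('n) * (LINT x|lborel. cmod (h x))) * gaussian s \<xi>)"
      by (intro integrable_mult_right gi)
    show "AE \<xi> in lborel. norm (k \<xi>) \<le> norm ((fourier_const TYPE('n) * (LINT x|lborel. cmod (h x))) * gaussian s \<xi>)"
    proof (rule AE_I2)
      fix \<xi>
      have "norm (k \<xi>) \<le> (fourier_const TYPE('n) * (LINT x|lborel. cmod (h x))) * gaussian s \<xi>"
        unfolding k_def norm_mult using FT1_bound[of h \<xi>] by (simp add: mult_right_mono)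
      then show "norm (k \<xi>) \<le> norm ((fourier_const TYPE('n) * (LINT x|lborel. cmod (h x))) * gaussian s \<xi>)"
        using abs_ge_self order_trans by (metis real_norm_def)
    qed
  qed measurable
  have "FT1 k x = (LINT y|lborel. cnj (h y) * complex_of_real (heat_kernel s (x - y)))" for x
  proof -
    \<comment> \<open>A modulated Gaussian: its transform is, up to a constant, the heat kernel
      centred at \<open>x\<close>.\<close>
    define e where "e \<xi> = exp (- \<i> * complex_of_real (\<xi> \<bullet> (- x))) * complex_of_real (gaussian s \<xi>)" for \<xi>
    have ei: "integrable lborel e"
      unfolding e_def[abs_def] using gi by (intro FT1_integrand) auto
    have Fe: "FT1 e y = complex_of_real (heat_kernel s (x - y) / fourier_const TYPE('n))" for y
    proof -
      have "FT1 e y = FT1 (\<lambda>\<xi>. complex_of_real (gaussian s \<xi>)) (y - x)"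
        unfolding FT1_eq e_def
        by (simp add: exp_add[symmetric] mult.assoc[symmetric] inner_diff_right algebra_simps)
      then show ?thesis by (simp add: FT1_gaussian[OF s] heat_kernel_even[of s x y])
    qed
    have "exp (- \<i> * complex_of_real (\<xi> \<bullet> x)) * k \<xi> = cnj (FT1 h \<xi> * e \<xi>)" for \<xi>
      by (simp add: k_def e_def exp_cnj)
    then have "FT1 k x = complex_of_real (fourier_const TYPE('n)) * cnj (LINT \<xi>|lborel. FT1 h \<xi> * e \<xi>)"
      by (simp only: FT1_eq[of k] Bochner_Integration.integral_cnj)
    also have "(LINT \<xi>|lborel. FT1 h \<xi> * e \<xi>) = (LINT y|lborel. h y * FT1 e y)"
      by (rule FT1_mult_formula[OF h ei])
    also have "complex_of_real (fourier_const TYPE('n)) * cnj (LINT y|lborel. h y * FT1 e y)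
       = (LINT y|lborel. complex_of_real (fourier_const TYPE('n)) * cnj (h y * FT1 e y))"
      by (simp flip: Bochner_Integration.integral_cnj)
    also have "\<dots> = (LINT y|lborel. cnj (h y) * complex_of_real (heat_kernel s (x - y)))"
      using fourier_const_pos[where 'n='n] by (intro Bochner_Integration.integral_cong) (auto simp: Fe)
    finally show ?thesis .
  qed
  then show ?thesis using FT1_mult_formula[OF f k] by (simp add: k_def)
qed

lemma integral_norm_bound_ennreal':
  fixes f :: "'a \<Rightarrow> 'b::{banach, second_countable_topology}"
  shows "ennreal (norm (integral\<^sup>L M f)) \<le> (\<integral>\<^sup>+x. ennreal (norm (f x)) \<partial>M)"
  by (cases "integrable M f") (auto simp: integral_norm_bound_ennreal not_integrable_integral_eq)

text \<open>Writing the left-hand side as a double integral against a heat kernel of unit mass reduces the contraction to \<open>|f x||f y| \<le> (|f x|\<^sup>2 + |f y|\<^sup>2) / 2\<close>.\<close>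

lemma nn_sq_FT1_gauss_le:
  fixes f :: "real^'n \<Rightarrow> complex"
  assumes f: "integrable lborel f" and s: "s > 0"
  shows "(\<integral>\<^sup>+\<xi>. ennreal ((cmod (FT1 f \<xi>))\<^sup>2 * gaussian s \<xi>) \<partial>lborel) \<le> nn_sq f"
proof -
  have [measurable]: "f \<in> borel_measurable borel" using f by auto
  have gi: "integrable lborel (\<lambda>\<xi>::real^'n. gaussian s \<xi>)" using gaussian_integrable[OF s] .
  have i1: "integrable lborel (\<lambda>\<xi>. (cmod (FT1 f \<xi>))\<^sup>2 * gaussian s \<xi>)"
  proof (rule Bochner_Integration.integrable_bound)
    show "integrable lborel (\<lambda>\<xi>::real^'n. (fourier_const TYPE('n) * (LINT x|lborel. cmod (f x)))\<^sup>2 * gaussian s \<xi>)"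
      by (intro integrable_mult_right gi)
    show "AE \<xi> in lborel. norm ((cmod (FT1 f \<xi>))\<^sup>2 * gaussian s \<xi>) \<le> norm ((fourier_const TYPE('n) * (LINT x|lborel. cmod (f x)))\<^sup>2 * gaussian s \<xi>)"
      using FT1_bound[of f] by (intro AE_I2) (simp add: abs_mult mult_right_mono power_mono)
  qed measurable
  define I where "I = (LINT \<xi>|lborel. (cmod (FT1 f \<xi>))\<^sup>2 * gaussian s \<xi>)"
  have "complex_of_real I = (LINT \<xi>|lborel. FT1 f \<xi> * (cnj (FT1 f \<xi>) * complex_of_real (gaussian s \<xi>)))"
    unfolding I_def integral_complex_of_real[symmetric] mult.assoc[symmetric] complex_norm_square[symmetric]
    by simp
  also have "\<dots> = (LINT x|lborel. f x * (LINT y|lborel. cnj (f y) * complex_of_real (heat_kernel s (x - y))))"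
    by (rule FT1_gauss_pair[OF f f s])
  finally have I: "complex_of_real I = \<dots>" .
  have "I \<ge> 0" unfolding I_def by simp
  have "ennreal I = ennreal (cmod (complex_of_real I))" using \<open>I \<ge> 0\<close> by simp
  also have "\<dots> \<le> (\<integral>\<^sup>+x. ennreal (cmod (f x * (LINT y|lborel. cnj (f y) * complex_of_real (heat_kernel s (x - y))))) \<partial>lborel)"
    unfolding I by (rule integral_norm_bound_ennreal')
  also have "\<dots> \<le> (\<integral>\<^sup>+x. \<integral>\<^sup>+y. ennreal (cmod (f x) * cmod (f y)) * ennreal (heat_kernel s (x - y)) \<partial>lborel \<partial>lborel)"
  proof (rule nn_integral_mono)
    fix x
    have "ennreal (cmod (LINT y|lborel. cnj (f y) * complex_of_real (heat_kernel s (x - y)))) \<le> (\<integral>\<^sup>+y. ennreal (cmod (cnj (f y) * complex_of_real (heat_kernel s (x - y)))) \<partial>lborel)"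
      by (rule integral_norm_bound_ennreal')
    then have "ennreal (cmod (f x * (LINT y|lborel. cnj (f y) * complex_of_real (heat_kernel s (x - y))))) \<le>
       ennreal (cmod (f x)) * (\<integral>\<^sup>+y. ennreal (cmod (cnj (f y) * complex_of_real (heat_kernel s (x - y)))) \<partial>lborel)"
      by (simp add: norm_mult ennreal_mult mult_left_mono)
    also have "\<dots> = (\<integral>\<^sup>+y. ennreal (cmod (f x) * cmod (f y)) * ennreal (heat_kernel s (x - y)) \<partial>lborel)"
      using s by (subst nn_integral_cmult[symmetric]) (auto simp: norm_mult ennreal_mult heat_kernel_nonneg mult.assoc)
    finally show "ennreal (cmod (f x * (LINT y|lborel. cnj (f y) * complex_of_real (heat_kernel s (x - y))))) \<le>
       (\<integral>\<^sup>+y. ennreal (cmod (f x) * cmod (f y)) * ennreal (heat_kernel s (x - y)) \<partial>lborel)" .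
  qed
  also have "\<dots> \<le> (\<integral>\<^sup>+x. \<integral>\<^sup>+y. ennreal ((cmod (f x))\<^sup>2 / 2) * ennreal (heat_kernel s (x - y)) + ennreal ((cmod (f y))\<^sup>2 / 2) * ennreal (heat_kernel s (x - y)) \<partial>lborel \<partial>lborel)"
  proof (intro nn_integral_mono)
    fix x y
    have "cmod (f x) * cmod (f y) \<le> (cmod (f x))\<^sup>2 / 2 + (cmod (f y))\<^sup>2 / 2"
      using sum_squares_bound[of "cmod (f x)" "cmod (f y)"] by simp
    then have "ennreal (cmod (f x) * cmod (f y)) \<le> ennreal ((cmod (f x))\<^sup>2 / 2) + ennreal ((cmod (f y))\<^sup>2 / 2)"
      by (subst ennreal_plus[symmetric]) (auto intro!: ennreal_leI simp del: ennreal_plus)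
    then show "ennreal (cmod (f x) * cmod (f y)) * ennreal (heat_kernel s (x - y)) \<le> ennreal ((cmod (f x))\<^sup>2 / 2) * ennreal (heat_kernel s (x - y)) + ennreal ((cmod (f y))\<^sup>2 / 2) * ennreal (heat_kernel s (x - y))"
      by (simp add: distrib_right[symmetric] mult_right_mono)
  qed
  also have "\<dots> = (\<integral>\<^sup>+x. \<integral>\<^sup>+y. ennreal ((cmod (f x))\<^sup>2 / 2) * ennreal (heat_kernel s (x - y)) \<partial>lborel \<partial>lborel)
      + (\<integral>\<^sup>+x. \<integral>\<^sup>+y. ennreal ((cmod (f y))\<^sup>2 / 2) * ennreal (heat_kernel s (x - y)) \<partial>lborel \<partial>lborel)"
    by (subst nn_integral_add[symmetric]) (auto simp: nn_integral_add)
  also have "(\<integral>\<^sup>+x. \<integral>\<^sup>+y. ennreal ((cmod (f y))\<^sup>2 / 2) * ennreal (heat_kernel s (x - y)) \<partial>lborel \<partial>lborel)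
     = (\<integral>\<^sup>+y. \<integral>\<^sup>+x. ennreal ((cmod (f y))\<^sup>2 / 2) * ennreal (heat_kernel s (x - y)) \<partial>lborel \<partial>lborel)"
    by (rule nn_swap) measurable
  also have "\<dots> = (\<integral>\<^sup>+x. \<integral>\<^sup>+y. ennreal ((cmod (f x))\<^sup>2 / 2) * ennreal (heat_kernel s (x - y)) \<partial>lborel \<partial>lborel)"
    by (simp add: heat_kernel_even)
  also have "(\<integral>\<^sup>+x. \<integral>\<^sup>+y. ennreal ((cmod (f x))\<^sup>2 / 2) * ennreal (heat_kernel s (x - y)) \<partial>lborel \<partial>lborel)
     = (\<integral>\<^sup>+x. ennreal ((cmod (f x))\<^sup>2 / 2) \<partial>lborel)"
  proof -
    have "(\<integral>\<^sup>+y. ennreal (heat_kernel s (x - y)) \<partial>lborel) = 1" for x :: "real^'n"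
      using nn_integral_reflect[of "\<lambda>z::real^'n. ennreal (heat_kernel s z)" x] nn_heat_kernel[OF s, where 'n='n] by simp
    then show ?thesis by (simp add: nn_integral_cmult)
  qed
  also have "(\<integral>\<^sup>+x. ennreal ((cmod (f x))\<^sup>2 / 2) \<partial>lborel) + (\<integral>\<^sup>+x. ennreal ((cmod (f x))\<^sup>2 / 2) \<partial>lborel) = nn_sq f"
    unfolding nn_sq_def by (subst nn_integral_add[symmetric]) (auto simp: ennreal_plus[symmetric] simp del: ennreal_plus)
  finally show ?thesis using i1 unfolding I_def by (subst nn_integral_eq_integral) auto
qed

lemma gaussian_tendsto: "(\<lambda>n. gaussian (1 / real (Suc n)) (x::real^'n)) \<longlonglongrightarrow> 1"
proof -
  have "(\<lambda>n. 1 / real (Suc n)) \<longlonglongrightarrow> 0" using LIMSEQ_inverse_real_of_nat by (simp add: inverse_eq_divide)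
  then have "(\<lambda>n. gaussian (1 / real (Suc n)) (x::real^'n)) \<longlonglongrightarrow> exp (- (0\<^sup>2 * (norm x)\<^sup>2 / 2))"
    by (intro tendsto_intros) simp_all
  then show ?thesis by simp
qed

text \<open>The Gaussian weights tend to 1, so Fatou removes them. Only the contraction property is
  obtained here; equality waits for the pairing with boxes.\<close>

lemma nn_sq_FT1_le:
  fixes f :: "real^'n \<Rightarrow> complex"
  assumes f: "integrable lborel f"
  shows "nn_sq (FT1 f) \<le> nn_sq f"
proof -
  have [measurable]: "f \<in> borel_measurable borel" using f by auto
  have "nn_sq (FT1 f) = (\<integral>\<^sup>+\<xi>. liminf (\<lambda>n. ennreal ((cmod (FT1 f \<xi>))\<^sup>2 * gaussian (1 / real (Suc n)) \<xi>)) \<partial>lborel)"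
    unfolding nn_sq_def
  proof (rule nn_integral_cong)
    fix \<xi>
    have "(\<lambda>n. ennreal ((cmod (FT1 f \<xi>))\<^sup>2 * gaussian (1 / real (Suc n)) \<xi>)) \<longlonglongrightarrow> ennreal ((cmod (FT1 f \<xi>))\<^sup>2 * 1)"
      by (intro tendsto_intros gaussian_tendsto)
    from lim_imp_Liminf[OF sequentially_bot this]
    show "ennreal ((cmod (FT1 f \<xi>))\<^sup>2) = liminf (\<lambda>n. ennreal ((cmod (FT1 f \<xi>))\<^sup>2 * gaussian (1 / real (Suc n)) \<xi>))" by simp
  qed
  also have "\<dots> \<le> liminf (\<lambda>n. \<integral>\<^sup>+\<xi>. ennreal ((cmod (FT1 f \<xi>))\<^sup>2 * gaussian (1 / real (Suc n)) \<xi>) \<partial>lborel)"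
    by (rule nn_integral_liminf) measurable
  also have "\<dots> \<le> liminf (\<lambda>n. nn_sq f)"
    by (intro Liminf_mono always_eventually allI nn_sq_FT1_gauss_le[OF f]) simp
  also have "\<dots> = nn_sq f" by (simp add: Liminf_const)
  finally show ?thesis .
qed

section \<open>Parseval's identity against indicators of boxes\<close>

lemma integral_affine:
  fixes f :: "'a::euclidean_space \<Rightarrow> real"
  assumes [measurable]: "f \<in> borel_measurable borel" and "c \<noteq> 0"
  shows "(LINT x|lborel. f x) = \<bar>c\<bar> ^ DIM('a) * (LINT x|lborel. f (t + c *\<^sub>R x))"
proof -
  have "(LINT x|lborel. f x) = integral\<^sup>L (density (distr lborel borel (\<lambda>x. t + c *\<^sub>R x)) (\<lambda>_. ennreal (\<bar>c\<bar> ^ DIM('a)))) f"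
    by (subst lborel_affine[OF assms(2), of t]) simp
  also have "\<dots> = integral\<^sup>L (distr lborel borel (\<lambda>x. t + c *\<^sub>R x)) (\<lambda>x. (\<bar>c\<bar> ^ DIM('a)) *\<^sub>R f x)"
    by (rule integral_density) auto
  also have "\<dots> = (LINT x|lborel. (\<bar>c\<bar> ^ DIM('a)) *\<^sub>R f (t + c *\<^sub>R x))"
    by (rule integral_distr) auto
  finally show ?thesis by simp
qed

lemma integrable_reflect:
  fixes f :: "'a::euclidean_space \<Rightarrow> 'b::{banach, second_countable_topology}"
  assumes "integrable lborel f" shows "integrable lborel (\<lambda>x. f (t - x))"
proof -
  have "integrable (distr lborel borel (\<lambda>x. t - x)) f"
    unfolding lborel_distr_reflect by (rule assms)
  from integrable_distr[OF _ this] show ?thesis by simp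
qed

lemma heat_kernel_scale: "s > 0 \<Longrightarrow> s ^ CARD('n) * heat_kernel s (s *\<^sub>R (z::real^'n)) = heat_kernel 1 z"
  by (simp add: heat_kernel_def power_mult_distrib power_divide)

text \<open>Substituting y = x - s z moves the parameter from the kernel into the indicator. For
  each fixed \<open>z\<close> the indicator is eventually constant, because \<open>x\<close> is off
  the boundary of the box, and the kernel of width 1 dominates.\<close>

lemma heat_kernel_conv_box:
  fixes a b x :: "real^'n"
  assumes "x \<notin> cbox a b - box a b"
  shows "(\<lambda>n. LINT y|lborel. indicat_real (box a b) y * heat_kernel (1 / real (Suc n)) (x - y)) \<longlonglongrightarrow> indicat_real (box a b) x"
proof -
  define s where "s n = 1 / real (Suc n)" for n
  have s: "s n > 0" for n by (simp add: s_def)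
  have s0: "s \<longlonglongrightarrow> 0" unfolding s_def using LIMSEQ_inverse_real_of_nat by (simp add: inverse_eq_divide)
  have "(LINT y|lborel. indicat_real (box a b) y * heat_kernel (s n) (x - y)) =
     (LINT z|lborel. indicat_real (box a b) (x - s n *\<^sub>R z) * heat_kernel 1 z)" for n
  proof -
    have "(LINT y|lborel. indicat_real (box a b) y * heat_kernel (s n) (x - y)) =
      \<bar>- s n\<bar> ^ DIM(real^'n) * (LINT z|lborel. indicat_real (box a b) (x + (- s n) *\<^sub>R z) * heat_kernel (s n) (x - (x + (- s n) *\<^sub>R z)))"
      using s[of n] by (intro integral_affine) auto
    also have "\<dots> = (LINT z|lborel. s n ^ CARD('n) * (indicat_real (box a b) (x - s n *\<^sub>R z) * heat_kernel (s n) (s n *\<^sub>R z)))"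
      using s[of n] by simp
    also have "\<dots> = (LINT z|lborel. indicat_real (box a b) (x - s n *\<^sub>R z) * heat_kernel 1 z)"
      using heat_kernel_scale[OF s[of n]] by (intro Bochner_Integration.integral_cong) (auto simp: indicator_def)
    finally show ?thesis .
  qed
  moreover have "(\<lambda>n. LINT z|lborel. indicat_real (box a b) (x - s n *\<^sub>R z) * heat_kernel 1 z) \<longlonglongrightarrow> (LINT z|lborel. indicat_real (box a b) x * heat_kernel 1 (z::real^'n))"
  proof (rule integral_dominated_convergence)
    show "integrable lborel (heat_kernel 1 :: real^'n \<Rightarrow> real)" by (rule heat_kernel_integral) simp
    show "AE z in lborel. norm (indicat_real (box a b) (x - s n *\<^sub>R z) * heat_kernel 1 z) \<le> heat_kernel 1 z" for n
      by (auto simp: indicator_def heat_kernel_nonneg)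
    show "AE z in lborel. (\<lambda>n. indicat_real (box a b) (x - s n *\<^sub>R z) * heat_kernel 1 z) \<longlonglongrightarrow> indicat_real (box a b) x * heat_kernel 1 z"
    proof (rule AE_I2)
      fix z :: "real^'n"
      have lim: "(\<lambda>n. x - s n *\<^sub>R z) \<longlonglongrightarrow> x - 0 *\<^sub>R z" by (intro tendsto_intros s0)
      have "\<forall>\<^sub>F n in sequentially. indicat_real (box a b) (x - s n *\<^sub>R z) = indicat_real (box a b) x"
      proof (cases "x \<in> box a b")
        case True
        then show ?thesis
          using topological_tendstoD[OF lim open_box, of a b] by (auto simp: indicator_def elim!: eventually_mono)
      next
        case False
        then have "x \<in> - cbox a b" using assms by auto
        moreover have "open (- cbox a b)" by (simp add: closed_cbox open_Compl)
        ultimately have "\<forall>\<^sub>F n in sequentially. x - s n *\<^sub>R z \<in> - cbox a b"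
          using topological_tendstoD[OF lim, of "- cbox a b"] by auto
        then show ?thesis
          using False box_subset_cbox[of a b] by (auto simp: indicator_def elim!: eventually_mono)
      qed
      then have "\<forall>\<^sub>F n in sequentially. indicat_real (box a b) x * heat_kernel 1 z = indicat_real (box a b) (x - s n *\<^sub>R z) * heat_kernel 1 z"
        by eventually_elim simp
      then show "(\<lambda>n. indicat_real (box a b) (x - s n *\<^sub>R z) * heat_kernel 1 z) \<longlonglongrightarrow> indicat_real (box a b) x * heat_kernel 1 z"
        by (rule Lim_transform_eventually[OF tendsto_const])
    qed
  qed measurable
  moreover have "(LINT z|lborel. indicat_real (box a b) x * heat_kernel 1 (z::real^'n)) = indicat_real (box a b) x"
    using heat_kernel_integral(2)[of 1, where 'n='n] by simp
  ultimately show ?thesis unfolding s_def[symmetric] by (simp only:)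
qed

definition in_L1_L2 :: "('a::euclidean_space \<Rightarrow> complex) \<Rightarrow> bool" where
  "in_L1_L2 f \<longleftrightarrow> integrable lborel f \<and> sq_int f"

lemma sq_int_FT1: "in_L1_L2 f \<Longrightarrow> sq_int (FT1 f)"
  using nn_sq_FT1_le[of f] by (auto simp: in_L1_L2_def sq_int_iff intro: le_less_trans)

lemma sq_int_indicator: "S \<in> sets borel \<Longrightarrow> emeasure lborel S < \<infinity> \<Longrightarrow> sq_int (\<lambda>x. indicator S x :: complex)"
proof (rule sq_intI)
  assume S: "S \<in> sets borel" "emeasure lborel S < \<infinity>"
  have "nn_sq (\<lambda>x. indicator S x :: complex) = (\<integral>\<^sup>+x. indicator S x \<partial>lborel)"
    unfolding nn_sq_def by (intro nn_integral_cong) (auto simp: indicator_def)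
  then show "nn_sq (\<lambda>x. indicator S x :: complex) < \<infinity>" using S by simp
qed simp

lemma integrable_indicator_mult:
  "S \<in> sets borel \<Longrightarrow> emeasure lborel S < \<infinity> \<Longrightarrow> sq_int f \<Longrightarrow> integrable lborel (\<lambda>x. indicator S x * f x)"
  using integrable_mult_sq[OF sq_int_indicator] by blast

lemma sq_int_indicator_mult:
  "S \<in> sets borel \<Longrightarrow> sq_int f \<Longrightarrow> sq_int (\<lambda>x. indicator S x * f x)"
  by (rule sq_int_bound[of f _ 1]) (auto simp: sq_int_iff indicator_def)

lemma in_L1_L2_indicator_mult:
  "S \<in> sets borel \<Longrightarrow> emeasure lborel S < \<infinity> \<Longrightarrow> sq_int f \<Longrightarrow> in_L1_L2 (\<lambda>x. indicator S x * f x)"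
  by (simp add: in_L1_L2_def sq_int_indicator_mult integrable_indicator_mult)

lemma in_L1_L2_box: "in_L1_L2 (\<lambda>x. indicator (box a b) x :: complex)"
proof -
  have s: "sq_int (\<lambda>x. indicator (box a b) x :: complex)"
    using emeasure_lborel_box_finite[of a b] by (intro sq_int_indicator) auto
  have "(\<lambda>x. indicator (box a b) x * indicator (box a b) x :: complex) = (\<lambda>x. indicator (box a b) x)"
    by (auto simp: indicator_def)
  then show ?thesis using integrable_mult_sq[OF s s] s by (simp add: in_L1_L2_def)
qed

lemma in_L1_L2_cmult: "in_L1_L2 f \<Longrightarrow> in_L1_L2 (\<lambda>x. c * f x)"
  by (auto simp: in_L1_L2_def)

text \<open>Both sides of \<open>FT1_gauss_pair\<close> pass to the limit: in frequency the product
  of two square integrable transforms dominates, in space the averages of the indicator are bounded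
  by 1 and converge off a null set.\<close>

lemma FT1_pair_box:
  fixes f :: "real^'n \<Rightarrow> complex" and a b :: "real^'n"
  assumes f: "in_L1_L2 f"
  shows "(LINT \<xi>|lborel. FT1 f \<xi> * cnj (FT1 (indicator (box a b)) \<xi>)) = (LINT x|lborel. f x * indicator (box a b) x)"
proof -
  define h :: "real^'n \<Rightarrow> complex" where "h = indicator (box a b)"
  have h: "in_L1_L2 h" unfolding h_def using in_L1_L2_box[of a b] by simp
  have [measurable]: "f \<in> borel_measurable borel" "h \<in> borel_measurable borel" using f h by (auto simp: in_L1_L2_def)
  have sf: "sq_int (FT1 f)" "sq_int (FT1 h)" using sq_int_FT1 f h by auto
  define s where "s n = 1 / real (Suc n)" for n
  have s: "s n > 0" for n by (simp add: s_def)
  have gl: "(\<lambda>n. complex_of_real (gaussian (s n) x)) \<longlonglongrightarrow> 1" for x :: "real^'n"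
    using tendsto_of_real[OF gaussian_tendsto[of x], where 'a=complex] by (simp add: s_def)
  have 1: "(\<lambda>n. LINT \<xi>|lborel. FT1 f \<xi> * (cnj (FT1 h \<xi>) * complex_of_real (gaussian (s n) \<xi>))) \<longlonglongrightarrow> (LINT \<xi>|lborel. FT1 f \<xi> * cnj (FT1 h \<xi>))"
  proof (rule integral_dominated_convergence)
    show "integrable lborel (\<lambda>\<xi>. cmod (FT1 f \<xi> * cnj (FT1 h \<xi>)))"
      by (intro integrable_norm integrable_mult_sq sq_int_cnj sf)
    show "AE \<xi> in lborel. (\<lambda>n. FT1 f \<xi> * (cnj (FT1 h \<xi>) * complex_of_real (gaussian (s n) \<xi>))) \<longlonglongrightarrow> FT1 f \<xi> * cnj (FT1 h \<xi>)"
    proof (rule AE_I2)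
      fix \<xi> :: "real^'n"
      have "(\<lambda>n. FT1 f \<xi> * (cnj (FT1 h \<xi>) * complex_of_real (gaussian (s n) \<xi>))) \<longlonglongrightarrow> FT1 f \<xi> * (cnj (FT1 h \<xi>) * 1)"
        by (intro tendsto_mult tendsto_const gl)
      then show "(\<lambda>n. FT1 f \<xi> * (cnj (FT1 h \<xi>) * complex_of_real (gaussian (s n) \<xi>))) \<longlonglongrightarrow> FT1 f \<xi> * cnj (FT1 h \<xi>)" by simp
    qed
    show "AE \<xi> in lborel. norm (FT1 f \<xi> * (cnj (FT1 h \<xi>) * complex_of_real (gaussian (s n) \<xi>))) \<le> cmod (FT1 f \<xi> * cnj (FT1 h \<xi>))" for n
      by (intro AE_I2) (simp add: norm_mult mult_left_le mult.assoc[symmetric])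
  qed measurable
  have 2: "(\<lambda>n. LINT x|lborel. f x * (LINT y|lborel. cnj (h y) * complex_of_real (heat_kernel (s n) (x - y)))) \<longlonglongrightarrow> (LINT x|lborel. f x * h x)"
  proof (rule integral_dominated_convergence)
    have inner: "(LINT y|lborel. cnj (h y) * complex_of_real (heat_kernel (s n) (x - y))) = complex_of_real (LINT y|lborel. indicat_real (box a b) y * heat_kernel (s n) (x - y))" for n and x :: "real^'n"
      unfolding integral_complex_of_real[symmetric] h_def
      by (intro Bochner_Integration.integral_cong) (auto simp: indicator_def)
    show "integrable lborel (\<lambda>x. cmod (f x))" using f by (simp add: in_L1_L2_def)
    have "AE x in lborel. x \<notin> cbox a b - box a b"
      using null_sets_cbox_Diff_box[of a b] by (rule AE_not_in)
    then show "AE x in lborel. (\<lambda>n. f x * (LINT y|lborel. cnj (h y) * complex_of_real (heat_kernel (s n) (x - y)))) \<longlonglongrightarrow> f x * h x"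
    proof eventually_elim
      case (elim x)
      have "(\<lambda>n. complex_of_real (LINT y|lborel. indicat_real (box a b) y * heat_kernel (s n) (x - y))) \<longlonglongrightarrow> complex_of_real (indicat_real (box a b) x)"
        unfolding s_def by (intro tendsto_of_real heat_kernel_conv_box elim)
      moreover have "complex_of_real (indicat_real (box a b) x) = h x" by (simp add: h_def indicator_def)
      ultimately show ?case unfolding inner by (intro tendsto_mult tendsto_const) simp
    qed
    show "AE x in lborel. norm (f x * (LINT y|lborel. cnj (h y) * complex_of_real (heat_kernel (s n) (x - y)))) \<le> cmod (f x)" for n
    proof (rule AE_I2)
      fix x :: "real^'n"
      have gi: "integrable lborel (\<lambda>y. heat_kernel (s n) (x - y))"
        by (rule integrable_reflect[OF heat_kernel_integral(1)[OF s]])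
      have "\<bar>LINT y|lborel. indicat_real (box a b) y * heat_kernel (s n) (x - y)\<bar> = (LINT y|lborel. indicat_real (box a b) y * heat_kernel (s n) (x - y))"
        using s[of n] by (intro abs_of_nonneg Bochner_Integration.integral_nonneg) (auto simp: heat_kernel_nonneg)
      also have "\<dots> \<le> (LINT y|lborel. heat_kernel (s n) (x - y))"
        using s[of n] gi by (intro integral_mono') (auto simp: indicator_def heat_kernel_nonneg)
      also have "\<dots> = 1"
        using heat_kernel_integral(2)[OF s[of n], where 'n='n] integral_reflect[of "heat_kernel (s n)" x] by simp
      finally show "norm (f x * (LINT y|lborel. cnj (h y) * complex_of_real (heat_kernel (s n) (x - y)))) \<le> cmod (f x)"
        unfolding inner norm_mult by (simp add: mult_left_le)
    qed
  qed measurable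
  have e: "(LINT \<xi>|lborel. FT1 f \<xi> * (cnj (FT1 h \<xi>) * complex_of_real (gaussian (s n) \<xi>))) =
        (LINT x|lborel. f x * (LINT y|lborel. cnj (h y) * complex_of_real (heat_kernel (s n) (x - y))))" for n
    using f h s by (intro FT1_gauss_pair) (simp_all add: in_L1_L2_def)
  show ?thesis
    using LIMSEQ_unique[OF 1[unfolded e] 2] unfolding h_def .
qed

text \<open>The positive and negative parts of \<open>h\<close> serve as densities of two measures
  that agree on boxes; boxes are stable under intersection and generate the Borel sets, so the
  densities coincide almost everywhere.\<close>

lemma AE_zero_boxes:
  fixes h :: "'a::euclidean_space \<Rightarrow> real"
  assumes [measurable]: "h \<in> borel_measurable borel"
    and i: "\<And>a b. integrable lborel (\<lambda>x. indicator (box a b) x * h x)"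
    and z: "\<And>a b. (LINT x|lborel. indicator (box a b) x * h x) = 0"
  shows "AE x in lborel. h x = 0"
proof -
  define p where "p x = ennreal (h x)" for x
  define q where "q x = ennreal (- h x)" for x
  have [measurable]: "p \<in> borel_measurable borel" "q \<in> borel_measurable borel"
    by (auto simp: p_def[abs_def] q_def[abs_def])
  have eq: "emeasure (density lborel p) (box a b) = emeasure (density lborel q) (box a b)"
    and fin: "emeasure (density lborel p) (box a b) \<noteq> \<infinity>" for a b
  proof -
    have P: "(\<integral>\<^sup>+x. ennreal (max 0 (indicator (box a b) x * h x)) \<partial>lborel) = ennreal (LINT x|lborel. max 0 (indicator (box a b) x * h x))"
      using i[of a b] by (intro nn_integral_eq_integral) auto
    have Q: "(\<integral>\<^sup>+x. ennreal (max 0 (- (indicator (box a b) x * h x))) \<partial>lborel) = ennreal (LINT x|lborel. max 0 (- (indicator (box a b) x * h x)))"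
      using i[of a b] by (intro nn_integral_eq_integral) auto
    have "(LINT x|lborel. max 0 (indicator (box a b) x * h x)) - (LINT x|lborel. max 0 (- (indicator (box a b) x * h x)))
       = (LINT x|lborel. indicator (box a b) x * h x)"
    proof -
      have "integrable lborel (\<lambda>x. max 0 (indicator (box a b) x * h x))"
        "integrable lborel (\<lambda>x. max 0 (- (indicator (box a b) x * h x)))"
        using i[of a b] by (auto intro!: integrable_max)
      from Bochner_Integration.integral_diff[OF this]
      have "(LINT x|lborel. max 0 (indicator (box a b) x * h x)) - (LINT x|lborel. max 0 (- (indicator (box a b) x * h x)))
       = (LINT x|lborel. max 0 (indicator (box a b) x * h x) - max 0 (- (indicator (box a b) x * h x)))" by simp
      also have "\<dots> = (LINT x|lborel. indicator (box a b) x * h x)"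
        by (intro Bochner_Integration.integral_cong) auto
      finally show ?thesis .
    qed
    with P Q z[of a b] have PQ: "(\<integral>\<^sup>+x. ennreal (max 0 (indicator (box a b) x * h x)) \<partial>lborel) = (\<integral>\<^sup>+x. ennreal (max 0 (- (indicator (box a b) x * h x))) \<partial>lborel)"
      by simp
    have p': "emeasure (density lborel p) (box a b) = (\<integral>\<^sup>+x. ennreal (max 0 (indicator (box a b) x * h x)) \<partial>lborel)"
      by (subst emeasure_density) (auto simp: p_def ennreal_neg intro!: nn_integral_cong split: split_indicator split_max)
    have q': "emeasure (density lborel q) (box a b) = (\<integral>\<^sup>+x. ennreal (max 0 (- (indicator (box a b) x * h x))) \<partial>lborel)"
      by (subst emeasure_density) (auto simp: q_def ennreal_neg intro!: nn_integral_cong split: split_indicator split_max)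
    show "emeasure (density lborel p) (box a b) = emeasure (density lborel q) (box a b)" using PQ p' q' by simp
    show "emeasure (density lborel p) (box a b) \<noteq> \<infinity>" unfolding p' P by simp
  qed
  have "density lborel p = density lborel q"
  proof (rule measure_eqI_generator_eq)
    let ?E = "range (\<lambda>(a, b). box a b::'a set)"
    show "Int_stable ?E" by (auto simp: Int_stable_def box_Int_box)
    show "?E \<subseteq> Pow UNIV" "sets (density lborel p) = sigma_sets UNIV ?E" "sets (density lborel q) = sigma_sets UNIV ?E"
      by (simp_all add: borel_eq_box)
    let ?A = "\<lambda>n::nat. box (- (real n *\<^sub>R One)) (real n *\<^sub>R One) :: 'a set"
    show "range ?A \<subseteq> ?E" "(\<Union>i. ?A i) = UNIV" unfolding UN_box_eq_UNIV by auto
    show "emeasure (density lborel p) (?A i) \<noteq> \<infinity>" for i by (rule fin)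
    show "emeasure (density lborel p) X = emeasure (density lborel q) X" if "X \<in> ?E" for X
      using that eq by auto
  qed
  then have "AE x in lborel. p x = q x" by (intro sigma_finite_measure.density_unique[OF sigma_finite_lborel]) auto
  then show ?thesis
  proof eventually_elim
    case (elim x)
    then show ?case unfolding p_def q_def
      by (cases "h x \<ge> 0") (auto simp: ennreal_neg ennreal_eq_0_iff)
  qed
qed

section \<open>Unitarity of the Fourier transform\<close>

lemma tendsto_iff_norm_diff:
  fixes f :: "'a \<Rightarrow> 'b::real_normed_vector"
  shows "(f \<longlongrightarrow> l) F \<longleftrightarrow> ((\<lambda>x. norm (f x - l)) \<longlongrightarrow> 0) F"
  by (subst Lim_null) (simp only: tendsto_norm_zero_iff)

definition trunc :: "real \<Rightarrow> ('a::euclidean_space \<Rightarrow> complex) \<Rightarrow> 'a \<Rightarrow> complex" where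
  "trunc R f x = indicator (ball 0 R) x * f x"

lemma trunc_measurable [measurable]:
  "f \<in> borel_measurable borel \<Longrightarrow> trunc R f \<in> borel_measurable borel"
  unfolding trunc_def[abs_def] by (intro borel_measurable_times borel_measurable_indicator) auto

lemma in_L1_L2_trunc: "sq_int f \<Longrightarrow> in_L1_L2 (trunc R f)"
  unfolding trunc_def using emeasure_lborel_ball_finite[of 0 R] by (intro in_L1_L2_indicator_mult) auto

lemma abs_trunc_tendsto:
  assumes f: "sq_int f"
  shows "((\<lambda>R. abs_l2 (trunc R f)) \<longlongrightarrow> abs_l2 f) at_top"
proof -
  have [measurable]: "f \<in> borel_measurable borel" using f by (simp add: sq_int_iff)
  have "((\<lambda>R. LINT x|lborel. (cmod (trunc R f x - f x))\<^sup>2) \<longlongrightarrow> (LINT x::'a|lborel. (cmod (0::complex))\<^sup>2)) at_top"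
  proof (rule integral_dominated_convergence_at_top)
    show "integrable lborel (\<lambda>x. (cmod (f x))\<^sup>2)" using f by (simp add: sq_int_def)
    show "AE x in lborel. ((\<lambda>R. (cmod (trunc R f x - f x))\<^sup>2) \<longlongrightarrow> (cmod (0::complex))\<^sup>2) at_top"
    proof (rule AE_I2)
      fix x :: 'a
      have "\<forall>\<^sub>F R in at_top. (cmod (0::complex))\<^sup>2 = (cmod (trunc R f x - f x))\<^sup>2"
        using eventually_gt_at_top[of "norm x"] by eventually_elim (simp add: trunc_def)
      then show "((\<lambda>R. (cmod (trunc R f x - f x))\<^sup>2) \<longlongrightarrow> (cmod (0::complex))\<^sup>2) at_top"
        by (rule Lim_transform_eventually[OF tendsto_const])
    qed
    show "\<forall>\<^sub>F R in at_top. AE x in lborel. norm ((cmod (trunc R f x - f x))\<^sup>2) \<le> (cmod (f x))\<^sup>2"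
      by (auto simp: trunc_def indicator_def)
  qed measurable
  then have "((\<lambda>R. sqrt (LINT x|lborel. (cmod (trunc R f x - f x))\<^sup>2)) \<longlongrightarrow> sqrt 0) at_top"
    by (intro tendsto_real_sqrt) simp
  moreover have "sqrt (LINT x|lborel. (cmod (trunc R f x - f x))\<^sup>2) = norm (abs_l2 (trunc R f) - abs_l2 f)" for R
    using in_L1_L2_trunc[OF f, of R] f
    by (subst abs_diff) (auto simp: in_L1_L2_def norm_abs_l2 sq_int_diff L2n_def)
  ultimately have "((\<lambda>R. norm (abs_l2 (trunc R f) - abs_l2 f)) \<longlongrightarrow> 0) at_top" by simp
  then show ?thesis by (rule tendsto_iff_norm_diff[THEN iffD2])
qed

lemma in_L1_L2_diff: "in_L1_L2 f \<Longrightarrow> in_L1_L2 g \<Longrightarrow> in_L1_L2 (\<lambda>x. f x - g x)"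
  by (auto simp: in_L1_L2_def)

lemma in_L1_L2_add: "in_L1_L2 f \<Longrightarrow> in_L1_L2 g \<Longrightarrow> in_L1_L2 (\<lambda>x. f x + g x)"
  by (auto simp: in_L1_L2_def)

lemma norm_FT1_diff_le:
  assumes "in_L1_L2 f" "in_L1_L2 g"
  shows "norm (abs_l2 (FT1 f) - abs_l2 (FT1 g)) \<le> norm (abs_l2 f - abs_l2 g)"
proof -
  have d: "in_L1_L2 (\<lambda>x. f x - g x)" using assms by (rule in_L1_L2_diff)
  have e: "(\<lambda>x. FT1 f x - FT1 g x) = FT1 (\<lambda>x. f x - g x)"
    using assms by (intro ext FT1_diff[symmetric]) (auto simp: in_L1_L2_def)
  have "norm (abs_l2 (FT1 f) - abs_l2 (FT1 g)) = norm (abs_l2 (FT1 (\<lambda>x. f x - g x)))"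
    by (simp add: abs_diff[OF sq_int_FT1[OF assms(1)] sq_int_FT1[OF assms(2)]] e)
  then have "ennreal ((norm (abs_l2 (FT1 f) - abs_l2 (FT1 g)))\<^sup>2) = nn_sq (FT1 (\<lambda>x. f x - g x))"
    using sq_int_FT1[OF d] by (simp add: norm_abs_nn_sq)
  also have "\<dots> \<le> nn_sq (\<lambda>x. f x - g x)" using d by (intro nn_sq_FT1_le) (simp add: in_L1_L2_def)
  also have "\<dots> = ennreal ((norm (abs_l2 f - abs_l2 g))\<^sup>2)"
    using assms d by (simp add: in_L1_L2_def abs_diff norm_abs_nn_sq)
  finally have "(norm (abs_l2 (FT1 f) - abs_l2 (FT1 g)))\<^sup>2 \<le> (norm (abs_l2 f - abs_l2 g))\<^sup>2"
    by (subst (asm) ennreal_le_iff) auto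
  then show ?thesis by (rule power2_le_imp_le) simp
qed

text \<open>The limit runs over integer radii because \<open>lim\<close> takes a sequence;
  \<open>Four_tendsto\<close> recovers the real parameter of \<open>isFT\<close>.\<close>

definition Four :: "(real^'n) l2 \<Rightarrow> (real^'n) l2" where
  "Four A = lim (\<lambda>n. abs_l2 (FT1 (trunc (real n) (rep_l2 A))))"

lemma Four_tendsto: "((\<lambda>R. abs_l2 (FT1 (trunc R (rep_l2 A)))) \<longlongrightarrow> Four A) at_top"
proof -
  define T where "T R = abs_l2 (trunc R (rep_l2 A))" for R
  define G where "G R = abs_l2 (FT1 (trunc R (rep_l2 A)))" for R
  have T: "(T \<longlongrightarrow> A) at_top" unfolding T_def using abs_trunc_tendsto[of "rep_l2 A"] by simp
  have Tn: "(\<lambda>n. T (real n)) \<longlonglongrightarrow> A" using filterlim_compose[OF T filterlim_real_sequentially] .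
  have le: "norm (G R - G R') \<le> norm (T R - T R')" for R R'
    unfolding G_def T_def by (intro norm_FT1_diff_le in_L1_L2_trunc) auto
  have "Cauchy (\<lambda>n. G (real n))"
    unfolding Cauchy_def dist_norm
  proof (intro allI impI)
    fix e :: real assume "e > 0"
    then obtain M where "\<forall>m\<ge>M. \<forall>n\<ge>M. norm (T (real m) - T (real n)) < e"
      using LIMSEQ_imp_Cauchy[OF Tn] unfolding Cauchy_def dist_norm by blast
    then show "\<exists>M. \<forall>m\<ge>M. \<forall>n\<ge>M. norm (G (real m) - G (real n)) < e"
      by (intro exI[of _ M]) (auto intro: le_less_trans[OF le])
  qed
  then have lim: "(\<lambda>n. G (real n)) \<longlonglongrightarrow> Four A"
    unfolding Four_def G_def by (simp add: Cauchy_convergent_iff convergent_LIMSEQ_iff)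
  \<comment> \<open>The second radius goes to infinity in the contraction bound; this is what passes
    from integer to arbitrary radii.\<close>
  have bd: "norm (G R - Four A) \<le> norm (T R - A)" for R
  proof (rule LIMSEQ_le)
    show "(\<lambda>n. norm (G R - G (real n))) \<longlonglongrightarrow> norm (G R - Four A)" by (intro tendsto_intros lim)
    show "(\<lambda>n. norm (T R - T (real n))) \<longlonglongrightarrow> norm (T R - A)" by (intro tendsto_intros Tn)
  qed (use le in auto)
  have "((\<lambda>R. norm (T R - A)) \<longlongrightarrow> 0) at_top" using T by (rule tendsto_iff_norm_diff[THEN iffD1])
  then have "((\<lambda>R. norm (G R - Four A)) \<longlongrightarrow> 0) at_top"
    by (rule tendsto_sandwich[OF _ _ tendsto_const, rotated 2]) (auto simp: bd)
  then show ?thesis unfolding G_def[symmetric] by (rule tendsto_iff_norm_diff[THEN iffD2])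
qed

lemma Four_in_L1_L2:
  assumes f: "in_L1_L2 f" shows "Four (abs_l2 f) = abs_l2 (FT1 f)"
proof -
  have sf: "sq_int f" using f by (simp add: in_L1_L2_def)
  have e: "abs_l2 (FT1 (trunc R (rep_l2 (abs_l2 f)))) = abs_l2 (FT1 (trunc R f))" for R
  proof -
    have "FT1 (trunc R (rep_l2 (abs_l2 f))) = FT1 (trunc R f)"
    proof (rule FT1_cong_AE)
      show "AE x in lborel. trunc R (rep_l2 (abs_l2 f)) x = trunc R f x"
        using rep_abs[OF sf] by eventually_elim (simp add: trunc_def)
      show "trunc R (rep_l2 (abs_l2 f)) \<in> borel_measurable borel" "trunc R f \<in> borel_measurable borel"
        using in_L1_L2_trunc[of "rep_l2 (abs_l2 f)" R] in_L1_L2_trunc[OF sf, of R] by (auto simp: in_L1_L2_def)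
    qed
    then show ?thesis by simp
  qed
  have lim: "((\<lambda>R. abs_l2 (FT1 (trunc R f))) \<longlongrightarrow> Four (abs_l2 f)) at_top"
    using Four_tendsto[of "abs_l2 f"] unfolding e .
  have "((\<lambda>R. norm (abs_l2 (trunc R f) - abs_l2 f)) \<longlongrightarrow> 0) at_top"
    using abs_trunc_tendsto[OF sf] by (rule tendsto_iff_norm_diff[THEN iffD1])
  then have "((\<lambda>R. norm (abs_l2 (FT1 (trunc R f)) - abs_l2 (FT1 f))) \<longlongrightarrow> 0) at_top"
    by (rule tendsto_sandwich[OF _ _ tendsto_const, rotated 2])
      (auto intro!: always_eventually norm_FT1_diff_le f in_L1_L2_trunc sf)
  then have "((\<lambda>R. abs_l2 (FT1 (trunc R f))) \<longlongrightarrow> abs_l2 (FT1 f)) at_top"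
    by (rule tendsto_iff_norm_diff[THEN iffD2])
  with lim show ?thesis by (intro tendsto_unique) auto
qed

lemma l2_trunc_tendsto: "((\<lambda>R. abs_l2 (trunc R (rep_l2 A))) \<longlongrightarrow> A) at_top"
  using abs_trunc_tendsto[of "rep_l2 A"] by simp

lemma Four_Lip: "norm (Four A - Four B) \<le> norm (A - B)"
proof (rule tendsto_le[OF trivial_limit_at_top_linorder])
  show "((\<lambda>R::real. norm (abs_l2 (FT1 (trunc R (rep_l2 A))) - abs_l2 (FT1 (trunc R (rep_l2 B))))) \<longlongrightarrow> norm (Four A - Four B)) at_top"
    by (intro tendsto_intros Four_tendsto)
  show "((\<lambda>R::real. norm (abs_l2 (trunc R (rep_l2 A)) - abs_l2 (trunc R (rep_l2 B)))) \<longlongrightarrow> norm (A - B)) at_top"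
    by (intro tendsto_intros l2_trunc_tendsto)
qed (auto intro!: always_eventually norm_FT1_diff_le in_L1_L2_trunc)

lemma Four_tendsto_compose:
  assumes "(f \<longlongrightarrow> A) F" shows "((\<lambda>x. Four (f x)) \<longlongrightarrow> Four A) F"
proof -
  have "((\<lambda>x. norm (f x - A)) \<longlongrightarrow> 0) F" using assms by (rule tendsto_iff_norm_diff[THEN iffD1])
  then have "((\<lambda>x. norm (Four (f x) - Four A)) \<longlongrightarrow> 0) F"
    by (rule tendsto_sandwich[OF _ _ tendsto_const, rotated 2]) (auto intro!: always_eventually Four_Lip)
  then show ?thesis by (rule tendsto_iff_norm_diff[THEN iffD2])
qed

lemma Four_add: "Four (A + B) = Four A + Four B"
proof (rule tendsto_unique[OF trivial_limit_at_top_linorder])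
  let ?T = "\<lambda>A R. abs_l2 (trunc R (rep_l2 A))"
  show "((\<lambda>R::real. Four (?T A R + ?T B R)) \<longlongrightarrow> Four (A + B)) at_top"
    by (intro tendsto_intros Four_tendsto_compose l2_trunc_tendsto)
  have "Four (?T A R + ?T B R) = Four (?T A R) + Four (?T B R)" for R
  proof -
    define f where "f = trunc R (rep_l2 A)"
    define g where "g = trunc R (rep_l2 B)"
    have fg: "in_L1_L2 f" "in_L1_L2 g" unfolding f_def g_def by (auto intro: in_L1_L2_trunc)
    then have s: "sq_int f" "sq_int g" "integrable lborel f" "integrable lborel g" by (auto simp: in_L1_L2_def)
    have "Four (abs_l2 f + abs_l2 g) = abs_l2 (FT1 (\<lambda>x. f x + g x))"
      by (simp add: abs_add s Four_in_L1_L2 in_L1_L2_add fg)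
    also have "FT1 (\<lambda>x. f x + g x) = (\<lambda>x. FT1 f x + FT1 g x)"
      by (intro ext FT1_add s)
    also have "abs_l2 \<dots> = Four (abs_l2 f) + Four (abs_l2 g)"
      by (simp add: Four_in_L1_L2 fg abs_add sq_int_FT1)
    finally show ?thesis by (simp add: f_def g_def)
  qed
  then show "((\<lambda>R::real. Four (?T A R + ?T B R)) \<longlongrightarrow> Four A + Four B) at_top"
    by (simp only:) (intro tendsto_intros Four_tendsto_compose l2_trunc_tendsto)
qed

abbreviation cm :: "complex \<Rightarrow> 'a::euclidean_space l2 \<Rightarrow> 'a l2" where
  "cm c \<equiv> mul (\<lambda>_. c)"

lemma mok_const [simp]: "mok (\<lambda>_. c) A"
  by (rule mok_bounded[of _ "cmod c"]) auto

lemma bounded_linear_cm: "bounded_linear (cm c)"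
  by (rule bounded_linear_mul[of _ "cmod c"]) auto

lemma cm_abs: "sq_int f \<Longrightarrow> cm c (abs_l2 f) = abs_l2 (\<lambda>x. c * f x)"
  unfolding mul_def using rep_abs[of f] by (intro abs_eqI) auto

lemma scaleR_cm: "r *\<^sub>R A = cm (complex_of_real r) A"
  by (rule mul_eqI[symmetric]) (auto intro: rep_scaleR)

lemma Four_cm: "Four (cm c A) = cm c (Four A)"
proof (rule tendsto_unique[OF trivial_limit_at_top_linorder])
  let ?T = "\<lambda>A R. abs_l2 (trunc R (rep_l2 A))"
  note cmt = bounded_linear.tendsto[OF bounded_linear_cm]
  show "((\<lambda>R::real. Four (cm c (?T A R))) \<longlongrightarrow> Four (cm c A)) at_top"
    by (intro Four_tendsto_compose l2_trunc_tendsto cmt)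
  have "Four (cm c (?T A R)) = cm c (Four (?T A R))" for R
  proof -
    define f where "f = trunc R (rep_l2 A)"
    have f: "in_L1_L2 f" unfolding f_def by (auto intro: in_L1_L2_trunc)
    then have s: "sq_int f" by (auto simp: in_L1_L2_def)
    have "Four (cm c (abs_l2 f)) = abs_l2 (FT1 (\<lambda>x. c * f x))"
      by (simp add: cm_abs s Four_in_L1_L2 in_L1_L2_cmult f)
    also have "\<dots> = cm c (Four (abs_l2 f))"
      by (simp add: Four_in_L1_L2 f cm_abs sq_int_FT1 FT1_cmult[abs_def])
    finally show ?thesis by (simp add: f_def)
  qed
  then show "((\<lambda>R::real. Four (cm c (?T A R))) \<longlongrightarrow> cm c (Four A)) at_top"
    by (simp only:) (intro cmt Four_tendsto_compose l2_trunc_tendsto)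
qed

lemma Four_zero: "Four 0 = 0"
  using Four_add[of 0 0] by simp

lemma norm_Four_le: "norm (Four A) \<le> norm A"
  using Four_Lip[of A 0] by (simp add: Four_zero)

lemma bounded_linear_Four: "bounded_linear Four"
  by (rule bounded_linear_intro[of _ 1]) (auto simp: Four_add scaleR_cm Four_cm norm_Four_le)

lemma sq_int_reflect: "sq_int f \<Longrightarrow> sq_int (\<lambda>x. f (- x))"
  and nn_sq_reflect: "f \<in> borel_measurable borel \<Longrightarrow> nn_sq (\<lambda>x. f (- x)) = nn_sq f"
proof -
  show 1: "f \<in> borel_measurable borel \<Longrightarrow> nn_sq (\<lambda>x. f (- x)) = nn_sq f" for f :: "'a \<Rightarrow> complex"
    unfolding nn_sq_def using nn_integral_reflect[of "\<lambda>x. ennreal ((cmod (f x))\<^sup>2)" 0] by simp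
  assume s: "sq_int f"
  then have [measurable]: "f \<in> borel_measurable borel" by (simp add: sq_int_iff)
  have "(\<lambda>x. f (- x)) \<in> borel_measurable borel" by measurable
  then show "sq_int (\<lambda>x. f (- x))" using s 1[of f] by (simp add: sq_int_iff)
qed

definition reflect_l2 :: "'a::euclidean_space l2 \<Rightarrow> 'a l2" where
  "reflect_l2 A = abs_l2 (\<lambda>x. rep_l2 A (- x))"

lemma rep_reflt: "AE x in lborel. rep_l2 (reflect_l2 A) x = rep_l2 A (- x)"
  unfolding reflect_l2_def by (intro rep_abs sq_int_reflect) auto

lemma reflect_l2_abs: "sq_int f \<Longrightarrow> reflect_l2 (abs_l2 f) = abs_l2 (\<lambda>x. f (- x))"
  unfolding reflect_l2_def using AE_reflect[OF rep_abs[of f], of 0]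
  by (intro abs_eqI sq_int_reflect) auto

lemma reflect_l2_diff: "reflect_l2 A - reflect_l2 B = reflect_l2 (A - B)"
proof (rule l2_eqI)
  show "AE x in lborel. rep_l2 (reflect_l2 A - reflect_l2 B) x = rep_l2 (reflect_l2 (A - B)) x"
    using rep_minus[of "reflect_l2 A" "reflect_l2 B"] rep_reflt[of A] rep_reflt[of B] rep_reflt[of "A - B"] AE_reflect[OF rep_minus[of A B], of 0]
    by eventually_elim simp
qed

lemma norm_reflt [simp]: "norm (reflect_l2 A) = norm A"
proof -
  have "ennreal ((norm (reflect_l2 A))\<^sup>2) = ennreal ((norm A)\<^sup>2)"
    unfolding reflect_l2_def norm_abs_nn_sq[OF sq_int_reflect[OF sq_int_rep]]
    by (simp add: nn_sq_reflect norm_l2_nn_sq)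
  then have "(norm (reflect_l2 A))\<^sup>2 = (norm A)\<^sup>2"
    by (subst (asm) ennreal_inj) auto
  then show ?thesis by simp
qed

lemma reflect_l2_tendsto:
  assumes "(f \<longlongrightarrow> A) F" shows "((\<lambda>x. reflect_l2 (f x)) \<longlongrightarrow> reflect_l2 A) F"
proof (rule tendsto_iff_norm_diff[THEN iffD2])
  show "((\<lambda>x. norm (reflect_l2 (f x) - reflect_l2 A)) \<longlongrightarrow> 0) F"
    using tendsto_iff_norm_diff[THEN iffD1, OF assms] by (simp only: reflect_l2_diff norm_reflt)
qed

text \<open>At this point only a candidate, recognised as the adjoint of \<open>Four\<close> in
  \<open>Four_adjoint\<close>; \<open>Fi_Four\<close> and \<open>Four_Fi\<close> identify it as the
  inverse.\<close>

definition Fi :: "(real^'n) l2 \<Rightarrow> (real^'n) l2" where "Fi A = reflect_l2 (Four A)"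

lemma in_L1_L2_reflect: "in_L1_L2 f \<Longrightarrow> in_L1_L2 (\<lambda>x. f (- x))"
  using sq_int_reflect[of f] integrable_reflect[of f 0] by (simp add: in_L1_L2_def)

lemma FT1_reflect:
  assumes [measurable]: "f \<in> borel_measurable borel"
  shows "FT1 (\<lambda>x. f (- x)) \<xi> = FT1 f (- \<xi>)"
proof -
  have "(\<lambda>x. exp (- \<i> * complex_of_real (x \<bullet> (- \<xi>))) * f x) \<in> borel_measurable borel" by measurable
  from integral_reflect[OF this, of 0] show ?thesis by (simp add: FT1_eq)
qed

lemma Four_reflt: "Four (reflect_l2 A) = reflect_l2 (Four A)"
proof (rule tendsto_unique[OF trivial_limit_at_top_linorder])
  let ?T = "\<lambda>A R. abs_l2 (trunc R (rep_l2 A))"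
  show "((\<lambda>R::real. Four (reflect_l2 (?T A R))) \<longlongrightarrow> Four (reflect_l2 A)) at_top"
    by (intro Four_tendsto_compose l2_trunc_tendsto reflect_l2_tendsto)
  have "Four (reflect_l2 (?T A R)) = reflect_l2 (Four (?T A R))" for R
  proof -
    define f where "f = trunc R (rep_l2 A)"
    have f: "in_L1_L2 f" unfolding f_def by (auto intro: in_L1_L2_trunc)
    then have s: "sq_int f" "f \<in> borel_measurable borel" by (auto simp: in_L1_L2_def)
    have "Four (reflect_l2 (abs_l2 f)) = abs_l2 (FT1 (\<lambda>x. f (- x)))"
      by (simp add: reflect_l2_abs s Four_in_L1_L2 in_L1_L2_reflect f)
    also have "\<dots> = reflect_l2 (Four (abs_l2 f))"
      by (simp add: Four_in_L1_L2 f reflect_l2_abs sq_int_FT1 FT1_reflect[OF s(2), abs_def] s)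
    finally show ?thesis by (simp add: f_def)
  qed
  then show "((\<lambda>R::real. Four (reflect_l2 (?T A R))) \<longlongrightarrow> reflect_l2 (Four A)) at_top"
    by (simp only:) (intro reflect_l2_tendsto Four_tendsto_compose l2_trunc_tendsto)
qed

lemma Fi_tendsto: "(f \<longlongrightarrow> A) F \<Longrightarrow> ((\<lambda>x. Fi (f x)) \<longlongrightarrow> Fi A) F"
  unfolding Fi_def by (intro reflect_l2_tendsto Four_tendsto_compose)

lemma inner_abs_Re:
  assumes "sq_int f" "sq_int g"
  shows "inner (abs_l2 f) (abs_l2 g) = Re (LINT x|lborel. f x * cnj (g x))"
proof -
  have e: "f x \<bullet> g x = Re (f x * cnj (g x))" for x by (simp add: inner_complex_def)
  have "integrable lborel (\<lambda>x. f x * cnj (g x))"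
    by (intro integrable_mult_sq sq_int_cnj assms)
  from integral_Re[OF this] show ?thesis unfolding inner_abs[OF assms] e .
qed

text \<open>The multiplication formula applied to \<open>f\<close> and the conjugate of
  \<open>g\<close>; conjugation turns the transform into its reflection. Truncations carry the
  identity to all of L^2.\<close>

lemma Four_adjoint: "inner (Four A) B = inner A (Fi B)"
proof (rule tendsto_unique[OF trivial_limit_at_top_linorder])
  let ?T = "\<lambda>A R. abs_l2 (trunc R (rep_l2 A))"
  show "((\<lambda>R::real. inner (Four (?T A R)) (?T B R)) \<longlongrightarrow> inner (Four A) B) at_top"
    by (intro tendsto_intros Four_tendsto_compose l2_trunc_tendsto)
  have "inner (Four (?T A R)) (?T B R) = inner (?T A R) (Fi (?T B R))" for R
  proof -
    define f where "f = trunc R (rep_l2 A)"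
    define g where "g = trunc R (rep_l2 B)"
    have fg: "in_L1_L2 f" "in_L1_L2 g" unfolding f_def g_def by (auto intro: in_L1_L2_trunc)
    then have s: "sq_int f" "sq_int g" "integrable lborel f" "integrable lborel g" by (auto simp: in_L1_L2_def)
    have c: "FT1 (\<lambda>x. cnj (g x)) x = cnj (FT1 g (- x))" for x
    proof -
      have "exp (- \<i> * complex_of_real (y \<bullet> x)) * cnj (g y) = cnj (exp (- \<i> * complex_of_real (y \<bullet> - x)) * g y)" for y
        by (simp add: exp_cnj)
      then have "(LINT y|lborel. exp (- \<i> * complex_of_real (y \<bullet> x)) * cnj (g y)) = cnj (LINT y|lborel. exp (- \<i> * complex_of_real (y \<bullet> - x)) * g y)"
        by (simp only: Bochner_Integration.integral_cnj)
      then show ?thesis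
        by (simp only: FT1_eq complex_cnj_mult complex_cnj_complex_of_real)
    qed
    have "inner (Four (abs_l2 f)) (abs_l2 g) = Re (LINT x|lborel. FT1 f x * cnj (g x))"
      by (simp only: Four_in_L1_L2 fg inner_abs_Re sq_int_FT1 s)
    also have "(LINT x|lborel. FT1 f x * cnj (g x)) = (LINT x|lborel. f x * cnj (FT1 g (- x)))"
      using FT1_mult_formula[of f "\<lambda>x. cnj (g x)"] s by (simp add: c)
    also have "Re \<dots> = inner (abs_l2 f) (Fi (abs_l2 g))"
      by (simp only: Fi_def Four_in_L1_L2 fg reflect_l2_abs inner_abs_Re sq_int_FT1 s sq_int_reflect)
    finally show ?thesis by (simp add: f_def g_def)
  qed
  then show "((\<lambda>R::real. inner (Four (?T A R)) (?T B R)) \<longlongrightarrow> inner A (Fi B)) at_top"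
    by (simp only:) (intro tendsto_intros Fi_tendsto l2_trunc_tendsto)
qed

definition box_l2 :: "complex \<Rightarrow> 'a::euclidean_space \<Rightarrow> 'a \<Rightarrow> 'a l2" where
  "box_l2 c a b = abs_l2 (\<lambda>x. c * indicator (box a b) x)"

lemma sq_int_box [simp, intro]: "sq_int (\<lambda>x. c * indicator (box a b) x)"
  using in_L1_L2_box[of a b] by (auto simp: in_L1_L2_def)

text \<open>The scalars \<open>c = 1\<close> and \<open>c = \<i>\<close> test the real and the
  imaginary part separately, since the pairing is only real.\<close>

lemma l2_zero_boxes:
  assumes "\<And>c a b. inner h (box_l2 c a b) = 0" shows "h = 0"
proof -
  have i: "integrable lborel (\<lambda>x. indicator (box a b) x * rep_l2 h x)" for a b
    using emeasure_lborel_box_finite[of a b] by (intro integrable_indicator_mult) auto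
  have e: "inner h (box_l2 c a b) = (LINT x|lborel. rep_l2 h x \<bullet> (c * indicator (box a b) x))" for c a b
    unfolding box_l2_def using inner_abs[of "rep_l2 h" "\<lambda>x. c * indicator (box a b) x"] by simp
  have "AE x in lborel. Re (rep_l2 h x) = 0"
  proof (rule AE_zero_boxes)
    fix a b :: 'a
    show "integrable lborel (\<lambda>x. indicat_real (box a b) x * Re (rep_l2 h x))"
    proof -
      have "Re (indicator (box a b) x * rep_l2 h x) = indicat_real (box a b) x * Re (rep_l2 h x)" for x
        by (auto simp: indicator_def)
      then show ?thesis using integrable_Re[OF i[of a b]] by (simp only:)
    qed
    have "(LINT x|lborel. indicat_real (box a b) x * Re (rep_l2 h x)) = inner h (box_l2 1 a b)"
      unfolding e by (intro Bochner_Integration.integral_cong) (auto simp: inner_complex_def indicator_def)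
    then show "(LINT x|lborel. indicat_real (box a b) x * Re (rep_l2 h x)) = 0" using assms by simp
  qed measurable
  moreover have "AE x in lborel. Im (rep_l2 h x) = 0"
  proof (rule AE_zero_boxes)
    fix a b :: 'a
    show "integrable lborel (\<lambda>x. indicat_real (box a b) x * Im (rep_l2 h x))"
    proof -
      have "Im (indicator (box a b) x * rep_l2 h x) = indicat_real (box a b) x * Im (rep_l2 h x)" for x
        by (auto simp: indicator_def)
      then show ?thesis using integrable_Im[OF i[of a b]] by (simp only:)
    qed
    have "(LINT x|lborel. indicat_real (box a b) x * Im (rep_l2 h x)) = inner h (box_l2 \<i> a b)"
      unfolding e by (intro Bochner_Integration.integral_cong) (auto simp: inner_complex_def indicator_def)
    then show "(LINT x|lborel. indicat_real (box a b) x * Im (rep_l2 h x)) = 0" using assms by simp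
  qed measurable
  ultimately show ?thesis
    using rep_zero by (intro l2_eqI, eventually_elim) (simp add: complex_eq_iff)
qed

lemma Re_cmult_integral:
  "integrable M f \<Longrightarrow> Re (c * integral\<^sup>L M f) = (LINT x|M. Re (c * f x))"
  by (subst integral_Re) auto

text \<open>Isometry is only checked against indicators of boxes, where the convolution with the heat kernel can be controlled; orthogonality to all boxes then identifies \<open>Fi (Four A)\<close> with \<open>A\<close>.\<close>

lemma inner_Four_box: "inner (Four A) (Four (box_l2 c a b)) = inner A (box_l2 c a b)"
proof (rule tendsto_unique[OF trivial_limit_at_top_linorder])
  let ?T = "\<lambda>A R. abs_l2 (trunc R (rep_l2 A))"
  show "((\<lambda>R::real. inner (Four (?T A R)) (Four (box_l2 c a b))) \<longlongrightarrow> inner (Four A) (Four (box_l2 c a b))) at_top"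
    by (intro tendsto_intros Four_tendsto_compose l2_trunc_tendsto)
  have "inner (Four (?T A R)) (Four (box_l2 c a b)) = inner (?T A R) (box_l2 c a b)" for R
  proof -
    define f where "f = trunc R (rep_l2 A)"
    define h :: "real^'a \<Rightarrow> complex" where "h = indicator (box a b)"
    have fh: "in_L1_L2 f" "in_L1_L2 h" unfolding f_def h_def using in_L1_L2_box[of a b] by (auto intro: in_L1_L2_trunc)
    then have s: "sq_int f" "sq_int h" by (auto simp: in_L1_L2_def)
    have box_l2: "box_l2 c a b = abs_l2 (\<lambda>x. c * h x)" by (simp add: box_l2_def h_def)
    have i1: "integrable lborel (\<lambda>x. FT1 f x * cnj (FT1 h x))"
      by (intro integrable_mult_sq sq_int_cnj s sq_int_FT1 fh)
    have i2: "integrable lborel (\<lambda>x. f x * h x)" by (intro integrable_mult_sq s)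
    have "inner (Four (abs_l2 f)) (Four (box_l2 c a b)) = (LINT x|lborel. Re (cnj c * (FT1 f x * cnj (FT1 h x))))"
      unfolding box_l2 using fh s
      by (simp add: Four_in_L1_L2 in_L1_L2_cmult FT1_cmult[abs_def] inner_abs sq_int_FT1 sq_int_cmult inner_complex_def algebra_simps)
    also have "\<dots> = Re (cnj c * (LINT x|lborel. FT1 f x * cnj (FT1 h x)))"
      by (rule Re_cmult_integral[OF i1, symmetric])
    also have "(LINT x|lborel. FT1 f x * cnj (FT1 h x)) = (LINT x|lborel. f x * h x)"
      using FT1_pair_box[OF fh(1), of a b] by (simp add: h_def)
    also have "Re (cnj c * \<dots>) = (LINT x|lborel. Re (cnj c * (f x * h x)))"
      by (rule Re_cmult_integral[OF i2])
    also have "\<dots> = inner (abs_l2 f) (box_l2 c a b)"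
      unfolding box_l2 using s
      by (simp add: inner_abs sq_int_cmult, intro Bochner_Integration.integral_cong)
        (auto simp: inner_complex_def h_def indicator_def algebra_simps)
    finally show ?thesis by (simp add: f_def)
  qed
  then show "((\<lambda>R::real. inner (Four (?T A R)) (Four (box_l2 c a b))) \<longlongrightarrow> inner A (box_l2 c a b)) at_top"
    by (simp only:) (intro tendsto_intros l2_trunc_tendsto)
qed

lemma Fi_Four [simp]: "Fi (Four A) = A"
proof -
  have "Fi (Four A) - A = 0"
  proof (rule l2_zero_boxes)
    fix c a b
    have "inner (Fi (Four A)) (box_l2 c a b) = inner (Four A) (Four (box_l2 c a b))"
      using Four_adjoint[of "box_l2 c a b" "Four A"] by (simp add: inner_commute)
    then show "inner (Fi (Four A) - A) (box_l2 c a b) = 0"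
      by (simp add: inner_Four_box inner_diff_left)
  qed
  then show ?thesis by simp
qed

text \<open>\<open>Four\<close> commutes with the reflection, so the left inverse is also a right
  inverse; this gives surjectivity.\<close>

lemma Four_Fi [simp]: "Four (Fi A) = A"
  using Fi_Four[of A] by (simp add: Fi_def Four_reflt)

lemma inner_Four: "inner (Four A) (Four B) = inner A B"
  by (simp add: Four_adjoint)

lemma norm_Four [simp]: "norm (Four A) = norm A"
  by (simp add: norm_eq_sqrt_inner inner_Four)

lemma norm_Fi [simp]: "norm (Fi A) = norm A"
  using norm_Four[of "Fi A"] by simp

lemma Fi_add: "Fi (A + B) = Fi A + Fi B"
  by (metis Four_Fi Fi_Four Four_add)

lemma Fi_cm: "Fi (cm c A) = cm c (Fi A)"
  by (metis Four_Fi Fi_Four Four_cm)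

lemma bounded_linear_Fi: "bounded_linear Fi"
  by (rule bounded_linear_intro[of _ 1]) (auto simp: Fi_add scaleR_cm Fi_cm)

lemma Fi_in_L1_L2: "in_L1_L2 g \<Longrightarrow> AE x in lborel. rep_l2 (Fi (abs_l2 g)) x = FT1 g (- x)"
  unfolding Fi_def
  using rep_abs[OF sq_int_reflect[OF sq_int_FT1[of g]]]
  by (simp add: Four_in_L1_L2 reflect_l2_abs sq_int_FT1)

text \<open>The bridge to the problem statement: the limit over truncation radii in
  \<open>isFT\<close> becomes an equation in \<open>l2\<close>.\<close>

lemma isFT_iff: "isFT f g \<longleftrightarrow> sq_int f \<and> sq_int g \<and> abs_l2 g = Four (abs_l2 f)"
proof (cases "sq_int f \<and> sq_int g")
  case True
  then have f: "sq_int f" and g: "sq_int g" by auto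
  have lim: "((\<lambda>R. Four (abs_l2 (trunc R f))) \<longlongrightarrow> Four (abs_l2 f)) at_top"
    by (intro Four_tendsto_compose abs_trunc_tendsto f)
  have "L2n (\<lambda>\<xi>. FT1 (\<lambda>x. indicator (ball 0 R) x * f x) \<xi> - g \<xi>) = norm (Four (abs_l2 (trunc R f)) - abs_l2 g)" for R
  proof -
    have "trunc R f = (\<lambda>x. indicator (ball 0 R) x * f x)" by (simp add: trunc_def[abs_def])
    then show ?thesis
      using in_L1_L2_trunc[OF f, of R] g
      by (simp add: Four_in_L1_L2 abs_diff sq_int_FT1 norm_abs_l2 sq_int_diff)
  qed
  then have "isFT f g \<longleftrightarrow> ((\<lambda>R. norm (Four (abs_l2 (trunc R f)) - abs_l2 g)) \<longlongrightarrow> 0) at_top"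
    using f g by (simp add: isFT_def)
  also have "\<dots> \<longleftrightarrow> ((\<lambda>R. Four (abs_l2 (trunc R f))) \<longlongrightarrow> abs_l2 g) at_top"
    by (rule tendsto_iff_norm_diff[symmetric])
  also have "\<dots> \<longleftrightarrow> abs_l2 g = Four (abs_l2 f)"
  proof
    assume "((\<lambda>R. Four (abs_l2 (trunc R f))) \<longlongrightarrow> abs_l2 g) at_top"
    then show "abs_l2 g = Four (abs_l2 f)" using lim by (rule tendsto_unique[OF trivial_limit_at_top_linorder])
  next
    assume "abs_l2 g = Four (abs_l2 f)"
    then show "((\<lambda>R. Four (abs_l2 (trunc R f))) \<longlongrightarrow> abs_l2 g) at_top" using lim by (simp only:)
  qed
  finally show ?thesis using f g by simp
qed (auto simp: isFT_def)

section \<open>Potentials in weak Lebesgue spaces\<close>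

lemma cball_measurable [measurable]: "cball a r \<in> sets borel" "- cball a r \<in> sets borel"
  by auto

text \<open>Read backwards, this writes 1/a^2 as a layer integral over radii, the form used to
  integrate 1/|xi|^2 over a ball.\<close>

lemma nn_power_tail:
  assumes "a > (0::real)"
  shows "(\<integral>\<^sup>+r. ennreal (2 / r ^ 3) * indicator {a..} r \<partial>lborel) = ennreal (1 / a\<^sup>2)"
proof -
  have "(\<integral>\<^sup>+r. ennreal (2 / r ^ 3) * indicator {a..} r \<partial>lborel) = ennreal (0 - (- 1 / a\<^sup>2))"
  proof (rule nn_integral_FTC_atLeast)
    fix r :: real assume r: "a \<le> r"
    show "DERIV (\<lambda>r. - 1 / r\<^sup>2) r :> 2 / r ^ 3"
      using r assms by (auto intro!: derivative_eq_intros simp: field_simps power2_eq_square power3_eq_cube)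
    show "0 \<le> 2 / r ^ 3" using r assms by simp
  next
    show "((\<lambda>r::real. - 1 / r\<^sup>2) \<longlongrightarrow> 0) at_top"
      by (intro tendsto_divide_0[OF tendsto_const] filterlim_at_top_imp_at_infinity filterlim_pow_at_top filterlim_ident) auto
  qed measurable
  then show ?thesis by simp
qed

lemma nn_inv_sq_tail:
  assumes "a > (0::real)" "0 \<le> c"
  shows "(\<integral>\<^sup>+r. ennreal (c / r\<^sup>2) * indicator {a..} r \<partial>lborel) = ennreal (c / a)"
proof -
  have "(\<integral>\<^sup>+r. ennreal (c / r\<^sup>2) * indicator {a..} r \<partial>lborel) = ennreal (0 - (- c / a))"
  proof (rule nn_integral_FTC_atLeast)
    fix r :: real assume r: "a \<le> r"
    show "DERIV (\<lambda>r. - c / r) r :> c / r\<^sup>2"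
      using r assms by (auto intro!: derivative_eq_intros simp: field_simps power2_eq_square)
    show "0 \<le> c / r\<^sup>2" using r assms by simp
  next
    show "((\<lambda>r::real. - c / r) \<longlongrightarrow> 0) at_top"
      by (intro tendsto_divide_0[OF tendsto_const] filterlim_at_top_imp_at_infinity filterlim_ident)
  qed measurable
  then show ?thesis by simp
qed

text \<open>Polar coordinates are replaced by writing 1/|xi|^2 as the integral of 2/r^3 over r >=
  |xi| and exchanging integrals. With v the volume of the unit ball, radii up to \<open>R\<close>
  contribute 2 v R^(d-2) and larger radii v R^(d-2), hence the factor 3. Integrability at the origin
  is where d >= 3 enters.\<close>

lemma nn_ball_inv_sq:
  fixes R :: real
  assumes d: "DIM('a::euclidean_space) \<ge> 3" and R: "R > 0"
  shows "(\<integral>\<^sup>+\<xi>. indicator (cball 0 R) \<xi> * ennreal (1 / (norm (\<xi>::'a))\<^sup>2) \<partial>lborel) \<le> ennreal (3 * unit_ball_vol DIM('a) * R ^ (DIM('a) - 2))"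
proof -
  define v where "v = unit_ball_vol (real DIM('a))"
  have v: "v \<ge> 0" by (simp add: v_def)
  define d where "d = DIM('a)"
  obtain m where m: "d = m + 3" using d by (metis add.commute d_def le_Suc_ex)
  have "(\<integral>\<^sup>+\<xi>. indicator (cball 0 R) \<xi> * ennreal (1 / (norm (\<xi>::'a))\<^sup>2) \<partial>lborel)
    = (\<integral>\<^sup>+\<xi>. \<integral>\<^sup>+r. indicator (cball 0 R) (\<xi>::'a) * (ennreal (2 / r ^ 3) * indicator {norm \<xi>..} r) \<partial>lborel \<partial>lborel)"
  proof (rule nn_integral_cong_AE)
    show "AE \<xi>::'a in lborel. indicator (cball 0 R) \<xi> * ennreal (1 / (norm \<xi>)\<^sup>2)
      = (\<integral>\<^sup>+r. indicator (cball 0 R) \<xi> * (ennreal (2 / r ^ 3) * indicator {norm \<xi>..} r) \<partial>lborel)"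
      using AE_lborel_singleton[of "0::'a"]
    proof eventually_elim
      case (elim \<xi>)
      then show ?case by (subst nn_integral_cmult) (auto simp: nn_power_tail)
    qed
  qed
  also have "\<dots> = (\<integral>\<^sup>+r. \<integral>\<^sup>+\<xi>. indicator (cball 0 R) (\<xi>::'a) * (ennreal (2 / r ^ 3) * indicator {norm \<xi>..} r) \<partial>lborel \<partial>lborel)"
  proof (rule nn_swap)
    have "(\<lambda>(\<xi>::'a, r). indicator (cball 0 R) \<xi> * (ennreal (2 / r ^ 3) * indicator {norm \<xi>..} r)) =
      (\<lambda>z. indicator {z. norm (fst z) \<le> R} z * (ennreal (2 / snd z ^ 3) * indicator {z::'a \<times> real. norm (fst z) \<le> snd z} z))"
      by (auto simp: fun_eq_iff indicator_def)
    also have "\<dots> \<in> borel_measurable (lborel \<Otimes>\<^sub>M lborel)" by measurable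
    finally show "(\<lambda>(\<xi>::'a, r). indicator (cball 0 R) \<xi> * (ennreal (2 / r ^ 3) * indicator {norm \<xi>..} r)) \<in> borel_measurable (lborel \<Otimes>\<^sub>M lborel)" .
  qed
  also have "\<dots> \<le> (\<integral>\<^sup>+r. ennreal (2 * v * R ^ m) * indicator {0..R} r + ennreal (v * R ^ d) * (ennreal (2 / r ^ 3) * indicator {R..} r) \<partial>lborel)"
  proof (rule nn_integral_mono)
    fix r :: real
    show "(\<integral>\<^sup>+\<xi>. indicator (cball 0 R) (\<xi>::'a) * (ennreal (2 / r ^ 3) * indicator {norm \<xi>..} r) \<partial>lborel)
      \<le> ennreal (2 * v * R ^ m) * indicator {0..R} r + ennreal (v * R ^ d) * (ennreal (2 / r ^ 3) * indicator {R..} r)"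
    proof (cases "r > 0")
      case False
      then have "(\<integral>\<^sup>+\<xi>. indicator (cball 0 R) (\<xi>::'a) * (ennreal (2 / r ^ 3) * indicator {norm \<xi>..} r) \<partial>lborel) = (\<integral>\<^sup>+\<xi>. 0 \<partial>(lborel :: 'a measure))"
        by (intro nn_integral_cong) (auto simp: indicator_def ennreal_neg divide_nonneg_nonpos intro: ennreal_neg dest: order_trans[OF norm_ge_zero])
      then show ?thesis by simp
    next
      case r: True
      have "(\<integral>\<^sup>+\<xi>. indicator (cball 0 R) (\<xi>::'a) * (ennreal (2 / r ^ 3) * indicator {norm \<xi>..} r) \<partial>lborel)
        \<le> (\<integral>\<^sup>+\<xi>. ennreal (2 / r ^ 3) * indicator (cball (0::'a) (min r R)) \<xi> \<partial>lborel)"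
        by (intro nn_integral_mono) (auto simp: indicator_def)
      also have "\<dots> = ennreal (2 / r ^ 3 * (v * (min r R) ^ d))"
        using r R v by (subst nn_integral_cmult) (auto simp: emeasure_cball v_def d_def ennreal_mult[symmetric])
      also have "\<dots> \<le> ennreal (2 * v * R ^ m) * indicator {0..R} r + ennreal (v * R ^ d) * (ennreal (2 / r ^ 3) * indicator {R..} r)"
      proof (cases "r \<le> R")
        case True
        have "2 / r ^ 3 * (v * (min r R) ^ d) = 2 * v * r ^ m"
          using True r by (simp add: m power_add min_def)
        also have "\<dots> \<le> 2 * v * R ^ m" using True r v by (intro mult_left_mono power_mono) auto
        finally have "ennreal (2 / r ^ 3 * (v * (min r R) ^ d)) \<le> ennreal (2 * v * R ^ m)" by (rule ennreal_leI)
        then show ?thesis using True r by (auto simp: indicator_def intro: add_increasing2)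
      next
        case False
        then show ?thesis using r v R by (auto simp: indicator_def ennreal_mult[symmetric] min_def mult.commute)
      qed
      finally show ?thesis .
    qed
  qed
  also have "\<dots> = ennreal (2 * v * R ^ m) * ennreal R + ennreal (v * R ^ d) * ennreal (1 / R\<^sup>2)"
    using R by (subst nn_integral_add) (auto simp: nn_integral_cmult nn_power_tail)
  also have "\<dots> = ennreal (3 * v * R ^ (d - 2))"
    using R v by (simp add: ennreal_mult[symmetric] ennreal_plus[symmetric] m power_add power2_eq_square power3_eq_cube del: ennreal_plus)
  finally show ?thesis by (simp add: v_def d_def)
qed

lemma emeasure_layer [simp]: "0 \<le> b \<Longrightarrow> emeasure lborel {l::real. 0 < l \<and> l < b} = ennreal b"
proof -
  assume "0 \<le> b"
  have "{l. 0 < l \<and> l < b} = {0<..<b}" by auto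
  then show ?thesis using \<open>0 \<le> b\<close> by simp
qed

lemma nn_layer: "0 \<le> b \<Longrightarrow> (\<integral>\<^sup>+l. indicator {l. 0 < l \<and> l < b} l \<partial>lborel) = ennreal (b::real)"
  by (subst nn_integral_indicator) auto

text \<open>On low frequencies the pointwise bound comes from Cauchy--Schwarz against \<open>1/|\<xi>|\<close>, which is square integrable near the origin because \<open>d \<ge> 3\<close>.\<close>

lemma freq_split_bound:
  fixes A :: "(real^'n) l2"
  assumes d: "CARD('n) \<ge> 3" and R: "R > 0" and E: "E \<in> sets borel"
  defines "c \<equiv> 6 * (fourier_const TYPE('n))\<^sup>2 * unit_ball_vol (real CARD('n))"
  shows "(\<integral>\<^sup>+x. indicator E x * ennreal ((cmod (rep_l2 (Fi A) x))\<^sup>2) \<partial>lborel) \<le>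
     ennreal (c * R ^ (CARD('n) - 2)) * emeasure lborel E * (\<integral>\<^sup>+\<xi>. indicator (cball 0 R) \<xi> * ennreal ((norm \<xi>)\<^sup>2 * (cmod (rep_l2 A \<xi>))\<^sup>2) \<partial>lborel)
     + 2 * (\<integral>\<^sup>+\<xi>. indicator (- cball 0 R) \<xi> * ennreal ((cmod (rep_l2 A \<xi>))\<^sup>2) \<partial>lborel)"
proof -
  define v where "v = unit_ball_vol (real CARD('n))"
  have v: "v \<ge> 0" by (simp add: v_def)
  define a where "a = rep_l2 A"
  have [measurable]: "a \<in> borel_measurable borel" unfolding a_def by simp
  note [measurable] = E
  define a1 where "a1 \<xi> = indicator (cball 0 R) \<xi> * a \<xi>" for \<xi>
  define a2 where "a2 \<xi> = indicator (- cball 0 R) \<xi> * a \<xi>" for \<xi>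
  have a1: "in_L1_L2 a1" unfolding a1_def[abs_def] a_def
    using emeasure_lborel_cball_finite[of 0 R] by (intro in_L1_L2_indicator_mult) auto
  have a2: "sq_int a2" unfolding a2_def[abs_def] a_def by (intro sq_int_indicator_mult) auto
  have s1: "sq_int a1" using a1 by (simp add: in_L1_L2_def)
  have "(\<lambda>x. a1 x + a2 x) = a" by (auto simp: a1_def a2_def indicator_def fun_eq_iff)
  then have A: "A = abs_l2 a1 + abs_l2 a2" by (simp add: abs_add s1 a2 a_def)
  define I1 where "I1 = (LINT \<xi>|lborel. cmod (a1 \<xi>))"
  define p2 where "p2 = rep_l2 (Fi (abs_l2 a2))"
  have [measurable]: "p2 \<in> borel_measurable borel" unfolding p2_def by simp
  have bd: "AE x in lborel. (cmod (rep_l2 (Fi A) x))\<^sup>2 \<le> 2 * (fourier_const TYPE('n) * I1)\<^sup>2 + 2 * (cmod (p2 x))\<^sup>2"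
    using rep_plus[of "Fi (abs_l2 a1)" "Fi (abs_l2 a2)"] Fi_in_L1_L2[OF a1]
  proof eventually_elim
    case (elim x)
    have "(cmod (rep_l2 (Fi A) x))\<^sup>2 = (cmod (FT1 a1 (- x) + p2 x))\<^sup>2"
      using elim by (simp add: A Fi_add p2_def)
    also have "\<dots> \<le> 2 * (cmod (FT1 a1 (- x)))\<^sup>2 + 2 * (cmod (p2 x))\<^sup>2" by (rule cmod_add_sq)
    also have "\<dots> \<le> 2 * (fourier_const TYPE('n) * I1)\<^sup>2 + 2 * (cmod (p2 x))\<^sup>2"
      using FT1_bound[of a1 "- x"] by (intro add_mono mult_left_mono power_mono) (auto simp: I1_def)
    finally show ?case .
  qed
  have I1: "ennreal I1 = (\<integral>\<^sup>+\<xi>. ennreal (cmod (a1 \<xi>)) \<partial>lborel)"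
    using a1 unfolding I1_def in_L1_L2_def by (intro nn_integral_eq_integral[symmetric]) auto
  define S where "S = (\<integral>\<^sup>+\<xi>. indicator (cball 0 R) \<xi> * ennreal ((norm \<xi>)\<^sup>2 * (cmod (a \<xi>))\<^sup>2) \<partial>lborel)"
  have "(ennreal I1)\<^sup>2 = (\<integral>\<^sup>+\<xi>. (indicator (cball 0 R) \<xi> * ennreal (1 / norm \<xi>)) * (indicator (cball 0 R) \<xi> * ennreal (norm \<xi> * cmod (a \<xi>))) \<partial>lborel)\<^sup>2"
    unfolding I1
  proof (intro arg_cong[where f="\<lambda>x. x\<^sup>2"] nn_integral_cong_AE)
    show "AE \<xi> in lborel. ennreal (cmod (a1 \<xi>)) = (indicator (cball 0 R) \<xi> * ennreal (1 / norm \<xi>)) * (indicator (cball 0 R) \<xi> * ennreal (norm \<xi> * cmod (a \<xi>)))"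
      using AE_lborel_singleton[of "0::real^'n"]
      by eventually_elim (auto simp: a1_def indicator_def ennreal_mult[symmetric])
  qed
  also have "\<dots> \<le> (\<integral>\<^sup>+\<xi>. (indicator (cball 0 R) \<xi> * ennreal (1 / norm (\<xi>::real^'n)))\<^sup>2 \<partial>lborel) * (\<integral>\<^sup>+\<xi>. (indicator (cball 0 R) \<xi> * ennreal (norm \<xi> * cmod (a \<xi>)))\<^sup>2 \<partial>lborel)"
    by (rule Cauchy_Schwarz_nn_integral) measurable
  also have "(\<integral>\<^sup>+\<xi>. (indicator (cball 0 R) \<xi> * ennreal (1 / norm (\<xi>::real^'n)))\<^sup>2 \<partial>lborel) = (\<integral>\<^sup>+\<xi>. indicator (cball 0 R) \<xi> * ennreal (1 / (norm (\<xi>::real^'n))\<^sup>2) \<partial>lborel)"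
    by (intro nn_integral_cong) (auto simp: indicator_def ennreal_power power_divide)
  also have "(\<integral>\<^sup>+\<xi>. (indicator (cball 0 R) \<xi> * ennreal (norm \<xi> * cmod (a \<xi>)))\<^sup>2 \<partial>lborel) = S"
    unfolding S_def by (intro nn_integral_cong) (auto simp: indicator_def ennreal_power power_mult_distrib)
  also have "(\<integral>\<^sup>+\<xi>. indicator (cball 0 R) \<xi> * ennreal (1 / (norm (\<xi>::real^'n))\<^sup>2) \<partial>lborel) * S \<le> ennreal (3 * v * R ^ (CARD('n) - 2)) * S"
    using nn_ball_inv_sq[OF _ R, where 'a="real^'n"] d by (intro mult_right_mono) (auto simp: v_def)
  finally have I1S: "ennreal (I1\<^sup>2) \<le> ennreal (3 * v * R ^ (CARD('n) - 2)) * S"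
    by (simp add: ennreal_power I1_def)
  have "(\<integral>\<^sup>+x. indicator E x * ennreal ((cmod (rep_l2 (Fi A) x))\<^sup>2) \<partial>lborel) \<le>
    (\<integral>\<^sup>+x. ennreal (2 * (fourier_const TYPE('n) * I1)\<^sup>2) * indicator E x + 2 * ennreal ((cmod (p2 x))\<^sup>2) \<partial>lborel)"
  proof (rule nn_integral_mono_AE, use bd in eventually_elim)
    case (elim x)
    have "ennreal ((cmod (rep_l2 (Fi A) x))\<^sup>2) \<le> ennreal (2 * (fourier_const TYPE('n) * I1)\<^sup>2 + 2 * (cmod (p2 x))\<^sup>2)"
      using elim by (rule ennreal_leI)
    also have "\<dots> = ennreal (2 * (fourier_const TYPE('n) * I1)\<^sup>2) + 2 * ennreal ((cmod (p2 x))\<^sup>2)"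
      by (simp add: ennreal_mult)
    finally show ?case by (auto simp: indicator_def)
  qed
  also have "\<dots> = ennreal (2 * (fourier_const TYPE('n) * I1)\<^sup>2) * emeasure lborel E + 2 * nn_sq p2"
    unfolding nn_sq_def by (subst nn_integral_add) (auto simp: nn_integral_cmult)
  also have "nn_sq p2 = nn_sq a2"
    using a2 unfolding p2_def by (simp add: norm_l2_nn_sq[symmetric] norm_abs_nn_sq[symmetric])
  also have "nn_sq a2 = (\<integral>\<^sup>+\<xi>. indicator (- cball 0 R) \<xi> * ennreal ((cmod (a \<xi>))\<^sup>2) \<partial>lborel)"
    unfolding nn_sq_def by (intro nn_integral_cong) (auto simp: a2_def indicator_def)
  \<comment> \<open>The 6 in \<open>c\<close> is 2 from the split into low and high frequencies
    times 3 from \<open>nn_ball_inv_sq\<close>.\<close>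
  also have "ennreal (2 * (fourier_const TYPE('n) * I1)\<^sup>2) * emeasure lborel E \<le> ennreal (c * R ^ (CARD('n) - 2)) * emeasure lborel E * S"
  proof -
    have "ennreal (2 * (fourier_const TYPE('n) * I1)\<^sup>2) = ennreal (2 * (fourier_const TYPE('n))\<^sup>2) * ennreal (I1\<^sup>2)"
      by (simp add: ennreal_mult[symmetric] power_mult_distrib algebra_simps)
    also have "\<dots> \<le> ennreal (2 * (fourier_const TYPE('n))\<^sup>2) * (ennreal (3 * v * R ^ (CARD('n) - 2)) * S)"
      using I1S by (intro mult_left_mono) auto
    also have "\<dots> = ennreal (c * R ^ (CARD('n) - 2)) * S"
      using R v by (simp add: c_def v_def mult.assoc[symmetric] ennreal_mult[symmetric])
    finally have "ennreal (2 * (fourier_const TYPE('n) * I1)\<^sup>2) * emeasure lborel E \<le> (ennreal (c * R ^ (CARD('n) - 2)) * S) * emeasure lborel E"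
      by (rule mult_right_mono) simp
    then show ?thesis by (simp add: ac_simps)
  qed
  finally show ?thesis unfolding S_def a_def by (simp add: add_right_mono)
qed

text \<open>The coefficient of K |xi| left after integrating over the levels in
  \<open>weak_Ld_bound\<close>: the first summand comes from low frequencies, the 2 from high ones.
  It depends on the dimension alone, and its reciprocal is the smallness threshold of the
  theorem.\<close>

definition weakL_const :: "'n::finite itself \<Rightarrow> real" where
  "weakL_const _ = 6 * (fourier_const TYPE('n))\<^sup>2 * unit_ball_vol (real CARD('n)) + 2"

lemma weakL_const_pos: "weakL_const TYPE('n::finite) > 0"
  unfolding weakL_const_def by (intro add_nonneg_pos mult_nonneg_nonneg) auto

text \<open>At level \<open>l\<close> the cutoff is R = l/K. Then R^(d-2) times the measure bound
  (K/l)^d equals K^2/l^2. For a fixed frequency the low part is integrated over l >= K|xi| and the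
  high part over l < K|xi|, and both give a multiple of K|xi|. This scale-invariant choice is why
  weak L^d suffices.\<close>

theorem weak_Ld_bound:
  fixes A :: "(real^'n) l2" and w :: "real^'n \<Rightarrow> real"
  assumes d: "CARD('n) \<ge> 3" and K: "K > 0" "K \<in> weakL_bounds CARD('n) w"
    and w [measurable]: "w \<in> borel_measurable borel"
  shows "(\<integral>\<^sup>+x. ennreal (\<bar>w x\<bar> * (cmod (rep_l2 (Fi A) x))\<^sup>2) \<partial>lborel) \<le>
    ennreal (weakL_const TYPE('n) * K) * (\<integral>\<^sup>+\<xi>. ennreal (norm \<xi> * (cmod (rep_l2 A \<xi>))\<^sup>2) \<partial>lborel)"
proof -
  define a where "a = rep_l2 A"
  define p where "p = rep_l2 (Fi A)"
  have [measurable]: "a \<in> borel_measurable borel" "p \<in> borel_measurable borel" unfolding a_def p_def by auto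
  define c where "c = 6 * (fourier_const TYPE('n))\<^sup>2 * unit_ball_vol (real CARD('n))"
  have c: "c \<ge> 0" by (simp add: c_def)
  obtain m where m: "CARD('n) = m + 3" using d by (metis add.commute le_Suc_ex)
  \<comment> \<open>The weight of one frequency at one level: the first term counts it as low, the
    second as high.\<close>
  define g where "g l \<xi> = ennreal (c * K\<^sup>2 * (norm \<xi>)\<^sup>2 / l\<^sup>2) * indicator {K * norm \<xi>..} l + 2 * indicator {l. 0 < l \<and> l < K * norm \<xi>} l"
    for l and \<xi> :: "real^'n"
  have heat_kernel: "(\<lambda>(l, \<xi>). g l \<xi> * ennreal ((cmod (a \<xi>))\<^sup>2)) \<in> borel_measurable (lborel \<Otimes>\<^sub>M lborel)"
  proof -
    have "(\<lambda>(l, \<xi>). g l \<xi> * ennreal ((cmod (a \<xi>))\<^sup>2)) = (\<lambda>z. (ennreal (c * K\<^sup>2 * (norm (snd z))\<^sup>2 / (fst z)\<^sup>2) * indicator {z. K * norm (snd z) \<le> fst z} z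
       + 2 * indicator {z. 0 < fst z \<and> fst z < K * norm (snd z)} z) * ennreal ((cmod (a (snd z)))\<^sup>2))"
      by (auto simp: g_def fun_eq_iff indicator_def)
    also have "\<dots> \<in> borel_measurable (lborel \<Otimes>\<^sub>M lborel)" by measurable
    finally show ?thesis .
  qed
  have "(\<integral>\<^sup>+x. ennreal (\<bar>w x\<bar> * (cmod (p x))\<^sup>2) \<partial>lborel) =
    (\<integral>\<^sup>+x. \<integral>\<^sup>+l. indicator {l. 0 < l \<and> l < \<bar>w x\<bar>} l * ennreal ((cmod (p x))\<^sup>2) \<partial>lborel \<partial>lborel)"
    by (intro nn_integral_cong) (simp add: nn_integral_multc nn_layer ennreal_mult)
  also have "\<dots> = (\<integral>\<^sup>+l. \<integral>\<^sup>+x. indicator {l. 0 < l \<and> l < \<bar>w x\<bar>} l * ennreal ((cmod (p x))\<^sup>2) \<partial>lborel \<partial>lborel)"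
  proof (rule nn_swap)
    have "(\<lambda>(x, l). indicator {l. 0 < l \<and> l < \<bar>w x\<bar>} l * ennreal ((cmod (p x))\<^sup>2)) =
       (\<lambda>z. indicator {z. 0 < snd z \<and> snd z < \<bar>w (fst z)\<bar>} z * ennreal ((cmod (p (fst z)))\<^sup>2))"
      by (auto simp: fun_eq_iff indicator_def)
    also have "\<dots> \<in> borel_measurable (lborel \<Otimes>\<^sub>M lborel)" by measurable
    finally show "(\<lambda>(x, l). indicator {l. 0 < l \<and> l < \<bar>w x\<bar>} l * ennreal ((cmod (p x))\<^sup>2)) \<in> borel_measurable (lborel \<Otimes>\<^sub>M lborel)" .
  qed
  also have "\<dots> \<le> (\<integral>\<^sup>+l. \<integral>\<^sup>+\<xi>. g l \<xi> * ennreal ((cmod (a \<xi>))\<^sup>2) \<partial>lborel \<partial>lborel)"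
  proof (rule nn_integral_mono)
    fix l :: real
    show "(\<integral>\<^sup>+x. indicator {l. 0 < l \<and> l < \<bar>w x\<bar>} l * ennreal ((cmod (p x))\<^sup>2) \<partial>lborel) \<le> (\<integral>\<^sup>+\<xi>. g l \<xi> * ennreal ((cmod (a \<xi>))\<^sup>2) \<partial>lborel)"
    proof (cases "l > 0")
      case False
      then have "(\<integral>\<^sup>+x. indicator {l. 0 < l \<and> l < \<bar>w x\<bar>} l * ennreal ((cmod (p x))\<^sup>2) \<partial>lborel) = 0" by simp
      then show ?thesis by simp
    next
      case l: True
      define E where "E = {x. \<bar>w x\<bar> > l}"
      have E: "E \<in> sets borel" unfolding E_def by measurable
      have mE: "emeasure lborel E \<le> ennreal ((K / l) ^ CARD('n))"
        using K l by (auto simp: weakL_bounds_def E_def)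
      define S where "S = (\<integral>\<^sup>+\<xi>. indicator (cball 0 (l / K)) \<xi> * ennreal ((norm \<xi>)\<^sup>2 * (cmod (a \<xi>))\<^sup>2) \<partial>lborel)"
      define T where "T = (\<integral>\<^sup>+\<xi>. indicator (- cball 0 (l / K)) \<xi> * ennreal ((cmod (a \<xi>))\<^sup>2) \<partial>lborel)"
      have "(\<integral>\<^sup>+x. indicator {l. 0 < l \<and> l < \<bar>w x\<bar>} l * ennreal ((cmod (p x))\<^sup>2) \<partial>lborel) = (\<integral>\<^sup>+x. indicator E x * ennreal ((cmod (p x))\<^sup>2) \<partial>lborel)"
        using l by (intro nn_integral_cong) (auto simp: E_def indicator_def)
      also have "\<dots> \<le> ennreal (c * (l / K) ^ (CARD('n) - 2)) * emeasure lborel E * S + 2 * T"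
        unfolding p_def c_def S_def T_def a_def using l K by (intro freq_split_bound d E) auto
      also have "\<dots> \<le> ennreal (c * (l / K) ^ (CARD('n) - 2)) * ennreal ((K / l) ^ CARD('n)) * S + 2 * T"
        by (intro add_right_mono mult_right_mono mult_left_mono mE) auto
      also have "ennreal (c * (l / K) ^ (CARD('n) - 2)) * ennreal ((K / l) ^ CARD('n)) = ennreal (c * K\<^sup>2 / l\<^sup>2)"
        using l K c by (simp add: ennreal_mult[symmetric] m power_add power_divide power2_eq_square power3_eq_cube field_simps)
      also have "ennreal (c * K\<^sup>2 / l\<^sup>2) * S + 2 * T = (\<integral>\<^sup>+\<xi>. g l \<xi> * ennreal ((cmod (a \<xi>))\<^sup>2) \<partial>lborel)"
        unfolding S_def T_def
        apply (subst nn_integral_cmult[symmetric], measurable)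
        apply (subst nn_integral_cmult[symmetric], measurable)
        apply (subst nn_integral_add[symmetric], measurable)
        apply (intro nn_integral_cong)
        using l K c
        by (auto simp: g_def indicator_def ennreal_mult[symmetric] field_simps)
      finally show ?thesis .
    qed
  qed
  also have "\<dots> = (\<integral>\<^sup>+\<xi>. \<integral>\<^sup>+l. g l \<xi> * ennreal ((cmod (a \<xi>))\<^sup>2) \<partial>lborel \<partial>lborel)"
    by (rule nn_swap[OF heat_kernel])
  also have "\<dots> = (\<integral>\<^sup>+\<xi>. ennreal (weakL_const TYPE('n) * K) * ennreal (norm \<xi> * (cmod (a \<xi>))\<^sup>2) \<partial>lborel)"
  proof (rule nn_integral_cong_AE)
    show "AE \<xi> in lborel. (\<integral>\<^sup>+l. g l \<xi> * ennreal ((cmod (a \<xi>))\<^sup>2) \<partial>lborel) = ennreal (weakL_const TYPE('n) * K) * ennreal (norm \<xi> * (cmod (a \<xi>))\<^sup>2)"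
      using AE_lborel_singleton[of "0::real^'n"]
    proof eventually_elim
      case (elim \<xi>)
      then have n: "norm \<xi> > 0" by simp
      have "(\<integral>\<^sup>+l. g l \<xi> \<partial>lborel) = ennreal (c * K\<^sup>2 * (norm \<xi>)\<^sup>2 / (K * norm \<xi>)) + 2 * ennreal (K * norm \<xi>)"
        unfolding g_def using n K c
        by (subst nn_integral_add) (auto simp: nn_integral_cmult nn_layer nn_inv_sq_tail)
      also have "\<dots> = ennreal (weakL_const TYPE('n) * K * norm \<xi>)"
      proof -
        have "c * K\<^sup>2 * (norm \<xi>)\<^sup>2 / (K * norm \<xi>) = c * K * norm \<xi>" using n K by (simp add: power2_eq_square)
        moreover have "2 * ennreal (K * norm \<xi>) = ennreal (2 * K * norm \<xi>)" using n K by (simp add: ennreal_mult mult.assoc)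
        ultimately show ?thesis using n K c
          by (simp add: ennreal_plus[symmetric] weakL_const_def c_def[symmetric] distrib_right del: ennreal_plus)
      qed
      finally have "(\<integral>\<^sup>+l. g l \<xi> \<partial>lborel) = ennreal (weakL_const TYPE('n) * K * norm \<xi>)" .
      moreover have "(\<integral>\<^sup>+l. g l \<xi> * ennreal ((cmod (a \<xi>))\<^sup>2) \<partial>lborel) = (\<integral>\<^sup>+l. g l \<xi> \<partial>lborel) * ennreal ((cmod (a \<xi>))\<^sup>2)"
        by (rule nn_integral_multc) (auto simp: g_def)
      ultimately show ?case using n K weakL_const_pos[where 'n='n] by (simp add: ennreal_mult[symmetric] mult.assoc)
    qed
  qed
  also have "\<dots> = ennreal (weakL_const TYPE('n) * K) * (\<integral>\<^sup>+\<xi>. ennreal (norm \<xi> * (cmod (a \<xi>))\<^sup>2) \<partial>lborel)"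
    by (rule nn_integral_cmult) measurable
  finally show ?thesis unfolding a_def p_def .
qed

section \<open>Sobolev norms and the Hartree nonlinearity\<close>

lemma one_plus_norm_sq: "1 + (norm \<xi>)\<^sup>2 > 0" "1 + (norm \<xi>)\<^sup>2 \<noteq> 0"
  using add_pos_nonneg[OF zero_less_one zero_le_power2[of "norm \<xi>"]] by auto

lemma jb_pos [simp]: "jb s \<xi> > 0"
  by (simp only: jb_def powr_gt_zero one_plus_norm_sq not_False_eq_True)

lemma jb_nonneg [simp]: "jb s \<xi> \<ge> 0" and jb_nz [simp]: "jb s \<xi> \<noteq> 0"
  using jb_pos[of s \<xi>] by linarith+

lemma jb_measurable [measurable]: "jb s \<in> borel_measurable borel"
  unfolding jb_def[abs_def] by measurable

lemma jb_0 [simp]: "jb 0 \<xi> = 1"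
  by (simp add: jb_def one_plus_norm_sq)

lemma jb_add: "jb (s + t) \<xi> = jb s \<xi> * jb t \<xi>"
  by (simp add: jb_def powr_add[symmetric] add_divide_distrib)

lemma jb_mono: "s \<le> t \<Longrightarrow> jb s \<xi> \<le> jb t \<xi>"
  unfolding jb_def by (intro powr_mono) auto

lemma jb_sq: "(jb s \<xi>)\<^sup>2 = jb (2 * s) \<xi>"
  using jb_add[of s s \<xi>] by (simp add: power2_eq_square)

lemma norm_le_jb: "norm \<xi> \<le> jb 1 \<xi>"
proof -
  have "norm \<xi> = sqrt ((norm \<xi>)\<^sup>2)" by simp
  also have "\<dots> \<le> sqrt (1 + (norm \<xi>)\<^sup>2)" by (intro real_sqrt_le_mono) auto
  also have "\<dots> = jb 1 \<xi>" by (simp add: jb_def powr_half_sqrt)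
  finally show ?thesis .
qed

abbreviation jc :: "real \<Rightarrow> real^'n \<Rightarrow> complex" where
  "jc s \<equiv> \<lambda>\<xi>. complex_of_real (jb s \<xi>)"

text \<open>From here on elements of \<open>l2\<close> are read as Fourier transforms, so Sobolev
  weights act by multiplication. For negative \<open>s\<close> this reaches only those members of
  H^s that lie in L^2.\<close>

abbreviation Hs :: "real \<Rightarrow> (real^'n) l2 \<Rightarrow> bool" where "Hs s A \<equiv> mok (jc s) A"

abbreviation hn :: "real \<Rightarrow> (real^'n) l2 \<Rightarrow> real" where "hn s A \<equiv> norm (mul (jc s) A)"

text \<open>Extended-valued, so that membership in H^s and the size of the norm come out of a single
  estimate (\<open>hn_leI\<close>).\<close>

definition sobolev_sq :: "real \<Rightarrow> (real^'n) l2 \<Rightarrow> ennreal" where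
  "sobolev_sq s A = (\<integral>\<^sup>+\<xi>. ennreal (jb (2 * s) \<xi> * (cmod (rep_l2 A \<xi>))\<^sup>2) \<partial>lborel)"

lemma sobolev_sq_nsq: "nn_sq (\<lambda>\<xi>. jc s \<xi> * rep_l2 A \<xi>) = sobolev_sq s A"
  unfolding nn_sq_def sobolev_sq_def by (intro nn_integral_cong) (simp add: norm_mult power_mult_distrib jb_sq)

lemma Hs_iff: "Hs s A \<longleftrightarrow> sobolev_sq s A < \<infinity>"
  unfolding mok_def sq_int_iff sobolev_sq_nsq by simp

lemma sobolev_sq_hn: "Hs s A \<Longrightarrow> sobolev_sq s A = ennreal ((hn s A)\<^sup>2)"
  unfolding mul_def using norm_abs_nn_sq[of "\<lambda>\<xi>. jc s \<xi> * rep_l2 A \<xi>"]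
  by (simp add: mok_def sobolev_sq_nsq)

lemma hn_leI:
  assumes "sobolev_sq s A \<le> ennreal (c\<^sup>2)" "0 \<le> c" shows "Hs s A" "hn s A \<le> c"
proof -
  show 1: "Hs s A" unfolding Hs_iff using assms(1) by (auto intro: le_less_trans)
  then have "(hn s A)\<^sup>2 \<le> c\<^sup>2" using assms(1) unfolding sobolev_sq_hn[OF 1] by (subst (asm) ennreal_le_iff) auto
  then show "hn s A \<le> c" by (rule power2_le_imp_le) fact
qed

lemma Hs_mono: "s \<le> t \<Longrightarrow> Hs t A \<Longrightarrow> Hs s A"
  by (rule mok_dom[of "jc t" _ _ 1]) (auto intro: jb_mono)

lemma hn_mono: "s \<le> t \<Longrightarrow> Hs t A \<Longrightarrow> hn s A \<le> hn t A"
  using norm_mul_mono[of "jc s" A "jc t" A 1] Hs_mono[of s t A]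
  by (simp add: norm_mult mult_right_mono jb_mono)

lemma norm_le_hn: "0 \<le> s \<Longrightarrow> Hs s A \<Longrightarrow> norm A \<le> hn s A"
  using hn_mono[of 0 s A] by simp

lemma Hs_add: "Hs s A \<Longrightarrow> Hs s B \<Longrightarrow> Hs s (A + B)"
  by (rule mok_add) auto

lemma Hs_diff: "Hs s A \<Longrightarrow> Hs s B \<Longrightarrow> Hs s (A - B)"
  by (rule mok_diff) auto

lemma hn_add: "Hs s A \<Longrightarrow> Hs s B \<Longrightarrow> hn s (A + B) \<le> hn s A + hn s B"
  by (subst mul_add) (auto intro: norm_triangle_ineq)

lemma Hs_contr:
  assumes "m \<in> borel_measurable borel" "\<And>x. cmod (m x) \<le> 1" "Hs s A"
  shows "Hs s (mul m A)" "hn s (mul m A) \<le> hn s A"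
proof -
  have m: "mok m A" using assms by (intro mok_bounded) auto
  have le: "cmod (jc s x * m x) \<le> 1 * cmod (jc s x)" for x
    using assms(2)[of x] by (simp add: norm_mult mult_left_le)
  note [measurable] = assms(1)
  have jm: "jc s \<in> borel_measurable borel" by measurable
  have mj: "mok (\<lambda>x. jc s x * m x) A"
    by (rule mok_dom[OF assms(3) _ le]) measurable
  show "Hs s (mul m A)" using mok_mul_iff[OF m jm assms(1)] mj by (rule iffD2)
  have "hn s (mul m A) = norm (mul (\<lambda>x. jc s x * m x) A)"
    by (simp only: mul_mul[OF m jm assms(1) mj])
  also have "\<dots> \<le> 1 * hn s A"
  proof (rule norm_mul_mono[OF mj assms(3)])
    show "AE x in lborel. cmod (jc s x * m x * rep_l2 A x) \<le> 1 * cmod (jc s x * rep_l2 A x)"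
    proof (rule AE_I2)
      fix x
      show "cmod (jc s x * m x * rep_l2 A x) \<le> 1 * cmod (jc s x * rep_l2 A x)"
        using mult_right_mono[OF le[of x], of "cmod (rep_l2 A x)"] by (simp add: norm_mult)
    qed
  qed simp
  finally show "hn s (mul m A) \<le> hn s A" by simp
qed

text \<open>Sharpness of the cutoff makes this an orthogonal projection (\<open>lp_idem\<close>,
  \<open>lp_selfadjoint\<close>), which is what keeps the truncated equation conservative.\<close>

definition lp :: "real \<Rightarrow> (real^'n) l2 \<Rightarrow> (real^'n) l2" where
  "lp R A = mul (indicator (cball 0 R)) A"

lemma cmod_indicator_le: "cmod (indicator S x) \<le> 1"
  by (simp add: indicator_def)

lemma ind_measurable [measurable]: "(indicator (cball 0 R) :: real^'n \<Rightarrow> complex) \<in> borel_measurable borel"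
  by (intro borel_measurable_indicator) auto

lemma rep_lp: "AE \<xi> in lborel. rep_l2 (lp R A) \<xi> = indicator (cball 0 R) \<xi> * rep_l2 A \<xi>"
  unfolding lp_def by (rule rep_mul[OF mok_bounded[of _ 1]]) (auto intro: cmod_indicator_le)

lemma bounded_linear_lp: "bounded_linear (lp R)"
  unfolding lp_def[abs_def] by (rule bounded_linear_mul[of _ 1]) (auto intro: cmod_indicator_le)

lemma norm_lp_le: "norm (lp R A) \<le> norm A"
  unfolding lp_def using norm_mul_le[of "indicator (cball 0 R)" 1 A] by (simp add: cmod_indicator_le)

lemma Hs_lp: "Hs s A \<Longrightarrow> Hs s (lp R A)" "Hs s A \<Longrightarrow> hn s (lp R A) \<le> hn s A"
  unfolding lp_def by (auto intro!: Hs_contr cmod_indicator_le)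

lemma lp_idem: "lp R (lp R A) = lp R A"
proof (rule l2_eqI)
  show "AE x in lborel. rep_l2 (lp R (lp R A)) x = rep_l2 (lp R A) x"
    using rep_lp[of R A] rep_lp[of R "lp R A"] by eventually_elim (simp add: indicator_def)
qed

text \<open>Bernstein's inequality: on the ball of radius \<open>R\<close> the weight is
  bounded.\<close>

lemma lp_bound:
  assumes "0 \<le> s" "0 \<le> R"
  shows "Hs s (lp R A)" "hn s (lp R A) \<le> (1 + R\<^sup>2) powr (s / 2) * norm A"
proof -
  have b: "jb s \<xi> * cmod (rep_l2 (lp R A) \<xi>) \<le> (1 + R\<^sup>2) powr (s / 2) * cmod (rep_l2 A \<xi>)"
    if "rep_l2 (lp R A) \<xi> = indicator (cball 0 R) \<xi> * rep_l2 A \<xi>" for \<xi>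
  proof (cases "norm \<xi> \<le> R")
    case True
    then have "jb s \<xi> \<le> (1 + R\<^sup>2) powr (s / 2)"
      unfolding jb_def using assms by (intro powr_mono2 add_left_mono power_mono) (auto simp: add_pos_nonneg)
    then show ?thesis using that True by (simp add: mult_right_mono)
  next
    case False
    then show ?thesis using that assms by simp
  qed
  have "sobolev_sq s (lp R A) \<le> (\<integral>\<^sup>+\<xi>. ennreal (((1 + R\<^sup>2) powr (s / 2))\<^sup>2 * (cmod (rep_l2 A \<xi>))\<^sup>2) \<partial>lborel)"
    unfolding sobolev_sq_def
  proof (rule nn_integral_mono_AE, use rep_lp[of R A] in eventually_elim)
    case (elim \<xi>)
    have "(jb s \<xi> * cmod (rep_l2 (lp R A) \<xi>))\<^sup>2 \<le> ((1 + R\<^sup>2) powr (s / 2) * cmod (rep_l2 A \<xi>))\<^sup>2"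
      using b[OF elim] by (intro power_mono) auto
    then show ?case by (intro ennreal_leI) (simp only: power_mult_distrib jb_sq)
  qed
  also have "\<dots> = ennreal (((1 + R\<^sup>2) powr (s / 2) * norm A)\<^sup>2)"
    by (simp add: ennreal_mult nn_integral_cmult power_mult_distrib norm_l2_nn_sq nn_sq_def)
  finally show "Hs s (lp R A)" "hn s (lp R A) \<le> (1 + R\<^sup>2) powr (s / 2) * norm A"
    by (auto intro: hn_leI)
qed

section \<open>The trilinear Hartree form and its L^2 bounds\<close>

definition N3 :: "(real^'n \<Rightarrow> real) \<Rightarrow> (real^'n \<Rightarrow> complex) \<Rightarrow> (real^'n \<Rightarrow> complex) \<Rightarrow> (real^'n \<Rightarrow> complex) \<Rightarrow> real^'n \<Rightarrow> complex" where
  "N3 w a b c x = (LINT y|lborel. complex_of_real (w (x - y)) * (a y * cnj (b y))) * c x"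

lemma hartree_N3: "hartree w \<psi> = N3 w \<psi> \<psi> \<psi>"
proof
  fix x
  have "complex_of_real (w (x - y) * (cmod (\<psi> y))\<^sup>2) = complex_of_real (w (x - y)) * (\<psi> y * cnj (\<psi> y))" for y
    by (simp add: complex_norm_square[symmetric])
  then show "hartree w \<psi> x = N3 w \<psi> \<psi> \<psi> x"
    unfolding hartree_def N3_def integral_complex_of_real[symmetric] by (simp only:)
qed

text \<open>All that the local theory asks of the potential. \<open>pot_le\<close> bounds the
  convolution of |w| with a density uniformly in \<open>x\<close>; sign and smallness enter only in
  the later extension \<open>small_hartree_potential\<close>.\<close>

locale hartree_potential =
  fixes w :: "real^'n \<Rightarrow> real" and Lam :: real
  assumes w_measurable [measurable]: "w \<in> borel_measurable borel"
    and w_even: "\<And>x. w (- x) = w x"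
    and Lam_pos: "Lam > 0"
    and pot_le: "\<And>A x. Hs (1/2) A \<Longrightarrow>
      (\<integral>\<^sup>+y. ennreal (\<bar>w (x - y)\<bar> * (cmod (rep_l2 (Fi A) y))\<^sup>2) \<partial>lborel) \<le> ennreal (Lam * (hn (1/2) A)\<^sup>2)"
begin

definition pot :: "(real^'n \<Rightarrow> complex) \<Rightarrow> real^'n \<Rightarrow> ennreal" where
  "pot a x = (\<integral>\<^sup>+y. ennreal (\<bar>w (x - y)\<bar> * (cmod (a y))\<^sup>2) \<partial>lborel)"

lemma w_even2: "w (x - y) = w (y - x)"
  using w_even[of "x - y"] by simp

abbreviation h2 :: "(real^'n) l2 \<Rightarrow> real" where "h2 \<equiv> hn (1/2)"
abbreviation r2 :: "(real^'n) l2 \<Rightarrow> real^'n \<Rightarrow> complex" where "r2 A \<equiv> rep_l2 (Fi A)"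

lemma pot_fin: "Hs (1/2) A \<Longrightarrow> pot (r2 A) x \<le> ennreal (Lam * (h2 A)\<^sup>2)"
  unfolding pot_def by (rule pot_le)

lemma pot_measurable [measurable]:
  assumes [measurable]: "a \<in> borel_measurable borel"
  shows "pot a \<in> borel_measurable borel"
  unfolding pot_def[abs_def] by measurable

lemma integrable_pot:
  assumes "Hs (1/2) A" "Hs (1/2) B"
  shows "integrable lborel (\<lambda>y. complex_of_real (w (x - y)) * (r2 A y * cnj (r2 B y)))"
proof (rule integrableI_bounded)
  have "(\<integral>\<^sup>+y. ennreal (norm (complex_of_real (w (x - y)) * (r2 A y * cnj (r2 B y)))) \<partial>lborel)
     \<le> (\<integral>\<^sup>+y. ennreal (\<bar>w (x - y)\<bar> * (cmod (r2 A y))\<^sup>2) + ennreal (\<bar>w (x - y)\<bar> * (cmod (r2 B y))\<^sup>2) \<partial>lborel)"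
  proof (rule nn_integral_mono)
    fix y
    have "cmod (r2 A y) * cmod (r2 B y) \<le> (cmod (r2 A y))\<^sup>2 + (cmod (r2 B y))\<^sup>2"
      using sum_squares_bound[of "cmod (r2 A y)" "cmod (r2 B y)"]
        mult_nonneg_nonneg[OF norm_ge_zero[of "r2 A y"] norm_ge_zero[of "r2 B y"]] by linarith
    then have "norm (complex_of_real (w (x - y)) * (r2 A y * cnj (r2 B y))) \<le> \<bar>w (x - y)\<bar> * ((cmod (r2 A y))\<^sup>2 + (cmod (r2 B y))\<^sup>2)"
      by (simp add: norm_mult mult_left_mono)
    then show "ennreal (norm (complex_of_real (w (x - y)) * (r2 A y * cnj (r2 B y)))) \<le>
      ennreal (\<bar>w (x - y)\<bar> * (cmod (r2 A y))\<^sup>2) + ennreal (\<bar>w (x - y)\<bar> * (cmod (r2 B y))\<^sup>2)"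
      by (subst ennreal_plus[symmetric]) (auto intro!: ennreal_leI simp: distrib_left simp del: ennreal_plus)
  qed
  also have "\<dots> = pot (r2 A) x + pot (r2 B) x"
    unfolding pot_def by (rule nn_integral_add) measurable
  also have "\<dots> < \<infinity>"
    using pot_fin[OF assms(1), of x] pot_fin[OF assms(2), of x] by (auto intro: le_less_trans)
  finally show "(\<integral>\<^sup>+y. ennreal (norm (complex_of_real (w (x - y)) * (r2 A y * cnj (r2 B y)))) \<partial>lborel) < \<infinity>" .
qed measurable

lemma N3_measurable [measurable]:
  assumes [measurable]: "a \<in> borel_measurable borel" "b \<in> borel_measurable borel" "c \<in> borel_measurable borel"
  shows "N3 w a b c \<in> borel_measurable borel"
proof -
  have "(\<lambda>x. LINT y|lborel. complex_of_real (w (x - y)) * (a y * cnj (b y))) \<in> borel_measurable borel"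
    by (rule lborel.borel_measurable_lebesgue_integral) measurable
  then show ?thesis unfolding N3_def[abs_def] by measurable
qed

lemma nn_abs_pot_sq:
  assumes [measurable]: "a \<in> borel_measurable borel" "b \<in> borel_measurable borel"
  shows "(\<integral>\<^sup>+y. ennreal (\<bar>w (x - y)\<bar> * (cmod (a y) * cmod (b y))) \<partial>lborel)\<^sup>2 \<le> pot a x * pot b x"
proof -
  have "(\<integral>\<^sup>+y. ennreal (\<bar>w (x - y)\<bar> * (cmod (a y) * cmod (b y))) \<partial>lborel)
     = (\<integral>\<^sup>+y. ennreal (sqrt \<bar>w (x - y)\<bar> * cmod (a y)) * ennreal (sqrt \<bar>w (x - y)\<bar> * cmod (b y)) \<partial>lborel)"
    by (intro nn_integral_cong) (simp add: ennreal_mult[symmetric] algebra_simps)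
  also have "\<dots>\<^sup>2 \<le> (\<integral>\<^sup>+y. (ennreal (sqrt \<bar>w (x - y)\<bar> * cmod (a y)))\<^sup>2 \<partial>lborel) * (\<integral>\<^sup>+y. (ennreal (sqrt \<bar>w (x - y)\<bar> * cmod (b y)))\<^sup>2 \<partial>lborel)"
    by (rule Cauchy_Schwarz_nn_integral) measurable
  also have "\<dots> = pot a x * pot b x"
    unfolding pot_def by (simp add: ennreal_power power_mult_distrib)
  finally show ?thesis .
qed

lemma nn_sq_N3:
  assumes [measurable]: "a \<in> borel_measurable borel" "b \<in> borel_measurable borel" "c \<in> borel_measurable borel"
  shows "nn_sq (N3 w a b c) \<le> (\<integral>\<^sup>+x. pot a x * pot b x * ennreal ((cmod (c x))\<^sup>2) \<partial>lborel)"
  unfolding nn_sq_def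
proof (rule nn_integral_mono)
  fix x
  have "ennreal (cmod (LINT y|lborel. complex_of_real (w (x - y)) * (a y * cnj (b y)))) \<le> (\<integral>\<^sup>+y. ennreal (\<bar>w (x - y)\<bar> * (cmod (a y) * cmod (b y))) \<partial>lborel)"
    using integral_norm_bound_ennreal'[of lborel "\<lambda>y. complex_of_real (w (x - y)) * (a y * cnj (b y))"]
    by (simp add: norm_mult)
  then have "(ennreal (cmod (LINT y|lborel. complex_of_real (w (x - y)) * (a y * cnj (b y)))))\<^sup>2 \<le> pot a x * pot b x"
    using nn_abs_pot_sq[OF assms(1,2), of x] by (meson order_trans power_mono zero_le)
  then show "ennreal ((cmod (N3 w a b c x))\<^sup>2) \<le> pot a x * pot b x * ennreal ((cmod (c x))\<^sup>2)"
    by (simp add: N3_def norm_mult power_mult_distrib ennreal_mult ennreal_power mult_right_mono)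
qed

text \<open>Tonelli and evenness let the density inside the convolution trade places with the one
  outside. This is how an L^2 factor sitting inside the convolution, out of reach of
  \<open>pot_fin\<close>, is handled.\<close>

lemma pot_swap:
  assumes [measurable]: "a \<in> borel_measurable borel" "c \<in> borel_measurable borel"
  shows "(\<integral>\<^sup>+x. pot a x * ennreal ((cmod (c x))\<^sup>2) \<partial>lborel) = (\<integral>\<^sup>+y. pot c y * ennreal ((cmod (a y))\<^sup>2) \<partial>lborel)"
proof -
  have "(\<integral>\<^sup>+x. pot a x * ennreal ((cmod (c x))\<^sup>2) \<partial>lborel) = (\<integral>\<^sup>+x. \<integral>\<^sup>+y. ennreal (\<bar>w (x - y)\<bar> * (cmod (a y))\<^sup>2) * ennreal ((cmod (c x))\<^sup>2) \<partial>lborel \<partial>lborel)"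
    unfolding pot_def by (simp add: nn_integral_multc)
  also have "\<dots> = (\<integral>\<^sup>+y. \<integral>\<^sup>+x. ennreal (\<bar>w (x - y)\<bar> * (cmod (a y))\<^sup>2) * ennreal ((cmod (c x))\<^sup>2) \<partial>lborel \<partial>lborel)"
    by (rule nn_swap) measurable
  also have "\<dots> = (\<integral>\<^sup>+y. \<integral>\<^sup>+x. ennreal (\<bar>w (y - x)\<bar> * (cmod (c x))\<^sup>2) * ennreal ((cmod (a y))\<^sup>2) \<partial>lborel \<partial>lborel)"
  proof (intro nn_integral_cong)
    fix x y
    show "ennreal (\<bar>w (x - y)\<bar> * (cmod (a y))\<^sup>2) * ennreal ((cmod (c x))\<^sup>2) = ennreal (\<bar>w (y - x)\<bar> * (cmod (c x))\<^sup>2) * ennreal ((cmod (a y))\<^sup>2)"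
      using w_even2[of x y] by (simp add: ennreal_mult[symmetric] ac_simps)
  qed
  also have "\<dots> = (\<integral>\<^sup>+y. pot c y * ennreal ((cmod (a y))\<^sup>2) \<partial>lborel)"
    unfolding pot_def by (simp add: nn_integral_multc)
  finally show ?thesis .
qed

lemma nn_sq_r2: "nn_sq (r2 A) = ennreal ((norm A)\<^sup>2)"
  by (simp add: norm_l2_nn_sq[symmetric])

lemma pot_int_le:
  assumes "Hs (1/2) A"
  shows "(\<integral>\<^sup>+x. pot (r2 A) x * ennreal ((cmod (r2 C x))\<^sup>2) \<partial>lborel) \<le> ennreal (Lam * (h2 A)\<^sup>2) * ennreal ((norm C)\<^sup>2)"
proof -
  have "(\<integral>\<^sup>+x. pot (r2 A) x * ennreal ((cmod (r2 C x))\<^sup>2) \<partial>lborel) \<le> (\<integral>\<^sup>+x. ennreal (Lam * (h2 A)\<^sup>2) * ennreal ((cmod (r2 C x))\<^sup>2) \<partial>lborel)"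
    by (intro nn_integral_mono mult_right_mono pot_fin assms) auto
  also have "\<dots> = ennreal (Lam * (h2 A)\<^sup>2) * ennreal ((norm C)\<^sup>2)"
    by (subst nn_integral_cmult) (auto simp: nn_sq_r2[symmetric] nn_sq_def)
  finally show ?thesis .
qed

text \<open>One potential with an H^(1/2) factor is estimated in the supremum norm by
  \<open>pot_fin\<close>; what remains is one potential integrated against one density, controlled
  by \<open>pot_int_le\<close> directly or, in the second part, after
  \<open>pot_swap\<close>.\<close>

lemma triple_le:
  assumes "Hs (1/2) A" "Hs (1/2) B"
  shows "(\<integral>\<^sup>+x. pot (r2 A) x * pot (r2 B) x * ennreal ((cmod (r2 C x))\<^sup>2) \<partial>lborel) \<le> ennreal ((Lam * h2 A * h2 B * norm C)\<^sup>2)"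
    and "(\<integral>\<^sup>+x. pot (r2 C) x * pot (r2 A) x * ennreal ((cmod (r2 B x))\<^sup>2) \<partial>lborel) \<le> ennreal ((Lam * h2 A * h2 B * norm C)\<^sup>2)"
proof -
  have e: "ennreal (Lam * (h2 A)\<^sup>2) * (ennreal (Lam * (h2 B)\<^sup>2) * ennreal ((norm C)\<^sup>2)) = ennreal ((Lam * h2 A * h2 B * norm C)\<^sup>2)"
    using Lam_pos by (simp add: ennreal_mult[symmetric] power_mult_distrib) (simp add: power2_eq_square ac_simps)
  have "(\<integral>\<^sup>+x. pot (r2 A) x * pot (r2 B) x * ennreal ((cmod (r2 C x))\<^sup>2) \<partial>lborel) \<le> (\<integral>\<^sup>+x. ennreal (Lam * (h2 A)\<^sup>2) * (pot (r2 B) x * ennreal ((cmod (r2 C x))\<^sup>2)) \<partial>lborel)"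
    by (intro nn_integral_mono) (simp add: mult.assoc mult_right_mono pot_fin assms)
  also have "\<dots> = ennreal (Lam * (h2 A)\<^sup>2) * (\<integral>\<^sup>+x. pot (r2 B) x * ennreal ((cmod (r2 C x))\<^sup>2) \<partial>lborel)"
    by (rule nn_integral_cmult) measurable
  also have "\<dots> \<le> ennreal (Lam * (h2 A)\<^sup>2) * (ennreal (Lam * (h2 B)\<^sup>2) * ennreal ((norm C)\<^sup>2))"
    by (intro mult_left_mono pot_int_le assms) auto
  finally show "(\<integral>\<^sup>+x. pot (r2 A) x * pot (r2 B) x * ennreal ((cmod (r2 C x))\<^sup>2) \<partial>lborel) \<le> ennreal ((Lam * h2 A * h2 B * norm C)\<^sup>2)"
    unfolding e .
  have "(\<integral>\<^sup>+x. pot (r2 C) x * pot (r2 A) x * ennreal ((cmod (r2 B x))\<^sup>2) \<partial>lborel) \<le> (\<integral>\<^sup>+x. ennreal (Lam * (h2 A)\<^sup>2) * (pot (r2 C) x * ennreal ((cmod (r2 B x))\<^sup>2)) \<partial>lborel)"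
  proof (intro nn_integral_mono)
    fix x
    have "pot (r2 A) x * (pot (r2 C) x * ennreal ((cmod (r2 B x))\<^sup>2)) \<le> ennreal (Lam * (h2 A)\<^sup>2) * (pot (r2 C) x * ennreal ((cmod (r2 B x))\<^sup>2))"
      by (intro mult_right_mono pot_fin assms) auto
    then show "pot (r2 C) x * pot (r2 A) x * ennreal ((cmod (r2 B x))\<^sup>2) \<le> ennreal (Lam * (h2 A)\<^sup>2) * (pot (r2 C) x * ennreal ((cmod (r2 B x))\<^sup>2))"
      by (simp add: ac_simps)
  qed
  also have "\<dots> = ennreal (Lam * (h2 A)\<^sup>2) * (\<integral>\<^sup>+x. pot (r2 C) x * ennreal ((cmod (r2 B x))\<^sup>2) \<partial>lborel)"
    by (rule nn_integral_cmult) measurable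
  also have "\<dots> \<le> ennreal (Lam * (h2 A)\<^sup>2) * (ennreal (Lam * (h2 B)\<^sup>2) * ennreal ((norm C)\<^sup>2))"
    unfolding pot_swap[OF rep_measurable rep_measurable, of "Fi C"] by (intro mult_left_mono pot_int_le assms) auto
  finally show "(\<integral>\<^sup>+x. pot (r2 C) x * pot (r2 A) x * ennreal ((cmod (r2 B x))\<^sup>2) \<partial>lborel) \<le> ennreal ((Lam * h2 A * h2 B * norm C)\<^sup>2)"
    unfolding e .
qed

definition Nx :: "(real^'n) l2 \<Rightarrow> (real^'n) l2 \<Rightarrow> (real^'n) l2 \<Rightarrow> real^'n \<Rightarrow> complex" where
  "Nx A B C = N3 w (r2 A) (r2 B) (r2 C)"

text \<open>Input and output are on the Fourier side. The second slot is conjugated, so the form is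
  additive but not complex linear there. The class is meaningful once \<open>A\<close> and
  \<open>B\<close> are in H^(1/2), see \<open>sq_int_Nx\<close>.\<close>

definition Nf :: "(real^'n) l2 \<Rightarrow> (real^'n) l2 \<Rightarrow> (real^'n) l2 \<Rightarrow> (real^'n) l2" where
  "Nf A B C = Four (abs_l2 (Nx A B C))"

lemma Nx_measurable [measurable]: "Nx A B C \<in> borel_measurable borel"
  unfolding Nx_def by measurable

lemma sq_int_Nx:
  assumes "Hs (1/2) A" "Hs (1/2) B" shows "sq_int (Nx A B C)"
  unfolding Nx_def using nn_sq_N3[of "r2 A" "r2 B" "r2 C"] triple_le(1)[OF assms, of C]
  by (intro sq_intI) (auto intro: le_less_trans order_trans)

lemma norm_Nf: "Hs (1/2) A \<Longrightarrow> Hs (1/2) B \<Longrightarrow> ennreal ((norm (Nf A B C))\<^sup>2) = nn_sq (Nx A B C)"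
  unfolding Nf_def by (simp add: norm_abs_nn_sq sq_int_Nx)

text \<open>Any one slot can carry the L^2 norm: for the outer slot this is immediate from the
  potential bounds, for an inner slot \<open>pot_swap\<close> is behind it. Telescoped differences
  need all three versions.\<close>

lemma Nf_le:
  assumes "Hs (1/2) A" "Hs (1/2) B" "Hs (1/2) C"
  shows "norm (Nf A B C) \<le> Lam * h2 A * h2 B * norm C"
    and "norm (Nf A B C) \<le> Lam * h2 B * h2 C * norm A"
    and "norm (Nf A B C) \<le> Lam * h2 A * h2 C * norm B"
proof -
  have fin: "norm (Nf A B C) \<le> c" if "(\<integral>\<^sup>+x. pot (r2 A) x * pot (r2 B) x * ennreal ((cmod (r2 C x))\<^sup>2) \<partial>lborel) \<le> ennreal (c\<^sup>2)" "0 \<le> c" for c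
  proof -
    have "ennreal ((norm (Nf A B C))\<^sup>2) \<le> ennreal (c\<^sup>2)"
      unfolding norm_Nf[OF assms(1,2)] Nx_def using that(1) nn_sq_N3[of "r2 A" "r2 B" "r2 C"] order_trans by auto
    then have "(norm (Nf A B C))\<^sup>2 \<le> c\<^sup>2" by (subst (asm) ennreal_le_iff) auto
    then show ?thesis by (rule power2_le_imp_le) fact
  qed
  show "norm (Nf A B C) \<le> Lam * h2 A * h2 B * norm C"
    using Lam_pos by (intro fin triple_le(1) assms) auto
  show "norm (Nf A B C) \<le> Lam * h2 B * h2 C * norm A"
    using Lam_pos by (intro fin triple_le(2) assms) auto
  show "norm (Nf A B C) \<le> Lam * h2 A * h2 C * norm B"
    using Lam_pos triple_le(2)[OF assms(1,3), of B] by (intro fin) (auto simp: mult.commute)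
qed

end

section \<open>Multilinearity and symmetries of the form\<close>

lemma Fi_diff: "Fi (A - B) = Fi A - Fi B"
  by (rule linear_diff[OF bounded_linear.linear[OF bounded_linear_Fi]])

lemma Four_diff: "Four (A - B) = Four A - Four B"
  by (rule linear_diff[OF bounded_linear.linear[OF bounded_linear_Four]])

lemma inner_Four_left: "inner (Four A) D = inner A (Fi D)"
  by (rule Four_adjoint)

lemma inner_cm: "inner (cm c A) B = inner A (cm (cnj c) B)"
  by (rule inner_mul) auto

context hartree_potential
begin

lemma r2_diff: "AE y in lborel. r2 (A - A') y = r2 A y - r2 A' y"
  unfolding Fi_diff by (rule rep_minus)

lemma Nx_diff1:
  assumes "Hs (1/2) A" "Hs (1/2) A'" "Hs (1/2) B"
  shows "Nx (A - A') B C x = Nx A B C x - Nx A' B C x"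
proof -
  have "(LINT y|lborel. complex_of_real (w (x - y)) * (r2 (A - A') y * cnj (r2 B y))) =
    (LINT y|lborel. complex_of_real (w (x - y)) * (r2 A y * cnj (r2 B y)) - complex_of_real (w (x - y)) * (r2 A' y * cnj (r2 B y)))"
  proof (rule integral_cong_AE)
    show "AE y in lborel. complex_of_real (w (x - y)) * (r2 (A - A') y * cnj (r2 B y)) =
      complex_of_real (w (x - y)) * (r2 A y * cnj (r2 B y)) - complex_of_real (w (x - y)) * (r2 A' y * cnj (r2 B y))"
      using r2_diff[of A A'] by eventually_elim (simp only: left_diff_distrib right_diff_distrib complex_cnj_diff)
  qed measurable
  also have "\<dots> = (LINT y|lborel. complex_of_real (w (x - y)) * (r2 A y * cnj (r2 B y))) - (LINT y|lborel. complex_of_real (w (x - y)) * (r2 A' y * cnj (r2 B y)))"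
    by (intro Bochner_Integration.integral_diff integrable_pot assms)
  finally show ?thesis by (simp add: Nx_def N3_def left_diff_distrib)
qed

lemma Nx_diff2:
  assumes "Hs (1/2) A" "Hs (1/2) B'" "Hs (1/2) B"
  shows "Nx A (B - B') C x = Nx A B C x - Nx A B' C x"
proof -
  have "(LINT y|lborel. complex_of_real (w (x - y)) * (r2 A y * cnj (r2 (B - B') y))) =
    (LINT y|lborel. complex_of_real (w (x - y)) * (r2 A y * cnj (r2 B y)) - complex_of_real (w (x - y)) * (r2 A y * cnj (r2 B' y)))"
  proof (rule integral_cong_AE)
    show "AE y in lborel. complex_of_real (w (x - y)) * (r2 A y * cnj (r2 (B - B') y)) =
      complex_of_real (w (x - y)) * (r2 A y * cnj (r2 B y)) - complex_of_real (w (x - y)) * (r2 A y * cnj (r2 B' y))"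
      using r2_diff[of B B'] by eventually_elim (simp only: left_diff_distrib right_diff_distrib complex_cnj_diff)
  qed measurable
  also have "\<dots> = (LINT y|lborel. complex_of_real (w (x - y)) * (r2 A y * cnj (r2 B y))) - (LINT y|lborel. complex_of_real (w (x - y)) * (r2 A y * cnj (r2 B' y)))"
    by (intro Bochner_Integration.integral_diff integrable_pot assms)
  finally show ?thesis by (simp add: Nx_def N3_def left_diff_distrib)
qed

lemma Nf_diff1:
  assumes "Hs (1/2) A" "Hs (1/2) A'" "Hs (1/2) B"
  shows "Nf (A - A') B C = Nf A B C - Nf A' B C"
  unfolding Nf_def Four_diff[symmetric] abs_diff[OF sq_int_Nx[OF assms(1,3)] sq_int_Nx[OF assms(2,3)]]
  by (simp only: Nx_diff1[OF assms, abs_def])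

lemma Nf_diff2:
  assumes "Hs (1/2) A" "Hs (1/2) B" "Hs (1/2) B'"
  shows "Nf A (B - B') C = Nf A B C - Nf A B' C"
  unfolding Nf_def Four_diff[symmetric] abs_diff[OF sq_int_Nx[OF assms(1,2)] sq_int_Nx[OF assms(1,3)]]
  by (simp only: Nx_diff2[OF assms(1,3,2), abs_def])

lemma Nf_diff3:
  assumes "Hs (1/2) A" "Hs (1/2) B"
  shows "Nf A B (C - C') = Nf A B C - Nf A B C'"
  unfolding Nf_def Four_diff[symmetric] abs_diff[OF sq_int_Nx[OF assms] sq_int_Nx[OF assms]]
proof (intro arg_cong[where f=Four] abs_eqI sq_int_diff sq_int_Nx assms)
  show "AE x in lborel. Nx A B (C - C') x = Nx A B C x - Nx A B C' x"
    using r2_diff[of C C'] by eventually_elim (simp only: Nx_def N3_def right_diff_distrib)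
qed

lemma Nf_add3:
  assumes "Hs (1/2) A" "Hs (1/2) B"
  shows "Nf A B (C + C') = Nf A B C + Nf A B C'"
  using Nf_diff3[OF assms, of "C + C'" C'] by simp

lemma Nf_telescope:
  assumes "Hs (1/2) A" "Hs (1/2) B" "Hs (1/2) C" "Hs (1/2) A'" "Hs (1/2) B'" "Hs (1/2) C'"
  shows "Nf A B C - Nf A' B' C' = Nf (A - A') B C + Nf A' (B - B') C + Nf A' B' (C - C')"
  using assms by (simp add: Nf_diff1 Nf_diff2 Nf_diff3)

text \<open>Differences are measured in L^2 while H^(1/2) norms are merely bounded. This asymmetry
  gives both the convergence of the truncations and uniqueness at the energy regularity.\<close>

lemma Nf_Lip:
  assumes "Hs (1/2) A" "Hs (1/2) B"
  shows "norm (Nf A A A - Nf B B B) \<le> Lam * ((h2 A)\<^sup>2 + h2 A * h2 B + (h2 B)\<^sup>2) * norm (A - B)"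
proof -
  have d: "Hs (1/2) (A - B)" using assms by (rule Hs_diff)
  have "norm (Nf A A A - Nf B B B) \<le> norm (Nf (A - B) A A) + norm (Nf B (A - B) A) + norm (Nf B B (A - B))"
    unfolding Nf_telescope[OF assms(1,1,1,2,2,2)] by (intro order_trans[OF norm_triangle_ineq] add_mono norm_triangle_ineq) auto
  also have "\<dots> \<le> Lam * h2 A * h2 A * norm (A - B) + Lam * h2 B * h2 A * norm (A - B) + Lam * h2 B * h2 B * norm (A - B)"
    using assms d by (intro add_mono Nf_le) auto
  also have "\<dots> = Lam * ((h2 A)\<^sup>2 + h2 A * h2 B + (h2 B)\<^sup>2) * norm (A - B)"
    by (simp add: algebra_simps power2_eq_square)
  finally show ?thesis .
qed

definition hartree_pot :: "(real^'n) l2 \<Rightarrow> real^'n \<Rightarrow> real" where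
  "hartree_pot A x = (LINT y|lborel. w (x - y) * (cmod (r2 A y))\<^sup>2)"

lemma Nx_hartree_pot: "Nx A A C x = complex_of_real (hartree_pot A x) * r2 C x"
proof -
  have "complex_of_real (w (x - y) * (cmod (r2 A y))\<^sup>2) = complex_of_real (w (x - y)) * (r2 A y * cnj (r2 A y))" for y
    by (simp add: complex_norm_square[symmetric])
  then show ?thesis
    unfolding Nx_def N3_def hartree_pot_def integral_complex_of_real[symmetric] by (simp only:)
qed

lemma Vp_measurable [measurable]: "hartree_pot A \<in> borel_measurable borel"
  unfolding hartree_pot_def[abs_def] by (rule lborel.borel_measurable_lebesgue_integral) measurable

lemma inner_Nf:
  assumes "Hs (1/2) A"
  shows "inner (Nf A A C) D = (LINT x|lborel. hartree_pot A x * (r2 C x \<bullet> r2 D x))"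
proof -
  have "inner (Nf A A C) D = (LINT x|lborel. Nx A A C x \<bullet> r2 D x)"
    unfolding Nf_def inner_Four_left using inner_abs[OF sq_int_Nx[OF assms assms], of "r2 D" C] by simp
  also have "\<dots> = (LINT x|lborel. hartree_pot A x * (r2 C x \<bullet> r2 D x))"
    unfolding Nx_hartree_pot by (intro Bochner_Integration.integral_cong) (auto simp: inner_complex_def algebra_simps)
  finally show ?thesis .
qed

lemma inner_Nf_sym: "Hs (1/2) A \<Longrightarrow> inner (Nf A A C) D = inner (Nf A A D) C"
  by (simp only: inner_Nf inner_commute[of "r2 C _"])

text \<open>A real potential multiplies symmetrically, so \<open>\<i>\<close> times it is skew; this
  is conservation of mass.\<close>

lemma inner_Nf_i:
  assumes "Hs (1/2) A" shows "inner (cm (- \<i>) (Nf A A C)) C = 0"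
proof -
  have "inner (cm (- \<i>) (Nf A A C)) C = inner (Nf A A C) (cm \<i> C)" by (simp add: inner_cm)
  also have "\<dots> = (LINT x|lborel. hartree_pot A x * (r2 C x \<bullet> (\<i> * r2 C x)))"
    unfolding inner_Nf[OF assms] Fi_cm
  proof (rule integral_cong_AE)
    show "AE x in lborel. hartree_pot A x * (r2 C x \<bullet> rep_l2 (cm \<i> (Fi C)) x) = hartree_pot A x * (r2 C x \<bullet> (\<i> * r2 C x))"
      using rep_mul[of "\<lambda>_. \<i>" "Fi C"] by auto
  qed measurable
  also have "\<dots> = 0" by (simp add: inner_complex_def algebra_simps)
  finally show ?thesis .
qed

text \<open>Evenness of the potential makes the quartic form symmetric under exchange of its two pairs of arguments; energy conservation rests on this.\<close>

lemma Nf_exchange: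
  assumes "Hs (1/2) A" "Hs (1/2) B"
  shows "inner (Nf A A B) B = inner (Nf B B A) A"
proof -
  define f where "f x y = complex_of_real (w (x - y) * (cmod (r2 A y))\<^sup>2 * (cmod (r2 B x))\<^sup>2)" for x y
  have sw: "(LINT x|lborel. LINT y|lborel. f x y) = (LINT y|lborel. LINT x|lborel. f x y)"
  proof (rule fubini_swap)
    show "case_prod f \<in> borel_measurable (lborel \<Otimes>\<^sub>M lborel)" unfolding f_def[abs_def] by measurable
    have "(\<integral>\<^sup>+x. \<integral>\<^sup>+y. ennreal (cmod (f x y)) \<partial>lborel \<partial>lborel) = (\<integral>\<^sup>+x. pot (r2 A) x * ennreal ((cmod (r2 B x))\<^sup>2) \<partial>lborel)"
      unfolding pot_def by (simp add: nn_integral_multc[symmetric] f_def norm_mult ennreal_mult[symmetric] norm_power)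
    also have "\<dots> < \<infinity>"
      using pot_int_le[OF assms(1), of B] by (auto simp: ennreal_mult_less_top intro: le_less_trans)
    finally show "(\<integral>\<^sup>+x. \<integral>\<^sup>+y. ennreal (cmod (f x y)) \<partial>lborel \<partial>lborel) < \<infinity>" .
  qed
  have 1: "(LINT y|lborel. f x y) = complex_of_real (hartree_pot A x * (r2 B x \<bullet> r2 B x))" for x
    unfolding f_def integral_complex_of_real hartree_pot_def by (simp add: power2_norm_eq_inner[symmetric])
  have 2: "(LINT x|lborel. f x y) = complex_of_real (hartree_pot B y * (r2 A y \<bullet> r2 A y))" for y
  proof -
    have "f x y = complex_of_real ((w (y - x) * (cmod (r2 B x))\<^sup>2) * (cmod (r2 A y))\<^sup>2)" for x
      unfolding f_def w_even2[of y x] by (simp add: ac_simps)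
    then have "(LINT x|lborel. f x y) = complex_of_real (LINT x|lborel. (w (y - x) * (cmod (r2 B x))\<^sup>2) * (cmod (r2 A y))\<^sup>2)"
      by (simp only: integral_complex_of_real)
    also have "(LINT x|lborel. (w (y - x) * (cmod (r2 B x))\<^sup>2) * (cmod (r2 A y))\<^sup>2) = hartree_pot B y * (cmod (r2 A y))\<^sup>2"
      unfolding hartree_pot_def by (rule integral_mult_left_zero)
    finally show ?thesis by (simp only: power2_norm_eq_inner)
  qed
  show ?thesis using sw unfolding 1 2 integral_complex_of_real of_real_eq_iff inner_Nf[OF assms(1)] inner_Nf[OF assms(2)] .
qed

end

section \<open>Frequency support of the nonlinearity and the Sobolev estimate\<close>

text \<open>Vanishing of modulated pairings is a complex statement, while \<open>inner\<close> sees
  only real parts. The imaginary part is recovered by testing with \<open>cm \<i>\<close>, so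
  Parseval's identity transfers.\<close>

definition complex_inner :: "'a::euclidean_space l2 \<Rightarrow> 'a l2 \<Rightarrow> complex" where
  "complex_inner A B = (LINT x|lborel. rep_l2 A x * cnj (rep_l2 B x))"

lemma Re_complex_inner: "Re (complex_inner A B) = inner A B"
  using inner_abs_Re[of "rep_l2 A" "rep_l2 B"] by (simp add: complex_inner_def)

lemma Im_complex_inner: "Im (complex_inner A B) = inner A (cm \<i> B)"
proof -
  have "inner A (cm \<i> B) = Re (LINT x|lborel. rep_l2 A x * cnj (\<i> * rep_l2 B x))"
    using inner_abs_Re[of "rep_l2 A" "\<lambda>x. \<i> * rep_l2 B x"] by (simp add: mul_def sq_int_cmult)
  also have "(LINT x|lborel. rep_l2 A x * cnj (\<i> * rep_l2 B x)) = (LINT x|lborel. (- \<i>) * (rep_l2 A x * cnj (rep_l2 B x)))"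
    by (intro Bochner_Integration.integral_cong) auto
  also have "\<dots> = (- \<i>) * complex_inner A B" unfolding complex_inner_def by (rule integral_mult_right_zero)
  finally show ?thesis by simp
qed

lemma inner_Fi: "inner (Fi A) (Fi B) = inner A B"
  using inner_Four[of "Fi A" "Fi B"] by simp

lemma complex_inner_Fi: "complex_inner (Fi A) (Fi B) = complex_inner A B"
  by (simp add: complex_eq_iff Re_complex_inner Im_complex_inner inner_Fi Fi_cm[symmetric])

lemma lp_selfadjoint: "inner (lp R A) B = inner A (lp R B)"
proof -
  have "(\<lambda>x. cnj (indicator (cball 0 R) x)) = (indicator (cball 0 R) :: real^'a \<Rightarrow> complex)"
    by (auto simp: indicator_def)
  moreover have "mok (indicator (cball 0 R)) X" for X :: "(real^'a) l2"
    by (rule mok_bounded[of _ 1]) (auto intro: cmod_indicator_le)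
  ultimately show ?thesis
    unfolding lp_def using inner_mul[of "indicator (cball 0 R)" A B] by simp
qed

lemma lp_diff: "lp R (A - B) = lp R A - lp R B"
  by (rule linear_diff[OF bounded_linear.linear[OF bounded_linear_lp]])

text \<open>Duality: the test vector is the high-frequency part of \<open>Y\<close> itself. It turns
  the support of a transform into the vanishing of integrals in space.\<close>

lemma supp_criterion:
  assumes "\<And>D. lp R D = 0 \<Longrightarrow> inner Y D = 0" shows "lp R Y = Y"
proof -
  define D where "D = Y - lp R Y"
  have D: "lp R D = 0" by (simp add: D_def lp_diff lp_idem)
  have "inner D D = inner Y D - inner Y (lp R D)"
    unfolding lp_selfadjoint[symmetric] by (simp add: D_def inner_diff_left)
  also have "\<dots> = 0" using assms[OF D] D by simp
  finally show ?thesis by (simp add: D_def)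
qed

lemma sq_int_translate: "sq_int f \<Longrightarrow> sq_int (\<lambda>x. f (x - t))"
proof -
  assume s: "sq_int f"
  then have [measurable]: "f \<in> borel_measurable borel" by (simp add: sq_int_iff)
  have "nn_sq (\<lambda>x. f (x - t)) = nn_sq f"
    unfolding nn_sq_def using nn_integral_affine[of "\<lambda>x. ennreal ((cmod (f x))\<^sup>2)" 1 "- t"] by simp
  moreover have "(\<lambda>x. f (x - t)) \<in> borel_measurable borel" by measurable
  ultimately show ?thesis using s by (simp add: sq_int_iff)
qed

lemma integrable_translate:
  fixes f :: "'a::euclidean_space \<Rightarrow> 'b::{banach, second_countable_topology}"
  assumes "integrable lborel f" shows "integrable lborel (\<lambda>x. f (x - t))"
  using integrable_reflect[OF integrable_reflect[OF assms, of "- t"], of 0] by simp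

lemma integral_translate:
  fixes f :: "'a::euclidean_space \<Rightarrow> 'b::{banach, second_countable_topology}"
  assumes [measurable]: "f \<in> borel_measurable borel"
  shows "(LINT x|lborel. f (x - t)) = (LINT x|lborel. f x)"
  using integral_reflect[of "\<lambda>x. f (- t - x)" 0] integral_reflect[of f "- t"] by simp

lemma FT1_translate:
  assumes [measurable]: "f \<in> borel_measurable borel"
  shows "FT1 (\<lambda>x. f (x - t)) \<xi> = exp (- \<i> * complex_of_real (t \<bullet> \<xi>)) * FT1 f \<xi>"
proof -
  have "(\<lambda>x. exp (- \<i> * complex_of_real ((x + t) \<bullet> \<xi>)) * f x) \<in> borel_measurable borel" by measurable
  from integral_translate[OF this, of t]
  have "(LINT x|lborel. exp (- \<i> * complex_of_real (x \<bullet> \<xi>)) * f (x - t)) = (LINT x|lborel. exp (- \<i> * complex_of_real ((x + t) \<bullet> \<xi>)) * f x)"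
    by simp
  also have "\<dots> = (LINT x|lborel. exp (- \<i> * complex_of_real (t \<bullet> \<xi>)) * (exp (- \<i> * complex_of_real (x \<bullet> \<xi>)) * f x))"
  proof (intro Bochner_Integration.integral_cong refl)
    fix x
    have "exp (- \<i> * complex_of_real ((x + t) \<bullet> \<xi>)) = exp (- \<i> * complex_of_real (t \<bullet> \<xi>)) * exp (- \<i> * complex_of_real (x \<bullet> \<xi>))"
      by (simp add: exp_add[symmetric] inner_add_left algebra_simps)
    then show "exp (- \<i> * complex_of_real ((x + t) \<bullet> \<xi>)) * f x = exp (- \<i> * complex_of_real (t \<bullet> \<xi>)) * (exp (- \<i> * complex_of_real (x \<bullet> \<xi>)) * f x)"
      by simp
  qed
  also have "\<dots> = exp (- \<i> * complex_of_real (t \<bullet> \<xi>)) * (LINT x|lborel. exp (- \<i> * complex_of_real (x \<bullet> \<xi>)) * f x)"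
    by (rule integral_mult_right_zero)
  finally show ?thesis by (simp add: FT1_eq)
qed

text \<open>A representative that vanishes everywhere, not just almost everywhere, outside the ball
  and is integrable, so that the inverse transform is an absolutely convergent integral.\<close>

definition cutoff_rep :: "real \<Rightarrow> (real^'n) l2 \<Rightarrow> real^'n \<Rightarrow> complex" where
  "cutoff_rep r E \<xi> = indicator (cball 0 r) \<xi> * rep_l2 E \<xi>"

lemma in_L1_L2_trc: "in_L1_L2 (cutoff_rep r E)"
  unfolding cutoff_rep_def[abs_def] using emeasure_lborel_cball_finite[of 0 r] by (intro in_L1_L2_indicator_mult) auto

lemma abs_trc: "abs_l2 (cutoff_rep r E) = lp r E"
  by (simp add: lp_def mul_def cutoff_rep_def[abs_def])

lemma rep_Fi_supp:
  assumes "lp r E = E" shows "AE x in lborel. rep_l2 (Fi E) x = FT1 (cutoff_rep r E) (- x)"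
  using Fi_in_L1_L2[OF in_L1_L2_trc[of r E]] unfolding abs_trc assms .

text \<open>Modulation by \<open>\<xi>\<close> translates the transform of \<open>E\<close> by
  \<open>\<xi>\<close>, keeping it within radius r + R, where \<open>D\<close> vanishes; Parseval's
  identity then gives zero.\<close>

lemma mod_pair_zero:
  assumes E: "lp r E = E" and D: "lp (r + R) D = 0" and \<xi>: "norm \<xi> \<le> R"
  shows "(LINT x|lborel. exp (\<i> * complex_of_real (x \<bullet> \<xi>)) * (rep_l2 (Fi E) x * cnj (rep_l2 (Fi D) x))) = 0"
proof -
  define e where "e = cutoff_rep r E"
  have e: "in_L1_L2 e" unfolding e_def by (rule in_L1_L2_trc)
  then have [measurable]: "e \<in> borel_measurable borel" by (auto simp: in_L1_L2_def)
  define g where "g \<eta> = e (\<eta> - \<xi>)" for \<eta>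
  have g: "in_L1_L2 g" using e unfolding g_def[abs_def] in_L1_L2_def by (auto intro: sq_int_translate integrable_translate)
  then have sg: "sq_int g" by (simp add: in_L1_L2_def)
  have "AE x in lborel. rep_l2 (Fi (abs_l2 g)) x = exp (\<i> * complex_of_real (x \<bullet> \<xi>)) * rep_l2 (Fi E) x"
    using Fi_in_L1_L2[OF g] rep_Fi_supp[OF E]
  proof eventually_elim
    case (elim x)
    then show ?case unfolding g_def by (simp add: FT1_translate e_def[symmetric] inner_commute)
  qed
  then have "(LINT x|lborel. exp (\<i> * complex_of_real (x \<bullet> \<xi>)) * (rep_l2 (Fi E) x * cnj (rep_l2 (Fi D) x))) = complex_inner (Fi (abs_l2 g)) (Fi D)"
    unfolding complex_inner_def by (intro integral_cong_AE) (measurable, auto)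
  also have "\<dots> = complex_inner (abs_l2 g) D" by (rule complex_inner_Fi)
  also have "\<dots> = (LINT x::real^'a|lborel. 0)"
    unfolding complex_inner_def
  proof (rule integral_cong_AE)
    have "AE x in lborel. indicator (cball 0 (r + R)) x * rep_l2 D x = 0"
      using rep_lp[of "r + R" D] rep_zero unfolding D by eventually_elim simp
    then show "AE x in lborel. rep_l2 (abs_l2 g) x * cnj (rep_l2 D x) = 0"
      using rep_abs[OF sg]
    proof eventually_elim
      case (elim x)
      show ?case
      proof (cases "norm x \<le> r + R")
        case True
        then show ?thesis using elim by (simp add: indicator_def)
      next
        case False
        then have "norm (x - \<xi>) > r" using \<xi> norm_triangle_ineq2[of x \<xi>] by linarith
        then show ?thesis using elim by (simp add: g_def e_def cutoff_rep_def)
      qed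
    qed
  qed measurable
  finally show ?thesis by simp
qed

text \<open>\<open>FT1 k\<close> is a superposition of modulations with frequencies in the support
  of \<open>k\<close>; Fubini reduces the claim to \<open>mod_pair_zero\<close>, frequency by
  frequency.\<close>

lemma conv_pair_zero:
  assumes k: "in_L1_L2 k" and kR: "\<And>\<xi>. norm \<xi> > R \<Longrightarrow> k \<xi> = 0" and E: "lp r E = E" and D: "lp (r + R) D = 0"
  shows "(LINT x|lborel. FT1 k (z - x) * (rep_l2 (Fi E) x * cnj (rep_l2 (Fi D) x))) = 0"
proof -
  have ki: "integrable lborel k" and [measurable]: "k \<in> borel_measurable borel" using k by (auto simp: in_L1_L2_def)
  define p where "p x = rep_l2 (Fi E) x * cnj (rep_l2 (Fi D) x)" for x
  have pi: "integrable lborel p" unfolding p_def[abs_def] by (intro integrable_mult_sq sq_int_cnj) auto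
  then have [measurable]: "p \<in> borel_measurable borel" by auto
  have "(LINT x|lborel. FT1 k (z - x) * p x) = (LINT x|lborel. complex_of_real (fourier_const TYPE('a)) * (LINT \<xi>|lborel. exp (- \<i> * complex_of_real (\<xi> \<bullet> (z - x))) * k \<xi> * p x))"
  proof (intro Bochner_Integration.integral_cong refl)
    fix x
    have "(LINT \<xi>|lborel. exp (- \<i> * complex_of_real (\<xi> \<bullet> (z - x))) * k \<xi> * p x) = (LINT \<xi>|lborel. exp (- \<i> * complex_of_real (\<xi> \<bullet> (z - x))) * k \<xi>) * p x"
      by (rule integral_mult_left_zero)
    then show "FT1 k (z - x) * p x = complex_of_real (fourier_const TYPE('a)) * (LINT \<xi>|lborel. exp (- \<i> * complex_of_real (\<xi> \<bullet> (z - x))) * k \<xi> * p x)"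
      by (simp only: FT1_eq mult.assoc)
  qed
  also have "\<dots> = complex_of_real (fourier_const TYPE('a)) * (LINT x|lborel. LINT \<xi>|lborel. exp (- \<i> * complex_of_real (\<xi> \<bullet> (z - x))) * k \<xi> * p x)"
    by (rule integral_mult_right_zero)
  also have "(LINT x|lborel. LINT \<xi>|lborel. exp (- \<i> * complex_of_real (\<xi> \<bullet> (z - x))) * k \<xi> * p x) = (LINT \<xi>|lborel. LINT x|lborel. exp (- \<i> * complex_of_real (\<xi> \<bullet> (z - x))) * k \<xi> * p x)"
  proof (rule fubini_swap)
    have "(\<integral>\<^sup>+ x. \<integral>\<^sup>+ \<xi>. ennreal (cmod (exp (- \<i> * complex_of_real (\<xi> \<bullet> (z - x))) * k \<xi> * p x)) \<partial>lborel \<partial>lborel)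
       = (\<integral>\<^sup>+ x. \<integral>\<^sup>+ \<xi>. ennreal (cmod (p x) * cmod (k \<xi>)) \<partial>lborel \<partial>lborel)"
      by (simp add: norm_mult mult.commute)
    also have "\<dots> < \<infinity>" by (rule nn_iterated_prod[OF pi ki])
    finally show "(\<integral>\<^sup>+ x. \<integral>\<^sup>+ \<xi>. ennreal (cmod (exp (- \<i> * complex_of_real (\<xi> \<bullet> (z - x))) * k \<xi> * p x)) \<partial>lborel \<partial>lborel) < \<infinity>" .
  qed measurable
  also have "\<dots> = (LINT \<xi>::real^'a|lborel. 0)"
  proof (intro Bochner_Integration.integral_cong refl)
    fix \<xi>
    show "(LINT x|lborel. exp (- \<i> * complex_of_real (\<xi> \<bullet> (z - x))) * k \<xi> * p x) = 0"
    proof (cases "norm \<xi> \<le> R")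
      case False then show ?thesis using kR[of \<xi>] by simp
    next
      case True
      have "(LINT x|lborel. exp (- \<i> * complex_of_real (\<xi> \<bullet> (z - x))) * k \<xi> * p x) = (LINT x|lborel. (exp (- \<i> * complex_of_real (\<xi> \<bullet> z)) * k \<xi>) * (exp (\<i> * complex_of_real (x \<bullet> \<xi>)) * p x))"
      proof (intro Bochner_Integration.integral_cong refl)
        fix x
        have "exp (- \<i> * complex_of_real (\<xi> \<bullet> (z - x))) = exp (- \<i> * complex_of_real (\<xi> \<bullet> z)) * exp (\<i> * complex_of_real (x \<bullet> \<xi>))"
          by (simp add: exp_add[symmetric] inner_diff_right inner_commute algebra_simps)
        then show "exp (- \<i> * complex_of_real (\<xi> \<bullet> (z - x))) * k \<xi> * p x = (exp (- \<i> * complex_of_real (\<xi> \<bullet> z)) * k \<xi>) * (exp (\<i> * complex_of_real (x \<bullet> \<xi>)) * p x)"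
          by simp
      qed
      also have "\<dots> = (exp (- \<i> * complex_of_real (\<xi> \<bullet> z)) * k \<xi>) * (LINT x|lborel. exp (\<i> * complex_of_real (x \<bullet> \<xi>)) * p x)"
        by (rule integral_mult_right_zero)
      also have "\<dots> = 0" unfolding p_def using mod_pair_zero[OF E D True] by simp
      finally show ?thesis .
    qed
  qed
  finally show ?thesis by (simp add: p_def)
qed

lemma mok_FT1:
  assumes "k \<in> borel_measurable borel" shows "mok (\<lambda>x. FT1 k (z - x)) X"
proof (rule mok_bounded)
  note [measurable] = assms
  show "(\<lambda>x. FT1 k (z - x)) \<in> borel_measurable borel" by measurable
qed (rule FT1_bound)

lemma conv_supp:
  assumes k: "in_L1_L2 k" and kR: "\<And>\<xi>. norm \<xi> > R \<Longrightarrow> k \<xi> = 0" and E: "lp r E = E"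
  shows "lp (r + R) (Four (mul (\<lambda>x. FT1 k (z - x)) (Fi E))) = Four (mul (\<lambda>x. FT1 k (z - x)) (Fi E))"
proof (rule supp_criterion)
  fix D :: "(real^'a) l2" assume D: "lp (r + R) D = 0"
  have [measurable]: "k \<in> borel_measurable borel" using k by (auto simp: in_L1_L2_def)
  have mk: "mok (\<lambda>x. FT1 k (z - x)) (Fi E)" by (rule mok_FT1) simp
  have "inner (Four (mul (\<lambda>x. FT1 k (z - x)) (Fi E))) D = Re (LINT x|lborel. FT1 k (z - x) * rep_l2 (Fi E) x * cnj (rep_l2 (Fi D) x))"
    unfolding inner_Four_left mul_def using inner_abs_Re[OF mk[unfolded mok_def], of "rep_l2 (Fi D)"] by simp
  also have "\<dots> = 0" using conv_pair_zero[OF k kR E D, of z] by (simp add: mult.assoc)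
  finally show "inner (Four (mul (\<lambda>x. FT1 k (z - x)) (Fi E))) D = 0" .
qed

lemma cnj_FT1: "cnj (FT1 g \<xi>) = FT1 (\<lambda>x. cnj (g x)) (- \<xi>)"
proof -
  have "exp (- \<i> * complex_of_real (y \<bullet> - \<xi>)) * cnj (g y) = cnj (exp (- \<i> * complex_of_real (y \<bullet> \<xi>)) * g y)" for y
    by (simp add: exp_cnj)
  then have "(LINT y|lborel. exp (- \<i> * complex_of_real (y \<bullet> - \<xi>)) * cnj (g y)) = cnj (LINT y|lborel. exp (- \<i> * complex_of_real (y \<bullet> \<xi>)) * g y)"
    by (simp only: Bochner_Integration.integral_cnj)
  then show ?thesis
    by (simp only: FT1_eq complex_cnj_mult complex_cnj_complex_of_real)
qed

text \<open>Radii add under multiplication. The first factor enlarges the support of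
  \<open>C\<close> to 2R, the conjugated factor (itself the transform of the reflected conjugate
  \<open>k\<close>) to 3R, and \<open>D\<close> lives beyond that.\<close>

lemma triple_pair_zero:
  assumes A: "in_L1_L2 ea" "\<And>\<xi>. norm \<xi> > R \<Longrightarrow> ea \<xi> = 0" and B: "in_L1_L2 eb" "\<And>\<xi>. norm \<xi> > R \<Longrightarrow> eb \<xi> = 0"
    and C: "lp R C = C" and D: "lp (3 * R) D = 0"
  shows "(LINT x|lborel. FT1 ea (z - x) * cnj (FT1 eb (z - x)) * (rep_l2 (Fi C) x * cnj (rep_l2 (Fi D) x))) = 0"
proof -
  have [measurable]: "ea \<in> borel_measurable borel" "eb \<in> borel_measurable borel" using A B by (auto simp: in_L1_L2_def)
  define E where "E = Four (mul (\<lambda>x. FT1 ea (z - x)) (Fi C))"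
  have E: "lp (R + R) E = E" unfolding E_def by (rule conv_supp[OF A C])
  define k where "k \<xi> = cnj (eb (- \<xi>))" for \<xi>
  have k: "in_L1_L2 k"
    using in_L1_L2_reflect[OF B(1)] unfolding k_def[abs_def] in_L1_L2_def by (auto intro: sq_int_cnj)
  have [measurable]: "k \<in> borel_measurable borel" using k by (auto simp: in_L1_L2_def)
  have kR: "k \<xi> = 0" if "norm \<xi> > R" for \<xi> using B(2)[of "- \<xi>"] that by (simp add: k_def)
  have Fk: "FT1 k \<xi> = cnj (FT1 eb \<xi>)" for \<xi>
    unfolding k_def cnj_FT1 using FT1_reflect[of "\<lambda>x. cnj (eb x)" \<xi>] by simp
  have D': "lp ((R + R) + R) D = 0" using D by (simp add: algebra_simps)
  have "AE x in lborel. rep_l2 (Fi E) x = FT1 ea (z - x) * rep_l2 (Fi C) x"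
    unfolding E_def Fi_Four by (rule rep_mul[OF mok_FT1]) simp
  then have "(LINT x|lborel. FT1 ea (z - x) * cnj (FT1 eb (z - x)) * (rep_l2 (Fi C) x * cnj (rep_l2 (Fi D) x))) = (LINT x|lborel. FT1 k (z - x) * (rep_l2 (Fi E) x * cnj (rep_l2 (Fi D) x)))"
    by (intro integral_cong_AE) (measurable, auto simp: Fk)
  also have "\<dots> = 0" by (rule conv_pair_zero[OF k kR E D'])
  finally show ?thesis .
qed

section \<open>Frequency tails and the tame Sobolev estimate\<close>

lemma lp_Hs: "0 \<le> s \<Longrightarrow> 0 \<le> R \<Longrightarrow> lp R A = A \<Longrightarrow> Hs s A"
  using lp_bound(1)[of s R A] by simp

text \<open>The \<open>H\<^sup>s\<close> norm is recovered from the tails by a layer-cake integral over the cutoff.\<close>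

definition freq_tail :: "real \<Rightarrow> (real^'n) l2 \<Rightarrow> ennreal" where
  "freq_tail r X = (\<integral>\<^sup>+\<xi>. indicator {\<xi>. r < norm \<xi>} \<xi> * ennreal ((cmod (rep_l2 X \<xi>))\<^sup>2) \<partial>lborel)"

lemma freq_tail_eq: "ennreal ((norm (X - lp r X))\<^sup>2) = freq_tail r X"
  unfolding norm_l2_nn_sq nn_sq_def freq_tail_def
proof (rule nn_integral_cong_AE)
  show "AE x in lborel. ennreal ((cmod (rep_l2 (X - lp r X) x))\<^sup>2) = indicator {\<xi>. r < norm \<xi>} x * ennreal ((cmod (rep_l2 X x))\<^sup>2)"
    using rep_minus[of X "lp r X"] rep_lp[of r X] by eventually_elim (auto simp: indicator_def)
qed

lemma norm_minus_lp_le: "norm (X - lp r X) \<le> norm X"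
proof -
  have "ennreal ((norm (X - lp r X))\<^sup>2) \<le> ennreal ((norm X)\<^sup>2)"
    unfolding freq_tail_eq unfolding freq_tail_def norm_l2_nn_sq nn_sq_def by (intro nn_integral_mono) (auto simp: indicator_def)
  then have "(norm (X - lp r X))\<^sup>2 \<le> (norm X)\<^sup>2" by (subst (asm) ennreal_le_iff) auto
  then show ?thesis by (rule power2_le_imp_le) simp
qed

text \<open>The level is l = (c |xi|)^(2s). The parameter \<open>c\<close> matches scales: the tail
  of the output at radius 3r is compared with tails of the inputs at radius r, which is
  \<open>c = 1\<close> against \<open>c = 3\<close> at the same level.\<close>

lemma nn_freq_tail_layer:
  assumes s: "s > 0" and c: "c > 0"
  shows "(\<integral>\<^sup>+l. indicator {0<..} l * freq_tail (l powr (1 / (2 * s)) / c) X \<partial>lborel)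
    = (\<integral>\<^sup>+\<xi>. ennreal ((c * norm \<xi>) powr (2 * s) * (cmod (rep_l2 X \<xi>))\<^sup>2) \<partial>lborel)"
proof -
  define x where "x = rep_l2 X"
  have [measurable]: "x \<in> borel_measurable borel" by (simp add: x_def)
  have iff: "l powr (1 / (2 * s)) / c < t \<longleftrightarrow> l < (c * t) powr (2 * s)" if "l > 0" "0 \<le> t" for l t
  proof -
    have "l powr (1 / (2 * s)) / c < t \<longleftrightarrow> l powr (1 / (2 * s)) < c * t" using c by (simp add: field_simps)
    also have "\<dots> \<longleftrightarrow> (l powr (1 / (2 * s))) powr (2 * s) < (c * t) powr (2 * s)"
    proof
      assume "l powr (1 / (2 * s)) < c * t"
      then show "(l powr (1 / (2 * s))) powr (2 * s) < (c * t) powr (2 * s)"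
        using s by (intro powr_less_mono2) auto
    next
      assume *: "(l powr (1 / (2 * s))) powr (2 * s) < (c * t) powr (2 * s)"
      show "l powr (1 / (2 * s)) < c * t"
      proof (rule ccontr)
        assume "\<not> l powr (1 / (2 * s)) < c * t"
        then have "(c * t) powr (2 * s) \<le> (l powr (1 / (2 * s))) powr (2 * s)"
          using s c that by (intro powr_mono2) auto
        with * show False by simp
      qed
    qed
    also have "(l powr (1 / (2 * s))) powr (2 * s) = l" using s that by (simp add: powr_powr)
    finally show ?thesis .
  qed
  have "(\<integral>\<^sup>+l. indicator {0<..} l * freq_tail (l powr (1 / (2 * s)) / c) X \<partial>lborel)
    = (\<integral>\<^sup>+l. \<integral>\<^sup>+\<xi>. indicator {l. 0 < l \<and> l < (c * norm \<xi>) powr (2 * s)} l * ennreal ((cmod (x \<xi>))\<^sup>2) \<partial>lborel \<partial>lborel)"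
  proof (rule nn_integral_cong)
    fix l :: real
    show "indicator {0<..} l * freq_tail (l powr (1 / (2 * s)) / c) X = (\<integral>\<^sup>+\<xi>. indicator {l. 0 < l \<and> l < (c * norm \<xi>) powr (2 * s)} l * ennreal ((cmod (x \<xi>))\<^sup>2) \<partial>lborel)"
    proof (cases "l > 0")
      case True
      then show ?thesis unfolding freq_tail_def x_def[symmetric]
        by (simp, intro nn_integral_cong) (auto simp: indicator_def iff)
    qed simp
  qed
  also have "\<dots> = (\<integral>\<^sup>+\<xi>. \<integral>\<^sup>+l. indicator {l. 0 < l \<and> l < (c * norm \<xi>) powr (2 * s)} l * ennreal ((cmod (x \<xi>))\<^sup>2) \<partial>lborel \<partial>lborel)"
  proof (rule nn_swap)
    have "(\<lambda>(l, \<xi>). indicator {l. 0 < l \<and> l < (c * norm \<xi>) powr (2 * s)} l * ennreal ((cmod (x \<xi>))\<^sup>2)) =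
       (\<lambda>z. indicator {z. 0 < fst z \<and> fst z < (c * norm (snd z)) powr (2 * s)} z * ennreal ((cmod (x (snd z)))\<^sup>2))"
      by (auto simp: fun_eq_iff indicator_def)
    also have "\<dots> \<in> borel_measurable (lborel \<Otimes>\<^sub>M lborel)" by measurable
    finally show "(\<lambda>(l, \<xi>). indicator {l. 0 < l \<and> l < (c * norm \<xi>) powr (2 * s)} l * ennreal ((cmod (x \<xi>))\<^sup>2)) \<in> borel_measurable (lborel \<Otimes>\<^sub>M lborel)" .
  qed
  also have "\<dots> = (\<integral>\<^sup>+\<xi>. ennreal ((c * norm \<xi>) powr (2 * s) * (cmod (x \<xi>))\<^sup>2) \<partial>lborel)"
    by (intro nn_integral_cong) (simp add: nn_integral_multc ennreal_mult)
  finally show ?thesis by (simp add: x_def)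
qed

lemma jb_split: "0 < s \<Longrightarrow> jb (2 * s) \<xi> \<le> 2 powr s * (1 + norm \<xi> powr (2 * s))"
proof -
  assume s: "0 < s"
  have e: "norm \<xi> powr (2 * s) = (norm \<xi>)\<^sup>2 powr s"
    by (cases "\<xi> = 0") (use s in \<open>simp_all add: powr_powr flip: powr_numeral\<close>)
  have "1 + (norm \<xi>)\<^sup>2 \<le> 2 * max 1 ((norm \<xi>)\<^sup>2)" by (simp add: max_def)
  then have "jb (2 * s) \<xi> \<le> (2 * max 1 ((norm \<xi>)\<^sup>2)) powr s"
    unfolding jb_def using s one_plus_norm_sq(1)[of \<xi>] by (simp add: powr_mono2)
  also have "\<dots> = 2 powr s * (max 1 ((norm \<xi>)\<^sup>2)) powr s" by (rule powr_mult)
  also have "\<dots> \<le> 2 powr s * (1 + norm \<xi> powr (2 * s))"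
    unfolding e by (intro mult_left_mono) (auto simp: max_def)
  finally show ?thesis .
qed

lemma norm_powr_le_jb: "0 < s \<Longrightarrow> (3 * norm \<xi>) powr (2 * s) \<le> 3 powr (2 * s) * jb (2 * s) \<xi>"
proof -
  assume s: "0 < s"
  have "norm \<xi> powr (2 * s) = (norm \<xi>)\<^sup>2 powr s"
    by (cases "\<xi> = 0") (use s in \<open>simp_all add: powr_powr flip: powr_numeral\<close>)
  also have "\<dots> \<le> jb (2 * s) \<xi>" unfolding jb_def using s by (simp add: powr_mono2)
  finally have "norm \<xi> powr (2 * s) \<le> jb (2 * s) \<xi>" .
  then show ?thesis by (simp add: powr_mult mult_left_mono)
qed

lemma sq_sum3: "(a + b + c)\<^sup>2 \<le> 3 * (a\<^sup>2 + b\<^sup>2 + (c::real)\<^sup>2)"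
  using sum_squares_bound[of a b] sum_squares_bound[of a c] sum_squares_bound[of b c]
  by (simp add: power2_eq_square algebra_simps)

context hartree_potential
begin

text \<open>Substituting z = x - y shifts the dependence on \<open>x\<close> from \<open>w\<close>
  to the band-limited factors. For fixed \<open>z\<close> the potential is then just a
  scalar.\<close>

lemma Nx_via:
  assumes A: "lp R A = A" and B: "lp R B = B"
  shows "Nx A B C x = (LINT z|lborel. complex_of_real (w z) * (FT1 (cutoff_rep R A) (z - x) * cnj (FT1 (cutoff_rep R B) (z - x)))) * r2 C x"
proof -
  have [measurable]: "cutoff_rep R A \<in> borel_measurable borel" "cutoff_rep R B \<in> borel_measurable borel"
    using in_L1_L2_trc[of R A] in_L1_L2_trc[of R B] by (auto simp: in_L1_L2_def)
  define g where "g y = complex_of_real (w (x - y)) * (FT1 (cutoff_rep R A) (- y) * cnj (FT1 (cutoff_rep R B) (- y)))" for y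
  have heat_kernel: "g \<in> borel_measurable borel" unfolding g_def[abs_def] by measurable
  have "(LINT y|lborel. complex_of_real (w (x - y)) * (r2 A y * cnj (r2 B y))) = (LINT y|lborel. g y)"
  proof (rule integral_cong_AE)
    show "AE y in lborel. complex_of_real (w (x - y)) * (r2 A y * cnj (r2 B y)) = g y"
      using rep_Fi_supp[OF A] rep_Fi_supp[OF B] by eventually_elim (simp add: g_def)
  qed (use heat_kernel in measurable)
  also have "\<dots> = (LINT z|lborel. g (x - z))" by (rule integral_reflect[OF heat_kernel, symmetric])
  finally show ?thesis by (simp add: Nx_def N3_def g_def)
qed

text \<open>The absolute convergence behind the exchange of integrals in
  \<open>Nf_supp\<close>.\<close>

lemma nn_quad_finite:
  assumes "Hs (1/2) A" "Hs (1/2) B"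
  shows "(\<integral>\<^sup>+x. (\<integral>\<^sup>+y. ennreal (\<bar>w (x - y)\<bar> * (cmod (r2 A y) * cmod (r2 B y))) \<partial>lborel) * ennreal (cmod (r2 C x) * cmod (r2 D x)) \<partial>lborel) < \<infinity>"
proof -
  define P where "P x = (\<integral>\<^sup>+y. ennreal (\<bar>w (x - y)\<bar> * (cmod (r2 A y) * cmod (r2 B y))) \<partial>lborel)" for x
  have [measurable]: "P \<in> borel_measurable borel" unfolding P_def[abs_def] by measurable
  have "(\<integral>\<^sup>+x. P x * ennreal (cmod (r2 C x) * cmod (r2 D x)) \<partial>lborel)\<^sup>2
    = (\<integral>\<^sup>+x. (P x * ennreal (cmod (r2 C x))) * ennreal (cmod (r2 D x)) \<partial>lborel)\<^sup>2"
    by (simp add: ennreal_mult mult.assoc)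
  also have "\<dots> \<le> (\<integral>\<^sup>+x. (P x * ennreal (cmod (r2 C x)))\<^sup>2 \<partial>lborel) * (\<integral>\<^sup>+x. (ennreal (cmod (r2 D x)))\<^sup>2 \<partial>lborel)"
    by (rule Cauchy_Schwarz_nn_integral) measurable
  also have "\<dots> \<le> (\<integral>\<^sup>+x. pot (r2 A) x * pot (r2 B) x * ennreal ((cmod (r2 C x))\<^sup>2) \<partial>lborel) * (\<integral>\<^sup>+x. (ennreal (cmod (r2 D x)))\<^sup>2 \<partial>lborel)"
  proof (intro mult_right_mono nn_integral_mono)
    fix x
    have "(P x)\<^sup>2 \<le> pot (r2 A) x * pot (r2 B) x" unfolding P_def by (rule nn_abs_pot_sq) auto
    then show "(P x * ennreal (cmod (r2 C x)))\<^sup>2 \<le> pot (r2 A) x * pot (r2 B) x * ennreal ((cmod (r2 C x))\<^sup>2)"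
      by (simp add: power_mult_distrib ennreal_power mult_right_mono)
  qed simp
  also have "\<dots> < \<infinity>"
    using triple_le(1)[OF assms, of C] nn_sq_r2[of D]
    by (auto simp: ennreal_power nn_sq_def ennreal_mult_less_top intro: le_less_trans)
  finally show ?thesis unfolding P_def[symmetric] by (simp add: power_less_top_ennreal)
qed

text \<open>With \<open>z\<close> integrated last, each slice pairs a product of three functions of
  frequency at most \<open>R\<close> with a function living beyond 3R, and vanishes by
  \<open>triple_pair_zero\<close>. No Fourier transform of \<open>w\<close> is taken.\<close>

lemma Nf_supp:
  assumes R: "0 \<le> R" and A: "lp R A = A" and B: "lp R B = B" and C: "lp R C = C"
  shows "lp (3 * R) (Nf A B C) = Nf A B C"
proof (rule supp_criterion)
  fix D :: "(real^'n) l2" assume D: "lp (3 * R) D = 0"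
  have H: "Hs (1/2) A" "Hs (1/2) B" using lp_Hs[OF _ R A, of "1/2"] lp_Hs[OF _ R B, of "1/2"] by simp_all
  define ea where "ea = cutoff_rep R A"
  define eb where "eb = cutoff_rep R B"
  have ea: "in_L1_L2 ea" "\<And>\<xi>. norm \<xi> > R \<Longrightarrow> ea \<xi> = 0" and eb: "in_L1_L2 eb" "\<And>\<xi>. norm \<xi> > R \<Longrightarrow> eb \<xi> = 0"
    unfolding ea_def eb_def by (auto simp: in_L1_L2_trc cutoff_rep_def)
  have [measurable]: "ea \<in> borel_measurable borel" "eb \<in> borel_measurable borel" using ea eb by (auto simp: in_L1_L2_def)
  define q where "q x = r2 C x * cnj (r2 D x)" for x
  have [measurable]: "q \<in> borel_measurable borel" unfolding q_def[abs_def] by measurable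
  define f where "f x z = complex_of_real (w z) * (FT1 ea (z - x) * cnj (FT1 eb (z - x))) * q x" for x z
  have sw: "(LINT x|lborel. LINT z|lborel. f x z) = (LINT z|lborel. LINT x|lborel. f x z)"
  proof (rule fubini_swap)
    show "case_prod f \<in> borel_measurable (lborel \<Otimes>\<^sub>M lborel)" unfolding f_def[abs_def] by measurable
    have "(\<integral>\<^sup>+z. ennreal (cmod (f x z)) \<partial>lborel) = (\<integral>\<^sup>+y. ennreal (\<bar>w (x - y)\<bar> * (cmod (r2 A y) * cmod (r2 B y))) \<partial>lborel) * ennreal (cmod (r2 C x) * cmod (r2 D x))" for x
    proof -
      have "(\<integral>\<^sup>+z. ennreal (cmod (f x z)) \<partial>lborel) = (\<integral>\<^sup>+y. ennreal (cmod (f x (x - y))) \<partial>lborel)"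
        by (rule nn_integral_reflect[symmetric]) (unfold f_def, measurable)
      also have "\<dots> = (\<integral>\<^sup>+y. ennreal (\<bar>w (x - y)\<bar> * (cmod (r2 A y) * cmod (r2 B y))) * ennreal (cmod (r2 C x) * cmod (r2 D x)) \<partial>lborel)"
      proof (rule nn_integral_cong_AE)
        show "AE y in lborel. ennreal (cmod (f x (x - y))) = ennreal (\<bar>w (x - y)\<bar> * (cmod (r2 A y) * cmod (r2 B y))) * ennreal (cmod (r2 C x) * cmod (r2 D x))"
          using rep_Fi_supp[OF A] rep_Fi_supp[OF B]
          by eventually_elim (simp add: f_def ea_def eb_def q_def norm_mult ennreal_mult[symmetric])
      qed
      finally show ?thesis by (simp add: nn_integral_multc)
    qed
    then show "(\<integral>\<^sup>+x. \<integral>\<^sup>+z. ennreal (cmod (f x z)) \<partial>lborel \<partial>lborel) < \<infinity>"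
      using nn_quad_finite[OF H, of C D] by (simp only:)
  qed
  have "Nx A B C x * cnj (r2 D x) = (LINT z|lborel. f x z)" for x
  proof -
    have "(LINT z|lborel. f x z) = (LINT z|lborel. complex_of_real (w z) * (FT1 ea (z - x) * cnj (FT1 eb (z - x)))) * q x"
      unfolding f_def by (rule integral_mult_left_zero)
    then show ?thesis unfolding Nx_via[OF A B] ea_def eb_def q_def by (simp only: mult.assoc)
  qed
  then have e: "inner (Nf A B C) D = Re (LINT x|lborel. LINT z|lborel. f x z)"
    unfolding Nf_def inner_Four_left using inner_abs_Re[OF sq_int_Nx[OF H], of "r2 D" C] by simp
  have z0: "(LINT x|lborel. f x z) = 0" for z
  proof -
    have "(LINT x|lborel. f x z) = (LINT x|lborel. complex_of_real (w z) * (FT1 ea (z - x) * cnj (FT1 eb (z - x)) * (r2 C x * cnj (r2 D x))))"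
      by (simp only: f_def q_def mult.assoc)
    also have "\<dots> = complex_of_real (w z) * (LINT x|lborel. FT1 ea (z - x) * cnj (FT1 eb (z - x)) * (r2 C x * cnj (r2 D x)))"
      by (rule integral_mult_right_zero)
    also have "(LINT x|lborel. FT1 ea (z - x) * cnj (FT1 eb (z - x)) * (r2 C x * cnj (r2 D x))) = 0"
      by (rule triple_pair_zero[OF ea eb C D])
    finally show ?thesis by simp
  qed
  show "inner (Nf A B C) D = 0" unfolding e sw z0 by simp
qed

text \<open>The form evaluated on low-pass inputs has no frequencies above 3r, so it may be
  subtracted before the low frequencies are removed. What is left is a telescoped difference in
  which each term has one factor restricted to high frequencies.\<close>

lemma Nf_tail:
  assumes r: "0 \<le> r" and H: "Hs (1/2) A" "Hs (1/2) B" "Hs (1/2) C"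
  shows "norm (Nf A B C - lp (3 * r) (Nf A B C)) \<le> Lam * (h2 B * h2 C * norm (A - lp r A) + h2 A * h2 C * norm (B - lp r B) + h2 A * h2 B * norm (C - lp r C))"
proof -
  define N0 where "N0 = Nf (lp r A) (lp r B) (lp r C)"
  have P: "Hs (1/2) (lp r A)" "Hs (1/2) (lp r B)" "Hs (1/2) (lp r C)" using H by (auto intro: Hs_lp)
  have "lp (3 * r) N0 = N0" unfolding N0_def by (rule Nf_supp[OF r lp_idem lp_idem lp_idem])
  then have eq: "Nf A B C - lp (3 * r) (Nf A B C) = (Nf A B C - N0) - lp (3 * r) (Nf A B C - N0)"
    by (simp add: lp_diff)
  have "norm (Nf A B C - lp (3 * r) (Nf A B C)) \<le> norm (Nf A B C - N0)"
    unfolding eq by (rule norm_minus_lp_le)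
  also have "\<dots> = norm (Nf (A - lp r A) B C + Nf (lp r A) (B - lp r B) C + Nf (lp r A) (lp r B) (C - lp r C))"
    unfolding N0_def by (subst Nf_telescope) (use H P in auto)
  also have "\<dots> \<le> norm (Nf (A - lp r A) B C) + norm (Nf (lp r A) (B - lp r B) C) + norm (Nf (lp r A) (lp r B) (C - lp r C))"
    by (intro order_trans[OF norm_triangle_ineq] add_mono norm_triangle_ineq) auto
  also have "\<dots> \<le> Lam * h2 B * h2 C * norm (A - lp r A) + Lam * h2 (lp r A) * h2 C * norm (B - lp r B) + Lam * h2 (lp r A) * h2 (lp r B) * norm (C - lp r C)"
    by (intro add_mono Nf_le) (use H P Hs_diff in auto)
  also have "\<dots> \<le> Lam * h2 B * h2 C * norm (A - lp r A) + Lam * h2 A * h2 C * norm (B - lp r B) + Lam * h2 A * h2 B * norm (C - lp r C)"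
    using Lam_pos H by (intro add_mono mult_right_mono mult_mono mult_left_mono Hs_lp) auto
  also have "\<dots> = Lam * (h2 B * h2 C * norm (A - lp r A) + h2 A * h2 C * norm (B - lp r B) + h2 A * h2 B * norm (C - lp r C))"
    by (simp add: algebra_simps)
  finally show ?thesis .
qed

lemma Nf_freq_tail:
  assumes r: "0 \<le> r" and H: "Hs (1/2) A" "Hs (1/2) B" "Hs (1/2) C"
  shows "freq_tail (3 * r) (Nf A B C) \<le> ennreal (3 * Lam\<^sup>2 * (h2 B * h2 C)\<^sup>2) * freq_tail r A + ennreal (3 * Lam\<^sup>2 * (h2 A * h2 C)\<^sup>2) * freq_tail r B + ennreal (3 * Lam\<^sup>2 * (h2 A * h2 B)\<^sup>2) * freq_tail r C"
proof -
  define a where "a = h2 B * h2 C * norm (A - lp r A)"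
  define b where "b = h2 A * h2 C * norm (B - lp r B)"
  define c where "c = h2 A * h2 B * norm (C - lp r C)"
  have "(norm (Nf A B C - lp (3 * r) (Nf A B C)))\<^sup>2 \<le> (Lam * (a + b + c))\<^sup>2"
    using Nf_tail[OF assms] by (intro power_mono) (auto simp: a_def b_def c_def)
  also have "\<dots> = Lam\<^sup>2 * (a + b + c)\<^sup>2" by (rule power_mult_distrib)
  also have "\<dots> \<le> Lam\<^sup>2 * (3 * (a\<^sup>2 + b\<^sup>2 + c\<^sup>2))" by (intro mult_left_mono sq_sum3) auto
  also have "\<dots> = 3 * Lam\<^sup>2 * (h2 B * h2 C)\<^sup>2 * (norm (A - lp r A))\<^sup>2 + 3 * Lam\<^sup>2 * (h2 A * h2 C)\<^sup>2 * (norm (B - lp r B))\<^sup>2 + 3 * Lam\<^sup>2 * (h2 A * h2 B)\<^sup>2 * (norm (C - lp r C))\<^sup>2"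
    by (simp add: a_def b_def c_def power_mult_distrib algebra_simps)
  finally have "freq_tail (3 * r) (Nf A B C) \<le> ennreal \<dots>" unfolding freq_tail_eq[symmetric] by (rule ennreal_leI)
  then show ?thesis unfolding freq_tail_eq[symmetric]
    by (simp add: ennreal_mult[symmetric] ennreal_plus[symmetric] del: ennreal_plus)
qed

lemma freq_tail_measurable [measurable]: "(\<lambda>l. freq_tail (l powr p / c) X) \<in> borel_measurable borel"
proof -
  have "(\<lambda>(l, \<xi>). indicator {\<xi>. l powr p / c < norm \<xi>} \<xi> * ennreal ((cmod (rep_l2 X \<xi>))\<^sup>2)) = (\<lambda>z::real \<times> (real^'a). indicator {z. fst z powr p / c < norm (snd z)} z * ennreal ((cmod (rep_l2 X (snd z)))\<^sup>2))"
    by (auto simp: fun_eq_iff indicator_def)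
  also have "\<dots> \<in> borel_measurable (borel \<Otimes>\<^sub>M lborel)" by measurable
  finally have m: "(\<lambda>(l, \<xi>). indicator {\<xi>. l powr p / c < norm \<xi>} \<xi> * ennreal ((cmod (rep_l2 X \<xi>))\<^sup>2)) \<in> borel_measurable (borel \<Otimes>\<^sub>M lborel)" .
  show ?thesis unfolding freq_tail_def by (rule lborel.borel_measurable_nn_integral[OF m])
qed

text \<open>Under the root: \<open>2 powr s\<close> from splitting the weight
  (\<open>jb_split\<close>), 1 for the L^2 part, 3 from squaring a sum of three terms, and
  \<open>3 powr (2 * s)\<close> from the tripling of frequencies.\<close>

definition Nf_const :: "real \<Rightarrow> real" where
  "Nf_const s = Lam * sqrt (2 powr s * (1 + 3 * 3 powr (2 * s)))"

lemma Nf_const_pos: "Nf_const s > 0"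
proof -
  have "2 powr s * (1 + 3 * 3 powr (2 * s)) > 0" by (intro mult_pos_pos add_pos_nonneg) auto
  then show ?thesis using Lam_pos by (simp add: Nf_const_def)
qed

text \<open>The tail bound \<open>Nf_freq_tail\<close> is integrated over levels with
  \<open>nn_freq_tail_layer\<close>. Each term carries the H^s norm of a single factor, so later
  Gronwall arguments in H^s are linear.\<close>

theorem Nf_Hs:
  assumes s: "s \<ge> 1/2" and H: "Hs s A" "Hs s B" "Hs s C"
  shows "Hs s (Nf A B C)"
    and "hn s (Nf A B C) \<le> Nf_const s * (hn s A * h2 B * h2 C + h2 A * hn s B * h2 C + h2 A * h2 B * hn s C)"
proof -
  have s0: "s > 0" using s by simp
  have H2: "Hs (1/2) A" "Hs (1/2) B" "Hs (1/2) C" using H s Hs_mono by blast+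
  define N where "N = Nf A B C"
  define a where "a = hn s A * h2 B * h2 C"
  define b where "b = h2 A * hn s B * h2 C"
  define c where "c = h2 A * h2 B * hn s C"
  have abc: "0 \<le> a" "0 \<le> b" "0 \<le> c" by (auto simp: a_def b_def c_def)
  define M where "M X = (\<integral>\<^sup>+\<xi>. ennreal ((3 * norm \<xi>) powr (2 * s) * (cmod (rep_l2 X \<xi>))\<^sup>2) \<partial>lborel)" for X :: "(real^'n) l2"
  have Mle: "M X \<le> ennreal (3 powr (2 * s) * (hn s X)\<^sup>2)" if "Hs s X" for X
  proof -
    have "M X \<le> (\<integral>\<^sup>+\<xi>. ennreal (3 powr (2 * s)) * ennreal (jb (2 * s) \<xi> * (cmod (rep_l2 X \<xi>))\<^sup>2) \<partial>lborel)"
      unfolding M_def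
    proof (rule nn_integral_mono)
      fix \<xi> :: "real^'n"
      have "(3 * norm \<xi>) powr (2 * s) * (cmod (rep_l2 X \<xi>))\<^sup>2 \<le> 3 powr (2 * s) * jb (2 * s) \<xi> * (cmod (rep_l2 X \<xi>))\<^sup>2"
        by (intro mult_right_mono norm_powr_le_jb s0) auto
      then show "ennreal ((3 * norm \<xi>) powr (2 * s) * (cmod (rep_l2 X \<xi>))\<^sup>2) \<le> ennreal (3 powr (2 * s)) * ennreal (jb (2 * s) \<xi> * (cmod (rep_l2 X \<xi>))\<^sup>2)"
        by (subst ennreal_mult[symmetric]) (auto intro!: ennreal_leI simp: mult.assoc)
    qed
    also have "\<dots> = ennreal (3 powr (2 * s)) * sobolev_sq s X" unfolding sobolev_sq_def by (rule nn_integral_cmult) measurable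
    also have "\<dots> = ennreal (3 powr (2 * s) * (hn s X)\<^sup>2)" unfolding sobolev_sq_hn[OF that] by (simp add: ennreal_mult)
    finally show ?thesis .
  qed
  have "(\<integral>\<^sup>+\<xi>. ennreal ((1 * norm \<xi>) powr (2 * s) * (cmod (rep_l2 N \<xi>))\<^sup>2) \<partial>lborel) = (\<integral>\<^sup>+l. indicator {0<..} l * freq_tail (l powr (1 / (2 * s)) / 1) N \<partial>lborel)"
    using s0 by (intro nn_freq_tail_layer[symmetric]) auto
  also have "\<dots> \<le> (\<integral>\<^sup>+l. ennreal (3 * Lam\<^sup>2 * (h2 B * h2 C)\<^sup>2) * (indicator {0<..} l * freq_tail (l powr (1 / (2 * s)) / 3) A)
     + ennreal (3 * Lam\<^sup>2 * (h2 A * h2 C)\<^sup>2) * (indicator {0<..} l * freq_tail (l powr (1 / (2 * s)) / 3) B)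
     + ennreal (3 * Lam\<^sup>2 * (h2 A * h2 B)\<^sup>2) * (indicator {0<..} l * freq_tail (l powr (1 / (2 * s)) / 3) C) \<partial>lborel)"
  proof (rule nn_integral_mono)
    fix l :: real
    have "0 \<le> l powr (1 / (2 * s)) / 3" by simp
    from Nf_freq_tail[OF this H2]
    show "indicator {0<..} l * freq_tail (l powr (1 / (2 * s)) / 1) N \<le> ennreal (3 * Lam\<^sup>2 * (h2 B * h2 C)\<^sup>2) * (indicator {0<..} l * freq_tail (l powr (1 / (2 * s)) / 3) A)
     + ennreal (3 * Lam\<^sup>2 * (h2 A * h2 C)\<^sup>2) * (indicator {0<..} l * freq_tail (l powr (1 / (2 * s)) / 3) B)
     + ennreal (3 * Lam\<^sup>2 * (h2 A * h2 B)\<^sup>2) * (indicator {0<..} l * freq_tail (l powr (1 / (2 * s)) / 3) C)"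
      by (cases "l > 0") (simp_all add: N_def)
  qed
  also have "\<dots> = ennreal (3 * Lam\<^sup>2 * (h2 B * h2 C)\<^sup>2) * M A + ennreal (3 * Lam\<^sup>2 * (h2 A * h2 C)\<^sup>2) * M B + ennreal (3 * Lam\<^sup>2 * (h2 A * h2 B)\<^sup>2) * M C"
    unfolding M_def using s0 by (simp add: nn_integral_add nn_integral_cmult nn_freq_tail_layer)
  also have "\<dots> \<le> ennreal (3 * Lam\<^sup>2 * (h2 B * h2 C)\<^sup>2) * ennreal (3 powr (2 * s) * (hn s A)\<^sup>2) + ennreal (3 * Lam\<^sup>2 * (h2 A * h2 C)\<^sup>2) * ennreal (3 powr (2 * s) * (hn s B)\<^sup>2) + ennreal (3 * Lam\<^sup>2 * (h2 A * h2 B)\<^sup>2) * ennreal (3 powr (2 * s) * (hn s C)\<^sup>2)"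
    by (intro add_mono mult_left_mono Mle H) auto
  also have "\<dots> = ennreal (3 * Lam\<^sup>2 * 3 powr (2 * s) * (a\<^sup>2 + b\<^sup>2 + c\<^sup>2))"
    by (simp add: ennreal_mult[symmetric] ennreal_plus[symmetric] a_def b_def c_def power_mult_distrib algebra_simps del: ennreal_plus)
  finally have hom: "(\<integral>\<^sup>+\<xi>. ennreal (norm \<xi> powr (2 * s) * (cmod (rep_l2 N \<xi>))\<^sup>2) \<partial>lborel) \<le> ennreal (3 * Lam\<^sup>2 * 3 powr (2 * s) * (a\<^sup>2 + b\<^sup>2 + c\<^sup>2))"
    by simp
  have "norm N \<le> Lam * h2 A * h2 B * norm C" unfolding N_def by (rule Nf_le[OF H2])
  also have "\<dots> \<le> Lam * c"
    unfolding c_def using Lam_pos norm_le_hn[of s C] H s0 by (simp add: mult.assoc mult_left_mono)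
  finally have "(norm N)\<^sup>2 \<le> (Lam * c)\<^sup>2" by (intro power_mono) auto
  also have "\<dots> \<le> Lam\<^sup>2 * (a\<^sup>2 + b\<^sup>2 + c\<^sup>2)" by (simp add: power_mult_distrib mult_left_mono)
  finally have l2: "(norm N)\<^sup>2 \<le> Lam\<^sup>2 * (a\<^sup>2 + b\<^sup>2 + c\<^sup>2)" .
  have "sobolev_sq s N \<le> (\<integral>\<^sup>+\<xi>. ennreal (2 powr s) * (ennreal ((cmod (rep_l2 N \<xi>))\<^sup>2) + ennreal (norm \<xi> powr (2 * s) * (cmod (rep_l2 N \<xi>))\<^sup>2)) \<partial>lborel)"
    unfolding sobolev_sq_def
  proof (rule nn_integral_mono)
    fix \<xi> :: "real^'n"
    have "jb (2 * s) \<xi> * (cmod (rep_l2 N \<xi>))\<^sup>2 \<le> 2 powr s * (1 + norm \<xi> powr (2 * s)) * (cmod (rep_l2 N \<xi>))\<^sup>2"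
      by (intro mult_right_mono jb_split s0) auto
    then show "ennreal (jb (2 * s) \<xi> * (cmod (rep_l2 N \<xi>))\<^sup>2) \<le> ennreal (2 powr s) * (ennreal ((cmod (rep_l2 N \<xi>))\<^sup>2) + ennreal (norm \<xi> powr (2 * s) * (cmod (rep_l2 N \<xi>))\<^sup>2))"
      by (subst ennreal_plus[symmetric], simp, simp, subst ennreal_mult[symmetric], simp, simp, intro ennreal_leI)
        (simp add: distrib_right mult.assoc)
  qed
  also have "\<dots> = ennreal (2 powr s) * (ennreal ((norm N)\<^sup>2) + (\<integral>\<^sup>+\<xi>. ennreal (norm \<xi> powr (2 * s) * (cmod (rep_l2 N \<xi>))\<^sup>2) \<partial>lborel))"
    by (simp add: nn_integral_cmult nn_integral_add norm_l2_nn_sq nn_sq_def)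
  also have "\<dots> \<le> ennreal (2 powr s) * (ennreal (Lam\<^sup>2 * (a\<^sup>2 + b\<^sup>2 + c\<^sup>2)) + ennreal (3 * Lam\<^sup>2 * 3 powr (2 * s) * (a\<^sup>2 + b\<^sup>2 + c\<^sup>2)))"
    by (intro mult_left_mono add_mono hom ennreal_leI l2) auto
  also have "\<dots> = ennreal (2 powr s * (Lam\<^sup>2 * (a\<^sup>2 + b\<^sup>2 + c\<^sup>2) + 3 * Lam\<^sup>2 * 3 powr (2 * s) * (a\<^sup>2 + b\<^sup>2 + c\<^sup>2)))"
    by (simp add: ennreal_mult[symmetric] ennreal_plus[symmetric] del: ennreal_plus)
  also have "\<dots> \<le> ennreal ((Nf_const s * (a + b + c))\<^sup>2)"
  proof (rule ennreal_leI)
    have "2 powr s * (Lam\<^sup>2 * (a\<^sup>2 + b\<^sup>2 + c\<^sup>2) + 3 * Lam\<^sup>2 * 3 powr (2 * s) * (a\<^sup>2 + b\<^sup>2 + c\<^sup>2)) = (Nf_const s)\<^sup>2 * (a\<^sup>2 + b\<^sup>2 + c\<^sup>2)"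
      by (simp add: Nf_const_def power_mult_distrib algebra_simps)
    also have "\<dots> \<le> (Nf_const s)\<^sup>2 * (a + b + c)\<^sup>2"
      using abc by (intro mult_left_mono) (auto simp: power2_eq_square algebra_simps)
    finally show "2 powr s * (Lam\<^sup>2 * (a\<^sup>2 + b\<^sup>2 + c\<^sup>2) + 3 * Lam\<^sup>2 * 3 powr (2 * s) * (a\<^sup>2 + b\<^sup>2 + c\<^sup>2)) \<le> (Nf_const s * (a + b + c))\<^sup>2"
      by (simp add: power_mult_distrib)
  qed
  finally have E: "sobolev_sq s N \<le> ennreal ((Nf_const s * (a + b + c))\<^sup>2)" .
  have nn: "0 \<le> Nf_const s * (a + b + c)" using abc Nf_const_pos[of s] by simp
  show "Hs s (Nf A B C)" using hn_leI(1)[OF E nn] by (simp add: N_def)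
  show "hn s (Nf A B C) \<le> Nf_const s * (hn s A * h2 B * h2 C + h2 A * hn s B * h2 C + h2 A * h2 B * hn s C)"
    using hn_leI(2)[OF E nn] by (simp add: N_def a_def b_def c_def)
qed

end

section \<open>Differential equations on the half-line\<close>

lemma at_within_halfline:
  "0 \<le> t \<Longrightarrow> t < b \<Longrightarrow> at t within {0..b} = at t within {0..}" for t b :: real
  by (rule at_within_nhd[of t "{..<b}"]) auto

lemma halfline_integral_deriv:
  fixes f :: "real \<Rightarrow> 'a::banach"
  assumes c: "continuous_on {0..} f" and t: "0 \<le> t"
  shows "((\<lambda>u. integral {0..u} f) has_vector_derivative f t) (at t within {0..})"
proof -
  have "continuous_on {0..t+1} f" using c by (rule continuous_on_subset) auto
  from integral_has_vector_derivative[OF this, of t] t show ?thesis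
    by (simp add: at_within_halfline[of t "t + 1"])
qed

lemma halfline_deriv_cont:
  fixes f :: "real \<Rightarrow> 'a::real_normed_vector"
  assumes "\<And>t. 0 \<le> t \<Longrightarrow> (f has_vector_derivative f' t) (at t within {0..})"
  shows "continuous_on {0..} f"
  using assms by (auto simp: continuous_on_eq_continuous_within intro!: has_vector_derivative_continuous)

text \<open>The fixed point is taken for \<open>exp (- 2 L t) u t\<close> in the bounded continuous functions, where the integral operator contracts globally in time.\<close>

lemma ode_global:
  fixes G :: "real \<Rightarrow> 'a::banach \<Rightarrow> 'a"
  assumes cont: "\<And>u. continuous_on {0..} u \<Longrightarrow> continuous_on {0..} (\<lambda>t. G t (u t))"
    and Lip: "\<And>t x y. 0 \<le> t \<Longrightarrow> norm (G t x - G t y) \<le> L * norm (x - y)"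
    and zero: "\<And>t. 0 \<le> t \<Longrightarrow> G t 0 = 0" and L: "L > 0"
  shows "\<exists>u. u 0 = x0 \<and> (\<forall>t\<ge>0. (u has_vector_derivative G t (u t)) (at t within {0..}))"
proof -
  define v where "v b t = exp (2 * L * t) *\<^sub>R apply_bcontfun b t" for b :: "real \<Rightarrow>\<^sub>C 'a" and t
  define I where "I b t = x0 + integral {0..t} (\<lambda>s. G s (v b s))" for b t
  \<comment> \<open>Freezing the time at 0 for negative arguments makes \<open>F b\<close> a
    function on the whole line, as the type of bounded continuous functions requires.\<close>
  define F where "F b t = exp (- (2 * L * max 0 t)) *\<^sub>R I b (max 0 t)" for b t
  have vc: "continuous_on {0..} (v b)" for b
    unfolding v_def by (intro continuous_intros) auto
  have Gc: "continuous_on {0..} (\<lambda>s. G s (v b s))" for b by (rule cont[OF vc])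
  have Gi: "(\<lambda>s. G s (v b s)) integrable_on {0..t}" for b t
    by (rule integrable_continuous_real, rule continuous_on_subset[OF Gc]) auto
  have Ei: "(\<lambda>s. exp (2 * L * s)) integrable_on {0..t}" for t :: real
    by (rule integrable_continuous_real) (intro continuous_intros)
  have Eint: "integral {0..t} (\<lambda>s. exp (2 * L * s)) \<le> exp (2 * L * t) / (2 * L)" if "0 \<le> t" for t
  proof -
    have "((\<lambda>s. exp (2 * L * s)) has_integral (exp (2 * L * t) / (2 * L) - exp (2 * L * 0) / (2 * L))) {0..t}"
      using that L by (intro fundamental_theorem_of_calculus)
        (auto intro!: derivative_eq_intros simp: has_real_derivative_iff_has_vector_derivative[symmetric])
    then have "integral {0..t} (\<lambda>s. exp (2 * L * s)) = exp (2 * L * t) / (2 * L) - exp (2 * L * 0) / (2 * L)"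
      by (rule integral_unique)
    then show ?thesis using L by simp
  qed
  \<comment> \<open>The exponential weight gains a factor 1/2 after integration, which is the
    contraction constant.\<close>
  have int_le: "norm (integral {0..t} f) \<le> L * c * (exp (2 * L * t) / (2 * L))"
    if "0 \<le> t" "f integrable_on {0..t}" "\<And>s. 0 \<le> s \<Longrightarrow> norm (f s) \<le> L * c * exp (2 * L * s)" "0 \<le> c"
    for f :: "real \<Rightarrow> 'a" and t c
  proof -
    have "norm (integral {0..t} f) \<le> integral {0..t} (\<lambda>s. L * c * exp (2 * L * s))"
      using that by (intro integral_norm_bound_integral integrable_on_mult_right Ei) auto
    also have "\<dots> = L * c * integral {0..t} (\<lambda>s. exp (2 * L * s))" by simp
    also have "\<dots> \<le> L * c * (exp (2 * L * t) / (2 * L))"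
      using that L Eint[OF that(1)] by (intro mult_left_mono) auto
    finally show ?thesis .
  qed
  have Ic: "continuous_on {0..} (I b)" for b
    unfolding I_def by (intro continuous_on_add continuous_on_const halfline_deriv_cont[OF halfline_integral_deriv[OF Gc]])
  have FB: "F b \<in> bcontfun" for b
  proof (rule bcontfun_normI)
    show "continuous_on UNIV (F b)"
      unfolding F_def
      by (intro continuous_intros continuous_on_compose2[OF Ic]) auto
    fix t :: real
    define r where "r = max 0 t"
    have r: "0 \<le> r" by (simp add: r_def)
    have "norm (G s (v b s)) \<le> L * norm b * exp (2 * L * s)" if "0 \<le> s" for s
    proof -
      have "norm (G s (v b s)) \<le> L * norm (v b s)" using Lip[OF that, of "v b s" 0] zero[OF that] by simp
      also have "\<dots> \<le> L * (exp (2 * L * s) * norm b)"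
        unfolding v_def using L norm_bounded[of b s] by (simp add: mult_left_mono)
      finally show ?thesis by (simp add: ac_simps)
    qed
    then have "norm (integral {0..r} (\<lambda>s. G s (v b s))) \<le> L * norm b * (exp (2 * L * r) / (2 * L))"
      using r Gi by (intro int_le) auto
    then have "norm (I b r) \<le> norm x0 + norm b * exp (2 * L * r) / 2"
      unfolding I_def using L norm_triangle_ineq[of x0 "integral {0..r} (\<lambda>s. G s (v b s))"] by simp
    also have "\<dots> \<le> exp (2 * L * r) * (norm x0 + norm b / 2)"
      using L r mult_right_mono[of 1 "exp (2 * L * r)" "norm x0"] by (simp add: algebra_simps)
    finally have "exp (- (2 * L * r)) * norm (I b r) \<le> exp (- (2 * L * r)) * (exp (2 * L * r) * (norm x0 + norm b / 2))"
      by (intro mult_left_mono) auto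
    then show "norm (F b t) \<le> norm x0 + norm b / 2"
      unfolding F_def r_def[symmetric] by (simp add: mult.assoc[symmetric] exp_add[symmetric])
  qed
  define \<Phi> where "\<Phi> b = Bcontfun (F b)" for b
  have ap: "apply_bcontfun (\<Phi> b) = F b" for b unfolding \<Phi>_def by (rule Bcontfun_inverse[OF FB])
  have "dist (\<Phi> b) (\<Phi> b') \<le> 1/2 * dist b b'" for b b'
  proof (rule dist_bound)
    fix t :: real
    define r where "r = max 0 t"
    have r: "0 \<le> r" by (simp add: r_def)
    have "norm (G s (v b s) - G s (v b' s)) \<le> L * dist b b' * exp (2 * L * s)" if "0 \<le> s" for s
    proof -
      have "norm (G s (v b s) - G s (v b' s)) \<le> L * norm (v b s - v b' s)" by (rule Lip[OF that])
      also have "norm (v b s - v b' s) = exp (2 * L * s) * dist (apply_bcontfun b s) (apply_bcontfun b' s)"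
        unfolding v_def dist_norm by (simp add: scaleR_diff_right[symmetric])
      also have "L * \<dots> \<le> L * (exp (2 * L * s) * dist b b')"
        using L dist_bounded[of b s b'] by (simp add: mult_left_mono)
      finally show ?thesis by (simp add: ac_simps)
    qed
    then have "norm (integral {0..r} (\<lambda>s. G s (v b s) - G s (v b' s))) \<le> L * dist b b' * (exp (2 * L * r) / (2 * L))"
      using r Gi by (intro int_le integrable_diff) auto
    moreover have "I b r - I b' r = integral {0..r} (\<lambda>s. G s (v b s) - G s (v b' s))"
      unfolding I_def using Gi by (simp add: Henstock_Kurzweil_Integration.integral_diff)
    ultimately have "norm (I b r - I b' r) \<le> exp (2 * L * r) * (1/2 * dist b b')"
      using L by (simp add: field_simps)
    then have "exp (- (2 * L * r)) * norm (I b r - I b' r) \<le> exp (- (2 * L * r)) * (exp (2 * L * r) * (1/2 * dist b b'))"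
      by (intro mult_left_mono) auto
    then show "dist (apply_bcontfun (\<Phi> b) t) (apply_bcontfun (\<Phi> b') t) \<le> 1/2 * dist b b'"
      unfolding ap F_def r_def[symmetric] dist_norm
      by (simp add: scaleR_diff_right[symmetric] mult.assoc[symmetric] exp_add[symmetric])
  qed
  then have "\<exists>!b. \<Phi> b = b" by (intro banach_fix_type[of "1/2"]) auto
  then obtain b where b: "\<Phi> b = b" by blast
  define u where "u t = I b t" for t
  have ub: "u t = v b t" if "0 \<le> t" for t
  proof -
    have "apply_bcontfun b t = F b t" using ap[of b] b by simp
    then show ?thesis using that by (simp add: u_def v_def F_def exp_add[symmetric])
  qed
  have "u 0 = x0" by (simp add: u_def I_def)
  moreover have "(u has_vector_derivative G t (u t)) (at t within {0..})" if t: "0 \<le> t" for t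
  proof -
    have "(u has_vector_derivative 0 + G t (v b t)) (at t within {0..})"
      unfolding u_def[abs_def] I_def
      by (intro has_vector_derivative_add has_vector_derivative_const halfline_integral_deriv Gc t)
    then show ?thesis using ub[OF t] by simp
  qed
  ultimately show ?thesis by blast
qed

text \<open>\<open>f + e / c\<close> satisfies the homogeneous inequality, so its product with
  exp(-ct) is nonincreasing.\<close>

lemma gronwall:
  fixes f :: "real \<Rightarrow> real"
  assumes c: "c > 0" and d: "\<And>t. 0 \<le> t \<Longrightarrow> (f has_vector_derivative f' t) (at t within {0..})"
    and le: "\<And>t. 0 \<le> t \<Longrightarrow> t < T \<Longrightarrow> f' t \<le> c * f t + e" and t: "0 \<le> t" "t \<le> T"
  shows "f t + e / c \<le> (f 0 + e / c) * exp (c * t)"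
proof -
  define g where "g s = (f s + e / c) * exp (- (c * s))" for s
  have gt: "g t \<le> g 0"
  proof (rule DERIV_nonpos_imp_decreasing_open[OF t(1)])
    fix s assume s: "0 < s" "s < t"
    have "at s within {0..} = at s" using s by (intro at_within_interior) auto
    then have "(f has_real_derivative f' s) (at s)"
      using d[of s] s by (simp add: has_real_derivative_iff_has_vector_derivative)
    then have D: "(g has_real_derivative (f' s * exp (- (c * s)) + (f s + e / c) * (exp (- (c * s)) * - c))) (at s)"
      unfolding g_def by (auto intro!: derivative_eq_intros)
    have "f' s * exp (- (c * s)) + (f s + e / c) * (exp (- (c * s)) * - c) = (f' s - (c * f s + e)) * exp (- (c * s))"
      using c by (simp add: algebra_simps)
    also have "\<dots> \<le> 0" using le[of s] s t by (intro mult_nonpos_nonneg) auto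
    finally have "f' s * exp (- (c * s)) + (f s + e / c) * (exp (- (c * s)) * - c) \<le> 0" .
    with D show "\<exists>y. (g has_real_derivative y) (at s) \<and> y \<le> 0" by blast
  next
    have "continuous_on {0..} f" using d by (rule halfline_deriv_cont)
    then have "continuous_on {0..t} f" by (rule continuous_on_subset) auto
    then show "continuous_on {0..t} g" unfolding g_def by (intro continuous_intros)
  qed
  have g0: "g 0 = f 0 + e / c" by (simp add: g_def)
  have "g t * exp (c * t) \<le> (f 0 + e / c) * exp (c * t)"
    using gt unfolding g0 by (rule mult_right_mono) simp
  moreover have "g t * exp (c * t) = f t + e / c"
  proof -
    have "exp (- (c * t)) * exp (c * t) = 1" by (simp add: exp_add[symmetric])
    then show ?thesis unfolding g_def mult.assoc by (simp only: mult_1_right)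
  qed
  ultimately show ?thesis by (simp only:)
qed

lemma deriv_const:
  fixes f :: "real \<Rightarrow> 'a::real_normed_vector"
  assumes "\<And>t. 0 \<le> t \<Longrightarrow> (f has_vector_derivative 0) (at t within {0..})" "0 \<le> t"
  shows "f t = f 0"
proof -
  show ?thesis
  proof (rule has_vector_derivative_zero_constant[of "{0..}" f])
    show "convex {0::real..}" by simp
    show "(f has_vector_derivative 0) (at x within {0..})" if "x \<in> {0..}" for x
      using that assms(1) by simp
    fix c assume c: "\<And>x. x \<in> {0..} \<Longrightarrow> f x = c"
    show ?thesis using c[of t] c[of 0] assms(2) by simp
  qed
qed

section \<open>The free propagator\<close>

text \<open>Dominated convergence in frequency, with the square of \<open>C\<close> times
  \<open>k\<close> times \<open>A\<close> as majorant; the real parameter is reduced to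
  sequences.\<close>

lemma l2_mul_dominated:
  fixes A :: "'a::euclidean_space l2" and m :: "real \<Rightarrow> 'a \<Rightarrow> complex"
  assumes k: "mok k A" and m: "\<And>h. m h \<in> borel_measurable borel" and b: "\<And>h x. cmod (m h x) \<le> C * cmod (k x)"
    and lim: "\<And>x. ((\<lambda>h. m h x) \<longlongrightarrow> 0) (at t within S)"
  shows "((\<lambda>h. mul (m h) A) \<longlongrightarrow> 0) (at t within S)"
  unfolding tendsto_at_iff_sequentially
proof (intro allI impI)
  fix X :: "nat \<Rightarrow> real" assume X: "\<forall>i. X i \<in> S - {t}" "X \<longlonglongrightarrow> t"
  note [measurable] = m
  have mk: "mok (m h) A" for h by (rule mok_dom[OF k m b])
  have sq: "sq_int (\<lambda>x. complex_of_real C * (k x * rep_l2 A x))" using k unfolding mok_def by (rule sq_int_cmult)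
  have n: "(norm (mul (m h) A))\<^sup>2 = (LINT x|lborel. (cmod (m h x * rep_l2 A x))\<^sup>2)" for h
    using mk[of h] unfolding mul_def mok_def by (simp add: norm_abs_l2 L2n_def)
  have "(\<lambda>i. LINT x|lborel. (cmod (m (X i) x * rep_l2 A x))\<^sup>2) \<longlonglongrightarrow> (LINT x::'a|lborel. 0)"
  proof (rule integral_dominated_convergence)
    show "integrable lborel (\<lambda>x. (cmod (complex_of_real C * (k x * rep_l2 A x)))\<^sup>2)"
      using sq by (simp add: sq_int_def)
    show "AE x in lborel. (\<lambda>i. (cmod (m (X i) x * rep_l2 A x))\<^sup>2) \<longlonglongrightarrow> 0"
    proof (rule AE_I2)
      fix x
      have "(\<lambda>i. m (X i) x) \<longlonglongrightarrow> 0"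
        using lim[of x] X unfolding tendsto_at_iff_sequentially by (auto simp: comp_def)
      then have "(\<lambda>i. (cmod (m (X i) x * rep_l2 A x))\<^sup>2) \<longlonglongrightarrow> (cmod (0 * rep_l2 A x))\<^sup>2"
        by (intro tendsto_intros)
      then show "(\<lambda>i. (cmod (m (X i) x * rep_l2 A x))\<^sup>2) \<longlonglongrightarrow> 0" by simp
    qed
    show "AE x in lborel. norm ((cmod (m (X i) x * rep_l2 A x))\<^sup>2) \<le> (cmod (complex_of_real C * (k x * rep_l2 A x)))\<^sup>2" for i
    proof (rule AE_I2)
      fix x
      have "C * cmod (k x) \<le> \<bar>C\<bar> * cmod (k x)" by (intro mult_right_mono) auto
      then have "cmod (m (X i) x * rep_l2 A x) \<le> cmod (complex_of_real C * (k x * rep_l2 A x))"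
        using mult_right_mono[OF order_trans[OF b[of "X i" x]], of "\<bar>C\<bar> * cmod (k x)" "cmod (rep_l2 A x)"]
        by (simp add: norm_mult mult.assoc)
      then show "norm ((cmod (m (X i) x * rep_l2 A x))\<^sup>2) \<le> (cmod (complex_of_real C * (k x * rep_l2 A x)))\<^sup>2"
        by (simp add: power_mono)
    qed
  qed measurable
  then have "(\<lambda>i. sqrt ((norm (mul (m (X i)) A))\<^sup>2)) \<longlonglongrightarrow> sqrt 0"
    unfolding n by (intro tendsto_real_sqrt) simp
  then have "(\<lambda>i. norm (mul (m (X i)) A)) \<longlonglongrightarrow> 0" by simp
  then show "((\<lambda>h. mul (m h) A) \<circ> X) \<longlonglongrightarrow> 0"
    unfolding comp_def by (rule tendsto_norm_zero_cancel)
qed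

definition sg :: "real \<Rightarrow> real^'n \<Rightarrow> complex" where "sg t \<xi> = cis (- (t * jb 1 \<xi>))"

definition Sg :: "real \<Rightarrow> (real^'n) l2 \<Rightarrow> (real^'n) l2" where "Sg t A = mul (sg t) A"

lemma sg_measurable [measurable]: "sg t \<in> borel_measurable borel"
  unfolding sg_def[abs_def] cis_conv_exp by measurable

lemma cmod_sg [simp]: "cmod (sg t \<xi>) = 1"
  by (simp add: sg_def)

lemma sg_add: "sg (s + t) \<xi> = sg s \<xi> * sg t \<xi>"
  by (simp add: sg_def cis_mult algebra_simps)

lemma mok_sg [simp]: "mok (sg t) A"
  by (rule mok_bounded[of _ 1]) auto

lemma norm_Sg [simp]: "norm (Sg t A) = norm A"
  unfolding Sg_def by (rule norm_mul_eq) auto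

lemma bounded_linear_Sg: "bounded_linear (Sg t)"
  unfolding Sg_def[abs_def] by (rule bounded_linear_mul[of _ 1]) auto

lemma Sg_diff: "Sg t (A - B) = Sg t A - Sg t B"
  by (rule linear_diff[OF bounded_linear.linear[OF bounded_linear_Sg]])

lemma Sg_scaleR: "Sg t (r *\<^sub>R A) = r *\<^sub>R Sg t A"
  by (rule linear_scale[OF bounded_linear.linear[OF bounded_linear_Sg]])

lemma Sg_0 [simp]: "Sg 0 (A :: (real^'n) l2) = A"
proof -
  have "sg 0 = (\<lambda>_::real^'n. 1 :: complex)" by (auto simp: sg_def fun_eq_iff)
  then show ?thesis by (simp add: Sg_def)
qed

lemma Sg_Sg: "Sg s (Sg t A) = Sg (s + t) A"
proof -
  have "mok (\<lambda>x. sg s x * sg t x) A" by (rule mok_bounded[of _ 1]) (auto simp: norm_mult)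
  then show ?thesis
    unfolding Sg_def by (subst mul_mul) (auto simp: sg_add[abs_def])
qed

lemma Sg_inv [simp]: "Sg t (Sg (- t) A) = A" "Sg (- t) (Sg t A) = A"
  by (simp_all add: Sg_Sg)

lemma rep_Sg: "AE x in lborel. rep_l2 (Sg t A) x = sg t x * rep_l2 A x"
  unfolding Sg_def by (rule rep_mul) simp

lemma Sg_lp: "Sg t (lp R A) = lp R (Sg t A)"
proof (rule l2_eqI)
  show "AE x in lborel. rep_l2 (Sg t (lp R A)) x = rep_l2 (lp R (Sg t A)) x"
    using rep_Sg[of t "lp R A"] rep_Sg[of t A] rep_lp[of R A] rep_lp[of R "Sg t A"]
    by eventually_elim simp
qed

lemma Sg_cm: "Sg t (cm c A) = cm c (Sg t A)"
proof (rule l2_eqI)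
  show "AE x in lborel. rep_l2 (Sg t (cm c A)) x = rep_l2 (cm c (Sg t A)) x"
    using rep_Sg[of t "cm c A"] rep_Sg[of t A] rep_mul[of "\<lambda>_. c" A] rep_mul[of "\<lambda>_. c" "Sg t A"]
    by (auto)
qed

lemma lp_cm: "lp t (cm c A) = cm c (lp t A)"
proof (rule l2_eqI)
  show "AE x in lborel. rep_l2 (lp t (cm c A)) x = rep_l2 (cm c (lp t A)) x"
    using rep_lp[of t "cm c A"] rep_lp[of t A] rep_mul[of "\<lambda>_. c" A] rep_mul[of "\<lambda>_. c" "lp t A"]
    by (auto)
qed

lemma Hs_Sg: "Hs s A \<Longrightarrow> Hs s (Sg t A)" "Hs s A \<Longrightarrow> hn s (Sg t A) = hn s A"
proof -
  show 1: "Hs s (Sg t A)" if "Hs s A" for s t and A :: "(real^'a) l2"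
    unfolding Sg_def using that by (intro Hs_contr) auto
  have 2: "hn s (Sg t A) \<le> hn s A" if "Hs s A" for s t and A :: "(real^'a) l2"
    unfolding Sg_def using that by (intro Hs_contr) auto
  show "hn s (Sg t A) = hn s A" if "Hs s A"
    using 2[OF that, of t] 2[OF 1[OF that, of t], of "- t"] by simp
qed

lemma inner_Sg: "inner (Sg t A) B = inner (A :: (real^'n) l2) (Sg (- t) B)"
proof -
  have "(\<lambda>x. cnj (sg t x)) = (sg (- t) :: real^'n \<Rightarrow> complex)" by (auto simp: sg_def fun_eq_iff cis_cnj)
  then show ?thesis unfolding Sg_def by (subst inner_mul) simp_all
qed

lemma Sg_cont0: "((\<lambda>h. Sg h A - A) \<longlongrightarrow> 0) (at 0 within S)"
proof -
  have "((\<lambda>h. mul (\<lambda>x. sg h x - 1) A) \<longlongrightarrow> 0) (at 0 within S)"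
  proof (rule l2_mul_dominated[of "\<lambda>_. 1" _ _ 2])
    fix h x
    show "cmod (sg h x - 1) \<le> 2 * cmod 1" using norm_triangle_ineq4[of "sg h x" 1] by simp
    have "((\<lambda>h. cis (- (h * jb 1 x)) - 1) \<longlongrightarrow> cis (- (0 * jb 1 x)) - 1) (at 0 within S)"
      unfolding cis_conv_exp by (intro tendsto_intros)
    then show "((\<lambda>h. sg h x - 1) \<longlongrightarrow> 0) (at 0 within S)" by (simp add: sg_def)
  qed auto
  moreover have "mul (\<lambda>x. sg h x - 1) A = Sg h A - A" for h
  proof (rule mul_eqI)
    show "mok (\<lambda>x. sg h x - 1) A"
      by (rule mok_bounded[of _ 2]) (auto intro: order_trans[OF norm_triangle_ineq4])
    show "AE x in lborel. rep_l2 (Sg h A - A) x = (sg h x - 1) * rep_l2 A x"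
      using rep_minus[of "Sg h A" A] rep_Sg[of h A] by eventually_elim (simp add: algebra_simps)
  qed
  ultimately show ?thesis by simp
qed

text \<open>Only strong continuity of the group is at hand, hence the split: the change of the
  vector passes through an isometry, and the change of time acts on the fixed vector
  \<open>Sg (g t) (a t)\<close>.\<close>

lemma Sg_continuous:
  assumes "continuous_on T a" "continuous_on T g"
  shows "continuous_on T (\<lambda>t. Sg (g t) (a t))"
  unfolding continuous_on_def
proof
  fix t assume t: "t \<in> T"
  have ga: "(a \<longlongrightarrow> a t) (at t within T)" "(g \<longlongrightarrow> g t) (at t within T)"
    using assms t by (auto simp: continuous_on_def)
  have S: "isCont (\<lambda>h. Sg h (Sg (g t) (a t)) - Sg (g t) (a t)) 0"
    unfolding isCont_def using Sg_cont0[of "Sg (g t) (a t)" UNIV] by simp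
  have "((\<lambda>s. g s - g t) \<longlongrightarrow> 0) (at t within T)" using ga(2) by (simp add: Lim_null[symmetric])
  from isCont_tendsto_compose[OF S this]
  have 1: "((\<lambda>s. Sg (g s - g t) (Sg (g t) (a t)) - Sg (g t) (a t)) \<longlongrightarrow> 0) (at t within T)" by simp
  have 2: "((\<lambda>s. norm (Sg (g s) (a s - a t))) \<longlongrightarrow> 0) (at t within T)"
    using ga(1) by (simp add: tendsto_norm_zero_iff Lim_null[symmetric])
  have "((\<lambda>s. Sg (g s) (a s - a t) + (Sg (g s - g t) (Sg (g t) (a t)) - Sg (g t) (a t))) \<longlongrightarrow> 0 + 0) (at t within T)"
    by (intro tendsto_add 1 tendsto_norm_zero_cancel[OF 2])
  moreover have "Sg (g s) (a s - a t) + (Sg (g s - g t) (Sg (g t) (a t)) - Sg (g t) (a t)) = Sg (g s) (a s) - Sg (g t) (a t)" for s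
    by (simp add: Sg_diff Sg_Sg)
  ultimately have "((\<lambda>s. Sg (g s) (a s) - Sg (g t) (a t)) \<longlongrightarrow> 0) (at t within T)" by simp
  then show "((\<lambda>s. Sg (g s) (a s)) \<longlongrightarrow> Sg (g t) (a t)) (at t within T)" by (rule Lim_null[THEN iffD2])
qed

definition radial_retract :: "real \<Rightarrow> 'a::real_normed_vector \<Rightarrow> 'a" where
  "radial_retract r x = (r / max r (norm x)) *\<^sub>R x"

lemma radial_retract_id: "r > 0 \<Longrightarrow> norm x \<le> r \<Longrightarrow> radial_retract r x = x"
  by (simp add: radial_retract_def max_def)

lemma norm_radial_retract: "r > 0 \<Longrightarrow> norm (radial_retract r x) \<le> r"
  by (simp add: radial_retract_def max_def field_simps)

text \<open>The crude constant 2 holds in any normed space; it enters only the auxiliary Lipschitz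
  bound of the truncated equation.\<close>

lemma radial_retract_Lip:
  assumes r: "r > 0" shows "norm (radial_retract r x - radial_retract r y) \<le> 2 * norm (x - y)"
proof -
  define p where "p = max r (norm x)"
  define q where "q = max r (norm y)"
  have pq: "p \<ge> r" "q \<ge> r" "q \<ge> norm y" "p > 0" "q > 0" using r by (auto simp: p_def q_def)
  have d: "\<bar>q - p\<bar> \<le> norm (x - y)"
    using norm_triangle_ineq3[of x y] unfolding p_def q_def by linarith
  have "radial_retract r x - radial_retract r y = (r / p) *\<^sub>R (x - y) + ((r / p) * (q - p) / q) *\<^sub>R y"
  proof -
    have "r / p - r / q = (r / p) * (q - p) / q" using pq by (simp add: field_simps)
    then have "((r / p) * (q - p) / q) *\<^sub>R y = (r / p) *\<^sub>R y - (r / q) *\<^sub>R y" by (simp add: scaleR_diff_left[symmetric])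
    then show ?thesis by (simp add: radial_retract_def p_def[symmetric] q_def[symmetric] scaleR_diff_right)
  qed
  then have "norm (radial_retract r x - radial_retract r y) \<le> norm ((r / p) *\<^sub>R (x - y)) + norm (((r / p) * (q - p) / q) *\<^sub>R y)"
    by (simp only: norm_triangle_ineq)
  also have "norm ((r / p) *\<^sub>R (x - y)) = (r / p) * norm (x - y)" using pq r by simp
  also have "(r / p) * norm (x - y) \<le> 1 * norm (x - y)" using pq r by (intro mult_right_mono) auto
  also have "norm (((r / p) * (q - p) / q) *\<^sub>R y) = (r / p) * \<bar>q - p\<bar> * (norm y / q)"
    using pq r by (simp add: abs_mult)
  also have "\<dots> \<le> 1 * norm (x - y) * 1"
    using pq r d by (intro mult_mono) auto
  finally show ?thesis by simp
qed

lemma has_vector_derivative_iff_quotient: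
  fixes f :: "real \<Rightarrow> 'a::real_normed_vector"
  shows "(f has_vector_derivative f') (at t within S) \<longleftrightarrow> ((\<lambda>s. (f s - f t) /\<^sub>R (s - t)) \<longlongrightarrow> f') (at t within S)"
proof -
  have "(f has_vector_derivative f') (at t within S) \<longleftrightarrow> ((\<lambda>s. norm ((f s - f t) - (s - t) *\<^sub>R f') / norm (s - t)) \<longlongrightarrow> 0) (at t within S)"
    unfolding has_vector_derivative_def has_derivative_iff_norm by (simp add: bounded_linear_scaleR_left)
  also have "\<dots> \<longleftrightarrow> ((\<lambda>s. norm ((f s - f t) /\<^sub>R (s - t) - f')) \<longlongrightarrow> 0) (at t within S)"
  proof (rule filterlim_cong[OF refl refl])
    show "\<forall>\<^sub>F s in at t within S. norm ((f s - f t) - (s - t) *\<^sub>R f') / norm (s - t) = norm ((f s - f t) /\<^sub>R (s - t) - f')"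
      unfolding eventually_at_filter
    proof (intro always_eventually allI impI)
      fix s assume "s \<noteq> t"
      then have "(f s - f t) /\<^sub>R (s - t) - f' = ((f s - f t) - (s - t) *\<^sub>R f') /\<^sub>R (s - t)"
        by (simp add: scaleR_diff_right)
      then show "norm ((f s - f t) - (s - t) *\<^sub>R f') / norm (s - t) = norm ((f s - f t) /\<^sub>R (s - t) - f')"
        by (simp add: divide_inverse mult.commute)
    qed
  qed
  also have "\<dots> \<longleftrightarrow> ((\<lambda>s. (f s - f t) /\<^sub>R (s - t)) \<longlongrightarrow> f') (at t within S)"
    by (rule tendsto_iff_norm_diff[symmetric])
  finally show ?thesis .
qed

lemma linear_cm: "linear (cm c)"
  by (rule bounded_linear.linear[OF bounded_linear_cm])

lemmas cm_diff = linear_diff[OF linear_cm] and cm_add = linear_add[OF linear_cm]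
  and cm_scaleR = linear_scale[OF linear_cm] and cm_zero = linear_0[OF linear_cm]

lemma norm_cm: "norm (cm c A) = cmod c * norm A"
proof (cases "c = 0")
  case True
  have "cm 0 A = 0" by (rule mul_eqI) (use rep_zero in auto)
  then show ?thesis using True by simp
next
  case False
  have 1: "norm (cm c A) \<le> cmod c * norm A" for c and A :: "'a l2" by (rule norm_mul_le) auto
  have "cm (inverse c) (cm c A) = A" using False by (subst mul_mul) auto
  then have "norm A \<le> cmod (inverse c) * norm (cm c A)" using 1[of "inverse c" "cm c A"] by simp
  then have "cmod c * norm A \<le> cmod c * (cmod (inverse c) * norm (cm c A))"
    by (rule mult_left_mono) simp
  also have "\<dots> = norm (cm c A)" using False by (simp add: mult.assoc[symmetric] norm_mult[symmetric])
  finally have "cmod c * norm A \<le> norm (cm c A)" .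
  then show ?thesis using 1[of c A] by simp
qed

lemma sg_diff_le: "cmod (sg h \<xi> - 1) \<le> \<bar>h\<bar> * jb 1 \<xi>"
proof -
  have "cmod (iexp (- (h * jb 1 \<xi>)) - (\<Sum>k\<le>0. (\<i> * complex_of_real (- (h * jb 1 \<xi>))) ^ k / fact k)) \<le> \<bar>- (h * jb 1 \<xi>)\<bar> ^ Suc 0 / fact (Suc 0)"
    by (rule iexp_approx1)
  then show ?thesis by (simp add: sg_def cis_conv_exp abs_mult)
qed

text \<open>H^1 is the domain of the generator: the difference quotients of the symbol are bounded
  by \<open>jb 1\<close>, so dominated convergence applies.\<close>

lemma Sg_deriv0:
  fixes A :: "(real^'a) l2"
  assumes A: "Hs 1 A"
  shows "((\<lambda>h. (Sg h A - A) /\<^sub>R h) \<longlongrightarrow> cm (- \<i>) (mul (jc 1) A)) (at 0 within S)"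
proof -
  define m where "m h \<xi> = (sg h \<xi> - 1) / complex_of_real h + \<i> * jc 1 \<xi>" for h and \<xi> :: "real^'a"
  have [measurable]: "m h \<in> borel_measurable borel" for h unfolding m_def[abs_def] by measurable
  \<comment> \<open>For \<open>h = 0\<close> the division returns 0, so the bound holds for every
    \<open>h\<close>, as \<open>l2_mul_dominated\<close> demands.\<close>
  have q: "cmod ((sg h \<xi> - 1) / complex_of_real h) \<le> jb 1 \<xi>" for h and \<xi> :: "real^'a"
    using sg_diff_le[of h \<xi>] by (cases "h = 0") (auto simp: norm_divide field_simps)
  have b: "cmod (m h \<xi>) \<le> 2 * cmod (jc 1 \<xi>)" for h \<xi>
  proof -
    have "cmod (m h \<xi>) \<le> cmod ((sg h \<xi> - 1) / complex_of_real h) + cmod (\<i> * jc 1 \<xi>)"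
      unfolding m_def by (rule norm_triangle_ineq)
    then show ?thesis using q[of h \<xi>] by (simp add: norm_mult)
  qed
  have lim: "((\<lambda>h. m h \<xi>) \<longlongrightarrow> 0) (at 0 within S)" for \<xi>
  proof -
    have "((\<lambda>z. exp (- (\<i> * jc 1 \<xi>) * z)) has_field_derivative - (\<i> * jc 1 \<xi>)) (at (complex_of_real 0))"
      by (auto intro!: derivative_eq_intros)
    then have "((\<lambda>h. exp (- (\<i> * jc 1 \<xi>) * complex_of_real h)) has_vector_derivative - (\<i> * jc 1 \<xi>)) (at 0 within S)"
      by (rule has_vector_derivative_real_field)
    moreover have "exp (- (\<i> * jc 1 \<xi>) * complex_of_real h) = sg h \<xi>" for h
      by (simp add: sg_def cis_conv_exp ac_simps)
    ultimately have "((\<lambda>h. sg h \<xi>) has_vector_derivative - (\<i> * jc 1 \<xi>)) (at 0 within S)"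
      by (simp only:)
    then have "((\<lambda>h. (sg h \<xi> - 1) / complex_of_real h) \<longlongrightarrow> - (\<i> * jc 1 \<xi>)) (at 0 within S)"
      unfolding has_vector_derivative_iff_quotient by (simp add: sg_def scaleR_conv_of_real divide_inverse mult.commute)
    from tendsto_add[OF this tendsto_const[of "\<i> * jc 1 \<xi>"]] show ?thesis by (simp add: m_def)
  qed
  have mm: "mok (m h) A" for h by (rule mok_dom[OF A _ b]) measurable
  have "((\<lambda>h. mul (m h) A) \<longlongrightarrow> 0) (at 0 within S)"
    by (rule l2_mul_dominated[OF A _ b lim]) measurable
  moreover have "mul (m h) A = (Sg h A - A) /\<^sub>R h - cm (- \<i>) (mul (jc 1) A)" for h
  proof (rule mul_eqI[OF mm])
    show "AE x in lborel. rep_l2 ((Sg h A - A) /\<^sub>R h - cm (- \<i>) (mul (jc 1) A)) x = m h x * rep_l2 A x"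
      using rep_minus[of "(Sg h A - A) /\<^sub>R h" "cm (- \<i>) (mul (jc 1) A)"] rep_scaleR[of "inverse h" "Sg h A - A"]
        rep_minus[of "Sg h A" A] rep_Sg[of h A] rep_mul[OF A] rep_mul[OF mok_const, of "- \<i>" "mul (jc 1) A"]
      by eventually_elim (simp add: m_def divide_inverse algebra_simps)
  qed
  ultimately have "((\<lambda>h. (Sg h A - A) /\<^sub>R h - cm (- \<i>) (mul (jc 1) A)) \<longlongrightarrow> 0) (at 0 within S)" by simp
  then show ?thesis by (rule Lim_null[THEN iffD2])
qed

text \<open>The product rule for a strongly continuous isometric group; isometry lets the error in
  the difference quotient of \<open>c\<close> pass through the moving operator.\<close>

lemma Sg_deriv:
  assumes c: "(c has_vector_derivative c') (at t within S)" and H: "Hs 1 (c t)"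
  shows "((\<lambda>s. Sg s (c s)) has_vector_derivative Sg t c' + cm (- \<i>) (mul (jc 1) (Sg t (c t)))) (at t within S)"
  unfolding has_vector_derivative_iff_quotient
proof -
  have x: "((\<lambda>s. (c s - c t) /\<^sub>R (s - t)) \<longlongrightarrow> c') (at t within S)" using c unfolding has_vector_derivative_iff_quotient .
  have "((\<lambda>s. Sg s ((c s - c t) /\<^sub>R (s - t) - c')) \<longlongrightarrow> 0) (at t within S)"
  proof (rule tendsto_norm_zero_cancel)
    show "((\<lambda>s. norm (Sg s ((c s - c t) /\<^sub>R (s - t) - c'))) \<longlongrightarrow> 0) (at t within S)"
      using tendsto_iff_norm_diff[THEN iffD1, OF x] by (simp only: norm_Sg)
  qed
  moreover have "((\<lambda>s. Sg s c') \<longlongrightarrow> Sg t c') (at t within S)"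
  proof -
    have "continuous_on UNIV (\<lambda>s. Sg s c')" by (intro Sg_continuous continuous_intros)
    then show ?thesis by (simp add: continuous_on_eq_continuous_at isCont_def tendsto_within_subset[OF _ subset_UNIV])
  qed
  ultimately have 1: "((\<lambda>s. Sg s ((c s - c t) /\<^sub>R (s - t) - c') + Sg s c') \<longlongrightarrow> 0 + Sg t c') (at t within S)"
    by (rule tendsto_add)
  have f: "filterlim (\<lambda>s. s - t) (at 0) (at t within S)"
    unfolding filterlim_at by (auto intro!: tendsto_eq_intros simp: eventually_at_filter)
  have "((\<lambda>s. (Sg (s - t) (c t) - c t) /\<^sub>R (s - t)) \<longlongrightarrow> cm (- \<i>) (mul (jc 1) (c t))) (at t within S)"
    using filterlim_compose[OF Sg_deriv0[OF H, of UNIV] f] .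
  then have 2: "((\<lambda>s. Sg t ((Sg (s - t) (c t) - c t) /\<^sub>R (s - t))) \<longlongrightarrow> Sg t (cm (- \<i>) (mul (jc 1) (c t)))) (at t within S)"
    by (rule bounded_linear.tendsto[OF bounded_linear_Sg])
  have e: "(Sg s (c s) - Sg t (c t)) /\<^sub>R (s - t) = (Sg s ((c s - c t) /\<^sub>R (s - t) - c') + Sg s c') + Sg t ((Sg (s - t) (c t) - c t) /\<^sub>R (s - t))" for s
    by (simp add: Sg_diff Sg_scaleR Sg_Sg scaleR_diff_right)
  have "Sg t (cm (- \<i>) (mul (jc 1) (c t))) = cm (- \<i>) (mul (jc 1) (Sg t (c t)))"
  proof -
    have "Sg t (mul (jc 1) (c t)) = mul (jc 1) (Sg t (c t))"
    proof (rule mul_eqI[symmetric])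
      show "mok (jc 1) (Sg t (c t))" using H by (rule Hs_Sg)
      show "AE x in lborel. rep_l2 (Sg t (mul (jc 1) (c t))) x = jc 1 x * rep_l2 (Sg t (c t)) x"
        using rep_Sg[of t "c t"] rep_Sg[of t "mul (jc 1) (c t)"] rep_mul[OF H] by eventually_elim simp
    qed
    then show ?thesis by (simp add: Sg_cm)
  qed
  with tendsto_add[OF 1 2] show "((\<lambda>s. (Sg s (c s) - Sg t (c t)) /\<^sub>R (s - t)) \<longlongrightarrow> Sg t c' + cm (- \<i>) (mul (jc 1) (Sg t (c t)))) (at t within S)"
    unfolding e by simp
qed

context hartree_potential
begin

abbreviation NN :: "(real^'n) l2 \<Rightarrow> (real^'n) l2" where "NN u \<equiv> Nf u u u"

lemma NN_Lip_B:
  assumes "Hs (1/2) u" "Hs (1/2) v" "h2 u \<le> B" "h2 v \<le> B"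
  shows "norm (NN u - NN v) \<le> 3 * Lam * B\<^sup>2 * norm (u - v)"
proof -
  have B: "0 \<le> B" using assms(3) norm_ge_zero order_trans by blast
  have "(h2 u)\<^sup>2 + h2 u * h2 v + (h2 v)\<^sup>2 \<le> B\<^sup>2 + B * B + B\<^sup>2"
    using assms B by (intro add_mono power_mono mult_mono) auto
  then have "Lam * ((h2 u)\<^sup>2 + h2 u * h2 v + (h2 v)\<^sup>2) * norm (u - v) \<le> Lam * (B\<^sup>2 + B * B + B\<^sup>2) * norm (u - v)"
    using Lam_pos by (intro mult_right_mono mult_left_mono) auto
  with Nf_Lip[OF assms(1,2)] show ?thesis by (simp add: power2_eq_square algebra_simps)
qed

lemma Nf_zero: "NN 0 = 0"
proof -
  have "lp 1 (0 :: (real^'n) l2) = 0" by (rule linear_0[OF bounded_linear.linear[OF bounded_linear_lp]])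
  then have H: "Hs (1/2) (0 :: (real^'n) l2)"
    using lp_bound(1)[of "1/2" 1 "0 :: (real^'n) l2"] by simp
  show ?thesis using Nf_le(1)[OF H H H] by simp
qed

section \<open>Truncated equations\<close>

text \<open>The radial retraction makes the truncated vector field globally Lipschitz; it is inactive along the solution because the mass is conserved.\<close>

lemma galerkin:
  assumes k: "k > 0" and r: "r > 0" and a0: "lp k a0 = a0" "norm a0 \<le> r"
  shows "\<exists>a. a 0 = a0 \<and> (\<forall>t\<ge>0. lp k (a t) = a t \<and> norm (a t) = norm a0 \<and>
    (a has_vector_derivative cm (- \<i>) (Sg (- t) (lp k (NN (Sg t (a t)))))) (at t within {0..}))"
proof -
  define cut_arg where "cut_arg t x = lp k (Sg t (radial_retract r x))" for t and x :: "(real^'n) l2"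
  define G where "G t x = cm (- \<i>) (Sg (- t) (lp k (NN (cut_arg t x))))" for t x
  \<comment> \<open>Bernstein's constant (1 + k^2)^(s/2) at s = 1/2, on the ball of radius
    \<open>r\<close>.\<close>
  define B where "B = (1 + k\<^sup>2) powr (1 / 4) * r"
  have B: "0 \<le> B" using r by (simp add: B_def)
  have bH: "Hs (1/2) (cut_arg t x)" "h2 (cut_arg t x) \<le> B" for t x
  proof -
    show "Hs (1/2) (cut_arg t x)" unfolding cut_arg_def using k by (intro lp_bound) auto
    have "h2 (cut_arg t x) \<le> (1 + k\<^sup>2) powr (1/2 / 2) * norm (Sg t (radial_retract r x))"
      unfolding cut_arg_def using k by (intro lp_bound) auto
    also have "\<dots> \<le> B" unfolding B_def using norm_radial_retract[OF r, of x] by (simp add: mult_left_mono)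
    finally show "h2 (cut_arg t x) \<le> B" .
  qed
  have bL: "norm (cut_arg t x - cut_arg t y) \<le> 2 * norm (x - y)" for t x y
    unfolding cut_arg_def lp_diff[symmetric] Sg_diff[symmetric]
    using norm_lp_le[of k "Sg t (radial_retract r x - radial_retract r y)"] radial_retract_Lip[OF r, of x y] by simp
  \<comment> \<open>The L^2 Lipschitz constant of \<open>NN\<close> times the 2 of the retraction;
    the added 1 keeps it visibly positive.\<close>
  define L where "L = 3 * Lam * B\<^sup>2 * 2 + 1"
  have L: "L > 0" unfolding L_def using Lam_pos by (simp add: add_nonneg_pos)
  have GL: "norm (G t x - G t y) \<le> L * norm (x - y)" for t x y
  proof -
    have "norm (G t x - G t y) \<le> norm (NN (cut_arg t x) - NN (cut_arg t y))"
      unfolding G_def cm_diff[symmetric] Sg_diff[symmetric] lp_diff[symmetric] norm_cm by (simp add: norm_lp_le)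
    also have "\<dots> \<le> 3 * Lam * B\<^sup>2 * norm (cut_arg t x - cut_arg t y)" by (intro NN_Lip_B bH)
    also have "\<dots> \<le> 3 * Lam * B\<^sup>2 * (2 * norm (x - y))" using Lam_pos by (intro mult_left_mono bL) auto
    also have "\<dots> \<le> L * norm (x - y)" by (simp add: L_def algebra_simps)
    finally show ?thesis .
  qed
  have G0: "G t 0 = 0" for t
  proof -
    have "cut_arg t 0 = 0" by (simp add: cut_arg_def radial_retract_def linear_0[OF bounded_linear.linear[OF bounded_linear_Sg]] linear_0[OF bounded_linear.linear[OF bounded_linear_lp]])
    then show ?thesis by (simp add: G_def Nf_zero linear_0[OF bounded_linear.linear[OF bounded_linear_Sg]] linear_0[OF bounded_linear.linear[OF bounded_linear_lp]] cm_zero)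
  qed
  have Lc: "continuous_on T (\<lambda>t. f (g t))" if g: "continuous_on T g" and f: "\<And>s t. s \<in> T \<Longrightarrow> t \<in> T \<Longrightarrow> norm (f (g s) - f (g t)) \<le> c * norm (g s - g t)"
    for T :: "real set" and f :: "(real^'n) l2 \<Rightarrow> (real^'n) l2" and g c
    unfolding continuous_on_def
  proof
    fix t assume t: "t \<in> T"
    have "((\<lambda>s. c * norm (g s - g t)) \<longlongrightarrow> c * norm (g t - g t)) (at t within T)"
      using g t by (intro tendsto_intros) (auto simp: continuous_on_def)
    then have "((\<lambda>s. c * norm (g s - g t)) \<longlongrightarrow> 0) (at t within T)" by simp
    then have "((\<lambda>s. norm (f (g s) - f (g t))) \<longlongrightarrow> 0) (at t within T)"
    proof (rule tendsto_sandwich[OF _ _ tendsto_const, rotated 2])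
      show "\<forall>\<^sub>F s in at t within T. norm (f (g s) - f (g t)) \<le> c * norm (g s - g t)"
        using f t by (simp add: eventually_at_filter)
    qed simp
    then show "((\<lambda>s. f (g s)) \<longlongrightarrow> f (g t)) (at t within T)" by (rule tendsto_iff_norm_diff[THEN iffD2])
  qed
  have Gc: "continuous_on {0..} (\<lambda>t. G t (u t))" if u: "continuous_on {0..} u" for u
  proof -
    have "continuous_on {0..} (\<lambda>t. radial_retract r (u t))"
      by (rule Lc[OF u, of _ 2]) (rule radial_retract_Lip[OF r])
    then have "continuous_on {0..} (\<lambda>t. cut_arg t (u t))"
      unfolding cut_arg_def by (intro bounded_linear.continuous_on[OF bounded_linear_lp] Sg_continuous continuous_intros)
    then have "continuous_on {0..} (\<lambda>t. NN (cut_arg t (u t)))"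
      by (rule Lc[where f="\<lambda>v. NN v" and c="3 * Lam * B\<^sup>2"]) (intro NN_Lip_B bH)
    then show ?thesis
      unfolding G_def by (intro bounded_linear.continuous_on[OF bounded_linear_lp] bounded_linear.continuous_on[OF bounded_linear_cm] Sg_continuous continuous_intros)
  qed
  obtain a where a: "a 0 = a0" and ad: "\<And>t. 0 \<le> t \<Longrightarrow> (a has_vector_derivative G t (a t)) (at t within {0..})"
    using ode_global[OF Gc GL G0 L, of a0] by auto
  have lpG: "lp k (G t x) = G t x" for t x
    by (simp add: G_def lp_cm Sg_lp[symmetric] lp_idem)
  have lpa: "lp k (a t) = a t" if "0 \<le> t" for t
  proof -
    have "(\<lambda>t. a t - lp k (a t)) t = (\<lambda>t. a t - lp k (a t)) 0"
    proof (rule deriv_const[OF _ that])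
      fix t :: real assume "0 \<le> t"
      from has_vector_derivative_diff[OF ad[OF this] bounded_linear.has_vector_derivative[OF bounded_linear_lp ad[OF this]], of k]
      show "((\<lambda>t. a t - lp k (a t)) has_vector_derivative 0) (at t within {0..})" by (simp add: lpG)
    qed
    then show ?thesis using a a0 by simp
  qed
  \<comment> \<open>Skewness survives the retraction because the retracted argument is a positive
    multiple of the projected state. So mass is conserved for the modified field, before the
    retraction is known to be inactive.\<close>
  have iG: "inner (a t) (G t (a t)) = 0" for t
  proof -
    define c where "c = r / max r (norm (a t))"
    have c: "c > 0" using r unfolding c_def by (intro divide_pos_pos) (simp_all add: less_max_iff_disj)
    have b: "cut_arg t (a t) = c *\<^sub>R lp k (Sg t (a t))"
      unfolding cut_arg_def radial_retract_def c_def[symmetric] by (simp add: Sg_scaleR linear_scale[OF bounded_linear.linear[OF bounded_linear_lp]])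
    have "inner (G t (a t)) (a t) = inner (Sg (- t) (lp k (cm (- \<i>) (NN (cut_arg t (a t)))))) (a t)"
      by (simp add: G_def Sg_cm lp_cm)
    also have "\<dots> = inner (cm (- \<i>) (NN (cut_arg t (a t)))) (lp k (Sg t (a t)))"
      by (simp add: inner_Sg lp_selfadjoint)
    also have "c * \<dots> = inner (cm (- \<i>) (NN (cut_arg t (a t)))) (cut_arg t (a t))"
      unfolding b by simp
    also have "\<dots> = 0" by (rule inner_Nf_i[OF bH(1)])
    finally show ?thesis using c by (simp add: inner_commute)
  qed
  have na: "norm (a t) = norm a0" if "0 \<le> t" for t
  proof -
    have "(\<lambda>t. inner (a t) (a t)) t = (\<lambda>t. inner (a t) (a t)) 0"
    proof (rule deriv_const[OF _ that])
      fix t :: real assume t: "0 \<le> t"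
      have "((\<lambda>t. inner (a t) (a t)) has_vector_derivative (inner (a t) (G t (a t)) + inner (G t (a t)) (a t))) (at t within {0..})"
        using bounded_bilinear.has_vector_derivative[OF bounded_bilinear_inner ad[OF t] ad[OF t]] .
      then show "((\<lambda>t. inner (a t) (a t)) has_vector_derivative 0) (at t within {0..})"
        using iG[of t] by (simp add: inner_commute)
    qed
    then show ?thesis using a by (simp add: norm_eq_sqrt_inner)
  qed
  have "G t (a t) = cm (- \<i>) (Sg (- t) (lp k (NN (Sg t (a t)))))" if "0 \<le> t" for t
  proof -
    have "radial_retract r (a t) = a t" using na[OF that] a0 r by (intro radial_retract_id) auto
    then have "cut_arg t (a t) = Sg t (a t)" using lpa[OF that] by (simp add: cut_arg_def Sg_lp[symmetric])
    then show ?thesis by (simp add: G_def)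
  qed
  then show ?thesis using a ad lpa na by (intro exI[of _ a]) auto
qed

end

section \<open>Weighted bounds for the truncated solutions\<close>

lemma jc_add: "jc (s + t) \<xi> = jc s \<xi> * jc t \<xi>"
  by (simp only: jb_add of_real_mult)

text \<open>On the range of \<open>lp k\<close> this agrees with the Sobolev weight, but it is a
  bounded operator, so it may be applied to time derivatives.\<close>

definition trunc_weight :: "real \<Rightarrow> real \<Rightarrow> (real^'n) l2 \<Rightarrow> (real^'n) l2" where
  "trunc_weight s k A = mul (\<lambda>\<xi>. jc s \<xi> * indicator (cball 0 k) \<xi>) A"

lemma trunc_weight_bound:
  assumes "0 \<le> s" "0 \<le> k"
  shows "cmod (jc s \<xi> * indicator (cball 0 k) \<xi>) \<le> (1 + k\<^sup>2) powr (s / 2)"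
proof (cases "norm \<xi> \<le> k")
  case True
  then have "jb s \<xi> \<le> (1 + k\<^sup>2) powr (s / 2)"
    unfolding jb_def using assms by (intro powr_mono2 add_left_mono power_mono) (auto simp: one_plus_norm_sq less_imp_le)
  then show ?thesis using True by simp
qed simp

lemma trunc_weight_measurable [measurable]: "(\<lambda>\<xi>::real^'n. jc s \<xi> * indicator (cball 0 k) \<xi>) \<in> borel_measurable borel"
  by (intro borel_measurable_times ind_measurable) measurable

lemma bounded_linear_Jk: "0 \<le> s \<Longrightarrow> 0 \<le> k \<Longrightarrow> bounded_linear (trunc_weight s k)"
  unfolding trunc_weight_def[abs_def] by (rule bounded_linear_mul[OF trunc_weight_measurable trunc_weight_bound])

lemma trunc_weight_lp:
  assumes "0 \<le> s" "0 \<le> k" shows "mul (jc s) (lp k A) = trunc_weight s k A"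
proof (rule mul_eqI)
  have mk: "mok (\<lambda>\<xi>. jc s \<xi> * indicator (cball 0 k) \<xi>) A" by (rule mok_bounded[OF trunc_weight_measurable trunc_weight_bound[OF assms]])
  show "Hs s (lp k A)" using assms by (rule lp_bound)
  show "AE x in lborel. rep_l2 (trunc_weight s k A) x = jc s x * rep_l2 (lp k A) x"
    unfolding trunc_weight_def using rep_mul[OF mk] rep_lp[of k A] by eventually_elim simp
qed

lemma trunc_weight_eq: "0 \<le> s \<Longrightarrow> 0 \<le> k \<Longrightarrow> lp k A = A \<Longrightarrow> trunc_weight s k A = mul (jc s) A"
  using trunc_weight_lp[of s k A] by simp

text \<open>Chebyshev in frequency: beyond radius \<open>k\<close> the squared weight of order 1/2
  exceeds \<open>k\<close>. This is the source of the rate k^(-1/2).\<close>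

lemma tail_le:
  assumes k: "k > 0" and H: "Hs (1/2) X"
  shows "(norm (X - lp k X))\<^sup>2 \<le> (hn (1/2) X)\<^sup>2 / k"
proof -
  have "ennreal k * ennreal ((norm (X - lp k X))\<^sup>2) = (\<integral>\<^sup>+\<xi>. ennreal k * (indicator {\<xi>. k < norm \<xi>} \<xi> * ennreal ((cmod (rep_l2 X \<xi>))\<^sup>2)) \<partial>lborel)"
    unfolding freq_tail_eq freq_tail_def by (rule nn_integral_cmult[symmetric]) measurable
  also have "\<dots> \<le> sobolev_sq (1/2) X"
    unfolding sobolev_sq_def
  proof (rule nn_integral_mono)
    fix \<xi> :: "real^'a"
    have "k * (cmod (rep_l2 X \<xi>))\<^sup>2 \<le> jb (2 * (1/2)) \<xi> * (cmod (rep_l2 X \<xi>))\<^sup>2" if "k < norm \<xi>"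
      using that norm_le_jb[of \<xi>] by (intro mult_right_mono) auto
    then show "ennreal k * (indicator {\<xi>. k < norm \<xi>} \<xi> * ennreal ((cmod (rep_l2 X \<xi>))\<^sup>2)) \<le> ennreal (jb (2 * (1/2)) \<xi> * (cmod (rep_l2 X \<xi>))\<^sup>2)"
      using k by (auto simp: indicator_def ennreal_mult[symmetric] intro!: ennreal_leI)
  qed
  also have "\<dots> = ennreal ((hn (1/2) X)\<^sup>2)" by (rule sobolev_sq_hn[OF H])
  finally have "k * (norm (X - lp k X))\<^sup>2 \<le> (hn (1/2) X)\<^sup>2"
    using k by (subst (asm) ennreal_mult[symmetric]) (auto simp: ennreal_le_iff)
  then show ?thesis using k by (simp add: field_simps)
qed

text \<open>Lower semicontinuity by hand: for each fixed cutoff the weighted norm is continuous in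
  L^2, and Fatou then removes the cutoff.\<close>

lemma Hs_limit:
  assumes X: "X \<longlonglongrightarrow> L" and s: "0 \<le> s" and H: "\<And>n. Hs s (X n)" "\<And>n. hn s (X n) \<le> M"
  shows "Hs s L" "hn s L \<le> M"
proof -
  have M: "0 \<le> M" using H(2)[of 0] norm_ge_zero order_trans by blast
  have le: "hn s (lp (real R) L) \<le> M" for R
  proof -
    have "(\<lambda>n. norm (trunc_weight s (real R) (X n))) \<longlonglongrightarrow> norm (trunc_weight s (real R) L)"
      using s by (intro tendsto_norm bounded_linear.tendsto[OF bounded_linear_Jk] X) auto
    moreover have "norm (trunc_weight s (real R) (X n)) \<le> M" for n
      using s Hs_lp(2)[OF H(1), of "real R" n] H(2)[of n] by (simp add: trunc_weight_lp[symmetric])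
    ultimately have "norm (trunc_weight s (real R) L) \<le> M" by (intro LIMSEQ_le_const2) auto
    then show ?thesis using s by (simp add: trunc_weight_lp)
  qed
  have "sobolev_sq s L = (\<integral>\<^sup>+\<xi>. liminf (\<lambda>n. ennreal (jb (2 * s) \<xi> * (cmod (indicator (cball 0 (real n)) \<xi> * rep_l2 L \<xi>))\<^sup>2)) \<partial>lborel)"
    unfolding sobolev_sq_def
  proof (rule nn_integral_cong)
    fix \<xi> :: "real^'a"
    obtain N :: nat where N: "norm \<xi> \<le> real N" using real_arch_simple by blast
    have "\<forall>\<^sub>F n in sequentially. ennreal (jb (2 * s) \<xi> * (cmod (rep_l2 L \<xi>))\<^sup>2) = ennreal (jb (2 * s) \<xi> * (cmod (indicator (cball 0 (real n)) \<xi> * rep_l2 L \<xi>))\<^sup>2)"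
      using eventually_ge_at_top[of N] by eventually_elim (use N in \<open>auto simp: indicator_def\<close>)
    then have "(\<lambda>n. ennreal (jb (2 * s) \<xi> * (cmod (indicator (cball 0 (real n)) \<xi> * rep_l2 L \<xi>))\<^sup>2)) \<longlonglongrightarrow> ennreal (jb (2 * s) \<xi> * (cmod (rep_l2 L \<xi>))\<^sup>2)"
      by (rule Lim_transform_eventually[OF tendsto_const])
    from lim_imp_Liminf[OF sequentially_bot this]
    show "ennreal (jb (2 * s) \<xi> * (cmod (rep_l2 L \<xi>))\<^sup>2) = liminf (\<lambda>n. ennreal (jb (2 * s) \<xi> * (cmod (indicator (cball 0 (real n)) \<xi> * rep_l2 L \<xi>))\<^sup>2))" by simp
  qed
  also have "\<dots> \<le> liminf (\<lambda>n. \<integral>\<^sup>+\<xi>. ennreal (jb (2 * s) \<xi> * (cmod (indicator (cball 0 (real n)) \<xi> * rep_l2 L \<xi>))\<^sup>2) \<partial>lborel)"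
    by (rule nn_integral_liminf) measurable
  also have "\<dots> \<le> liminf (\<lambda>n. ennreal (M\<^sup>2))"
  proof (intro Liminf_mono always_eventually allI)
    fix n :: nat
    have "(\<integral>\<^sup>+\<xi>. ennreal (jb (2 * s) \<xi> * (cmod (indicator (cball 0 (real n)) \<xi> * rep_l2 L \<xi>))\<^sup>2) \<partial>lborel) = sobolev_sq s (lp (real n) L)"
      unfolding sobolev_sq_def
    proof (rule nn_integral_cong_AE)
      show "AE \<xi> in lborel. ennreal (jb (2 * s) \<xi> * (cmod (indicator (cball 0 (real n)) \<xi> * rep_l2 L \<xi>))\<^sup>2) = ennreal (jb (2 * s) \<xi> * (cmod (rep_l2 (lp (real n) L) \<xi>))\<^sup>2)"
        using rep_lp[of "real n" L] by eventually_elim simp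
    qed
    also have "\<dots> = ennreal ((hn s (lp (real n) L))\<^sup>2)" using s by (intro sobolev_sq_hn lp_bound) auto
    also have "\<dots> \<le> ennreal (M\<^sup>2)" by (intro ennreal_leI power_mono le) auto
    finally show "(\<integral>\<^sup>+\<xi>. ennreal (jb (2 * s) \<xi> * (cmod (indicator (cball 0 (real n)) \<xi> * rep_l2 L \<xi>))\<^sup>2) \<partial>lborel) \<le> ennreal (M\<^sup>2)" .
  qed
  also have "\<dots> = ennreal (M\<^sup>2)" by (simp add: Liminf_const)
  finally have "sobolev_sq s L \<le> ennreal (M\<^sup>2)" .
  then show "Hs s L" "hn s L \<le> M" using M by (auto intro: hn_leI)
qed

context hartree_potential
begin

definition galerkin_sol :: "real \<Rightarrow> (real^'n) l2 \<Rightarrow> (real \<Rightarrow> (real^'n) l2) \<Rightarrow> bool" where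
  "galerkin_sol k a0 a \<longleftrightarrow> a 0 = a0 \<and> (\<forall>t\<ge>0. lp k (a t) = a t \<and> norm (a t) = norm a0 \<and>
    (a has_vector_derivative cm (- \<i>) (Sg (- t) (lp k (NN (Sg t (a t)))))) (at t within {0..}))"

lemma NN_Hs:
  assumes s: "s \<ge> 1/2" and H: "Hs s u" "h2 u \<le> B"
  shows "Hs s (NN u)" "hn s (NN u) \<le> 3 * Nf_const s * B\<^sup>2 * hn s u"
proof -
  show "Hs s (NN u)" by (rule Nf_Hs(1)[OF s H(1) H(1) H(1)])
  have B: "0 \<le> B" using H(2) norm_ge_zero order_trans by blast
  have "hn s (NN u) \<le> Nf_const s * (hn s u * h2 u * h2 u + h2 u * hn s u * h2 u + h2 u * h2 u * hn s u)"
    by (rule Nf_Hs(2)[OF s H(1) H(1) H(1)])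
  also have "\<dots> = 3 * Nf_const s * (h2 u)\<^sup>2 * hn s u" by (simp add: power2_eq_square algebra_simps)
  also have "\<dots> \<le> 3 * Nf_const s * B\<^sup>2 * hn s u"
    using Nf_const_pos[of s] H(2) by (intro mult_right_mono mult_left_mono power_mono) auto
  finally show "hn s (NN u) \<le> 3 * Nf_const s * B\<^sup>2 * hn s u" .
qed

lemma Hs_cm: "Hs s A \<Longrightarrow> cmod c \<le> 1 \<Longrightarrow> Hs s (cm c A)" "Hs s A \<Longrightarrow> cmod c \<le> 1 \<Longrightarrow> hn s (cm c A) \<le> hn s A"
  for A :: "(real^'n) l2"
  by (auto intro: Hs_contr)

lemma rhs_Hs:
  assumes s: "s \<ge> 1/2" and H: "Hs s a" "h2 a \<le> B"
  shows "Hs s (cm (- \<i>) (Sg (- t) (lp k (NN (Sg t a)))))"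
    "hn s (cm (- \<i>) (Sg (- t) (lp k (NN (Sg t a))))) \<le> 3 * Nf_const s * B\<^sup>2 * hn s a"
proof -
  have u: "Hs s (Sg t a)" "hn s (Sg t a) = hn s a" using Hs_Sg H by auto
  have h: "h2 (Sg t a) \<le> B" using Hs_Sg(2)[OF Hs_mono[OF s H(1)]] H(2) by simp
  note N = NN_Hs[OF s u(1) h]
  have l: "Hs s (lp k (NN (Sg t a)))" "hn s (lp k (NN (Sg t a))) \<le> hn s (NN (Sg t a))" using Hs_lp N by auto
  have g: "Hs s (Sg (- t) (lp k (NN (Sg t a))))" "hn s (Sg (- t) (lp k (NN (Sg t a)))) = hn s (lp k (NN (Sg t a)))"
    using Hs_Sg l by auto
  show "Hs s (cm (- \<i>) (Sg (- t) (lp k (NN (Sg t a)))))" using g by (intro Hs_cm) auto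
  have "hn s (cm (- \<i>) (Sg (- t) (lp k (NN (Sg t a))))) \<le> hn s (Sg (- t) (lp k (NN (Sg t a))))"
    using g by (intro Hs_cm) auto
  then show "hn s (cm (- \<i>) (Sg (- t) (lp k (NN (Sg t a))))) \<le> 3 * Nf_const s * B\<^sup>2 * hn s a"
    using g(2) l(2) N(2)[unfolded u(2)] by linarith
qed

lemma galerkin_sol_rhs_lp: "lp k (cm (- \<i>) (Sg (- t) (lp k X))) = cm (- \<i>) (Sg (- t) (lp k X))"
  by (simp add: lp_cm Sg_lp[symmetric] lp_idem)

lemma galerkin_sol_Jk:
  assumes g: "galerkin_sol k a0 a" and k: "0 \<le> k" and s: "0 \<le> s" and t: "0 \<le> t"
  shows "((\<lambda>t. trunc_weight s k (a t)) has_vector_derivative mul (jc s) (cm (- \<i>) (Sg (- t) (lp k (NN (Sg t (a t))))))) (at t within {0..})"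
proof -
  have "(a has_vector_derivative cm (- \<i>) (Sg (- t) (lp k (NN (Sg t (a t)))))) (at t within {0..})"
    using g t unfolding galerkin_sol_def by blast
  from bounded_linear.has_vector_derivative[OF bounded_linear_Jk[OF s k] this]
  show ?thesis unfolding trunc_weight_eq[OF s k galerkin_sol_rhs_lp] .
qed

text \<open>The nonlinearity is bounded linearly in the H^s norm once \<open>h2\<close> is at most
  \<open>B\<close>, so Gronwall gives a rate that depends on neither \<open>k\<close> nor the H^s
  size of the data. The free group leaves no trace, being isometric in H^s.\<close>

lemma galerkin_sol_hn:
  assumes g: "galerkin_sol k a0 a" and k: "0 \<le> k" and s: "s \<ge> 1/2" and B: "B > 0" "\<And>t. 0 \<le> t \<Longrightarrow> h2 (a t) \<le> B" and t: "0 \<le> t"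
  shows "Hs s (a t)" "hn s (a t) \<le> hn s a0 * exp (3 * Nf_const s * B\<^sup>2 * t)"
proof -
  define c where "c = 3 * Nf_const s * B\<^sup>2"
  have c: "c > 0" using Nf_const_pos[of s] B by (simp add: c_def)
  have s0: "0 \<le> s" using s by simp
  have lpa: "lp k (a t) = a t" if "0 \<le> t" for t using g that by (simp add: galerkin_sol_def)
  have Ha: "Hs s (a t)" if "0 \<le> t" for t using lp_Hs[OF s0 k lpa[OF that]] .
  show "Hs s (a t)" by (rule Ha[OF t])
  define f where "f t = inner (trunc_weight s k (a t)) (trunc_weight s k (a t))" for t
  have fe: "f t = (hn s (a t))\<^sup>2" if "0 \<le> t" for t
    using trunc_weight_eq[OF s0 k lpa[OF that]] by (simp add: f_def power2_norm_eq_inner)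
  define f' where "f' t = 2 * inner (trunc_weight s k (a t)) (mul (jc s) (cm (- \<i>) (Sg (- t) (lp k (NN (Sg t (a t)))))))" for t
  have d: "(f has_vector_derivative f' t) (at t within {0..})" if t: "0 \<le> t" for t
  proof -
    note J = galerkin_sol_Jk[OF g k s0 t]
    show ?thesis unfolding f_def[abs_def] f'_def
      using bounded_bilinear.has_vector_derivative[OF bounded_bilinear_inner J J] by (simp add: inner_commute)
  qed
  have le: "f' t \<le> (2 * c) * f t + 0" if t: "0 \<le> t" for t
  proof -
    have "f' t \<le> 2 * (hn s (a t) * hn s (cm (- \<i>) (Sg (- t) (lp k (NN (Sg t (a t)))))))"
      unfolding f'_def trunc_weight_eq[OF s0 k lpa[OF t]] by (intro mult_left_mono norm_cauchy_schwarz) auto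
    also have "\<dots> \<le> 2 * (hn s (a t) * (c * hn s (a t)))"
      unfolding c_def using rhs_Hs(2)[OF s Ha[OF t] B(2)[OF t], of t k] by (intro mult_left_mono) auto
    finally show ?thesis using fe[OF t] by (simp add: power2_eq_square algebra_simps)
  qed
  have "f t + 0 / (2 * c) \<le> (f 0 + 0 / (2 * c)) * exp (2 * c * t)"
    using gronwall[of "2 * c" f f' t 0 t] c d le t by simp
  then have "(hn s (a t))\<^sup>2 \<le> (hn s (a 0))\<^sup>2 * exp (2 * c * t)" using fe[OF t] fe[of 0] by simp
  also have "\<dots> = (hn s a0 * exp (c * t))\<^sup>2" using g by (simp add: galerkin_sol_def power_mult_distrib exp_double[symmetric] mult.assoc)
  finally show "hn s (a t) \<le> hn s a0 * exp (3 * Nf_const s * B\<^sup>2 * t)"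
    unfolding c_def by (rule power2_le_imp_le) auto
qed

text \<open>The mean value inequality for the profile: its derivative stays in H^s with a bound free
  of \<open>k\<close>, whereas that of \<open>Sg t (a t)\<close> would lose a derivative.\<close>

lemma galerkin_sol_Lip:
  assumes g: "galerkin_sol k a0 a" and k: "0 \<le> k" and s: "s \<ge> 1/2" and B: "\<And>t. 0 \<le> t \<Longrightarrow> h2 (a t) \<le> B"
    and M: "\<And>t. 0 \<le> t \<Longrightarrow> t \<le> T \<Longrightarrow> hn s (a t) \<le> M" and t: "0 \<le> t" "t \<le> T" "0 \<le> t'" "t' \<le> T"
  shows "Hs s (a t - a t')" "hn s (a t - a t') \<le> 3 * Nf_const s * B\<^sup>2 * M * \<bar>t - t'\<bar>"
proof -
  have s0: "0 \<le> s" using s by simp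
  have lpa: "lp k (a t) = a t" if "0 \<le> t" for t using g that by (simp add: galerkin_sol_def)
  have Ha: "Hs s (a t)" if "0 \<le> t" for t using lp_Hs[OF s0 k lpa[OF that]] .
  show "Hs s (a t - a t')" by (intro Hs_diff Ha t)
  have "norm (trunc_weight s k (a t) - trunc_weight s k (a t')) \<le> (3 * Nf_const s * B\<^sup>2 * M) * norm (t - t')"
  proof (rule differentiable_bound[of "{0..T}"])
    fix r assume r: "r \<in> {0..T}"
    have "((\<lambda>t. trunc_weight s k (a t)) has_vector_derivative mul (jc s) (cm (- \<i>) (Sg (- r) (lp k (NN (Sg r (a r))))))) (at r within {0..T})"
      using galerkin_sol_Jk[OF g k s0, of r] r by (auto intro: has_vector_derivative_within_subset)
    then show "((\<lambda>t. trunc_weight s k (a t)) has_derivative (\<lambda>h. h *\<^sub>R mul (jc s) (cm (- \<i>) (Sg (- r) (lp k (NN (Sg r (a r)))))))) (at r within {0..T})"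
      by (simp add: has_vector_derivative_def)
    have r0: "0 \<le> r" using r by simp
    have "hn s (cm (- \<i>) (Sg (- r) (lp k (NN (Sg r (a r)))))) \<le> 3 * Nf_const s * B\<^sup>2 * hn s (a r)"
      by (rule rhs_Hs(2)[OF s Ha[OF r0] B[OF r0]])
    also have "\<dots> \<le> 3 * Nf_const s * B\<^sup>2 * M" using M[of r] r Nf_const_pos[of s] by (intro mult_left_mono) auto
    finally show "onorm (\<lambda>h. h *\<^sub>R mul (jc s) (cm (- \<i>) (Sg (- r) (lp k (NN (Sg r (a r))))))) \<le> 3 * Nf_const s * B\<^sup>2 * M"
      by (simp add: onorm_scaleR_left onorm_id)
  qed (use t in auto)
  moreover have "trunc_weight s k (a t) - trunc_weight s k (a t') = mul (jc s) (a t - a t')"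
    using t lpa by (simp add: trunc_weight_eq[OF s0 k] mul_diff Ha)
  ultimately show "hn s (a t - a t') \<le> 3 * Nf_const s * B\<^sup>2 * M * \<bar>t - t'\<bar>" by simp
qed

text \<open>The double integral of w(x-y) |psi(x)|^2 |psi(y)|^2; it enters the energy with the
  factor 1/4.\<close>

definition quartic :: "(real^'n) l2 \<Rightarrow> real" where "quartic u = inner (NN u) u"

text \<open>When the right side is expanded, the mixed terms cancel by the symmetry of each form and
  by \<open>Nf_exchange\<close>. The increment \<open>u - v\<close> is split off as a linear factor,
  which suits differentiation in L^2.\<close>

lemma quartic_diff:
  assumes "Hs (1/2) u" "Hs (1/2) v"
  shows "quartic u - quartic v = inner (u - v) (Nf u u (u + v) + Nf v v (u + v))"
proof -
  have "inner (u - v) (Nf u u (u + v) + Nf v v (u + v)) =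
    inner (Nf u u u) u - inner (Nf u u u) v + inner (Nf u u v) u - inner (Nf u u v) v
    + (inner (Nf v v u) u - inner (Nf v v u) v + inner (Nf v v v) u - inner (Nf v v v) v)"
    by (simp add: Nf_add3 assms inner_diff_left inner_add_right inner_commute)
  also have "inner (Nf u u v) u = inner (Nf u u u) v" by (rule inner_Nf_sym[OF assms(1)])
  also have "inner (Nf v v u) v = inner (Nf v v v) u" by (rule inner_Nf_sym[OF assms(2)])
  also have "inner (Nf u u v) v = inner (Nf v v u) u" by (rule Nf_exchange[OF assms])
  finally show ?thesis by (simp add: quartic_def)
qed

text \<open>\<open>u\<close> is differentiable only in L^2, although \<open>quartic\<close> lives on
  H^(1/2). After division of \<open>quartic_diff\<close> by the time step, the quotient converges in
  L^2, and so does the other factor by the one-slot estimates; of H^(1/2) only a bound is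
  used.\<close>

lemma quartic_deriv:
  assumes d: "(u has_vector_derivative u') (at t within S)" and t: "t \<in> S"
    and H: "\<And>r. r \<in> S \<Longrightarrow> Hs (1/2) (u r)" "\<And>r. r \<in> S \<Longrightarrow> h2 (u r) \<le> B"
  shows "((\<lambda>r. quartic (u r)) has_vector_derivative 4 * inner (NN (u t)) u') (at t within S)"
  unfolding has_vector_derivative_iff_quotient
proof -
  have B: "0 \<le> B" using H(2)[OF t] norm_ge_zero order_trans by blast
  define R where "R r = Nf (u r) (u r) (u r + u t) + Nf (u t) (u t) (u r + u t)" for r
  have uc: "(u \<longlongrightarrow> u t) (at t within S)"
    using has_vector_derivative_continuous[OF d] by (simp add: continuous_within)
  have Rb: "norm (R r - R t) \<le> 6 * Lam * B\<^sup>2 * norm (u r - u t)" if r: "r \<in> S" for r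
  proof -
    define w where "w = u r + u t"
    define v where "v = u t + u t"
    have Hw: "Hs (1/2) w" "h2 w \<le> 2 * B" "Hs (1/2) v"
      unfolding w_def v_def using H[OF r] H[OF t] hn_add[of "1/2" "u r" "u t"] by (auto intro: Hs_add)
    have wv: "w - v = u r - u t" by (simp add: w_def v_def)
    have Hd: "Hs (1/2) (u r - u t)" using H t r by (intro Hs_diff) auto
    have "R r - R t = (Nf (u r) (u r) w - Nf (u t) (u t) v) + (Nf (u t) (u t) w - Nf (u t) (u t) v)"
      by (simp add: R_def w_def v_def)
    also have "Nf (u r) (u r) w - Nf (u t) (u t) v = Nf (u r - u t) (u r) w + Nf (u t) (u r - u t) w + Nf (u t) (u t) (u r - u t)"
      using H t r Hw by (subst Nf_telescope) (auto simp: wv)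
    also have "Nf (u t) (u t) w - Nf (u t) (u t) v = Nf (u t) (u t) (u r - u t)"
      using H t by (simp add: Nf_diff3[symmetric] wv)
    finally have "norm (R r - R t) \<le> norm (Nf (u r - u t) (u r) w) + norm (Nf (u t) (u r - u t) w) + norm (Nf (u t) (u t) (u r - u t)) + norm (Nf (u t) (u t) (u r - u t))"
      by (simp only:) (intro order_trans[OF norm_triangle_ineq] add_mono norm_triangle_ineq order_refl)
    also have "\<dots> \<le> Lam * h2 (u r) * h2 w * norm (u r - u t) + Lam * h2 (u t) * h2 w * norm (u r - u t) + Lam * h2 (u t) * h2 (u t) * norm (u r - u t) + Lam * h2 (u t) * h2 (u t) * norm (u r - u t)"
      using H t r Hw Hd by (intro add_mono Nf_le) auto
    also have "\<dots> \<le> Lam * B * (2 * B) * norm (u r - u t) + Lam * B * (2 * B) * norm (u r - u t) + Lam * B * B * norm (u r - u t) + Lam * B * B * norm (u r - u t)"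
      using H t r Hw Lam_pos B by (intro add_mono mult_right_mono mult_mono) auto
    also have "\<dots> = 6 * Lam * B\<^sup>2 * norm (u r - u t)" by (simp add: power2_eq_square algebra_simps)
    finally show ?thesis .
  qed
  have "((\<lambda>r. 6 * Lam * B\<^sup>2 * norm (u r - u t)) \<longlongrightarrow> 6 * Lam * B\<^sup>2 * norm (u t - u t)) (at t within S)"
    by (intro tendsto_intros uc)
  then have "((\<lambda>r. 6 * Lam * B\<^sup>2 * norm (u r - u t)) \<longlongrightarrow> 0) (at t within S)" by simp
  then have "((\<lambda>r. norm (R r - R t)) \<longlongrightarrow> 0) (at t within S)"
  proof (rule tendsto_sandwich[OF _ _ tendsto_const, rotated 2])
    show "\<forall>\<^sub>F r in at t within S. norm (R r - R t) \<le> 6 * Lam * B\<^sup>2 * norm (u r - u t)"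
      using Rb by (simp add: eventually_at_filter)
  qed simp
  then have Rc: "(R \<longlongrightarrow> R t) (at t within S)" by (rule tendsto_iff_norm_diff[THEN iffD2])
  \<comment> \<open>At coinciding arguments four copies of \<open>NN\<close> appear, cancelling the
    1/4 in the energy.\<close>
  have Rt: "R t = 4 *\<^sub>R NN (u t)"
  proof -
    have "Nf (u t) (u t) (u t + u t) = 2 *\<^sub>R NN (u t)" using H t by (simp add: Nf_add3 scaleR_2)
    moreover have "2 *\<^sub>R NN (u t) + 2 *\<^sub>R NN (u t) = 4 *\<^sub>R NN (u t)" by (simp add: scaleR_add_left[symmetric])
    ultimately show ?thesis by (simp add: R_def)
  qed
  have li: "((\<lambda>r. inner ((u r - u t) /\<^sub>R (r - t)) (R r)) \<longlongrightarrow> inner u' (R t)) (at t within S)"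
    using d unfolding has_vector_derivative_iff_quotient by (intro tendsto_inner Rc)
  have ri: "inner u' (R t) = 4 * inner (NN (u t)) u'" unfolding Rt by (simp add: inner_commute)
  have "\<forall>\<^sub>F r in at t within S. inner ((u r - u t) /\<^sub>R (r - t)) (R r) = (quartic (u r) - quartic (u t)) /\<^sub>R (r - t)"
    unfolding eventually_at_filter R_def using quartic_diff H t by (intro always_eventually) auto
  with li show "((\<lambda>r. (quartic (u r) - quartic (u t)) /\<^sub>R (r - t)) \<longlongrightarrow> 4 * inner (NN (u t)) u') (at t within S)"
    unfolding ri by (rule Lim_transform_eventually)
qed

end

section \<open>Energy conservation and the uniform H^(1/2) bound\<close>

lemma jc_half: "jc (1/2) \<xi> * jc (1/2) \<xi> = jc 1 \<xi>"
  using jc_add[of "1/2" "1/2" \<xi>] by simp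

context hartree_potential
begin

text \<open>The kinetic term is differentiated along the profile, the potential term along
  \<open>Sg t (a t)\<close>. The former pairs \<open>D\<close> with -i times \<open>N\<close>, the
  latter \<open>N\<close> with -i times \<open>D\<close>, and these are opposite by skewness. The
  projection in the equation is harmless, being selfadjoint and fixing \<open>D\<close>.\<close>

lemma galerkin_sol_energy:
  assumes g: "galerkin_sol k a0 a" and k: "0 \<le> k" and t: "0 \<le> t"
  shows "(h2 (a t))\<^sup>2 / 2 + quartic (Sg t (a t)) / 4 = (h2 a0)\<^sup>2 / 2 + quartic a0 / 4"
proof -
  have lpa: "lp k (a t) = a t" if "0 \<le> t" for t using g that by (simp add: galerkin_sol_def)
  have Ha: "Hs s (a t)" if "0 \<le> t" "0 \<le> s" for s t using lp_Hs[OF that(2) k lpa[OF that(1)]] .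
  define u where "u t = Sg t (a t)" for t
  have Hu: "Hs s (u t)" "hn s (u t) = hn s (a t)" if "0 \<le> t" "0 \<le> s" for s t
    using Hs_Sg[OF Ha[OF that]] by (auto simp: u_def)
  define B where "B = (1 + k\<^sup>2) powr (1/2 / 2) * norm a0"
  have hB: "h2 (u t) \<le> B" if "0 \<le> t" for t
  proof -
    have "h2 (lp k (a t)) \<le> (1 + k\<^sup>2) powr (1/2 / 2) * norm (a t)" by (rule lp_bound) (use k in auto)
    moreover have "norm (a t) = norm a0" using g that by (simp add: galerkin_sol_def)
    ultimately show ?thesis using Hu(2)[OF that, of "1/2"] lpa[OF that] by (simp add: B_def)
  qed
  define f where "f t = inner (trunc_weight (1/2) k (a t)) (trunc_weight (1/2) k (a t)) / 2 + quartic (u t) / 4" for t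
  have fe: "f t = (h2 (a t))\<^sup>2 / 2 + quartic (u t) / 4" if "0 \<le> t" for t
    using trunc_weight_eq[of "1/2", OF _ k lpa[OF that]] by (simp add: f_def power2_norm_eq_inner)
  have "f t = f 0"
  proof (rule deriv_const[OF _ t])
    fix t :: real assume t: "0 \<le> t"
    define N where "N = NN (u t)"
    define a' where "a' = cm (- \<i>) (Sg (- t) (lp k N))"
    define D where "D = mul (jc 1) (u t)"
    have la': "lp k a' = a'" unfolding a'_def by (rule galerkin_sol_rhs_lp)
    have ad: "(a has_vector_derivative a') (at t within {0..})"
      using g t by (simp add: galerkin_sol_def a'_def N_def u_def)
    have Ja: "((\<lambda>t. trunc_weight (1/2) k (a t)) has_vector_derivative mul (jc (1/2)) a') (at t within {0..})"
      using galerkin_sol_Jk[OF g k _ t, of "1/2"] by (simp add: a'_def N_def u_def)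
    have ud: "(u has_vector_derivative Sg t a' + cm (- \<i>) D) (at t within {0..})"
      unfolding u_def[abs_def] D_def using Sg_deriv[OF ad Ha[OF t]] by simp
    have qd: "((\<lambda>t. quartic (u t)) has_vector_derivative 4 * inner N (Sg t a' + cm (- \<i>) D)) (at t within {0..})"
      unfolding N_def using quartic_deriv[OF ud, of B] t Hu hB by simp
    have fd: "(f has_vector_derivative (inner (trunc_weight (1/2) k (a t)) (mul (jc (1/2)) a') + inner (mul (jc (1/2)) a') (trunc_weight (1/2) k (a t))) / 2 + 4 * inner N (Sg t a' + cm (- \<i>) D) / 4) (at t within {0..})"
      unfolding f_def[abs_def]
      by (intro has_vector_derivative_add has_vector_derivative_divide bounded_bilinear.has_vector_derivative[OF bounded_bilinear_inner] Ja qd)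
    \<comment> \<open>Multipliers preserve frequency support; this lets the projection on
      \<open>N\<close> be dropped in \<open>p1\<close>.\<close>
    have lD: "lp k D = D"
    proof -
      have "D = trunc_weight 1 k (u t)" unfolding D_def
        by (rule trunc_weight_eq[symmetric]) (use k lpa[OF t] in \<open>auto simp: u_def Sg_lp[symmetric]\<close>)
      then have "D = mul (jc 1) (lp k (u t))" using trunc_weight_lp[of 1 k "u t"] k by simp
      moreover have "AE x in lborel. rep_l2 (lp k (mul (jc 1) (u t))) x = rep_l2 (mul (jc 1) (u t)) x"
      proof -
        have "lp k (u t) = u t" using lpa[OF t] by (simp add: u_def Sg_lp[symmetric])
        then show ?thesis
          using rep_lp[of k "mul (jc 1) (u t)"] rep_mul[OF Hu(1)[OF t, of 1]] rep_lp[of k "u t"]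
          by (auto elim!: eventually_elim2 simp: indicator_def)
      qed
      ultimately show ?thesis unfolding D_def by (intro l2_eqI) simp
    qed
    have anti: "inner X (cm (- \<i>) Y) = - inner Y (cm (- \<i>) X)" for X Y :: "(real^'n) l2"
    proof -
      have "cm (- \<i>) X = - cm \<i> X" by (rule mul_eqI) (use rep_uminus[of "cm \<i> X"] rep_mul[OF mok_const, of \<i> X] in \<open>auto\<close>)
      moreover have "inner X (cm (- \<i>) Y) = inner (cm \<i> X) Y" by (simp add: inner_cm)
      ultimately show ?thesis by (simp add: inner_commute)
    qed
    have p1: "inner (trunc_weight (1/2) k (a t)) (mul (jc (1/2)) a') = inner D (cm (- \<i>) N)"
    proof -
      have Ha': "Hs (1/2) a'" using lp_Hs[of "1/2" k a'] k la' by simp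
      have e: "mul (jc (1/2)) (mul (jc (1/2)) (a t)) = mul (jc 1) (a t)"
      proof -
        have j: "(\<lambda>\<xi>::real^'n. jc (1/2) \<xi> * jc (1/2) \<xi>) = jc 1"
          by (intro ext) (rule jc_half)
        show ?thesis using Ha[OF t, of 1] Ha[OF t, of "1/2"] by (subst mul_mul) (auto simp: j)
      qed
      have m2: "mok (jc (1/2)) (mul (jc (1/2)) (a t))"
      proof -
        have j: "(\<lambda>\<xi>::real^'n. jc (1/2) \<xi> * jc (1/2) \<xi>) = jc 1"
          by (intro ext) (rule jc_half)
        show ?thesis using Ha[OF t, of 1] Ha[OF t, of "1/2"] by (subst mok_mul_iff) (auto simp: j)
      qed
      have "inner (trunc_weight (1/2) k (a t)) (mul (jc (1/2)) a') = inner (mul (jc (1/2)) (a t)) (mul (jc (1/2)) a')"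
        using trunc_weight_eq[of "1/2", OF _ k lpa[OF t]] by simp
      also have "\<dots> = inner (mul (jc (1/2)) (mul (jc (1/2)) (a t))) a'"
        using inner_mul[of "jc (1/2)" "mul (jc (1/2)) (a t)" a'] m2 Ha' by simp
      also have "\<dots> = inner (mul (jc 1) (a t)) (Sg (- t) (cm (- \<i>) (lp k N)))"
        unfolding e a'_def by (simp add: Sg_cm)
      also have "\<dots> = inner (Sg t (mul (jc 1) (a t))) (cm (- \<i>) (lp k N))"
        using inner_Sg[of t "mul (jc 1) (a t)"] by simp
      also have "Sg t (mul (jc 1) (a t)) = D" unfolding D_def u_def
      proof (rule mul_eqI[symmetric])
        show "mok (jc 1) (Sg t (a t))" using Ha[OF t] by (intro Hs_Sg) auto
        show "AE x in lborel. rep_l2 (Sg t (mul (jc 1) (a t))) x = jc 1 x * rep_l2 (Sg t (a t)) x"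
          using rep_Sg[of t "a t"] rep_Sg[of t "mul (jc 1) (a t)"] rep_mul[OF Ha[OF t, of 1]] by auto
      qed
      also have "inner D (cm (- \<i>) (lp k N)) = inner D (cm (- \<i>) N)"
        unfolding lp_cm[symmetric] using lp_selfadjoint[of k D "cm (- \<i>) N"] lD by simp
      finally show ?thesis .
    qed
    \<comment> \<open>In the physical frame the nonlinear velocity is -i times the projected
      \<open>N\<close>, hence orthogonal to \<open>N\<close> in the real pairing.\<close>
    have p2: "inner N (Sg t a') = 0"
    proof -
      have "Sg t a' = lp k (cm (- \<i>) (lp k N))"
        by (simp add: a'_def Sg_cm lp_cm lp_idem)
      then have "inner N (Sg t a') = inner (lp k N) (cm (- \<i>) (lp k N))" by (simp add: lp_selfadjoint)
      then show ?thesis using anti[of "lp k N" "lp k N"] by simp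
    qed
    have "(inner (trunc_weight (1/2) k (a t)) (mul (jc (1/2)) a') + inner (mul (jc (1/2)) a') (trunc_weight (1/2) k (a t))) / 2 + 4 * inner N (Sg t a' + cm (- \<i>) D) / 4 = 0"
      using p1 p2 anti[of N D] by (simp add: inner_add_right inner_commute)
    then show "(f has_vector_derivative 0) (at t within {0..})" using fd by simp
  qed
  then show ?thesis using fe[OF t] fe[of 0] g by (simp add: galerkin_sol_def u_def)
qed

end

lemma tendsto_norm_le_0I:
  fixes f :: "nat \<Rightarrow> 'a::real_normed_vector"
  assumes "\<And>n. norm (f n - l) \<le> g n" "g \<longlonglongrightarrow> 0" shows "f \<longlonglongrightarrow> l"
proof (rule tendsto_iff_norm_diff[THEN iffD2])
  show "(\<lambda>n. norm (f n - l)) \<longlonglongrightarrow> 0"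
    by (rule tendsto_sandwich[OF _ _ tendsto_const assms(2)]) (auto intro: always_eventually assms(1))
qed

lemma inverse_sqrt_lim: "(\<lambda>n. c / sqrt (real (Suc n))) \<longlonglongrightarrow> 0"
proof -
  have "(\<lambda>n. c * sqrt (inverse (real (Suc n)))) \<longlonglongrightarrow> c * sqrt 0"
    by (intro tendsto_intros LIMSEQ_inverse_real_of_nat)
  then show ?thesis by (simp add: real_sqrt_inverse divide_inverse)
qed

text \<open>The two constants play different roles: \<open>kappa\<close> multiplies the H^(1/2) norm
  and will have to be small against the mass, while \<open>Minf\<close> multiplies only the
  conserved mass and may be large.\<close>

locale small_hartree_potential = hartree_potential +
  fixes kappa Minf :: real
  assumes kap_nonneg: "kappa \<ge> 0" and Mi_nonneg: "Minf \<ge> 0"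
    and neg_le: "\<And>A x. Hs (1/2) A \<Longrightarrow>
      (\<integral>\<^sup>+y. ennreal (max (- w (x - y)) 0 * (cmod (rep_l2 (Fi A) y))\<^sup>2) \<partial>lborel) \<le> ennreal (kappa * (hn (1/2) A)\<^sup>2 + Minf * (norm A)\<^sup>2)"
begin

text \<open>Discarding the positive part of \<open>w\<close> bounds the Hartree potential from below
  at every point; integration against the density, whose total is the mass, finishes. Integrability
  comes from the two-sided bound with \<open>Lam\<close>.\<close>

lemma quartic_lower:
  assumes A: "Hs (1/2) A"
  shows "quartic A \<ge> - (kappa * (h2 A)\<^sup>2 + Minf * (norm A)\<^sup>2) * (norm A)\<^sup>2"
proof -
  define m where "m = kappa * (h2 A)\<^sup>2 + Minf * (norm A)\<^sup>2"
  have m: "0 \<le> m" using kap_nonneg Mi_nonneg by (simp add: m_def)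
  have i1: "integrable lborel (\<lambda>y. w (x - y) * (cmod (r2 A y))\<^sup>2)" for x
  proof -
    have "integrable lborel (\<lambda>y. Re (complex_of_real (w (x - y)) * (r2 A y * cnj (r2 A y))))"
      by (intro integrable_Re integrable_pot A)
    moreover have "Re (complex_of_real (w (x - y)) * (r2 A y * cnj (r2 A y))) = w (x - y) * (cmod (r2 A y))\<^sup>2" for y
      by (simp add: complex_norm_square[symmetric])
    ultimately show ?thesis by (simp only:)
  qed
  have V: "hartree_pot A x \<ge> - m" for x
  proof -
    have i2: "integrable lborel (\<lambda>y. max (- w (x - y)) 0 * (cmod (r2 A y))\<^sup>2)"
      by (rule Bochner_Integration.integrable_bound[OF i1[of x]]) (auto simp: abs_mult intro!: mult_right_mono)
    have "ennreal (LINT y|lborel. max (- w (x - y)) 0 * (cmod (r2 A y))\<^sup>2) = (\<integral>\<^sup>+y. ennreal (max (- w (x - y)) 0 * (cmod (r2 A y))\<^sup>2) \<partial>lborel)"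
      by (rule nn_integral_eq_integral[OF i2, symmetric]) auto
    also have "\<dots> \<le> ennreal m" unfolding m_def by (rule neg_le[OF A])
    finally have "(LINT y|lborel. max (- w (x - y)) 0 * (cmod (r2 A y))\<^sup>2) \<le> m" using m by (simp add: ennreal_le_iff)
    moreover have "(LINT y|lborel. - (max (- w (x - y)) 0 * (cmod (r2 A y))\<^sup>2)) \<le> hartree_pot A x"
      unfolding hartree_pot_def
    proof (rule integral_mono)
      show "integrable lborel (\<lambda>y. - (max (- w (x - y)) 0 * (cmod (r2 A y))\<^sup>2))" using i2 by simp
      show "integrable lborel (\<lambda>y. w (x - y) * (cmod (r2 A y))\<^sup>2)" by (rule i1)
      fix y
      have "- max (- w (x - y)) 0 * (cmod (r2 A y))\<^sup>2 \<le> w (x - y) * (cmod (r2 A y))\<^sup>2"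
        by (intro mult_right_mono) auto
      then show "- (max (- w (x - y)) 0 * (cmod (r2 A y))\<^sup>2) \<le> w (x - y) * (cmod (r2 A y))\<^sup>2" by simp
    qed
    ultimately show ?thesis by simp
  qed
  have V2: "\<bar>hartree_pot A x\<bar> \<le> Lam * (h2 A)\<^sup>2" for x
  proof -
    have "ennreal \<bar>hartree_pot A x\<bar> \<le> (\<integral>\<^sup>+y. ennreal (norm (w (x - y) * (cmod (r2 A y))\<^sup>2)) \<partial>lborel)"
      using integral_norm_bound_ennreal'[of lborel "\<lambda>y. w (x - y) * (cmod (r2 A y))\<^sup>2"] by (simp add: hartree_pot_def)
    also have "\<dots> = pot (r2 A) x" by (simp add: pot_def abs_mult)
    also have "\<dots> \<le> ennreal (Lam * (h2 A)\<^sup>2)" by (rule pot_fin[OF A])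
    finally show ?thesis using Lam_pos by (simp add: ennreal_le_iff)
  qed
  have i3: "integrable lborel (\<lambda>x. r2 A x \<bullet> r2 A x)" by (intro integrable_inner_sq) auto
  have na: "(LINT x|lborel. r2 A x \<bullet> r2 A x) = (norm A)\<^sup>2"
    using inner_Fi[of A A] by (simp add: inner_l2_def[symmetric] power2_norm_eq_inner)
  have "- m * (norm A)\<^sup>2 = (LINT x|lborel. - m * (r2 A x \<bullet> r2 A x))" by (simp add: na)
  also have "\<dots> \<le> (LINT x|lborel. hartree_pot A x * (r2 A x \<bullet> r2 A x))"
  proof (rule integral_mono)
    show "integrable lborel (\<lambda>x. - m * (r2 A x \<bullet> r2 A x))" using i3 by simp
    show "integrable lborel (\<lambda>x. hartree_pot A x * (r2 A x \<bullet> r2 A x))"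
    proof (rule Bochner_Integration.integrable_bound)
      show "integrable lborel (\<lambda>x. (Lam * (h2 A)\<^sup>2) * (r2 A x \<bullet> r2 A x))" using i3 by simp
      show "AE x in lborel. norm (hartree_pot A x * (r2 A x \<bullet> r2 A x)) \<le> norm ((Lam * (h2 A)\<^sup>2) * (r2 A x \<bullet> r2 A x))"
        using V2 Lam_pos by (intro AE_I2) (simp add: abs_mult mult_right_mono)
    qed measurable
    fix x show "- m * (r2 A x \<bullet> r2 A x) \<le> hartree_pot A x * (r2 A x \<bullet> r2 A x)" using V[of x] by (intro mult_right_mono) auto
  qed
  also have "\<dots> = quartic A" unfolding quartic_def inner_Nf[OF A] ..
  finally show ?thesis by (simp add: m_def)
qed

lemma quartic_upper:
  assumes A: "Hs (1/2) A" shows "quartic A \<le> Lam * (h2 A)\<^sup>2 * (norm A)\<^sup>2"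
proof -
  have "quartic A \<le> norm (NN A) * norm A" unfolding quartic_def by (rule norm_cauchy_schwarz)
  also have "\<dots> \<le> (Lam * h2 A * h2 A * norm A) * norm A" by (intro mult_right_mono Nf_le A) auto
  finally show ?thesis by (simp add: power2_eq_square algebra_simps)
qed

text \<open>With h the squared H^(1/2) norm and \<open>kappa\<close> times the mass at most 1, the
  interaction can absorb only h/4 of the kinetic h/2. The remaining quarter, multiplied by 4, gives
  the bound; \<open>k\<close> enters it only through \<open>a0\<close>.\<close>

lemma galerkin_sol_h2:
  assumes g: "galerkin_sol k a0 a" and k: "0 \<le> k" and t: "0 \<le> t" and small: "kappa * (norm a0)\<^sup>2 \<le> 1"
  shows "(h2 (a t))\<^sup>2 \<le> 2 * (h2 a0)\<^sup>2 + Lam * (h2 a0)\<^sup>2 * (norm a0)\<^sup>2 + Minf * (norm a0) ^ 4"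
proof -
  have lpa: "lp k (a t) = a t" if "0 \<le> t" for t using g that by (simp add: galerkin_sol_def)
  have Ha: "Hs (1/2) (a t)" if "0 \<le> t" for t using lp_Hs[OF _ k lpa[OF that]] by simp
  have H0: "Hs (1/2) a0" using Ha[of 0] g by (simp add: galerkin_sol_def)
  define h where "h = (h2 (a t))\<^sup>2"
  define m where "m = (norm a0)\<^sup>2"
  have nm: "norm (Sg t (a t)) = norm a0" using g t by (simp add: galerkin_sol_def)
  have "- (kappa * h + Minf * m) * m \<le> quartic (Sg t (a t))"
    using quartic_lower[OF Hs_Sg(1)[OF Ha[OF t]], of t] unfolding nm Hs_Sg(2)[OF Ha[OF t]] h_def m_def .
  moreover have "- (kappa * h + Minf * m) * m = - (kappa * m * h) - Minf * m\<^sup>2" by (simp add: power2_eq_square algebra_simps)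
  ultimately have e1: "- (kappa * m * h) - Minf * m\<^sup>2 \<le> quartic (Sg t (a t))" by (simp only:)
  have e2: "h / 2 + quartic (Sg t (a t)) / 4 = (h2 a0)\<^sup>2 / 2 + quartic a0 / 4"
    unfolding h_def by (rule galerkin_sol_energy[OF g k t])
  have e3: "quartic a0 \<le> Lam * (h2 a0)\<^sup>2 * m" unfolding m_def by (rule quartic_upper[OF H0])
  have e4: "kappa * m * h \<le> 1 * h" using small by (intro mult_right_mono) (auto simp: m_def h_def)
  have e5: "m\<^sup>2 = norm a0 ^ 4" by (simp add: m_def)
  have "h \<le> 2 * (h2 a0)\<^sup>2 + Lam * (h2 a0)\<^sup>2 * m + Minf * norm a0 ^ 4"
    using e1 e2 e3 e4 unfolding e5 by linarith
  then show ?thesis by (simp add: h_def m_def)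
qed

end

section \<open>Convergence of the truncated solutions in L^2\<close>

context hartree_potential
begin

text \<open>Twice the Lipschitz constant \<open>3 * Lam * B\<^sup>2\<close>, as the squared distance
  is differentiated, plus 1 from Young's inequality for the tail term.\<close>

definition gap_rate :: "real \<Rightarrow> real" where "gap_rate B = 6 * Lam * B\<^sup>2 + 1"
text \<open>The H^(1/2) bound that \<open>NN_Hs\<close> gives for \<open>NN u\<close> when
  \<open>h2 u\<close> is at most \<open>B\<close>.\<close>

definition tail_const :: "real \<Rightarrow> real" where "tail_const B = 3 * Nf_const (1/2) * B\<^sup>2 * B"

lemma tail_const_nonneg: "0 \<le> B \<Longrightarrow> 0 \<le> tail_const B"
  using Nf_const_pos[of "1/2"] by (simp add: tail_const_def)

lemma lp_lp: "k \<le> l \<Longrightarrow> lp l (lp k X) = lp k X"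
proof (rule l2_eqI)
  assume kl: "k \<le> l"
  show "AE x in lborel. rep_l2 (lp l (lp k X)) x = rep_l2 (lp k X) x"
    using rep_lp[of l "lp k X"] rep_lp[of k X] by eventually_elim (use kl in \<open>auto simp: indicator_def\<close>)
qed

text \<open>\<open>NN u\<close> inherits the H^(1/2) regularity of \<open>u\<close>, so
  \<open>tail_le\<close> applies to the nonlinearity too.\<close>

lemma NN_tail:
  assumes k: "k > 0" and H: "Hs (1/2) u" "h2 u \<le> B"
  shows "norm (NN u - lp k (NN u)) \<le> tail_const B / sqrt k"
proof -
  have B: "0 \<le> B" using H(2) norm_ge_zero order_trans by blast
  note N = NN_Hs[OF order_refl H]
  have "3 * Nf_const (1/2) * B\<^sup>2 * h2 u \<le> tail_const B" unfolding tail_const_def using Nf_const_pos[of "1/2"] H by (intro mult_left_mono) auto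
  then have h: "h2 (NN u) \<le> tail_const B" using N(2) by linarith
  have "(norm (NN u - lp k (NN u)))\<^sup>2 \<le> (h2 (NN u))\<^sup>2 / k" by (rule tail_le[OF k N(1)])
  also have "\<dots> \<le> (tail_const B)\<^sup>2 / k" using h k by (intro divide_right_mono power_mono) auto
  also have "\<dots> = (tail_const B / sqrt k)\<^sup>2" using k by (simp add: power_divide)
  finally show ?thesis by (rule power2_le_imp_le) (use tail_const_nonneg[OF B] k in simp)
qed

lemma NN_diff_lp:
  assumes k: "k > 0" "k \<le> l" and H: "Hs (1/2) u" "h2 u \<le> B" "Hs (1/2) v" "h2 v \<le> B"
  shows "norm (lp k (NN u) - lp l (NN v)) \<le> 3 * Lam * B\<^sup>2 * norm (u - v) + tail_const B / sqrt k"
proof -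
  \<comment> \<open>As \<open>k\<close> is at most \<open>l\<close>, the larger projection fixes the
    range of the smaller one, so the single contraction \<open>lp l\<close> can be pulled
    out.\<close>
  have "lp k (NN u) - lp l (NN v) = lp l ((NN u - NN v) - (NN u - lp k (NN u)))"
    by (simp add: lp_diff lp_lp[OF k(2)])
  then have "norm (lp k (NN u) - lp l (NN v)) \<le> norm ((NN u - NN v) - (NN u - lp k (NN u)))"
    using norm_lp_le by metis
  also have "\<dots> \<le> norm (NN u - NN v) + norm (NN u - lp k (NN u))" by (rule norm_triangle_ineq4)
  also have "\<dots> \<le> 3 * Lam * B\<^sup>2 * norm (u - v) + tail_const B / sqrt k"
    by (intro add_mono NN_Lip_B NN_tail k H)
  finally show ?thesis .
qed

text \<open>Profiles may be compared instead of solutions because the free group is isometric. Both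
  sources of error, the tails of the data and of the nonlinearity, have size k^(-1/2), and Gronwall
  keeps that rate on bounded times.\<close>

lemma galerkin_sol_Cauchy:
  assumes a: "galerkin_sol k (lp k u0) a" and b: "galerkin_sol l (lp l u0) b" and k: "k > 0" "k \<le> l" and u0: "Hs (1/2) u0"
    and B: "0 \<le> B" "h2 u0 \<le> B" "\<And>t. 0 \<le> t \<Longrightarrow> h2 (a t) \<le> B" "\<And>t. 0 \<le> t \<Longrightarrow> h2 (b t) \<le> B" and t: "0 \<le> t"
  shows "norm (a t - b t) \<le> sqrt ((B\<^sup>2 + (tail_const B)\<^sup>2) * exp (gap_rate B * t)) / sqrt k"
proof -
  have l: "l > 0" using k by simp
  have Ha: "Hs (1/2) (a t)" if "0 \<le> t" for t using lp_Hs[of "1/2" k "a t"] a that k by (simp add: galerkin_sol_def)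
  have Hb: "Hs (1/2) (b t)" if "0 \<le> t" for t using lp_Hs[of "1/2" l "b t"] b that l by (simp add: galerkin_sol_def)
  define a' where "a' t = cm (- \<i>) (Sg (- t) (lp k (NN (Sg t (a t)))))" for t
  define b' where "b' t = cm (- \<i>) (Sg (- t) (lp l (NN (Sg t (b t)))))" for t
  have ad: "(a has_vector_derivative a' t) (at t within {0..})" if "0 \<le> t" for t using a that by (simp add: galerkin_sol_def a'_def)
  have bd: "(b has_vector_derivative b' t) (at t within {0..})" if "0 \<le> t" for t using b that by (simp add: galerkin_sol_def b'_def)
  define f where "f t = inner (a t - b t) (a t - b t)" for t
  define f' where "f' t = 2 * inner (a t - b t) (a' t - b' t)" for t
  have fd: "(f has_vector_derivative f' t) (at t within {0..})" if t: "0 \<le> t" for t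
  proof -
    note d = has_vector_derivative_diff[OF ad[OF t] bd[OF t]]
    show ?thesis unfolding f_def[abs_def] f'_def
      using bounded_bilinear.has_vector_derivative[OF bounded_bilinear_inner d d] by (simp add: inner_commute)
  qed
  define D where "D = (tail_const B)\<^sup>2 / k"
  have le: "f' t \<le> gap_rate B * f t + D" if t: "0 \<le> t" for t
  proof -
    define z where "z = norm (a t - b t)"
    have "norm (a' t - b' t) = norm (lp k (NN (Sg t (a t))) - lp l (NN (Sg t (b t))))"
      unfolding a'_def b'_def cm_diff[symmetric] Sg_diff[symmetric] norm_cm by simp
    also have "\<dots> \<le> 3 * Lam * B\<^sup>2 * norm (Sg t (a t) - Sg t (b t)) + tail_const B / sqrt k"
      using Hs_Sg[OF Ha[OF t]] Hs_Sg[OF Hb[OF t]] B(3)[OF t] B(4)[OF t] by (intro NN_diff_lp k) auto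
    also have "norm (Sg t (a t) - Sg t (b t)) = z" unfolding Sg_diff[symmetric] z_def by simp
    finally have n: "norm (a' t - b' t) \<le> 3 * Lam * B\<^sup>2 * z + tail_const B / sqrt k" .
    have "f' t \<le> 2 * (z * norm (a' t - b' t))" unfolding f'_def z_def by (intro mult_left_mono norm_cauchy_schwarz) auto
    also have "\<dots> \<le> 2 * (z * (3 * Lam * B\<^sup>2 * z + tail_const B / sqrt k))" by (intro mult_left_mono n) (auto simp: z_def)
    also have "\<dots> = 6 * Lam * B\<^sup>2 * z\<^sup>2 + 2 * z * (tail_const B / sqrt k)" by (simp add: power2_eq_square algebra_simps)
    also have "2 * z * (tail_const B / sqrt k) \<le> z\<^sup>2 + (tail_const B / sqrt k)\<^sup>2" by (rule sum_squares_bound)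
    also have "(tail_const B / sqrt k)\<^sup>2 = D" using k by (simp add: D_def power_divide)
    finally have "f' t \<le> 6 * Lam * B\<^sup>2 * z\<^sup>2 + (z\<^sup>2 + D)" by simp
    moreover have "f t = z\<^sup>2" by (simp add: f_def z_def power2_norm_eq_inner)
    ultimately show ?thesis by (simp add: gap_rate_def algebra_simps)
  qed
  have c: "gap_rate B \<ge> 1" using Lam_pos by (simp add: gap_rate_def)
  have g: "f t + D / gap_rate B \<le> (f 0 + D / gap_rate B) * exp (gap_rate B * t)"
    by (rule gronwall[of "gap_rate B" f f' t D t]) (use c fd le t in auto)
  have f0: "f 0 \<le> B\<^sup>2 / k"
  proof -
    have "a 0 - b 0 = lp l (lp k u0 - u0)" using a b by (simp add: galerkin_sol_def lp_diff lp_lp[OF k(2)])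
    then have "norm (a 0 - b 0) \<le> norm (lp k u0 - u0)" using norm_lp_le by metis
    then have "f 0 \<le> (norm (lp k u0 - u0))\<^sup>2" by (simp add: f_def power2_norm_eq_inner[symmetric] power_mono)
    also have "\<dots> \<le> (h2 u0)\<^sup>2 / k" using tail_le[OF k(1) u0] by (simp add: norm_minus_commute)
    also have "\<dots> \<le> B\<^sup>2 / k" using B k by (intro divide_right_mono power_mono) auto
    finally show ?thesis .
  qed
  have D0: "0 \<le> D" using k by (simp add: D_def)
  have "D / gap_rate B \<le> D / 1" using D0 c by (intro divide_left_mono) auto
  then have "D / gap_rate B \<le> D" by simp
  then have "(f 0 + D / gap_rate B) * exp (gap_rate B * t) \<le> (B\<^sup>2 / k + D) * exp (gap_rate B * t)" using f0 by (intro mult_right_mono add_mono) auto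
  moreover have "0 \<le> D / gap_rate B" using D0 c by simp
  ultimately have "f t \<le> (B\<^sup>2 / k + D) * exp (gap_rate B * t)" using g by linarith
  also have "\<dots> = ((B\<^sup>2 + (tail_const B)\<^sup>2) * exp (gap_rate B * t)) / k" by (simp add: D_def add_divide_distrib algebra_simps)
  finally have "(norm (a t - b t))\<^sup>2 \<le> ((B\<^sup>2 + (tail_const B)\<^sup>2) * exp (gap_rate B * t)) / k" by (simp add: f_def power2_norm_eq_inner)
  then have "sqrt ((norm (a t - b t))\<^sup>2) \<le> sqrt (((B\<^sup>2 + (tail_const B)\<^sup>2) * exp (gap_rate B * t)) / k)" by (rule real_sqrt_le_mono)
  then show ?thesis by (simp add: real_sqrt_divide)
qed

end

section \<open>The limit of the truncated solutions\<close>

lemma locally_lipschitz_continuous: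
  fixes f :: "real \<Rightarrow> 'a::real_normed_vector"
  assumes "\<And>T. 0 \<le> T \<Longrightarrow> \<exists>L. \<forall>t\<in>{0..T}. \<forall>t'\<in>{0..T}. norm (f t - f t') \<le> L * \<bar>t - t'\<bar>"
  shows "continuous_on {0..} f"
  unfolding continuous_on_def
proof
  fix t :: real assume "t \<in> {0..}"
  then have t: "0 \<le> t" by simp
  then have t1: "0 \<le> t + 1" by simp
  obtain L where L: "\<forall>r\<in>{0..t+1}. \<forall>r'\<in>{0..t+1}. norm (f r - f r') \<le> L * \<bar>r - r'\<bar>"
    using assms[OF t1] by (elim exE)
  have "((\<lambda>r. L * \<bar>r - t\<bar>) \<longlongrightarrow> L * \<bar>t - t\<bar>) (at t within {0..t+1})" by (intro tendsto_intros)
  then have "((\<lambda>r. L * \<bar>r - t\<bar>) \<longlongrightarrow> 0) (at t within {0..t+1})" by simp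
  then have "((\<lambda>r. norm (f r - f t)) \<longlongrightarrow> 0) (at t within {0..t+1})"
  proof (rule tendsto_sandwich[OF _ _ tendsto_const, rotated 2])
    show "\<forall>\<^sub>F r in at t within {0..t+1}. norm (f r - f t) \<le> L * \<bar>r - t\<bar>"
      using L t by (simp add: eventually_at_filter)
  qed simp
  then have "(f \<longlongrightarrow> f t) (at t within {0..t+1})" by (rule tendsto_iff_norm_diff[THEN iffD2])
  then show "(f \<longlongrightarrow> f t) (at t within {0..})" using at_within_halfline[of t "t + 1"] t by simp
qed

lemma jc_measurable: "jc s \<in> borel_measurable borel"
  by measurable

lemma mul_jc_Sg:
  assumes "Hs s X" shows "mul (jc s) (Sg t X) = Sg t (mul (jc s) X)"
proof (rule mul_eqI)
  show "Hs s (Sg t X)" using assms by (rule Hs_Sg)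
  show "AE x in lborel. rep_l2 (Sg t (mul (jc s) X)) x = jc s x * rep_l2 (Sg t X) x"
    using rep_Sg[of t X] rep_Sg[of t "mul (jc s) X"] rep_mul[OF assms] by eventually_elim simp
qed

lemma mul_jc_cm:
  assumes "Hs s X" shows "mul (jc s) (cm c X) = cm c (mul (jc s) X)"
proof (rule mul_eqI)
  show "Hs s (cm c X)"
  proof (rule mok_mul_iff[THEN iffD2])
    show "mok (\<lambda>x. jc s x * c) X" by (rule mok_dom[OF assms, of _ "cmod c"]) (auto simp: norm_mult mult.commute)
  qed auto
  show "AE x in lborel. rep_l2 (cm c (mul (jc s) X)) x = jc s x * rep_l2 (cm c X) x"
    using rep_mul[OF mok_const, of c X] rep_mul[OF mok_const, of c "mul (jc s) X"] rep_mul[OF assms] by eventually_elim simp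
qed

lemma Hs_neg: "s \<le> 0 \<Longrightarrow> Hs s X"
  by (rule Hs_mono[of s 0]) auto

lemma bounded_linear_jc_neg: "s \<le> 0 \<Longrightarrow> bounded_linear (mul (jc s))"
proof (rule bounded_linear_mul[of _ 1])
  fix x assume "s \<le> 0"
  then show "cmod (jc s x) \<le> 1" using jb_mono[of s 0 x] by simp
qed measurable

lemma mul_jc_jc:
  assumes "Hs t X" "Hs (s + t) X" shows "mul (jc s) (mul (jc t) X) = mul (jc (s + t)) X" "Hs s (mul (jc t) X)"
proof -
  have j: "(\<lambda>x. jc s x * jc t x) = jc (s + t)" by (intro ext) (rule jc_add[symmetric])
  have mm: "jc s \<in> borel_measurable borel" "jc t \<in> borel_measurable borel" for s t :: real by auto
  show "mul (jc s) (mul (jc t) X) = mul (jc (s + t)) X"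
    using mul_mul[of "jc t" X "jc s"] assms unfolding j by simp
  show "Hs s (mul (jc t) X)"
    using mok_mul_iff[of "jc t" X "jc s"] assms unfolding j by simp
qed

context hartree_potential
begin

text \<open>The 9 is three telescoping terms times three summands of \<open>Nf_Hs\<close>. Unlike
  the L^2 estimate, this one serves the continuity in time of the nonlinearity in H^s.\<close>

lemma NN_Hs_Lip:
  assumes s: "s \<ge> 1/2" and H: "Hs s u" "Hs s v" "hn s u \<le> M" "hn s v \<le> M"
  shows "hn s (NN u - NN v) \<le> 9 * Nf_const s * M\<^sup>2 * hn s (u - v)"
proof -
  have M: "0 \<le> M" using H(3) norm_ge_zero order_trans by blast
  have H2: "Hs (1/2) u" "Hs (1/2) v" using H s Hs_mono by blast+
  have d: "Hs s (u - v)" using H by (intro Hs_diff) auto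
  have b: "h2 u \<le> M" "h2 v \<le> M" "h2 (u - v) \<le> hn s (u - v)"
    using hn_mono[OF s H(1)] hn_mono[OF s H(2)] hn_mono[OF s d] H by auto
  define z where "z = hn s (u - v)"
  have z: "0 \<le> z" by (simp add: z_def)
  have K: "0 \<le> Nf_const s" using Nf_const_pos[of s] by simp
  have 1: "hn s (Nf (u - v) u u) \<le> Nf_const s * (z * M * M + z * M * M + z * M * M)"
    by (rule order_trans[OF Nf_Hs(2)[OF s d H(1) H(1)]], intro mult_left_mono add_mono mult_mono K)
      (use b H M z in \<open>auto simp: z_def\<close>)
  have 2: "hn s (Nf v (u - v) u) \<le> Nf_const s * (M * z * M + M * z * M + M * z * M)"
    by (rule order_trans[OF Nf_Hs(2)[OF s H(2) d H(1)]], intro mult_left_mono add_mono mult_mono K)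
      (use b H M z in \<open>auto simp: z_def\<close>)
  have 3: "hn s (Nf v v (u - v)) \<le> Nf_const s * (M * M * z + M * M * z + M * M * z)"
    by (rule order_trans[OF Nf_Hs(2)[OF s H(2) H(2) d]], intro mult_left_mono add_mono mult_mono K)
      (use b H M z in \<open>auto simp: z_def\<close>)
  have HN: "Hs s (Nf (u - v) u u)" "Hs s (Nf v (u - v) u)" "Hs s (Nf v v (u - v))"
    using Nf_Hs(1)[OF s] d H by auto
  have "hn s (NN u - NN v) \<le> hn s (Nf (u - v) u u + Nf v (u - v) u) + hn s (Nf v v (u - v))"
    unfolding Nf_telescope[OF H2(1,1,1) H2(2,2,2)] by (intro hn_add Hs_add HN)
  also have "\<dots> \<le> hn s (Nf (u - v) u u) + hn s (Nf v (u - v) u) + hn s (Nf v v (u - v))"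
    by (intro add_right_mono hn_add HN)
  also have "\<dots> \<le> Nf_const s * (z * M * M + z * M * M + z * M * M) + Nf_const s * (M * z * M + M * z * M + M * z * M) + Nf_const s * (M * M * z + M * M * z + M * M * z)"
    by (intro add_mono 1 2 3)
  also have "\<dots> = 9 * Nf_const s * M\<^sup>2 * hn s (u - v)" by (simp add: z_def power2_eq_square algebra_simps)
  finally show ?thesis .
qed

lemma NN_Hs_continuous:
  fixes u :: "real \<Rightarrow> (real^'n) l2"
  assumes s: "s \<ge> 1/2" and H: "\<And>t. 0 \<le> t \<Longrightarrow> Hs s (u t)" and c: "continuous_on {0..} (\<lambda>t. mul (jc s) (u t))"
  shows "continuous_on {0..} (\<lambda>t. mul (jc s) (NN (u t)))"
  unfolding continuous_on_def
proof
  fix t :: real assume "t \<in> {0..}"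
  then have t: "0 \<le> t" by simp
  have l: "((\<lambda>r. mul (jc s) (u r)) \<longlongrightarrow> mul (jc s) (u t)) (at t within {0..})"
    using c t by (simp add: continuous_on_def)
  \<comment> \<open>The added 1 leaves room for nearby times, making \<open>M\<close> a local
    bound.\<close>
  define M where "M = hn s (u t) + 1"
  have "\<forall>\<^sub>F r in at t within {0..}. dist (mul (jc s) (u r)) (mul (jc s) (u t)) < 1"
    using tendstoD[OF l] by simp
  then have ev: "\<forall>\<^sub>F r in at t within {0..}. 0 \<le> r \<and> hn s (u r) \<le> M"
    unfolding eventually_at_filter
  proof eventually_elim
    case (elim r)
    show ?case
    proof (intro impI)
      assume r: "r \<noteq> t" "r \<in> {0..}"
      then have "norm (mul (jc s) (u r) - mul (jc s) (u t)) < 1" using elim by (simp add: dist_norm)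
      then have "hn s (u r) \<le> hn s (u t) + 1"
        using norm_triangle_ineq2[of "mul (jc s) (u r)" "mul (jc s) (u t)"] by linarith
      then show "0 \<le> r \<and> hn s (u r) \<le> M" using r by (simp add: M_def)
    qed
  qed
  have "((\<lambda>r. 9 * Nf_const s * M\<^sup>2 * norm (mul (jc s) (u r) - mul (jc s) (u t))) \<longlongrightarrow> 9 * Nf_const s * M\<^sup>2 * norm (mul (jc s) (u t) - mul (jc s) (u t))) (at t within {0..})"
    by (intro tendsto_intros l)
  then have "((\<lambda>r. 9 * Nf_const s * M\<^sup>2 * norm (mul (jc s) (u r) - mul (jc s) (u t))) \<longlongrightarrow> 0) (at t within {0..})" by simp
  then have "((\<lambda>r. norm (mul (jc s) (NN (u r)) - mul (jc s) (NN (u t)))) \<longlongrightarrow> 0) (at t within {0..})"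
  proof (rule tendsto_sandwich[OF _ _ tendsto_const, rotated 2])
    show "\<forall>\<^sub>F r in at t within {0..}. norm (mul (jc s) (NN (u r)) - mul (jc s) (NN (u t))) \<le> 9 * Nf_const s * M\<^sup>2 * norm (mul (jc s) (u r) - mul (jc s) (u t))"
      using ev
    proof eventually_elim
      case (elim r)
      have Hr: "Hs s (u r)" "Hs s (u t)" using H elim t by auto
      have N: "Hs s (NN (u r))" "Hs s (NN (u t))" using Nf_Hs(1)[OF s] Hr by auto
      have "hn s (NN (u r) - NN (u t)) \<le> 9 * Nf_const s * M\<^sup>2 * hn s (u r - u t)"
        using elim by (intro NN_Hs_Lip s Hr) (auto simp: M_def)
      then show ?case
        by (simp only: mul_diff[OF jc_measurable N] mul_diff[OF jc_measurable Hr])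
    qed
  qed simp
  then show "((\<lambda>r. mul (jc s) (NN (u r))) \<longlongrightarrow> mul (jc s) (NN (u t))) (at t within {0..})"
    by (rule tendsto_iff_norm_diff[THEN iffD2])
qed

end

context small_hartree_potential
begin

text \<open>The limit is taken in L^2 at each time. Boundedness and Lipschitz continuity in H^s are
  inherited through \<open>Hs_limit\<close>, and the equation passes to the limit in integrated
  form.\<close>

lemma limit_solution:
  assumes s: "s \<ge> 1/2" and u0: "Hs s u0" and small: "kappa * (norm u0)\<^sup>2 \<le> 1"
  shows "\<exists>a. a 0 = u0 \<and> continuous_on {0..} (\<lambda>t. mul (jc s) (a t)) \<and> (\<forall>t\<ge>0. Hs s (a t) \<and>
    (a has_vector_derivative cm (- \<i>) (Sg (- t) (NN (Sg t (a t))))) (at t within {0..}))"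
proof -
  have s0: "0 \<le> s" using s by simp
  have u02: "Hs (1/2) u0" using u0 s by (rule Hs_mono[rotated])
  define E where "E = 2 * (h2 u0)\<^sup>2 + Lam * (h2 u0)\<^sup>2 * (norm u0)\<^sup>2 + Minf * (norm u0) ^ 4"
  \<comment> \<open>Dominates the data and all truncated solutions at once; the 1 makes it positive
    even for zero data.\<close>
  define B where "B = sqrt E + h2 u0 + 1"
  have E: "E \<ge> 0" using Lam_pos Mi_nonneg by (simp add: E_def)
  have B: "B > 0" "0 \<le> B" "h2 u0 \<le> B" using E by (auto simp: B_def add_nonneg_pos)
  define k where "k n = real (Suc n)" for n
  have k: "k n > 0" "0 \<le> k n" "n \<le> m \<Longrightarrow> k n \<le> k m" for n m by (auto simp: k_def)
  have "\<exists>a. galerkin_sol (k n) (lp (k n) u0) a" for n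
  proof -
    have "norm u0 + 1 > 0" "norm (lp (k n) u0) \<le> norm u0 + 1"
      using norm_lp_le[of "k n" u0] norm_ge_zero[of u0] by linarith+
    then show ?thesis using galerkin[OF k(1) _ lp_idem] unfolding galerkin_sol_def by blast
  qed
  then obtain A where A: "\<And>n. galerkin_sol (k n) (lp (k n) u0) (A n)" by metis
  have small': "kappa * (norm (lp (k n) u0))\<^sup>2 \<le> 1" for n
    using mult_left_mono[OF power_mono[OF norm_lp_le[of "k n" u0], of 2] kap_nonneg] small by simp
  have AB: "h2 (A n t) \<le> B" if "0 \<le> t" for n t
  proof -
    have "(h2 (A n t))\<^sup>2 \<le> 2 * (h2 (lp (k n) u0))\<^sup>2 + Lam * (h2 (lp (k n) u0))\<^sup>2 * (norm (lp (k n) u0))\<^sup>2 + Minf * (norm (lp (k n) u0)) ^ 4"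
      by (rule galerkin_sol_h2[OF A k(2) that small'])
    also have "\<dots> \<le> E" unfolding E_def
      using Lam_pos Mi_nonneg Hs_lp(2)[OF u02, of "k n"] norm_lp_le[of "k n" u0]
      by (intro add_mono mult_left_mono mult_mono power_mono) auto
    finally have "h2 (A n t) \<le> sqrt E" by (rule real_le_rsqrt)
    then show ?thesis unfolding B_def using norm_ge_zero[of "mul (jc (1/2)) u0"] by linarith
  qed
  define C where "C t = sqrt ((B\<^sup>2 + (tail_const B)\<^sup>2) * exp (gap_rate B * t))" for t
  have C0: "0 \<le> C t" for t by (simp add: C_def)
  have ccp: "gap_rate B \<ge> 0" using Lam_pos by (simp add: gap_rate_def)
  have Cm: "C r \<le> C t" if "r \<le> t" for r t
    unfolding C_def using that ccp by (intro real_sqrt_le_mono mult_left_mono) (auto intro: mult_left_mono)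
  have Cau: "norm (A n t - A m t) \<le> C t / sqrt (k n)" if "0 \<le> t" "n \<le> m" for n m t
    unfolding C_def using that by (intro galerkin_sol_Cauchy[OF A A] k u02 B AB) auto
  have lim0: "(\<lambda>n. c / sqrt (k n)) \<longlonglongrightarrow> 0" for c unfolding k_def by (rule inverse_sqrt_lim)
  have "Cauchy (\<lambda>n. A n t)" if t: "0 \<le> t" for t
  proof (rule metric_CauchyI)
    fix e :: real assume "e > 0"
    then have "\<forall>\<^sub>F n in sequentially. C t / sqrt (k n) < e"
      using order_tendstoD(2)[OF lim0[of "C t"]] by simp
    then obtain N where N: "\<And>n. n \<ge> N \<Longrightarrow> C t / sqrt (k n) < e" unfolding eventually_sequentially by auto
    show "\<exists>M. \<forall>m\<ge>M. \<forall>n\<ge>M. dist (A m t) (A n t) < e"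
    proof (intro exI[of _ N] allI impI)
      fix m n assume mn: "m \<ge> N" "n \<ge> N"
      show "dist (A m t) (A n t) < e"
        using Cau[OF t, of m n] Cau[OF t, of n m] N[OF mn(1)] N[OF mn(2)] linear[of m n]
        by (auto simp: dist_norm norm_minus_commute)
    qed
  qed
  then have conv: "convergent (\<lambda>n. A n t)" if "0 \<le> t" for t using that by (simp add: Cauchy_convergent_iff)
  define a where "a t = lim (\<lambda>n. A n t)" for t
  have al: "(\<lambda>n. A n t) \<longlonglongrightarrow> a t" if "0 \<le> t" for t using conv[OF that] by (simp add: a_def convergent_LIMSEQ_iff)
  have ar: "norm (A n t - a t) \<le> C t / sqrt (k n)" if t: "0 \<le> t" for n t
  proof (rule LIMSEQ_le_const2)
    show "(\<lambda>m. norm (A n t - A m t)) \<longlonglongrightarrow> norm (A n t - a t)" by (intro tendsto_intros al t)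
    show "\<exists>N. \<forall>m\<ge>N. norm (A n t - A m t) \<le> C t / sqrt (k n)" using Cau[OF t] by blast
  qed
  define M where "M t = hn s u0 * exp (3 * Nf_const s * B\<^sup>2 * t)" for t
  have M0: "0 \<le> M t" for t by (simp add: M_def)
  have KB: "0 \<le> 3 * Nf_const s * B\<^sup>2" using Nf_const_pos[of s] by simp
  have Mm: "M r \<le> M t" if "r \<le> t" for r t
    unfolding M_def using mult_left_mono[OF that KB] by (intro mult_left_mono) simp_all
  have AM: "Hs s (A n t)" "hn s (A n t) \<le> M t" if t: "0 \<le> t" for n t
  proof -
    note h = galerkin_sol_hn[OF A k(2) s B(1) AB t]
    show "Hs s (A n t)" by (rule h(1)) auto
    have "hn s (A n t) \<le> hn s (lp (k n) u0) * exp (3 * Nf_const s * B\<^sup>2 * t)" by (rule h(2)) auto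
    also have "\<dots> \<le> M t" unfolding M_def by (intro mult_right_mono Hs_lp u0) auto
    finally show "hn s (A n t) \<le> M t" .
  qed
  have aH: "Hs s (a t)" "hn s (a t) \<le> M t" if t: "0 \<le> t" for t
    using Hs_limit[OF al[OF t] s0 AM(1)[OF t] AM(2)[OF t]] by auto
  have aH2: "Hs (1/2) (a t)" "h2 (a t) \<le> B" "Hs (1/2) (A n t)" if t: "0 \<le> t" for n t
  proof -
    show "Hs (1/2) (a t)" using aH(1)[OF t] s by (rule Hs_mono[rotated])
    show 1: "Hs (1/2) (A n t)" for n using AM(1)[OF t] s by (rule Hs_mono[rotated])
    show "h2 (a t) \<le> B" by (rule Hs_limit(2)[OF al[OF t] _ 1 AB[OF t]]) simp
  qed
  \<comment> \<open>Convergence in H^s has not been shown, so the bound on time increments is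
    transferred instead.\<close>
  have aL: "hn s (a t - a t') \<le> 3 * Nf_const s * B\<^sup>2 * M T * \<bar>t - t'\<bar>" if t: "0 \<le> t" "t \<le> T" "0 \<le> t'" "t' \<le> T" for t t' T
  proof (rule Hs_limit(2)[OF _ s0])
    show "(\<lambda>n. A n t - A n t') \<longlonglongrightarrow> a t - a t'" by (intro tendsto_intros al t)
    fix n
    have MM: "hn s (A n r) \<le> M T" if "0 \<le> r" "r \<le> T" for r using AM(2)[OF that(1)] Mm[OF that(2)] by (rule order_trans)
    show "Hs s (A n t - A n t')" by (rule galerkin_sol_Lip(1)[OF A k(2) s AB MM t])
    show "hn s (A n t - A n t') \<le> 3 * Nf_const s * B\<^sup>2 * M T * \<bar>t - t'\<bar>" by (rule galerkin_sol_Lip(2)[OF A k(2) s AB MM t])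
  qed
  have Uc: "continuous_on {0..} (\<lambda>t. mul (jc s) (a t))"
  proof (rule locally_lipschitz_continuous)
    fix T :: real assume "0 \<le> T"
    show "\<exists>L. \<forall>t\<in>{0..T}. \<forall>t'\<in>{0..T}. norm (mul (jc s) (a t) - mul (jc s) (a t')) \<le> L * \<bar>t - t'\<bar>"
      using aL[of _ T] aH(1) by (intro exI[of _ "3 * Nf_const s * B\<^sup>2 * M T"] ballI) (simp add: mul_diff[OF jc_measurable, symmetric])
  qed
  have ac: "continuous_on {0..} a"
  proof (rule locally_lipschitz_continuous)
    fix T :: real assume "0 \<le> T"
    have "norm (a t - a t') \<le> 3 * Nf_const s * B\<^sup>2 * M T * \<bar>t - t'\<bar>" if "t \<in> {0..T}" "t' \<in> {0..T}" for t t'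
      using aL[of t T t'] norm_le_hn[OF s0 Hs_diff[OF aH(1) aH(1)], of t t'] that by simp
    then show "\<exists>L. \<forall>t\<in>{0..T}. \<forall>t'\<in>{0..T}. norm (a t - a t') \<le> L * \<bar>t - t'\<bar>" by blast
  qed
  define G where "G t = cm (- \<i>) (Sg (- t) (NN (Sg t (a t))))" for t
  define Gn where "Gn n t = cm (- \<i>) (Sg (- t) (lp (k n) (NN (Sg t (A n t)))))" for n t
  \<comment> \<open>Continuity of the nonlinearity is known in Sobolev norms, so the argument goes
    up to H^(1/2) and returns to L^2 through the weight of order -1/2.\<close>
  have Gc: "continuous_on {0..} G"
  proof -
    have "continuous_on {0..} (\<lambda>t. mul (jc (1/2)) (Sg t (a t)))"
    proof -
      have "continuous_on {0..} (\<lambda>t. Sg t (mul (jc (1/2 - s)) (mul (jc s) (a t))))"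
        using s by (intro Sg_continuous continuous_intros bounded_linear.continuous_on[OF bounded_linear_jc_neg] Uc) auto
      then show ?thesis
        by (rule continuous_on_cong[THEN iffD1, rotated 2, OF _ refl]) (use aH2 aH in \<open>simp add: mul_jc_Sg mul_jc_jc\<close>)
    qed
    then have "continuous_on {0..} (\<lambda>t. mul (jc (1/2)) (NN (Sg t (a t))))"
      using aH2 by (intro NN_Hs_continuous Hs_Sg) auto
    then have "continuous_on {0..} (\<lambda>t. mul (jc (- 1/2)) (mul (jc (1/2)) (NN (Sg t (a t)))))"
      by (rule bounded_linear.continuous_on[OF bounded_linear_jc_neg, rotated]) simp
    then have "continuous_on {0..} (\<lambda>t. NN (Sg t (a t)))"
    proof (rule continuous_on_cong[THEN iffD1, rotated 2, OF _ refl])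
      fix t :: real assume "t \<in> {0..}"
      then have "Hs (1/2) (Sg t (a t))" using Hs_Sg(1)[OF aH2(1)] by simp
      then have "Hs (1/2) (NN (Sg t (a t)))" by (intro Nf_Hs) simp_all
      then show "mul (jc (- 1/2)) (mul (jc (1/2)) (NN (Sg t (a t)))) = NN (Sg t (a t))"
        by (subst mul_jc_jc) auto
    qed
    then show ?thesis unfolding G_def
      by (intro bounded_linear.continuous_on[OF bounded_linear_cm] Sg_continuous continuous_intros)
  qed
  have Gd: "norm (Gn n r - G r) \<le> (3 * Lam * B\<^sup>2 * C t + tail_const B) / sqrt (k n)" if r: "0 \<le> r" "r \<le> t" for n r t
  proof -
    define X where "X = NN (Sg r (A n r))"
    define Y where "Y = NN (Sg r (a r))"
    have HX: "Hs (1/2) (Sg r (A n r))" "h2 (Sg r (A n r)) \<le> B" "Hs (1/2) (Sg r (a r))" "h2 (Sg r (a r)) \<le> B"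
      using Hs_Sg[OF aH2(1)[OF r(1)]] Hs_Sg[OF aH2(3)[OF r(1)]] AB[OF r(1)] aH2(2)[OF r(1)] by auto
    have "norm (Gn n r - G r) = norm (lp (k n) X - Y)"
      unfolding Gn_def G_def X_def Y_def cm_diff[symmetric] Sg_diff[symmetric] norm_cm by simp
    also have "lp (k n) X - Y = lp (k n) (X - Y) - (Y - lp (k n) Y)" by (simp add: lp_diff)
    also have "norm \<dots> \<le> norm (X - Y) + norm (Y - lp (k n) Y)"
      by (intro order_trans[OF norm_triangle_ineq4] add_mono norm_lp_le order_refl)
    also have "\<dots> \<le> 3 * Lam * B\<^sup>2 * norm (Sg r (A n r) - Sg r (a r)) + tail_const B / sqrt (k n)"
      unfolding X_def Y_def by (intro add_mono NN_Lip_B NN_tail HX k)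
    also have "norm (Sg r (A n r) - Sg r (a r)) = norm (A n r - a r)" by (simp add: Sg_diff[symmetric])
    also have "3 * Lam * B\<^sup>2 * norm (A n r - a r) \<le> 3 * Lam * B\<^sup>2 * (C t / sqrt (k n))"
    proof (intro mult_left_mono)
      show "norm (A n r - a r) \<le> C t / sqrt (k n)"
        using ar[OF r(1), of n] Cm[OF r(2)] k[of n] by (meson divide_right_mono order_trans real_sqrt_ge_zero)
    qed (use Lam_pos in auto)
    finally show ?thesis by (simp add: add_divide_distrib)
  qed
  have a0: "a 0 = u0"
  proof -
    have "(\<lambda>n. A n 0) \<longlonglongrightarrow> u0"
    proof (rule tendsto_norm_le_0I[OF _ lim0[of "h2 u0"]])
      fix n
      have "(norm (A n 0 - u0))\<^sup>2 \<le> (h2 u0 / sqrt (k n))\<^sup>2"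
        using tail_le[OF k(1) u02, of n] A[of n] k[of n] by (simp add: galerkin_sol_def norm_minus_commute power_divide)
      then show "norm (A n 0 - u0) \<le> h2 u0 / sqrt (k n)"
        by (rule power2_le_imp_le) (use k[of n] in simp)
    qed
    then show ?thesis using al[of 0] LIMSEQ_unique by blast
  qed
  \<comment> \<open>Uniform convergence of \<open>Gn\<close> to \<open>G\<close> on bounded
    intervals turns the fundamental theorem of calculus for \<open>A n\<close> into the integral
    equation.\<close>
  have eq: "a t = u0 + integral {0..t} G" if t: "0 \<le> t" for t
  proof -
    have Gi: "(G has_integral integral {0..t} G) {0..t}"
      by (intro integrable_integral integrable_continuous_real continuous_on_subset[OF Gc]) auto
    have Ai: "(Gn n has_integral A n t - A n 0) {0..t}" for n
    proof (rule fundamental_theorem_of_calculus[OF t])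
      fix r assume "r \<in> {0..t}"
      then show "(A n has_vector_derivative Gn n r) (at r within {0..t})"
        using A[of n] unfolding galerkin_sol_def Gn_def by (auto intro: has_vector_derivative_within_subset[of _ _ _ "{0..}"])
    qed
    have bd: "norm ((A n t - A n 0) - integral {0..t} G) \<le> (3 * Lam * B\<^sup>2 * C t + tail_const B) / sqrt (k n) * (t - 0)" for n
    proof -
      have "0 \<le> (3 * Lam * B\<^sup>2 * C t + tail_const B) / sqrt (k n)"
        using Lam_pos C0[of t] tail_const_nonneg[OF B(2)] k by (intro divide_nonneg_nonneg add_nonneg_nonneg mult_nonneg_nonneg) auto
      then show ?thesis
        using has_integral_bound_real[OF _ finite.emptyI has_integral_diff[OF Ai[of n] Gi], of "(3 * Lam * B\<^sup>2 * C t + tail_const B) / sqrt (k n)"] Gd[of _ t n] t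
        by simp
    qed
    have "(\<lambda>n. A n t - A n 0) \<longlonglongrightarrow> integral {0..t} G"
    proof (rule tendsto_norm_le_0I[OF _ lim0])
      show "norm ((A n t - A n 0) - integral {0..t} G) \<le> (3 * Lam * B\<^sup>2 * C t + tail_const B) * t / sqrt (k n)" for n
        using bd[of n] by simp
    qed
    moreover have "(\<lambda>n. A n t - A n 0) \<longlonglongrightarrow> a t - a 0" by (intro tendsto_intros al t order_refl)
    ultimately have "a t - a 0 = integral {0..t} G" by (rule LIMSEQ_unique[rotated])
    then show ?thesis using a0 by (simp add: algebra_simps)
  qed
  have "(a has_vector_derivative G t) (at t within {0..})" if t: "0 \<le> t" for t
  proof (rule has_vector_derivative_transform)
    show "((\<lambda>t. u0 + integral {0..t} G) has_vector_derivative G t) (at t within {0..})"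
      using has_vector_derivative_add[OF has_vector_derivative_const halfline_integral_deriv[OF Gc t], of u0] by simp
  qed (use t eq in auto)
  with a0 show ?thesis using Uc aH(1) unfolding G_def by (intro exI[of _ a]) auto
qed

end

text \<open>The negative weight sends all of L^2 into H^s, so the outer \<open>mul\<close> is
  legitimate. It serves to read off the weighted profile from an identity in L^2.\<close>

lemma jc_mul_neg: "mul (jc s) (mul (jc (- s)) X) = X" if "s \<ge> 0"
proof -
  have j: "jc 0 = (\<lambda>\<xi>::real^'n. 1)" by (simp add: fun_eq_iff)
  show ?thesis using mul_jc_jc(1)[of "- s" X s] Hs_neg[of "- s" X] that by (simp add: j)
qed

text \<open>A product rule in which one factor is differentiable and the other merely continuous:
  symmetry factors the increment as the pairing of \<open>Y r - Y t\<close> with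
  \<open>Z r + Z t\<close>. It will be applied to a difference of solutions weighted with orders
  -1/2 and 1/2.\<close>

lemma vector_derivative_inner_sym:
  fixes Y Z :: "real \<Rightarrow> 'a::real_inner"
  assumes Y: "(Y has_vector_derivative D) (at t within S)" and Z: "(Z \<longlongrightarrow> Z t) (at t within S)" and t: "t \<in> S"
    and sym: "\<And>r r'. r \<in> S \<Longrightarrow> r' \<in> S \<Longrightarrow> inner (Y r) (Z r') = inner (Y r') (Z r)"
  shows "((\<lambda>r. inner (Y r) (Z r)) has_vector_derivative 2 * inner D (Z t)) (at t within S)"
  unfolding has_vector_derivative_iff_quotient
proof -
  have l: "((\<lambda>r. (Y r - Y t) /\<^sub>R (r - t)) \<longlongrightarrow> D) (at t within S)" using Y unfolding has_vector_derivative_iff_quotient .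
  have "((\<lambda>r. inner ((Y r - Y t) /\<^sub>R (r - t)) (Z r + Z t)) \<longlongrightarrow> inner D (Z t + Z t)) (at t within S)"
    by (intro tendsto_intros l Z)
  moreover have "\<forall>\<^sub>F r in at t within S. inner ((Y r - Y t) /\<^sub>R (r - t)) (Z r + Z t) = (inner (Y r) (Z r) - inner (Y t) (Z t)) /\<^sub>R (r - t)"
  proof -
    have "inner (Y r - Y t) (Z r + Z t) = inner (Y r) (Z r) - inner (Y t) (Z t)" if "r \<in> S" for r
      using sym[OF that t] by (simp add: inner_diff_left inner_add_right)
    then show ?thesis by (simp add: eventually_at_filter)
  qed
  ultimately show "((\<lambda>r. (inner (Y r) (Z r) - inner (Y t) (Z t)) /\<^sub>R (r - t)) \<longlongrightarrow> 2 * inner D (Z t)) (at t within S)"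
    using Lim_transform_eventually by (fastforce simp: inner_add_right)
qed

context hartree_potential
begin

section \<open>Well-posedness at the level of the Hilbert space\<close>

text \<open>The derivative lives in \<open>H\<^sup>s\<^sup>-\<^sup>1\<close>, which is not contained in \<open>L\<^sup>2\<close> when \<open>s < 1\<close>; hence the weight is applied before differentiating.\<close>

definition flow :: "real \<Rightarrow> (real \<Rightarrow> (real^'n) l2) \<Rightarrow> bool" where
  "flow s U \<longleftrightarrow> (\<forall>t\<ge>0. Hs s (U t)) \<and> continuous_on {0..} (\<lambda>t. mul (jc s) (U t)) \<and>
    (\<forall>t\<ge>0. ((\<lambda>t. mul (jc (s - 1)) (U t)) has_vector_derivative
      cm (- \<i>) (mul (jc s) (U t) + mul (jc (s - 1)) (NN (U t)))) (at t within {0..}))"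

text \<open>An L^2 derivative is upgraded to an H^s derivative. The weighted right side is
  continuous, so it has a primitive \<open>W\<close>; removing the weight from \<open>W\<close>
  gives a curve with the same derivative and the same start as \<open>a\<close>, hence
  \<open>a\<close> itself.\<close>

lemma profile_deriv:
  fixes a :: "real \<Rightarrow> (real^'n) l2"
  assumes s: "s \<ge> 1/2" and c: "continuous_on {0..} (\<lambda>t. mul (jc s) (a t))" and H: "\<And>t. 0 \<le> t \<Longrightarrow> Hs s (a t)"
    and d: "\<And>t. 0 \<le> t \<Longrightarrow> (a has_vector_derivative cm (- \<i>) (Sg (- t) (NN (Sg t (a t))))) (at t within {0..})"
    and t: "0 \<le> t"
  shows "((\<lambda>t. mul (jc s) (a t)) has_vector_derivative cm (- \<i>) (Sg (- t) (mul (jc s) (NN (Sg t (a t)))))) (at t within {0..})"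
proof -
  define F where "F t = cm (- \<i>) (Sg (- t) (mul (jc s) (NN (Sg t (a t)))))" for t
  define W where "W t = mul (jc s) (a 0) + integral {0..t} F" for t
  have s0: "- s \<le> 0" "0 \<le> s" using s by auto
  have HS: "Hs s (Sg t (a t))" if "0 \<le> t" for t using Hs_Sg(1)[OF H[OF that]] .
  have HN: "Hs s (NN (Sg t (a t)))" if "0 \<le> t" for t using Nf_Hs(1)[OF s] HS[OF that] by blast
  have "continuous_on {0..} (\<lambda>t. Sg t (mul (jc s) (a t)))" by (intro Sg_continuous c continuous_intros)
  then have "continuous_on {0..} (\<lambda>t. mul (jc s) (Sg t (a t)))"
    by (rule continuous_on_cong[THEN iffD1, rotated 2, OF _ refl]) (simp add: mul_jc_Sg H)
  then have "continuous_on {0..} (\<lambda>t. mul (jc s) (NN (Sg t (a t))))" by (intro NN_Hs_continuous s HS)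
  then have Fc: "continuous_on {0..} F" unfolding F_def
    by (intro bounded_linear.continuous_on[OF bounded_linear_cm] Sg_continuous continuous_intros)
  have Wd: "(W has_vector_derivative F t) (at t within {0..})" if t: "0 \<le> t" for t
    unfolding W_def using has_vector_derivative_add[OF has_vector_derivative_const halfline_integral_deriv[OF Fc t], of "mul (jc s) (a 0)"] by simp
  have KF: "mul (jc (- s)) (F t) = cm (- \<i>) (Sg (- t) (NN (Sg t (a t))))" if t: "0 \<le> t" for t
  proof -
    have "mul (jc (- s)) (F t) = cm (- \<i>) (Sg (- t) (mul (jc (- s)) (mul (jc s) (NN (Sg t (a t))))))"
      unfolding F_def using s0 by (simp only: mul_jc_cm[OF Hs_neg] mul_jc_Sg[OF Hs_neg])
    also have "mul (jc (- s)) (mul (jc s) (NN (Sg t (a t)))) = mul (jc 0) (NN (Sg t (a t)))"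
      using mul_jc_jc(1)[OF HN[OF t], of "- s"] Hs_neg[of 0 "NN (Sg t (a t))"] by simp
    also have "\<dots> = NN (Sg t (a t))" by simp
    finally show ?thesis .
  qed
  have KW: "mul (jc (- s)) (W t) = a t" if t: "0 \<le> t" for t
  proof -
    have "((\<lambda>t. mul (jc (- s)) (W t) - a t) has_vector_derivative 0) (at t within {0..})" if t: "0 \<le> t" for t
      using has_vector_derivative_diff[OF bounded_linear.has_vector_derivative[OF bounded_linear_jc_neg[OF s0(1)] Wd[OF t]] d[OF t]]
      by (simp add: KF[OF t])
    then have "mul (jc (- s)) (W t) - a t = mul (jc (- s)) (W 0) - a 0" by (rule deriv_const[OF _ t])
    also have "W 0 = mul (jc s) (a 0)" by (simp add: W_def)
    also have "mul (jc (- s)) (mul (jc s) (a 0)) = a 0"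
      using mul_jc_jc(1)[OF H, of 0 "- s"] Hs_neg[of 0 "a 0"] by simp
    finally show ?thesis by simp
  qed
  have "mul (jc s) (a t) = W t" if "0 \<le> t" for t using KW[OF that] jc_mul_neg[OF s0(2), of "W t"] by simp
  then show ?thesis
    using has_vector_derivative_transform[of t "{0..}" "\<lambda>t. mul (jc s) (a t)" W "F t"] Wd[OF t] t unfolding F_def by simp
qed

lemma flow_of_profile:
  fixes a :: "real \<Rightarrow> (real^'n) l2"
  assumes s: "s \<ge> 1/2" and c: "continuous_on {0..} (\<lambda>t. mul (jc s) (a t))" and H: "\<And>t. 0 \<le> t \<Longrightarrow> Hs s (a t)"
    and d: "\<And>t. 0 \<le> t \<Longrightarrow> (a has_vector_derivative cm (- \<i>) (Sg (- t) (NN (Sg t (a t))))) (at t within {0..})"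
  shows "flow s (\<lambda>t. Sg t (a t))"
  unfolding flow_def
proof (intro conjI allI impI)
  show "Hs s (Sg t (a t))" if "0 \<le> t" for t using Hs_Sg(1)[OF H[OF that]] .
  have "continuous_on {0..} (\<lambda>t. Sg t (mul (jc s) (a t)))" by (intro Sg_continuous c continuous_intros)
  then show "continuous_on {0..} (\<lambda>t. mul (jc s) (Sg t (a t)))"
    by (rule continuous_on_cong[THEN iffD1, rotated 2, OF _ refl]) (simp add: mul_jc_Sg H)
  fix t :: real assume t: "0 \<le> t"
  have H1: "Hs (s - 1) (a t)" if "0 \<le> t" for t by (rule Hs_mono[OF _ H[OF that]]) simp
  have HS: "Hs s (Sg t (a t))" using Hs_Sg(1)[OF H[OF t]] .
  have HN: "Hs s (NN (Sg t (a t)))" using Nf_Hs(1)[OF s] HS by blast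
  have HN': "Hs (s - 1) (NN (Sg t (a t)))" by (rule Hs_mono[OF _ HN]) simp
  have c1: "mul (jc (- 1)) (mul (jc s) (a t)) = mul (jc (s - 1)) (a t)" if "0 \<le> t" for t
    using mul_jc_jc(1)[OF H[OF that], of "- 1"] H1[OF that] by simp
  have cd: "((\<lambda>t. mul (jc (s - 1)) (a t)) has_vector_derivative mul (jc (- 1)) (cm (- \<i>) (Sg (- t) (mul (jc s) (NN (Sg t (a t))))))) (at t within {0..})"
  proof (rule has_vector_derivative_transform)
    show "((\<lambda>t. mul (jc (- 1)) (mul (jc s) (a t))) has_vector_derivative mul (jc (- 1)) (cm (- \<i>) (Sg (- t) (mul (jc s) (NN (Sg t (a t))))))) (at t within {0..})"
      by (rule bounded_linear.has_vector_derivative[OF bounded_linear_jc_neg profile_deriv[OF s c H d t]]) simp_all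
  qed (use t c1 in auto)
  have e1: "Sg t (mul (jc (- 1)) (cm (- \<i>) (Sg (- t) (mul (jc s) (NN (Sg t (a t))))))) = cm (- \<i>) (mul (jc (s - 1)) (NN (Sg t (a t))))"
  proof -
    have "mul (jc (- 1)) (cm (- \<i>) (Sg (- t) (mul (jc s) (NN (Sg t (a t)))))) = cm (- \<i>) (Sg (- t) (mul (jc (- 1)) (mul (jc s) (NN (Sg t (a t))))))"
      by (subst mul_jc_cm[OF Hs_neg], simp, subst mul_jc_Sg[OF Hs_neg], simp, rule refl)
    also have "mul (jc (- 1)) (mul (jc s) (NN (Sg t (a t)))) = mul (jc (s - 1)) (NN (Sg t (a t)))"
      using mul_jc_jc(1)[OF HN, of "- 1"] HN' by simp
    finally show ?thesis by (simp add: Sg_cm Sg_Sg Sg_0)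
  qed
  \<comment> \<open>The weight of order s - 1 leaves exactly one derivative to spare, which is what
    \<open>Sg_deriv\<close> requires of its argument.\<close>
  have j: "mul (jc 1) (mul (jc (s - 1)) (a t)) = mul (jc s) (a t)" "Hs 1 (mul (jc (s - 1)) (a t))"
    using mul_jc_jc[OF H1[OF t], of 1] H[OF t] by auto
  have "((\<lambda>t. Sg t (mul (jc (s - 1)) (a t))) has_vector_derivative cm (- \<i>) (mul (jc (s - 1)) (NN (Sg t (a t)))) + cm (- \<i>) (mul (jc s) (Sg t (a t)))) (at t within {0..})"
  proof -
    have "mul (jc 1) (Sg t (mul (jc (s - 1)) (a t))) = mul (jc s) (Sg t (a t))"
      by (simp add: mul_jc_Sg j H t)
    then show ?thesis using Sg_deriv[OF cd j(2)] unfolding e1 by simp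
  qed
  then have "((\<lambda>t. Sg t (mul (jc (s - 1)) (a t))) has_vector_derivative cm (- \<i>) (mul (jc s) (Sg t (a t)) + mul (jc (s - 1)) (NN (Sg t (a t))))) (at t within {0..})"
    by (simp add: cm_add add.commute)
  then show "((\<lambda>t. mul (jc (s - 1)) (Sg t (a t))) has_vector_derivative
      cm (- \<i>) (mul (jc s) (Sg t (a t)) + mul (jc (s - 1)) (NN (Sg t (a t))))) (at t within {0..})"
    by (rule has_vector_derivative_transform[rotated 2]) (use t H1 in \<open>auto simp: mul_jc_Sg\<close>)
qed

text \<open>A bounded weight lowers the regularity, so uniqueness need only be shown at s = 1/2,
  where the orders 1/2 and -1/2 are dual.\<close>

lemma flow_half:
  assumes s: "s \<ge> 1/2" and f: "flow s U"
  shows "flow (1/2) U"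
  unfolding flow_def
proof (intro conjI allI impI)
  have H: "Hs s (U t)" if "0 \<le> t" for t using f that by (simp add: flow_def)
  show H2: "Hs (1/2) (U t)" if "0 \<le> t" for t by (rule Hs_mono[OF s H[OF that]])
  have r: "1/2 - s \<le> 0" using s by simp
  have e: "mul (jc (1/2 - s)) (mul (jc s) (U t)) = mul (jc (1/2)) (U t)" if "0 \<le> t" for t
    using mul_jc_jc(1)[OF H[OF that], of "1/2 - s"] H2[OF that] by simp
  have "continuous_on {0..} (\<lambda>t. mul (jc (1/2 - s)) (mul (jc s) (U t)))"
    using f by (intro bounded_linear.continuous_on[OF bounded_linear_jc_neg[OF r]]) (simp add: flow_def)
  then show "continuous_on {0..} (\<lambda>t. mul (jc (1/2)) (U t))"
    by (rule continuous_on_cong[THEN iffD1, rotated 2, OF _ refl]) (simp add: e)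
  fix t :: real assume t: "0 \<le> t"
  have HN: "Hs s (NN (U t))" using Nf_Hs(1)[OF s] H[OF t] by blast
  have e': "mul (jc (1/2 - s)) (mul (jc (s - 1)) X) = mul (jc (1/2 - 1)) X" if "Hs s X" for X
    using mul_jc_jc(1)[of "s - 1" X "1/2 - s"] Hs_neg[of "1/2 - 1" X] Hs_mono[of "s - 1" s X] that by simp
  have "((\<lambda>t. mul (jc (1/2 - s)) (mul (jc (s - 1)) (U t))) has_vector_derivative
      mul (jc (1/2 - s)) (cm (- \<i>) (mul (jc s) (U t) + mul (jc (s - 1)) (NN (U t))))) (at t within {0..})"
    using f t by (intro bounded_linear.has_vector_derivative[OF bounded_linear_jc_neg[OF r]]) (simp add: flow_def)
  also have "mul (jc (1/2 - s)) (cm (- \<i>) (mul (jc s) (U t) + mul (jc (s - 1)) (NN (U t)))) =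
     cm (- \<i>) (mul (jc (1/2)) (U t) + mul (jc (1/2 - 1)) (NN (U t)))"
    by (simp only: mul_jc_cm[OF Hs_neg[OF r]] mul_add[OF jc_measurable Hs_neg[OF r] Hs_neg[OF r]] e[OF t] e'[OF HN])
  finally show "((\<lambda>t. mul (jc (1/2 - 1)) (U t)) has_vector_derivative
      cm (- \<i>) (mul (jc (1/2)) (U t) + mul (jc (1/2 - 1)) (NN (U t)))) (at t within {0..})"
    by (rule has_vector_derivative_transform[rotated 2]) (use t e'[OF H] in \<open>simp_all del: minus_divide_left\<close>)
qed

lemma flow_unique:
  assumes s: "s \<ge> 1/2" and f: "flow s U" "flow s V" and init: "U 0 = V 0" and t: "0 \<le> t"
  shows "U t = V t"
proof -
  note f = flow_half[OF s f(1)] flow_half[OF s f(2)]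
  define z where "z t = U t - V t" for t
  define Y where "Y t = mul (jc (- 1/2)) (z t)" for t
  define Z where "Z t = mul (jc (1/2)) (z t)" for t
  define D where "D t = NN (U t) - NN (V t)" for t
  have H: "Hs (1/2) (U t)" "Hs (1/2) (V t)" "Hs (1/2) (z t)" if "0 \<le> t" for t
    using f that unfolding flow_def z_def by (auto intro!: Hs_diff)
  have cont: "continuous_on {0..} (\<lambda>t. mul (jc (1/2)) (U t))" "continuous_on {0..} (\<lambda>t. mul (jc (1/2)) (V t))"
    using f unfolding flow_def by auto
  have Zc: "continuous_on {0..} Z"
    using continuous_on_diff[OF cont]
    by (rule continuous_on_cong[THEN iffD1, rotated 2, OF _ refl]) (simp add: Z_def z_def mul_diff[OF jc_measurable] H)
  have Hm: "Hs (- 1/2) X" for X :: "(real^'n) l2" by (rule Hs_neg) simp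
  have Yd: "(Y has_vector_derivative cm (- \<i>) (Z r + mul (jc (- 1/2)) (D r))) (at r within {0..})" if r: "0 \<le> r" for r
  proof -
    have der: "((\<lambda>t. mul (jc (- 1/2)) (W t)) has_vector_derivative
      cm (- \<i>) (mul (jc (1/2)) (W r) + mul (jc (- 1/2)) (NN (W r)))) (at r within {0..})" if "flow (1/2) W" for W
      using that r by (simp add: flow_def)
    have e: "mul (jc (- 1/2)) (A - B) = mul (jc (- 1/2)) A - mul (jc (- 1/2)) B" for A B :: "(real^'n) l2"
      by (rule mul_diff[OF jc_measurable Hm Hm])
    have Ye: "Y = (\<lambda>t. mul (jc (- 1/2)) (U t) - mul (jc (- 1/2)) (V t))"
      by (simp only: Y_def[abs_def] z_def e)
    have De: "mul (jc (- 1/2)) (D r) = mul (jc (- 1/2)) (NN (U r)) - mul (jc (- 1/2)) (NN (V r))"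
      by (simp only: D_def e)
    have Ze: "Z r = mul (jc (1/2)) (U r) - mul (jc (1/2)) (V r)"
      unfolding Z_def z_def by (rule mul_diff[OF jc_measurable H(1,2)[OF r]])
    have "cm (- \<i>) (Z r + mul (jc (- 1/2)) (D r)) = cm (- \<i>) (mul (jc (1/2)) (U r) + mul (jc (- 1/2)) (NN (U r))) - cm (- \<i>) (mul (jc (1/2)) (V r) + mul (jc (- 1/2)) (NN (V r)))"
      unfolding De Ze cm_diff[symmetric] by (rule arg_cong[where f="cm (- \<i>)"]) (simp only: algebra_simps)
    then show ?thesis unfolding Ye by (simp only: has_vector_derivative_diff[OF der[OF f(1)] der[OF f(2)]])
  qed
  \<comment> \<open>The weights of order -1/2 and 1/2 cancel in the pairing, which makes it
    symmetric in the two times.\<close>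
  have inn: "inner (Y r) (Z r') = inner (z r) (z r')" if "0 \<le> r" "0 \<le> r'" for r r'
  proof -
    have "mul (jc (- 1/2)) (Z r') = z r'"
      using mul_jc_jc(1)[OF H(3)[OF that(2)], of "- 1/2"] Hs_neg[of 0 "z r'"] by (simp add: Z_def)
    then show ?thesis unfolding Y_def using inner_mul[of "jc (- 1/2)" "z r" "Z r'"] Hm by simp
  qed
  define g where "g r = (norm (z r))\<^sup>2" for r
  have gi: "g r = inner (Y r) (Z r)" if "0 \<le> r" for r using inn[OF that that] by (simp add: g_def power2_norm_eq_inner)
  \<comment> \<open>The kinetic part is skew and drops out; only the difference of the
    nonlinearities, measured in L^2, is left.\<close>
  have gd: "(g has_vector_derivative 2 * inner (cm (- \<i>) (D r)) (z r)) (at r within {0..})" if r: "0 \<le> r" for r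
  proof -
    have "((\<lambda>r. inner (Y r) (Z r)) has_vector_derivative 2 * inner (cm (- \<i>) (Z r + mul (jc (- 1/2)) (D r))) (Z r)) (at r within {0..})"
      by (rule vector_derivative_inner_sym[OF Yd[OF r]])
        (use r Zc inn in \<open>auto simp: continuous_on_def inner_commute\<close>)
    also have "inner (cm (- \<i>) (Z r + mul (jc (- 1/2)) (D r))) (Z r) = inner (cm (- \<i>) (D r)) (z r)"
    proof -
      have 0: "inner (cm (- \<i>) X) X = 0" for X :: "(real^'n) l2"
      proof -
        have "inner (cm (- \<i>) X) X = inner X (cm \<i> X)" by (simp add: inner_cm)
        also have "cm \<i> X = - cm (- \<i>) X" by (rule mul_eqI) (use rep_mul[OF mok_const, of "- \<i>" X] rep_uminus[of "cm (- \<i>) X"] in auto)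
        finally show ?thesis by (simp add: inner_commute)
      qed
      have "inner (mul (jc (- 1/2)) (cm (- \<i>) (D r))) (Z r) = inner (cm (- \<i>) (D r)) (mul (jc (- 1/2)) (Z r))"
        using inner_mul[of "jc (- 1/2)" "cm (- \<i>) (D r)" "Z r"] Hm by simp
      also have "mul (jc (- 1/2)) (Z r) = z r"
        using mul_jc_jc(1)[OF H(3)[OF r], of "- 1/2"] Hs_neg[of 0 "z r"] by (simp add: Z_def)
      finally have "inner (cm (- \<i>) (mul (jc (- 1/2)) (D r))) (Z r) = inner (cm (- \<i>) (D r)) (z r)"
        unfolding mul_jc_cm[OF Hm] .
      then show ?thesis unfolding cm_add inner_add_left 0 by simp
    qed
    finally show ?thesis by (rule has_vector_derivative_transform[rotated 2]) (use r gi in auto)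
  qed
  \<comment> \<open>Continuity in H^(1/2) on a compact time interval bounds both solutions, so
    uniqueness does not rest on the energy bound.\<close>
  obtain B where B: "\<And>r. r \<in> {0..t} \<Longrightarrow> h2 (U r) \<le> B \<and> h2 (V r) \<le> B"
  proof -
    have b: "bounded ((\<lambda>r. mul (jc (1/2)) (W r)) ` {0..t})" if "continuous_on {0..} (\<lambda>r. mul (jc (1/2)) (W r))" for W :: "real \<Rightarrow> (real^'n) l2"
      by (intro compact_imp_bounded compact_continuous_image continuous_on_subset[OF that]) auto
    obtain B1 B2 where "\<forall>x\<in>(\<lambda>r. mul (jc (1/2)) (U r)) ` {0..t}. norm x \<le> B1" "\<forall>x\<in>(\<lambda>r. mul (jc (1/2)) (V r)) ` {0..t}. norm x \<le> B2"
      using b[OF cont(1)] b[OF cont(2)] unfolding bounded_iff by blast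
    then show thesis by (intro that[of "max B1 B2"]) (auto simp: le_max_iff_disj)
  qed
  define c where "c = 6 * Lam * B\<^sup>2 + 1"
  have c: "c > 0" using Lam_pos by (simp add: c_def add_nonneg_pos)
  have le: "2 * inner (cm (- \<i>) (D r)) (z r) \<le> c * g r + 0" if r: "0 \<le> r" "r < t" for r
  proof -
    have "inner (cm (- \<i>) (D r)) (z r) \<le> norm (D r) * norm (z r)"
      using norm_cauchy_schwarz[of "cm (- \<i>) (D r)" "z r"] by (simp add: norm_cm)
    also have "\<dots> \<le> (3 * Lam * B\<^sup>2 * norm (z r)) * norm (z r)"
      unfolding D_def z_def using B[of r] r H by (intro mult_right_mono NN_Lip_B) auto
    finally have "2 * inner (cm (- \<i>) (D r)) (z r) \<le> 6 * Lam * B\<^sup>2 * g r" by (simp add: g_def power2_eq_square algebra_simps)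
    moreover have "c * g r = 6 * Lam * B\<^sup>2 * g r + g r" by (simp add: c_def distrib_right)
    moreover have "0 \<le> g r" by (simp add: g_def)
    ultimately show ?thesis by linarith
  qed
  have "g t + 0 / c \<le> (g 0 + 0 / c) * exp (c * t)" by (rule gronwall[OF c gd le t order_refl])
  then have "g t \<le> 0" using init by (simp add: g_def z_def)
  then show ?thesis by (simp add: g_def z_def)
qed

end

section \<open>From the Hilbert space back to functions\<close>

text \<open>A member of H^(s-1) need not be in L^2, so only its weighted version can be an element
  of \<open>l2\<close>; the time derivative \<open>v\<close> enters through this map.\<close>

definition weighted_l2 :: "real \<Rightarrow> (real^'n \<Rightarrow> complex) \<Rightarrow> (real^'n) l2" where
  "weighted_l2 \<sigma> f = abs_l2 (\<lambda>\<xi>. jc \<sigma> \<xi> * f \<xi>)"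

lemma wnorm_weighted_l2:
  assumes "wL2 \<sigma> f" "wL2 \<sigma> g"
  shows "wnorm \<sigma> (\<lambda>\<xi>. f \<xi> - g \<xi>) = norm (weighted_l2 \<sigma> f - weighted_l2 \<sigma> g)"
  using assms unfolding wnorm_def weighted_l2_def wL2_def
  by (simp add: abs_diff norm_abs_l2 sq_int_diff right_diff_distrib)

lemma wcont_iff: "wcont \<sigma> f \<longleftrightarrow> (\<forall>t\<ge>0. wL2 \<sigma> (f t)) \<and> continuous_on {0..} (\<lambda>t. weighted_l2 \<sigma> (f t))"
proof -
  have "((\<lambda>t'. wnorm \<sigma> (\<lambda>\<xi>. f t' \<xi> - f t \<xi>)) \<longlongrightarrow> 0) (at t within {0..}) \<longleftrightarrow>
      ((\<lambda>t'. weighted_l2 \<sigma> (f t')) \<longlongrightarrow> weighted_l2 \<sigma> (f t)) (at t within {0..})"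
    if H: "\<And>t. 0 \<le> t \<Longrightarrow> wL2 \<sigma> (f t)" and t: "0 \<le> t" for t :: real
  proof -
    have "((\<lambda>t'. wnorm \<sigma> (\<lambda>\<xi>. f t' \<xi> - f t \<xi>)) \<longlongrightarrow> 0) (at t within {0..}) \<longleftrightarrow>
        ((\<lambda>t'. norm (weighted_l2 \<sigma> (f t') - weighted_l2 \<sigma> (f t))) \<longlongrightarrow> 0) (at t within {0..})"
      by (rule tendsto_cong) (simp add: eventually_at_filter wnorm_weighted_l2 H t)
    also have "\<dots> \<longleftrightarrow> ((\<lambda>t'. weighted_l2 \<sigma> (f t')) \<longlongrightarrow> weighted_l2 \<sigma> (f t)) (at t within {0..})"
      by (rule tendsto_iff_norm_diff[symmetric])
    finally show ?thesis .
  qed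
  then show ?thesis unfolding wcont_def continuous_on_def by auto
qed

text \<open>The problem statement takes difference quotients in the increment \<open>h\<close> from
  -t on, vector derivatives in the time itself; this translation of filters connects the
  two.\<close>

lemma at_within_shift: "at t within {0..} = filtermap (\<lambda>h. t + h) (at (0::real) within {- t..})"
proof -
  have n: "nhds t = filtermap (\<lambda>h. t + h) (nhds (0::real))"
    using filtermap_nhds_shift[of "- t" 0] by (simp add: add.commute)
  have e: "(t + h \<noteq> t \<longrightarrow> t + h \<in> {0..} \<longrightarrow> P) \<longleftrightarrow> (h \<noteq> 0 \<longrightarrow> h \<in> {- t..} \<longrightarrow> P)" for h P
    by auto
  show ?thesis
    by (rule filter_eq_iff[THEN iffD2]) (simp only: eventually_filtermap eventually_at_filter n e simp_thms)
qed

lemma wnorm_deriv_iff: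
  assumes H: "\<And>t. 0 \<le> t \<Longrightarrow> wL2 \<sigma> (u t)" and v: "wL2 \<sigma> v" and t: "0 \<le> (t::real)"
  shows "((\<lambda>h. wnorm \<sigma> (\<lambda>\<xi>. (u (t + h) \<xi> - u t \<xi>) / complex_of_real h - v \<xi>)) \<longlongrightarrow> 0) (at 0 within {- t..}) \<longleftrightarrow>
    ((\<lambda>t. weighted_l2 \<sigma> (u t)) has_vector_derivative weighted_l2 \<sigma> v) (at t within {0..})"
proof -
  have e: "wnorm \<sigma> (\<lambda>\<xi>. (u (t + h) \<xi> - u t \<xi>) / complex_of_real h - v \<xi>) =
      norm ((weighted_l2 \<sigma> (u (t + h)) - weighted_l2 \<sigma> (u t)) /\<^sub>R (t + h - t) - weighted_l2 \<sigma> v)" if h: "h \<in> {- t..}" for h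
  proof -
    have s: "sq_int (\<lambda>\<xi>. jc \<sigma> \<xi> * u (t + h) \<xi>)" "sq_int (\<lambda>\<xi>. jc \<sigma> \<xi> * u t \<xi>)"
      using H[of "t + h"] H[of t] h t by (auto simp: wL2_def)
    have eq: "jc \<sigma> \<xi> * ((u (t + h) \<xi> - u t \<xi>) / complex_of_real h) = complex_of_real (inverse h) * (jc \<sigma> \<xi> * u (t + h) \<xi> - jc \<sigma> \<xi> * u t \<xi>)" for \<xi>
      by (simp add: divide_inverse algebra_simps)
    have q: "wL2 \<sigma> (\<lambda>\<xi>. (u (t + h) \<xi> - u t \<xi>) / complex_of_real h)"
      unfolding wL2_def eq by (intro sq_int_cmult sq_int_diff s)
    have "weighted_l2 \<sigma> (\<lambda>\<xi>. (u (t + h) \<xi> - u t \<xi>) / complex_of_real h) = (weighted_l2 \<sigma> (u (t + h)) - weighted_l2 \<sigma> (u t)) /\<^sub>R h"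
      unfolding weighted_l2_def eq abs_diff[OF s] scaleR_cm by (rule cm_abs[symmetric]) (intro sq_int_diff s)
    then show ?thesis unfolding wnorm_weighted_l2[OF q v] by simp
  qed
  have "((\<lambda>h. wnorm \<sigma> (\<lambda>\<xi>. (u (t + h) \<xi> - u t \<xi>) / complex_of_real h - v \<xi>)) \<longlongrightarrow> 0) (at 0 within {- t..}) \<longleftrightarrow>
      ((\<lambda>h. norm ((weighted_l2 \<sigma> (u (t + h)) - weighted_l2 \<sigma> (u t)) /\<^sub>R (t + h - t) - weighted_l2 \<sigma> v)) \<longlongrightarrow> 0) (at 0 within {- t..})"
    by (rule tendsto_cong) (use e in \<open>auto simp: eventually_at_filter intro!: always_eventually\<close>)
  also have "\<dots> \<longleftrightarrow> ((\<lambda>r. norm ((weighted_l2 \<sigma> (u r) - weighted_l2 \<sigma> (u t)) /\<^sub>R (r - t) - weighted_l2 \<sigma> v)) \<longlongrightarrow> 0) (at t within {0..})"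
    unfolding at_within_shift[of t] by (rule filterlim_filtermap[symmetric])
  also have "\<dots> \<longleftrightarrow> ((\<lambda>r. (weighted_l2 \<sigma> (u r) - weighted_l2 \<sigma> (u t)) /\<^sub>R (r - t)) \<longlongrightarrow> weighted_l2 \<sigma> v) (at t within {0..})"
    by (rule tendsto_iff_norm_diff[symmetric])
  finally show ?thesis unfolding has_vector_derivative_iff_quotient .
qed

lemma wL2_iff: assumes "sq_int f" shows "wL2 \<sigma> f \<longleftrightarrow> Hs \<sigma> (abs_l2 f)"
proof -
  have [measurable]: "f \<in> borel_measurable borel" using assms by (simp add: sq_int_iff)
  have "AE \<xi> in lborel. jc \<sigma> \<xi> * rep_l2 (abs_l2 f) \<xi> = jc \<sigma> \<xi> * f \<xi>" using rep_abs[OF assms] by eventually_elim simp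
  moreover from this have "AE \<xi> in lborel. jc \<sigma> \<xi> * f \<xi> = jc \<sigma> \<xi> * rep_l2 (abs_l2 f) \<xi>" by eventually_elim simp
  ultimately show ?thesis unfolding wL2_def mok_def
    by (intro iffI; elim sq_int_cong_AE[rotated 2]) auto
qed

lemma weighted_l2_mul: assumes "sq_int f" "wL2 \<sigma> f" shows "weighted_l2 \<sigma> f = mul (jc \<sigma>) (abs_l2 f)"
  unfolding weighted_l2_def mul_def
proof (rule abs_eqI)
  show "sq_int (\<lambda>\<xi>. jc \<sigma> \<xi> * f \<xi>)" using assms by (simp add: wL2_def)
  show "sq_int (\<lambda>\<xi>. jc \<sigma> \<xi> * rep_l2 (abs_l2 f) \<xi>)" using assms wL2_iff[of f \<sigma>] by (simp add: mok_def)
  show "AE \<xi> in lborel. jc \<sigma> \<xi> * f \<xi> = jc \<sigma> \<xi> * rep_l2 (abs_l2 f) \<xi>" using rep_abs[OF assms(1)] by eventually_elim simp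
qed

text \<open>The equation is multiplied by the weight of order s - 1, which the symbol
  \<open>jb 1\<close> raises to order \<open>s\<close> on the solution itself.\<close>

lemma weighted_l2_rhs:
  assumes u: "wL2 s u" and n: "wL2 (s - 1) n" and v: "wL2 (s - 1) v"
    and eq: "AE \<xi> in lborel. \<i> * v \<xi> = jc 1 \<xi> * u \<xi> + n \<xi>"
  shows "weighted_l2 (s - 1) v = cm (- \<i>) (weighted_l2 s u + weighted_l2 (s - 1) n)"
proof -
  have s: "sq_int (\<lambda>\<xi>. jc s \<xi> * u \<xi>)" "sq_int (\<lambda>\<xi>. jc (s - 1) \<xi> * n \<xi>)" using u n by (auto simp: wL2_def)
  have "weighted_l2 (s - 1) v = abs_l2 (\<lambda>\<xi>. - \<i> * (jc s \<xi> * u \<xi> + jc (s - 1) \<xi> * n \<xi>))"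
    unfolding weighted_l2_def
  proof (rule abs_eqI)
    show "sq_int (\<lambda>\<xi>. jc (s - 1) \<xi> * v \<xi>)" using v by (simp add: wL2_def)
    show "sq_int (\<lambda>\<xi>. - \<i> * (jc s \<xi> * u \<xi> + jc (s - 1) \<xi> * n \<xi>))" by (intro sq_int_cmult sq_int_add s)
    show "AE \<xi> in lborel. jc (s - 1) \<xi> * v \<xi> = - \<i> * (jc s \<xi> * u \<xi> + jc (s - 1) \<xi> * n \<xi>)"
      using eq
    proof eventually_elim
      case (elim \<xi>)
      have j: "jc s \<xi> = jc (s - 1) \<xi> * jc 1 \<xi>" using jc_add[of "s - 1" 1 \<xi>] by simp
      have v: "v \<xi> = - \<i> * (jc 1 \<xi> * u \<xi> + n \<xi>)" unfolding elim[symmetric] by simp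
      show ?case unfolding v j by (simp add: algebra_simps)
    qed
  qed
  also have "\<dots> = cm (- \<i>) (weighted_l2 s u + weighted_l2 (s - 1) n)"
    unfolding weighted_l2_def abs_add[OF s] by (rule cm_abs[symmetric]) (intro sq_int_add s)
  finally show ?thesis .
qed

context hartree_potential
begin

text \<open>Independence of the representative: the convolution agrees at every point, and only the
  outer factor brings in an exceptional null set.\<close>

lemma abs_hartree:
  assumes psi: "sq_int \<psi>" "abs_l2 \<psi> = Fi A" and h: "sq_int (hartree w \<psi>)" and A: "Hs (1/2) A"
  shows "abs_l2 (hartree w \<psi>) = abs_l2 (Nx A A A)"
proof (rule abs_eqI[OF h sq_int_Nx[OF A A]])
  have [measurable]: "\<psi> \<in> borel_measurable borel" using psi by (simp add: sq_int_iff)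
  have ae: "AE y in lborel. r2 A y = \<psi> y" using rep_abs[OF psi(1)] psi(2) by simp
  have "(LINT y|lborel. complex_of_real (w (x - y)) * (\<psi> y * cnj (\<psi> y))) = (LINT y|lborel. complex_of_real (w (x - y)) * (r2 A y * cnj (r2 A y)))" for x
  proof (rule integral_cong_AE)
    show "AE y in lborel. complex_of_real (w (x - y)) * (\<psi> y * cnj (\<psi> y)) = complex_of_real (w (x - y)) * (r2 A y * cnj (r2 A y))"
      using ae by eventually_elim simp
  qed measurable
  note int = this
  show "AE x in lborel. hartree w \<psi> x = Nx A A A x"
    using ae unfolding hartree_N3 Nx_def N3_def int by eventually_elim simp
qed

lemma flow_solution:
  assumes s: "s \<ge> 1/2" and f: "flow s U" and init: "AE x in lborel. r2 (U 0) x = \<psi>0 x"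
  shows "is_solution s w \<psi>0 (\<lambda>t. r2 (U t))"
  unfolding is_solution_def
proof (intro exI conjI allI impI)
  \<comment> \<open>The velocity is read off from the equation, so the equation holds at every
    frequency and what remains is its continuity in H^(s-1) and its being the derivative.\<close>
  define v where "v t \<xi> = - \<i> * (jc 1 \<xi> * rep_l2 (U t) \<xi> + rep_l2 (NN (U t)) \<xi>)" for t \<xi>
  have H: "Hs s (U t)" if "0 \<le> t" for t using f that by (simp add: flow_def)
  have H2: "Hs (1/2) (U t)" if "0 \<le> t" for t by (rule Hs_mono[OF s H[OF that]])
  have HN: "Hs s (NN (U t))" if "0 \<le> t" for t using Nf_Hs(1)[OF s] H[OF that] by blast
  have HN1: "Hs (s - 1) (NN (U t))" if "0 \<le> t" for t by (rule Hs_mono[OF _ HN[OF that]]) simp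
  have H1: "Hs (s - 1) (U t)" if "0 \<le> t" for t by (rule Hs_mono[OF _ H[OF that]]) simp
  have u: "wL2 s (rep_l2 (U t))" "wL2 (s - 1) (rep_l2 (U t))" "wL2 (s - 1) (rep_l2 (NN (U t)))" if "0 \<le> t" for t
    using H[OF that] HN1[OF that] H1[OF that] by (simp_all add: wL2_iff)
  have v: "wL2 (s - 1) (v t)" if "0 \<le> t" for t
  proof -
    have "jc (s - 1) \<xi> * v t \<xi> = - \<i> * (jc s \<xi> * rep_l2 (U t) \<xi> + jc (s - 1) \<xi> * rep_l2 (NN (U t)) \<xi>)" for \<xi>
      using jc_add[of "s - 1" 1 \<xi>] by (simp add: v_def algebra_simps)
    then show ?thesis using u[OF that] unfolding wL2_def by (auto intro!: sq_int_cmult sq_int_add)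
  qed
  have veq: "\<i> * v t \<xi> = jc 1 \<xi> * rep_l2 (U t) \<xi> + rep_l2 (NN (U t)) \<xi>" for t \<xi> by (simp add: v_def)
  have vabs: "weighted_l2 (s - 1) (v t) = cm (- \<i>) (mul (jc s) (U t) + mul (jc (s - 1)) (NN (U t)))" if "0 \<le> t" for t
    using weighted_l2_rhs[OF u(1,3)[OF that] v[OF that]] veq u[OF that] by (simp add: weighted_l2_mul)
  have c: "continuous_on {0..} (\<lambda>t. mul (jc s) (U t))" using f by (simp add: flow_def)
  show "isFT (r2 (U t)) (rep_l2 (U t))" for t by (simp add: isFT_iff)
  show "wcont s (\<lambda>t. rep_l2 (U t))"
    unfolding wcont_iff
  proof
    show "continuous_on {0..} (\<lambda>t. weighted_l2 s (rep_l2 (U t)))"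
      by (rule continuous_on_cong[THEN iffD1, rotated 2, OF c refl]) (simp add: weighted_l2_mul u)
  qed (simp add: u)
  show "wcont (s - 1) v"
    unfolding wcont_iff
  proof
    have "continuous_on {0..} (\<lambda>t. mul (jc (- 1)) (mul (jc s) (NN (U t))))"
      by (intro bounded_linear.continuous_on[OF bounded_linear_jc_neg] NN_Hs_continuous s H c) simp_all
    then have "continuous_on {0..} (\<lambda>t. mul (jc (s - 1)) (NN (U t)))"
    proof (rule continuous_on_cong[THEN iffD1, rotated 2, OF _ refl])
      fix t :: real assume "t \<in> {0..}"
      then show "mul (jc (- 1)) (mul (jc s) (NN (U t))) = mul (jc (s - 1)) (NN (U t))"
        using mul_jc_jc(1)[OF HN, of t "- 1"] HN1[of t] by simp
    qed
    then have "continuous_on {0..} (\<lambda>t. cm (- \<i>) (mul (jc s) (U t) + mul (jc (s - 1)) (NN (U t))))"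
      by (intro bounded_linear.continuous_on[OF bounded_linear_cm] continuous_on_add c)
    then show "continuous_on {0..} (\<lambda>t. weighted_l2 (s - 1) (v t))"
      by (rule continuous_on_cong[THEN iffD1, rotated 2, OF _ refl]) (simp add: vabs)
  qed (simp add: v)
  show "isFT (hartree w (r2 (U t))) (rep_l2 (NN (U t)))" if t: "0 \<le> t" for t
  proof -
    have "hartree w (r2 (U t)) = Nx (U t) (U t) (U t)" by (simp add: hartree_N3 Nx_def)
    then show ?thesis using sq_int_Nx[OF H2[OF t] H2[OF t]] by (simp add: isFT_iff Nf_def)
  qed
  show "AE \<xi> in lborel. \<i> * v t \<xi> = complex_of_real (jb 1 \<xi>) * rep_l2 (U t) \<xi> + rep_l2 (NN (U t)) \<xi>" for t
    by (simp add: veq)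
  show "AE x in lborel. r2 (U 0) x = \<psi>0 x" by (rule init)
  fix t :: real assume t: "0 \<le> t"
  have "((\<lambda>t. mul (jc (s - 1)) (U t)) has_vector_derivative weighted_l2 (s - 1) (v t)) (at t within {0..})"
    using f t unfolding vabs[OF t] by (simp add: flow_def)
  then have "((\<lambda>t. weighted_l2 (s - 1) (rep_l2 (U t))) has_vector_derivative weighted_l2 (s - 1) (v t)) (at t within {0..})"
    by (rule has_vector_derivative_transform[rotated 2]) (use t u in \<open>simp_all add: weighted_l2_mul\<close>)
  then show "((\<lambda>h. wnorm (s - 1) (\<lambda>\<xi>. (rep_l2 (U (t + h)) \<xi> - rep_l2 (U t) \<xi>) / complex_of_real h - v t \<xi>)) \<longlongrightarrow> 0) (at 0 within {- t..})"
    by (subst wnorm_deriv_iff[OF u(2) v[OF t] t])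
qed

text \<open>The auxiliary functions of any solution are forced: \<open>n\<close> represents
  \<open>NN (U t)\<close> because a transform is determined by its function, and then
  \<open>v\<close> follows from the equation. So uniqueness for \<open>flow\<close> covers all
  solutions of the problem.\<close>

lemma solution_flow:
  assumes s: "s \<ge> 1/2" and sol: "is_solution s w \<psi>0 \<psi>"
  obtains U where "flow s U" "\<And>t. 0 \<le> t \<Longrightarrow> sq_int (\<psi> t) \<and> abs_l2 (\<psi> t) = Fi (U t)"
    "AE x in lborel. \<psi> 0 x = \<psi>0 x"
proof -
  obtain u v n where ft: "\<And>t. 0 \<le> t \<Longrightarrow> isFT (\<psi> t) (u t)" and uc: "wcont s u" and vc: "wcont (s - 1) v"
    and der: "\<And>t. 0 \<le> t \<Longrightarrow> ((\<lambda>h. wnorm (s - 1) (\<lambda>\<xi>. (u (t + h) \<xi> - u t \<xi>) / complex_of_real h - v t \<xi>)) \<longlongrightarrow> 0) (at 0 within {- t..})"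
    and hf: "\<And>t. 0 \<le> t \<Longrightarrow> isFT (hartree w (\<psi> t)) (n t)"
    and eq: "\<And>t. 0 \<le> t \<Longrightarrow> AE \<xi> in lborel. \<i> * v t \<xi> = jc 1 \<xi> * u t \<xi> + n t \<xi>"
    and init: "AE x in lborel. \<psi> 0 x = \<psi>0 x"
    using sol unfolding is_solution_def by blast
  define U where "U t = abs_l2 (u t)" for t
  have su: "sq_int (u t)" "sq_int (n t)" "sq_int (\<psi> t)" "abs_l2 (\<psi> t) = Fi (U t)" if "0 \<le> t" for t
    using ft[OF that] hf[OF that] by (simp_all add: isFT_iff U_def)
  have wu: "wL2 s (u t)" if "0 \<le> t" for t using uc that by (simp add: wcont_iff)
  have H: "Hs s (U t)" if "0 \<le> t" for t using wu[OF that] wL2_iff[OF su(1)[OF that]] by (simp add: U_def)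
  have H2: "Hs (1/2) (U t)" if "0 \<le> t" for t by (rule Hs_mono[OF s H[OF that]])
  have H1: "Hs (s - 1) (U t)" if "0 \<le> t" for t by (rule Hs_mono[OF _ H[OF that]]) simp
  have wu1: "wL2 (s - 1) (u t)" if "0 \<le> t" for t using H1[OF that] wL2_iff[OF su(1)[OF that]] by (simp add: U_def)
  have nN: "abs_l2 (n t) = NN (U t)" if "0 \<le> t" for t
    using hf[OF that] abs_hartree[OF su(3,4)[OF that] _ H2[OF that]] by (simp add: isFT_iff Nf_def)
  have HN: "Hs (s - 1) (NN (U t))" if "0 \<le> t" for t
    by (rule Hs_mono[OF _ Nf_Hs(1)[OF s H[OF that] H[OF that] H[OF that]]]) simp
  have wn: "wL2 (s - 1) (n t)" if "0 \<le> t" for t using HN[OF that] wL2_iff[OF su(2)[OF that]] nN[OF that] by simp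
  have wv: "wL2 (s - 1) (v t)" if "0 \<le> t" for t using vc that by (simp add: wcont_iff)
  have vabs: "weighted_l2 (s - 1) (v t) = cm (- \<i>) (mul (jc s) (U t) + mul (jc (s - 1)) (NN (U t)))" if "0 \<le> t" for t
    unfolding weighted_l2_rhs[OF wu[OF that] wn[OF that] wv[OF that] eq[OF that]] weighted_l2_mul[OF su(1)[OF that] wu[OF that]]
      weighted_l2_mul[OF su(2)[OF that] wn[OF that]] nN[OF that] U_def ..
  have "flow s U"
    unfolding flow_def
  proof (intro conjI allI impI H)
    show "continuous_on {0..} (\<lambda>t. mul (jc s) (U t))"
      by (rule continuous_on_cong[THEN iffD1, rotated 2, OF uc[unfolded wcont_iff, THEN conjunct2] refl])
        (simp add: weighted_l2_mul su wu U_def)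
    fix t :: real assume t: "0 \<le> t"
    have "((\<lambda>t. weighted_l2 (s - 1) (u t)) has_vector_derivative weighted_l2 (s - 1) (v t)) (at t within {0..})"
      using der[OF t] by (subst (asm) wnorm_deriv_iff[OF wu1 wv[OF t] t])
    then show "((\<lambda>t. mul (jc (s - 1)) (U t)) has_vector_derivative
        cm (- \<i>) (mul (jc s) (U t) + mul (jc (s - 1)) (NN (U t)))) (at t within {0..})"
      unfolding vabs[OF t]
      by (rule has_vector_derivative_transform[rotated 2]) (use t su wu1 in \<open>simp_all add: weighted_l2_mul U_def\<close>)
  qed
  then show thesis using su init by (intro that) auto
qed

end

section \<open>Potentials with a weak L^d part and a bounded part\<close>

lemma weakL_bounds_mono:
  assumes K: "K \<in> weakL_bounds p f" "K \<le> K'" shows "K' \<in> weakL_bounds p f"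
  unfolding weakL_bounds_def
proof (intro CollectI conjI allI impI)
  have K0: "0 \<le> K" using K(1) by (simp add: weakL_bounds_def)
  then show "0 \<le> K'" using K(2) by simp
  fix a :: real assume a: "0 < a"
  have "emeasure lborel {x. \<bar>f x\<bar> > a} \<le> ennreal ((K / a) ^ p)" using K(1) a by (simp add: weakL_bounds_def)
  also have "\<dots> \<le> ennreal ((K' / a) ^ p)"
    by (intro ennreal_leI power_mono divide_right_mono) (use K(2) K0 a in auto)
  finally show "emeasure lborel {x. \<bar>f x\<bar> > a} \<le> ennreal ((K' / a) ^ p)" .
qed

lemma weakL_bounds_dominated:
  assumes "K \<in> weakL_bounds p f" "\<And>x. \<bar>g x\<bar> \<le> \<bar>f x\<bar>" "f \<in> borel_measurable borel"
  shows "K \<in> weakL_bounds p g"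
  unfolding weakL_bounds_def
proof (intro CollectI conjI allI impI)
  show "0 \<le> K" using assms(1) by (simp add: weakL_bounds_def)
  fix a :: real assume a: "0 < a"
  have [measurable]: "f \<in> borel_measurable borel" by fact
  have "emeasure lborel {x. \<bar>g x\<bar> > a} \<le> emeasure lborel {x. \<bar>f x\<bar> > a}"
    by (rule emeasure_mono) (use assms(2) in \<open>auto intro: less_le_trans\<close>)
  also have "\<dots> \<le> ennreal ((K / a) ^ p)" using assms(1) a by (simp add: weakL_bounds_def)
  finally show "emeasure lborel {x. \<bar>g x\<bar> > a} \<le> ennreal ((K / a) ^ p)" .
qed

lemma weakL_bounds_reflect:
  assumes "K \<in> weakL_bounds p f" and [measurable]: "f \<in> borel_measurable borel"
  shows "K \<in> weakL_bounds p (\<lambda>y. f (x - y))"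
proof -
  have "emeasure lborel {y. \<bar>f (x - y)\<bar> > a} = emeasure lborel {y. \<bar>f y\<bar> > a}" for a
  proof -
    have "(\<integral>\<^sup>+y. indicator {y. \<bar>f y\<bar> > a} (x - y) \<partial>lborel) = (\<integral>\<^sup>+y. indicator {y. \<bar>f y\<bar> > a} y \<partial>lborel)"
      by (rule nn_integral_reflect) measurable
    moreover have "(\<integral>\<^sup>+y. indicator {y. \<bar>f y\<bar> > a} (x - y) \<partial>lborel) = (\<integral>\<^sup>+y. indicator {y. \<bar>f (x - y)\<bar> > a} y \<partial>lborel)"
      by (intro nn_integral_cong) (simp add: indicator_def)
    ultimately show ?thesis by simp
  qed
  then show ?thesis using assms(1) by (simp add: weakL_bounds_def)
qed

text \<open>Level sets keep their measure under the map sending y to x - y, so the bound is uniform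
  in \<open>x\<close>.\<close>

lemma weak_Ld_potential:
  fixes f :: "real^'n \<Rightarrow> real"
  assumes d: "CARD('n) \<ge> 3" and K: "K > 0" "K \<in> weakL_bounds CARD('n) f"
    and [measurable]: "f \<in> borel_measurable borel" and A: "Hs (1/2) A"
  shows "(\<integral>\<^sup>+y. ennreal (\<bar>f (x - y)\<bar> * (cmod (rep_l2 (Fi A) y))\<^sup>2) \<partial>lborel) \<le> ennreal (weakL_const TYPE('n) * K * (hn (1/2) A)\<^sup>2)"
proof -
  have "(\<integral>\<^sup>+y. ennreal (\<bar>f (x - y)\<bar> * (cmod (rep_l2 (Fi A) y))\<^sup>2) \<partial>lborel) \<le>
      ennreal (weakL_const TYPE('n) * K) * (\<integral>\<^sup>+\<xi>. ennreal (norm \<xi> * (cmod (rep_l2 A \<xi>))\<^sup>2) \<partial>lborel)"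
    by (rule weak_Ld_bound[OF d K(1) weakL_bounds_reflect[OF K(2)]]) measurable
  also have "\<dots> \<le> ennreal (weakL_const TYPE('n) * K) * sobolev_sq (1/2) A"
    unfolding sobolev_sq_def by (intro mult_left_mono nn_integral_mono ennreal_leI mult_right_mono) (auto intro: norm_le_jb)
  also have "\<dots> = ennreal (weakL_const TYPE('n) * K * (hn (1/2) A)\<^sup>2)"
    unfolding sobolev_sq_hn[OF A] using weakL_const_pos[where 'n='n] K by (simp add: ennreal_mult)
  finally show ?thesis .
qed

lemma Linf_potential:
  fixes f :: "real^'n \<Rightarrow> real"
  assumes f: "AE x in lborel. \<bar>f x\<bar> \<le> M" "0 \<le> M"
  shows "(\<integral>\<^sup>+y. ennreal (\<bar>f (x - y)\<bar> * (cmod (rep_l2 (Fi A) y))\<^sup>2) \<partial>lborel) \<le> ennreal (M * (norm A)\<^sup>2)"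
proof -
  have "(\<integral>\<^sup>+y. ennreal (\<bar>f (x - y)\<bar> * (cmod (rep_l2 (Fi A) y))\<^sup>2) \<partial>lborel) \<le> (\<integral>\<^sup>+y. ennreal M * ennreal ((cmod (rep_l2 (Fi A) y))\<^sup>2) \<partial>lborel)"
  proof (rule nn_integral_mono_AE)
    show "AE y in lborel. ennreal (\<bar>f (x - y)\<bar> * (cmod (rep_l2 (Fi A) y))\<^sup>2) \<le> ennreal M * ennreal ((cmod (rep_l2 (Fi A) y))\<^sup>2)"
      using AE_reflect[OF f(1), of x]
      by eventually_elim (use f(2) in \<open>auto simp: ennreal_mult[symmetric] intro!: ennreal_leI mult_right_mono\<close>)
  qed
  also have "\<dots> = ennreal M * nn_sq (rep_l2 (Fi A))" unfolding nn_sq_def by (rule nn_integral_cmult) measurable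
  also have "\<dots> = ennreal (M * (norm A)\<^sup>2)" using f(2) by (simp add: norm_l2_nn_sq[symmetric] ennreal_mult)
  finally show ?thesis .
qed

text \<open>Stated for a general \<open>F\<close> to cover both |w| and the negative part of
  \<open>w\<close>.\<close>

lemma potential_split:
  fixes f g :: "real^'n \<Rightarrow> real"
  assumes le: "\<And>y. F y \<le> \<bar>f y\<bar> + \<bar>g y\<bar>"
    and [measurable]: "f \<in> borel_measurable borel" "g \<in> borel_measurable borel" "a \<in> borel_measurable borel"
    and bd: "(\<integral>\<^sup>+y. ennreal (\<bar>f (x - y)\<bar> * (cmod (a y))\<^sup>2) \<partial>lborel) \<le> ennreal p"
      "(\<integral>\<^sup>+y. ennreal (\<bar>g (x - y)\<bar> * (cmod (a y))\<^sup>2) \<partial>lborel) \<le> ennreal q" "0 \<le> p" "0 \<le> q"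
  shows "(\<integral>\<^sup>+y. ennreal (F (x - y) * (cmod (a y))\<^sup>2) \<partial>lborel) \<le> ennreal (p + q)"
proof -
  have "(\<integral>\<^sup>+y. ennreal (F (x - y) * (cmod (a y))\<^sup>2) \<partial>lborel) \<le>
      (\<integral>\<^sup>+y. ennreal (\<bar>f (x - y)\<bar> * (cmod (a y))\<^sup>2) + ennreal (\<bar>g (x - y)\<bar> * (cmod (a y))\<^sup>2) \<partial>lborel)"
    by (intro nn_integral_mono)
      (auto simp: ennreal_plus[symmetric] distrib_right[symmetric] simp del: ennreal_plus intro!: ennreal_leI mult_right_mono le)
  also have "\<dots> = (\<integral>\<^sup>+y. ennreal (\<bar>f (x - y)\<bar> * (cmod (a y))\<^sup>2) \<partial>lborel) + (\<integral>\<^sup>+y. ennreal (\<bar>g (x - y)\<bar> * (cmod (a y))\<^sup>2) \<partial>lborel)"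
    by (rule nn_integral_add) measurable
  also have "\<dots> \<le> ennreal p + ennreal q" by (intro add_mono bd)
  finally show ?thesis using bd by (simp add: ennreal_plus)
qed

lemma (in small_hartree_potential) well_posed:
  assumes s: "s \<ge> 1/2" and psi0: "in_H s \<psi>0" and small: "kappa * (L2n \<psi>0)\<^sup>2 \<le> 1"
  shows "\<exists>\<psi>. is_solution s w \<psi>0 \<psi> \<and> (\<forall>\<phi>. is_solution s w \<psi>0 \<phi> \<longrightarrow> (\<forall>t\<ge>0. AE x in lborel. \<phi> t x = \<psi> t x))"
proof -
  obtain g where g: "isFT \<psi>0 g" "wL2 s g" using psi0 by (auto simp: in_H_def)
  define u0 where "u0 = abs_l2 g"
  have sq: "sq_int \<psi>0" "sq_int g" and u0: "u0 = Four (abs_l2 \<psi>0)" using g by (simp_all add: isFT_iff u0_def)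
  have H0: "Hs s u0" using wL2_iff[OF sq(2)] g(2) by (simp add: u0_def)
  have "kappa * (norm u0)\<^sup>2 \<le> 1" using small by (simp add: u0 norm_abs_l2 sq)
  then obtain a where a: "a 0 = u0" "continuous_on {0..} (\<lambda>t. mul (jc s) (a t))" "\<And>t. 0 \<le> t \<Longrightarrow> Hs s (a t)"
    "\<And>t. 0 \<le> t \<Longrightarrow> (a has_vector_derivative cm (- \<i>) (Sg (- t) (NN (Sg t (a t))))) (at t within {0..})"
    using limit_solution[OF s H0] by blast
  define U where "U t = Sg t (a t)" for t
  have U: "flow s U" unfolding U_def by (rule flow_of_profile[OF s a(2-4)])
  have U0: "U 0 = u0" by (simp add: U_def a(1) Sg_0)
  show ?thesis
  proof (intro exI conjI allI impI)
    show "is_solution s w \<psi>0 (\<lambda>t. r2 (U t))"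
      by (rule flow_solution[OF s U]) (use rep_abs[OF sq(1)] in \<open>simp add: U0 u0\<close>)
    fix \<phi> and t :: real assume sol: "is_solution s w \<psi>0 \<phi>" and t: "0 \<le> t"
    obtain V where V: "flow s V" "\<And>t. 0 \<le> t \<Longrightarrow> sq_int (\<phi> t) \<and> abs_l2 (\<phi> t) = Fi (V t)"
      "AE x in lborel. \<phi> 0 x = \<psi>0 x" using solution_flow[OF s sol] by blast
    have "Fi (V 0) = abs_l2 \<psi>0" using V(2)[of 0] abs_eqI[OF _ sq(1) V(3)] by simp
    then have "V 0 = u0" unfolding u0 by (metis Four_Fi)
    then have "U t = V t" by (intro flow_unique[OF s U V(1) _ t]) (simp add: U0)
    then have "abs_l2 (\<phi> t) = Fi (U t)" using V(2)[OF t] by simp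
    then show "AE x in lborel. \<phi> t x = r2 (U t) x"
      using rep_abs[of "\<phi> t"] V(2)[OF t] by (auto simp: eq_commute)
  qed
qed

theorem theorem2p5:
  assumes "CARD('n) \<ge> 3"
  shows "\<exists>C0>0. \<forall>(s::real) (w::real^'n \<Rightarrow> real) wd winf (\<psi>0::real^'n \<Rightarrow> complex).
    s \<ge> 1/2 \<longrightarrow>
    (\<forall>x. w (- x) = w x) \<longrightarrow>
    (\<forall>x. w x = wd x + winf x) \<longrightarrow>
    weakL CARD('n) wd \<longrightarrow> Linf winf \<longrightarrow>
    in_H s \<psi>0 \<longrightarrow>
    weakLnorm CARD('n) (negpart wd) * (L2n \<psi>0)\<^sup>2 < C0 \<longrightarrow>
    (\<exists>\<psi>. is_solution s w \<psi>0 \<psi> \<and>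
       (\<forall>\<phi>. is_solution s w \<psi>0 \<phi> \<longrightarrow> (\<forall>t\<ge>0. AE x in lborel. \<phi> t x = \<psi> t x)))"
proof (intro exI[of _ "1 / weakL_const TYPE('n)"] conjI allI impI)
  \<comment> \<open>The threshold is where \<open>kappa\<close> times the mass, with
    \<open>kappa\<close> equal to \<open>weakL_const\<close> times the weak norm, reaches 1.\<close>
  show "0 < 1 / weakL_const TYPE('n)" using weakL_const_pos by simp
  fix s :: real and w wd winf :: "real^'n \<Rightarrow> real" and \<psi>0 :: "real^'n \<Rightarrow> complex"
  assume s: "s \<ge> 1/2" and even: "\<forall>x. w (- x) = w x" and w: "\<forall>x. w x = wd x + winf x"
    and wd: "weakL CARD('n) wd" and winf: "Linf winf" and psi0: "in_H s \<psi>0"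
    and small: "weakLnorm CARD('n) (negpart wd) * (L2n \<psi>0)\<^sup>2 < 1 / weakL_const TYPE('n)"
  have [measurable]: "wd \<in> borel_measurable borel" "winf \<in> borel_measurable borel"
    using wd winf by (auto simp: weakL_def Linf_def)
  have wm [measurable]: "w \<in> borel_measurable borel" using w by (subst measurable_cong[of _ w "\<lambda>x. wd x + winf x"]) auto
  have nm [measurable]: "negpart wd \<in> borel_measurable borel" unfolding negpart_def[abs_def] by measurable
  note weakL_const = weakL_const_pos[where 'n='n]
  obtain M0 where M0: "AE x in lborel. \<bar>winf x\<bar> \<le> M0" using winf by (auto simp: Linf_def)
  define M where "M = max M0 0"
  have M: "AE x in lborel. \<bar>winf x\<bar> \<le> M" "0 \<le> M" using M0 by (auto simp: M_def elim: eventually_mono)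
  obtain K0 where K0: "K0 \<in> weakL_bounds CARD('n) wd" using wd by (auto simp: weakL_def)
  have K00: "0 \<le> K0" using K0 by (simp add: weakL_bounds_def)
  \<comment> \<open>\<open>K0\<close> may be 0, while \<open>weak_Ld_bound\<close> divides by its
    bound.\<close>
  define K1 where "K1 = K0 + 1"
  have K1: "K1 \<in> weakL_bounds CARD('n) wd" "K1 > 0"
    using weakL_bounds_mono[OF K0, of K1] K00 by (auto simp: K1_def)
  \<comment> \<open>Nonemptiness makes the infimum in \<open>weakLnorm\<close> a genuine
    one.\<close>
  have ne: "weakL_bounds CARD('n) (negpart wd) \<noteq> {}"
  proof -
    have "\<bar>negpart wd x\<bar> \<le> \<bar>wd x\<bar>" for x by (simp add: negpart_def max_def)
    then have "K0 \<in> weakL_bounds CARD('n) (negpart wd)" by (intro weakL_bounds_dominated[OF K0]) auto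
    then show ?thesis by blast
  qed
  define q where "q = (L2n \<psi>0)\<^sup>2"
  have q: "0 \<le> q" by (simp add: q_def)
  \<comment> \<open>The strict inequality in the hypothesis leaves room for a positive bound
    slightly above the infimum, so attainment is not an issue.\<close>
  obtain K where K: "K \<in> weakL_bounds CARD('n) (negpart wd)" "K > 0" "K * q \<le> 1 / weakL_const TYPE('n)"
  proof -
    define N where "N = weakLnorm CARD('n) (negpart wd)"
    have N0: "0 \<le> N" unfolding N_def weakLnorm_def using ne by (intro cInf_greatest) (auto simp: weakL_bounds_def)
    \<comment> \<open>Dividing by \<open>q + 1\<close> rather than \<open>q\<close> covers zero data
      and spends at most the available gap.\<close>
    define e where "e = (1 / weakL_const TYPE('n) - N * q) / (q + 1)"
    have e: "0 < e" unfolding e_def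
    proof (rule divide_pos_pos)
      show "0 < 1 / weakL_const TYPE('n) - N * q" using small by (simp add: N_def q_def)
    qed (use q in simp)
    obtain K where K: "K \<in> weakL_bounds CARD('n) (negpart wd)" "K < N + e"
      using cInf_lessD[OF ne, of "N + e"] e unfolding N_def weakLnorm_def by auto
    have "(N + e) * q \<le> N * q + e * (q + 1)" using e by (simp add: algebra_simps)
    also have "\<dots> = 1 / weakL_const TYPE('n)" unfolding e_def using q by simp
    finally show thesis using weakL_bounds_mono[OF K(1), of "N + e"] K(2) N0 e by (intro that[of "N + e"]) auto
  qed
  have pos: "\<bar>w y\<bar> \<le> \<bar>wd y\<bar> + \<bar>winf y\<bar>" "max (- w y) 0 \<le> \<bar>negpart wd y\<bar> + \<bar>winf y\<bar>" for y
    using w by (auto simp: negpart_def)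
  \<comment> \<open>The second argument is a crude bound on all of |w|, its bounded part being
    absorbed by the H^(1/2) norm; the third sees only the negative part of
    \<open>wd\<close>.\<close>
  interpret small_hartree_potential w "weakL_const TYPE('n) * K1 + M" "weakL_const TYPE('n) * K" M
  proof
    show "w (- x) = w x" for x using even by simp
    show "0 < weakL_const TYPE('n) * K1 + M" using weakL_const K1 M by (simp add: add_pos_nonneg)
    show "0 \<le> weakL_const TYPE('n) * K" using weakL_const K by simp
    fix A :: "(real^'n) l2" and x :: "real^'n" assume A: "Hs (1/2) A"
    have nn: "norm A \<le> hn (1/2) A" by (rule norm_le_hn) (use A in auto)
    have "(\<integral>\<^sup>+y. ennreal (\<bar>w (x - y)\<bar> * (cmod (rep_l2 (Fi A) y))\<^sup>2) \<partial>lborel) \<le> ennreal (weakL_const TYPE('n) * K1 * (hn (1/2) A)\<^sup>2 + M * (norm A)\<^sup>2)"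
      by (rule potential_split[OF pos(1) _ _ _ weak_Ld_potential[OF assms K1(2,1) _ A] Linf_potential[OF M]])
        (use weakL_const K1 M in auto)
    also have "\<dots> \<le> ennreal ((weakL_const TYPE('n) * K1 + M) * (hn (1/2) A)\<^sup>2)"
      unfolding distrib_right by (intro ennreal_leI add_left_mono mult_left_mono power_mono nn M) auto
    finally show "(\<integral>\<^sup>+y. ennreal (\<bar>w (x - y)\<bar> * (cmod (rep_l2 (Fi A) y))\<^sup>2) \<partial>lborel) \<le> ennreal ((weakL_const TYPE('n) * K1 + M) * (hn (1/2) A)\<^sup>2)" .
    show "(\<integral>\<^sup>+y. ennreal (max (- w (x - y)) 0 * (cmod (rep_l2 (Fi A) y))\<^sup>2) \<partial>lborel) \<le> ennreal (weakL_const TYPE('n) * K * (hn (1/2) A)\<^sup>2 + M * (norm A)\<^sup>2)"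
      by (rule potential_split[OF pos(2) _ _ _ weak_Ld_potential[OF assms K(2,1) _ A] Linf_potential[OF M]])
        (use weakL_const K M in auto)
  qed (use M wm in auto)
  show "\<exists>\<psi>. is_solution s w \<psi>0 \<psi> \<and> (\<forall>\<phi>. is_solution s w \<psi>0 \<phi> \<longrightarrow> (\<forall>t\<ge>0. AE x in lborel. \<phi> t x = \<psi> t x))"
    by (rule well_posed[OF s psi0]) (use K(3) weakL_const in \<open>simp add: q_def pos_le_divide_eq mult.commute mult.left_commute\<close>)
qed

end
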